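(* There are absolute constants $C\ge1$, $c>0$ such that the following holds. Let $N_1,N_2$ be positive integers with $N_1 \geq N_2^{1/2}$, let $\delta>0$, and let $f_0, f_1, f_2 : \mathbb{Z}^2 \to \mathbb{C}$ be bounded by $1$ in modulus with support contained in $[-N_1, N_1]\times [-N_2, N_2]$. Suppose that for some positive integers $q,M$ with $qM \leq N_2^{1/2}$ we have $$\Big|\sum_{x,y,d\in\mathbb{Z}} \mu_M(d)\, f_0(x,y)f_1(x+qd,y)f_2(x, y+q^2 d^2)\Big| \geq \delta N_1N_2.$$ Then there exists a positive integer $\tilde q \leq C\delta^{-C}$ such that for every positive integer $\widetilde M$, either $\widetilde M \geq c\,\delta^{C} M$, or $$\sum_{x,y\in\mathbb{Z}} \Big|\sum_{ \tilde d\in\mathbb{Z}}\mu_{ \widetilde M^2}( \tilde d)\, f_2(x, y+q^2 \tilde q^2 \tilde d) \Big| \geq c\,\delta^{C} N_1N_2.$$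
   Context: For real $H\ge 1$, the Fejér kernel $\mu_H:\mathbb{Z}\to[0,1]$ is $\mu_H(h)=\frac{1}{\lfloor H\rfloor}\big(1-\frac{|h|}{\lfloor H\rfloor}\big)_+ = \lfloor H\rfloor^{-2}(1_{[H]}*1_{-[H]})(h)$, where $[H]=\{1,\dots,\lfloor H\rfloor\}$ and $t_+=\max\{t,0\}$.
   Formalization: The formal theorem also assumes δ ≤ 1; without this the claim fails: for N_1=N_2=q=M=1, all f_i the indicator of [-1,1]^2 and δ=4, the sum is 9 ≥ 4, but Cδ^{-C} ≤ 1/4 leaves no positive integer q̃. *)

theory Defs
  imports "HOL-Analysis.Analysis"
begin

text \<open>Only used for \<open>H \<ge> 1\<close>; for \<open>H < 1\<close> the value has no mathematical meaning.\<close>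

definition fejer_kernel :: "real \<Rightarrow> int \<Rightarrow> real" where
  "fejer_kernel H h =
     1 / of_int \<lfloor>H\<rfloor> * max (1 - of_int \<bar>h\<bar> / of_int \<lfloor>H\<rfloor>) 0"

end

theory Submission
  imports Defs
begin

text \<open>Cauchy--Schwarz in \<open>x\<close> eliminates \<open>f\<^sub>1\<close>. Splitting \<open>y\<close> into residue classes modulo \<open>q\<^sup>2\<close> and blocks of length
  \<open>M\<^sup>2\<close> leaves, for most \<open>x\<close> and cells, a large average of
  \<open>g (s' - s) y * F (s' - s) (y + s\<^sup>2) * G (y + s'\<^sup>2)\<close> over \<open>y\<close> modulo \<open>P = 4 M\<^sup>2\<close> and over \<open>s, s'\<close> in an interval of
  length \<open>M\<close>. Here \<open>G\<close> may be replaced by the conjugate of the dual function \<open>D\<close> of the pair \<open>(g, F)\<close>.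
  Van der Corput differencing bounds the average by box norms of \<open>G\<close> in the directions \<open>2 c\<close>, \<open>2 (c - w \<tau>)\<close>,
  \<open>2 w \<tau>\<close>, and concatenation along generic parameters turns these into the third uniformity norm. A large uniformity norm
  of the dual function \<open>D\<close> forces a large Fourier coefficient of \<open>D\<close>: a Cauchy--Schwarz argument compares the maximal
  frequencies of the derivatives of \<open>D\<close>, and Weyl's inequality with Vinogradov's lemma shows that their differences are close to
  rationals with small denominators. The same Weyl estimate, with \<open>G\<close> a character, then places a positive
  proportion of the spectrum of \<open>F\<close>, that is of \<open>f\<^sub>2\<close> on the cells, near rationals with small denominators. On those
  frequencies the Fejer kernel with step \<open>q\<^sup>2 n\<^sup>2\<close>, where \<open>n\<close> is a suitable denominator, has multiplier of order one.\<close>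

subsection \<open>Averages over finite sets\<close>

text \<open>After the elimination of \<open>f\<^sub>1\<close>, \<open>x\<close> is a frozen
  parameter: the remaining functions see it only as \<open>x\<close> and
  \<open>x + q (s' - s)\<close>. Hence the one-dimensional operator \<open>lam\<close> carries
  families \<open>g b\<close>, \<open>F b\<close> indexed by \<open>b = s' - s\<close>, while
  \<open>G\<close> is a single function. The modulus is 4 M^2 so that a block of length M^2 can be
  moved by any square up to M^2 without wrapping around.

  The obstacle: differencing gives box norms along directions k |-> c k that take at most about M
  values, in a group of size 4 M^2. Two-parameter directions c k + c' k' with small gcd do
  equidistribute up to powers of Q. Each concatenation or spectral Cauchy-Schwarz therefore doubles
  a direction, and the free dilation \<open>w\<close> of the van der Corput shifts is there so that
  the direction produced by concatenation can be doubled as well.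

  All losses are powers of one integer Q of order 1/\<delta>^2; since Q is at least 1024, a
  numerical factor costs a few extra powers. If M is below a fixed power of Q, the first alternative
  of the conclusion always holds.\<close>

definition avg :: "'a set \<Rightarrow> ('a \<Rightarrow> 'b) \<Rightarrow> 'b::real_normed_field" where
  "avg S f = (\<Sum>x\<in>S. f x) / of_nat (card S)"

lemma avg_cong: "(\<And>x. x \<in> S \<Longrightarrow> f x = g x) \<Longrightarrow> avg S f = avg S g"
  unfolding avg_def by (simp cong: sum.cong)

lemma avg_const: "finite S \<Longrightarrow> S \<noteq> {} \<Longrightarrow> avg S (\<lambda>_. c) = c"
  unfolding avg_def by simp

lemma avg_0 [simp]: "avg S (\<lambda>_. 0) = 0"
  unfolding avg_def by simp

lemma avg_mono:
  fixes f g :: "'a \<Rightarrow> real"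
  assumes "\<And>x. x \<in> S \<Longrightarrow> f x \<le> g x"
  shows "avg S f \<le> avg S g"
  unfolding avg_def using assms by (intro divide_right_mono sum_mono) auto

lemma avg_nonneg:
  fixes f :: "'a \<Rightarrow> real"
  assumes "\<And>x. x \<in> S \<Longrightarrow> 0 \<le> f x"
  shows "0 \<le> avg S f"
  unfolding avg_def using assms by (simp add: sum_nonneg)

text \<open>Over an empty or infinite set \<open>avg\<close> is 0, so an upper bound
  \<open>c\<close> survives there only when it is nonnegative.\<close>

lemma avg_le:
  fixes f :: "'a \<Rightarrow> real"
  assumes "\<And>x. x \<in> S \<Longrightarrow> f x \<le> c" and "0 \<le> c"
  shows "avg S f \<le> c"
proof (cases "finite S \<and> S \<noteq> {}")
  case True
  have "avg S f \<le> avg S (\<lambda>_. c)" by (rule avg_mono) (use assms in auto)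
  then show ?thesis using True by (simp add: avg_const)
next
  case False
  then show ?thesis using assms(2) by (auto simp: avg_def)
qed

lemma avg_add: "avg S (\<lambda>x. f x + g x) = avg S f + avg S g"
  unfolding avg_def by (simp add: sum.distrib add_divide_distrib)

lemma avg_diff: "avg S (\<lambda>x. f x - g x) = avg S f - avg S g"
  unfolding avg_def by (simp add: sum_subtractf diff_divide_distrib)

lemma avg_cmult: "avg S (\<lambda>x. c * f x) = c * avg S f"
  unfolding avg_def by (simp add: sum_distrib_left)

lemma avg_multc: "avg S (\<lambda>x. f x * c) = avg S f * c"
  unfolding avg_def by (simp add: sum_distrib_right)

lemma avg_sum: "avg S (\<lambda>x. \<Sum>i\<in>I. f i x) = (\<Sum>i\<in>I. avg S (f i))"
  unfolding avg_def by (subst sum.swap) (simp add: sum_divide_distrib)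

lemma sum_avg: "(\<Sum>i\<in>I. avg S (f i)) = avg S (\<lambda>x. \<Sum>i\<in>I. f i x)"
  by (simp add: avg_sum)

lemma avg_swap: "avg S (\<lambda>x. avg T (\<lambda>y. f x y)) = avg T (\<lambda>y. avg S (\<lambda>x. f x y))"
  (is "?l = ?r")
proof -
  have "?l = (\<Sum>x\<in>S. \<Sum>y\<in>T. f x y) / (of_nat (card T) * of_nat (card S))"
    unfolding avg_def by (simp only: sum_divide_distrib[symmetric] divide_divide_eq_left)
  also have "\<dots> = (\<Sum>y\<in>T. \<Sum>x\<in>S. f x y) / (of_nat (card S) * of_nat (card T))"
    by (simp only: sum.swap[of f T S] mult.commute[of "of_nat (card T)"])
  also have "\<dots> = ?r"
    unfolding avg_def by (simp only: sum_divide_distrib[symmetric] divide_divide_eq_left)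
  finally show ?thesis .
qed

lemma avg_of_real: "avg S (\<lambda>x. of_real (f x)) = (of_real (avg S f) :: 'b::real_normed_field)"
  unfolding avg_def by simp

lemma avg_cnj: "avg S (\<lambda>x. cnj (f x)) = cnj (avg S f)"
  unfolding avg_def by simp

lemma avg_Re: "Re (avg S f) = avg S (\<lambda>x. Re (f x))"
  unfolding avg_def by (simp add: Re_divide_of_nat)

lemma norm_avg_le: "norm (avg S f) \<le> avg S (\<lambda>x. norm (f x))"
  unfolding avg_def by (simp add: norm_divide divide_right_mono norm_sum)

lemma norm_avg_le1:
  assumes "\<And>x. x \<in> S \<Longrightarrow> norm (f x) \<le> 1"
  shows "norm (avg S f) \<le> 1"
  using norm_avg_le[of S f] avg_le[of S "\<lambda>x. norm (f x)" 1] assms by fastforce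

lemma avg_pair: "avg (S \<times> T) (\<lambda>p. f (fst p) (snd p)) = avg S (\<lambda>x. avg T (\<lambda>y. f x y))"
  unfolding avg_def
  by (simp only: sum_divide_distrib[symmetric] divide_divide_eq_left sum.cartesian_product
      case_prod_unfold card_cartesian_product of_nat_mult mult.commute[of "of_nat (card T)"])

lemma avg_le_ex:
  fixes f :: "'a \<Rightarrow> real"
  assumes "finite S" "S \<noteq> {}"
  shows "\<exists>x\<in>S. avg S f \<le> f x"
proof (rule ccontr)
  assume "\<not> ?thesis"
  then have "\<forall>x\<in>S. f x < avg S f" by auto
  then have "(\<Sum>x\<in>S. f x) < (\<Sum>x\<in>S. avg S f)" using assms by (intro sum_strict_mono) auto
  also have "\<dots> = (\<Sum>x\<in>S. f x)" using assms by (simp add: avg_def)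
  finally show False by simp
qed

lemma avg_power2_le:
  fixes f :: "'a \<Rightarrow> real"
  shows "(avg S f)\<^sup>2 \<le> avg S (\<lambda>x. (f x)\<^sup>2)"
proof (cases "finite S \<and> S \<noteq> {}")
  case True
  have "0 \<le> avg S (\<lambda>x. (f x - avg S f)\<^sup>2)" by (rule avg_nonneg) simp
  also have "\<dots> = avg S (\<lambda>x. (f x)\<^sup>2) - (avg S f)\<^sup>2"
    using True by (simp add: power2_diff avg_add avg_diff avg_const avg_multc avg_cmult)
      (simp add: power2_eq_square)
  finally show ?thesis by simp
next
  case False
  then show ?thesis by (auto simp: avg_def)
qed

text \<open>Iterating the square case gives Jensen's inequality for the exponents
  \<open>2 ^ n\<close>, the ones that repeated Cauchy-Schwarz produces.\<close>

lemma avg_power_le: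
  fixes f :: "'a \<Rightarrow> real"
  assumes "\<And>x. x \<in> S \<Longrightarrow> 0 \<le> f x"
  shows "(avg S f) ^ (2 ^ n) \<le> avg S (\<lambda>x. f x ^ (2 ^ n))"
proof (induction n)
  case 0
  then show ?case by simp
next
  case (Suc n)
  have "(avg S f) ^ (2 ^ Suc n) = ((avg S f) ^ (2 ^ n))\<^sup>2"
    by (simp only: power_Suc2 power_mult)
  also have "\<dots> \<le> (avg S (\<lambda>x. f x ^ (2 ^ n)))\<^sup>2"
    by (intro power_mono Suc.IH zero_le_power avg_nonneg assms)
  also have "\<dots> \<le> avg S (\<lambda>x. (f x ^ (2 ^ n))\<^sup>2)" by (rule avg_power2_le)
  finally show ?case by (simp only: power_Suc2 power_mult)
qed

lemma norm_avg_power2_le: "(norm (avg S f))\<^sup>2 \<le> avg S (\<lambda>x. (norm (f x))\<^sup>2)"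
  by (rule order.trans[OF power_mono[OF norm_avg_le norm_ge_zero] avg_power2_le])

text \<open>The form of Cauchy-Schwarz that discards a bounded weight: every factor to be eliminated
  is first collected into \<open>u\<close>.\<close>

lemma norm_avg_mult_power2_le:
  assumes "\<And>x. x \<in> S \<Longrightarrow> norm (u x) \<le> 1"
  shows "(norm (avg S (\<lambda>x. u x * f x)))\<^sup>2 \<le> avg S (\<lambda>x. (norm (f x))\<^sup>2)"
proof -
  have "(norm (avg S (\<lambda>x. u x * f x)))\<^sup>2 \<le> avg S (\<lambda>x. (norm (u x * f x))\<^sup>2)"
    by (rule norm_avg_power2_le)
  also have "\<dots> \<le> avg S (\<lambda>x. (norm (f x))\<^sup>2)"
  proof (rule avg_mono)
    fix x assume "x \<in> S"
    then have "norm (u x * f x) \<le> norm (f x)"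
      using mult_right_mono[OF assms, of x "norm (f x)"] by (simp add: norm_mult)
    then show "(norm (u x * f x))\<^sup>2 \<le> (norm (f x))\<^sup>2" by (rule power_mono) simp
  qed
  finally show ?thesis .
qed

lemma norm_avg_square:
  "complex_of_real ((cmod (avg S f))\<^sup>2) = avg S (\<lambda>x. avg S (\<lambda>y. f x * cnj (f y)))"
  by (simp only: complex_norm_square avg_cmult avg_multc avg_cnj)

lemma norm_sum_square:
  "complex_of_real ((cmod (\<Sum>x\<in>S. f x))\<^sup>2) = (\<Sum>x\<in>S. \<Sum>y\<in>S. f x * cnj (f y))"
  by (simp only: complex_norm_square cnj_sum sum_product)

lemma avg_reindex_bij: "bij_betw h S T \<Longrightarrow> avg S (\<lambda>x. f (h x)) = avg T f"
  unfolding avg_def by (simp only: sum.reindex_bij_betw bij_betw_same_card)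

text \<open>An interval and its translate by \<open>j\<close> differ in at most 2 |j| points. For
  \<open>K = 0\<close> both averages and the bound are 0.\<close>

lemma avg_shift_interval:
  fixes X :: "int \<Rightarrow> complex"
  assumes X: "\<And>k. cmod (X k) \<le> 1"
  shows "cmod (avg {1..int K} (\<lambda>k. X (k + j)) - avg {1..int K} X) \<le> 2 * \<bar>j\<bar> / K"
proof (cases "K = 0")
  case False
  have eq: "(\<Sum>k\<in>{1..int K}. X (k + j)) = sum X {1+j..int K+j}"
    by (rule sum.reindex_bij_witness[of _ "\<lambda>k. k - j" "\<lambda>k. k + j"]) auto
  have split: "sum X A - sum X B = sum X (A - B) - sum X (B - A)" if "finite A" "finite B" for A B :: "int set"
  proof -
    have "sum X A = sum X (A - B) + sum X (A \<inter> B)"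
      using sum.Int_Diff[OF that(1), of X B] by (simp add: add.commute)
    moreover have "sum X B = sum X (B - A) + sum X (A \<inter> B)"
      using sum.Int_Diff[OF that(2), of X A] by (simp add: add.commute inf_commute)
    ultimately show ?thesis by (simp add: mult.left_commute mult.commute)
  qed
  have card_bd: "cmod (sum X A) \<le> real (card A)" for A
    using sum_norm_le[of A X "\<lambda>_. 1"] X by simp
  have c1: "card ({1+j..int K+j} - {1..int K}) \<le> nat \<bar>j\<bar>"
  proof (cases "j \<ge> 0")
    case True
    then have "{1+j..int K+j} - {1..int K} \<subseteq> {int K + 1..int K + j}" by auto
    from card_mono[OF _ this] show ?thesis using True by simp
  next
    case False
    then have "{1+j..int K+j} - {1..int K} \<subseteq> {1+j..0}" by auto
    from card_mono[OF _ this] show ?thesis using False by simp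
  qed
  have c2: "card ({1..int K} - {1+j..int K+j}) \<le> nat \<bar>j\<bar>"
  proof (cases "j \<ge> 0")
    case True
    then have "{1..int K} - {1+j..int K+j} \<subseteq> {1..j}" by auto
    from card_mono[OF _ this] show ?thesis using True by simp
  next
    case False
    then have "{1..int K} - {1+j..int K+j} \<subseteq> {int K + j + 1..int K}" by auto
    from card_mono[OF _ this] show ?thesis using False by simp
  qed
  have "cmod (sum X {1+j..int K+j} - sum X {1..int K}) \<le>
      real (card ({1+j..int K+j} - {1..int K})) + real (card ({1..int K} - {1+j..int K+j}))"
    unfolding split[OF finite_atLeastAtMost_int finite_atLeastAtMost_int]
    by (rule order.trans[OF norm_triangle_ineq4 add_mono[OF card_bd card_bd]])
  also have "\<dots> \<le> 2 * real_of_int \<bar>j\<bar>" using c1 c2 by linarith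
  finally have "cmod (sum X {1+j..int K+j} - sum X {1..int K}) \<le> 2 * real_of_int \<bar>j\<bar>" .
  moreover have "avg {1..int K} (\<lambda>k. X (k + j)) - avg {1..int K} X
      = (sum X {1+j..int K+j} - sum X {1..int K}) / of_nat K"
    unfolding avg_def eq by (simp add: diff_divide_distrib)
  ultimately show ?thesis
    by (simp only: norm_divide norm_of_nat) (intro divide_right_mono, simp_all)
qed (simp add: avg_def)

subsection \<open>Characters and the distance to the nearest integer\<close>

definition echar :: "real \<Rightarrow> complex" where
  "echar x = cis (2 * pi * x)"

lemma echar_add: "echar (x + y) = echar x * echar y"
  by (simp add: echar_def cis_mult distrib_left)

lemma echar_0 [simp]: "echar 0 = 1" by (simp add: echar_def)

lemma norm_echar [simp]: "cmod (echar x) = 1" by (simp add: echar_def)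

lemma cnj_echar: "cnj (echar x) = echar (- x)" by (simp add: echar_def cis_cnj)

lemma echar_of_int [simp]: "echar (of_int n) = 1"
  unfolding echar_def by (rule cis_multiple_2pi) simp

lemma echar_add_int: "echar (x + of_int n) = echar x"
  by (simp add: echar_add)

definition nint :: "real \<Rightarrow> real" where
  "nint x = \<bar>x - of_int (round x)\<bar>"

lemma nint_nonneg [simp]: "0 \<le> nint x" by (simp add: nint_def)

lemma nint_le_half: "nint x \<le> 1/2"
  unfolding nint_def using of_int_round_abs_le[of x] by (simp add: abs_minus_commute)

lemma nint_le: "nint x \<le> \<bar>x - of_int n\<bar>"
  unfolding nint_def using round_diff_minimal[of x n] by simp

lemma nint_obtain:
  obtains n :: int where "\<bar>x - of_int n\<bar> = nint x"
  by (auto simp: nint_def)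

lemma nint_add: "nint (x + y) \<le> nint x + nint y"
  using nint_le[of "x + y" "round x + round y"] unfolding nint_def by simp

lemma nint_minus: "nint (- x) = nint x"
proof -
  have *: "nint (- x) \<le> nint x" for x
    using nint_le[of "- x" "- round x"] unfolding nint_def by simp
  from *[of x] *[of "- x"] show ?thesis by simp
qed

lemma nint_diff: "nint (x - y) \<le> nint x + nint y"
  using nint_add[of x "- y"] by (simp add: nint_minus)

lemma nint_add_int: "nint (x + of_int n) = nint x"
proof -
  have *: "nint (x + of_int n) \<le> nint x" for x n
    using nint_le[of "x + of_int n" "round x + n"] unfolding nint_def by simp
  from *[of x n] *[of "x + of_int n" "- n"] show ?thesis by simp
qed

lemma nint_mult_int: "nint (of_int m * x) \<le> \<bar>of_int m\<bar> * nint x"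
proof -
  have "\<bar>of_int m * x - of_int (m * round x)\<bar> = \<bar>of_int m\<bar> * \<bar>x - of_int (round x)\<bar>"
    by (simp only: abs_mult[symmetric] right_diff_distrib of_int_mult)
  then show ?thesis using nint_le[of "of_int m * x" "m * round x"] by (simp only: nint_def)
qed

lemma nint_mult_nat: "nint (of_nat m * x) \<le> of_nat m * nint x"
  using nint_mult_int[of "int m" x] by simp

lemma nint_eq_abs: "\<bar>x\<bar> < 1/2 \<Longrightarrow> nint x = \<bar>x\<bar>"
  unfolding nint_def using round_unique'[of x 0] by simp

lemma norm_one_minus_echar: "cmod (1 - echar x) = 2 * \<bar>sin (pi * x)\<bar>"
proof -
  have "(cmod (1 - echar x))\<^sup>2 = (1 - cos (2*pi*x))\<^sup>2 + (sin (2*pi*x))\<^sup>2"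
    by (simp add: cmod_power2 echar_def)
  also have "\<dots> = 2 - 2 * cos (2 * (pi*x))"
    using sin_cos_squared_add[of "2*pi*x"] by (simp add: power2_eq_square algebra_simps)
  also have "\<dots> = (2 * \<bar>sin (pi * x)\<bar>)\<^sup>2"
    by (simp only: cos_double_sin) (simp add: power2_eq_square)
  finally show ?thesis by (rule power2_eq_imp_eq) auto
qed

lemma norm_one_minus_echar_le: "cmod (1 - echar x) \<le> 2 * pi * nint x"
proof -
  obtain n :: int where n: "\<bar>x - of_int n\<bar> = nint x" by (rule nint_obtain)
  have "echar x = echar (x - of_int n)" using echar_add_int[of "x - of_int n" n] by simp
  then have "cmod (1 - echar x) = 2 * \<bar>sin (pi * (x - of_int n))\<bar>"
    using norm_one_minus_echar[of "x - of_int n"] by simp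
  also have "\<dots> \<le> 2 * \<bar>pi * (x - of_int n)\<bar>" using abs_sin_x_le_abs_x by (intro mult_left_mono) auto
  finally show ?thesis using n by (simp add: abs_mult)
qed

text \<open>Concavity of the sine on [0, pi] puts it above its chord from 0 to pi/2, so sin (pi t)
  is at least 2 t for t between 0 and 1/2.\<close>

lemma norm_one_minus_echar_ge: "4 * nint x \<le> cmod (1 - echar x)"
proof -
  obtain n :: int where n: "\<bar>x - of_int n\<bar> = nint x" by (rule nint_obtain)
  define t where "t = nint x"
  have t: "0 \<le> t" "t \<le> 1/2" using nint_le_half by (auto simp: t_def)
  have "echar x = echar (x - of_int n)" using echar_add_int[of "x - of_int n" n] by simp
  then have 1: "cmod (1 - echar x) = 2 * \<bar>sin (pi * (x - of_int n))\<bar>"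
    using norm_one_minus_echar[of "x - of_int n"] by simp
  have 2: "\<bar>sin (pi * (x - of_int n))\<bar> = \<bar>sin (pi * t)\<bar>"
    using n unfolding t_def[symmetric] by (metis abs_if minus_mult_right sin_minus abs_minus_cancel)
  have "concave_on {0..pi} sin"
    unfolding concave_on_def
    by (rule f''_ge0_imp_convex[of _ _ "\<lambda>x. - cos x" sin])
       (auto intro!: derivative_eq_intros sin_ge_zero)
  from this t have "sin ((1 - 2*t) * 0 + 2*t * (pi/2)) \<ge> (1 - 2*t) * sin 0 + 2*t * sin (pi/2)"
    using concave_onD[of "{0..pi}" sin "2*t" 0 "pi/2"] t by simp
  then have "sin (pi * t) \<ge> 2 * t" by (simp add: mult.commute)
  then show ?thesis using 1 2 t unfolding t_def by linarith
qed

text \<open>The geometric series telescopes after multiplication by \<open>1 - echar x\<close>. The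
  product form of the bound includes the case \<open>nint x = 0\<close>.\<close>

lemma norm_geometric_echar:
  "cmod (\<Sum>s\<in>{p..q}. echar (of_int s * x)) * (2 * nint x) \<le> 1"
proof -
  have *: "(1 - echar x) * (\<Sum>s\<in>{p..q}. echar (of_int s * x)) = echar (of_int p * x) - echar (of_int (q+1) * x)"
    if pq: "p \<le> q + 1"
  proof -
    have "(1 - echar x) * (\<Sum>s\<in>{p..p + int n - 1}. echar (of_int s * x))
        = echar (of_int p * x) - echar (of_int (p + int n) * x)" for n
    proof (induction n)
      case (Suc n)
      have "{p..p + int (Suc n) - 1} = insert (p + int n) {p..p + int n - 1}" by auto
      moreover have "of_int (p + int (Suc n)) * x = x + of_int (p + int n) * x"
        by (simp add: algebra_simps)
      ultimately show ?case using Suc by (simp add: echar_add ring_distribs)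
    qed simp
    from this[of "nat (q + 1 - p)"] show ?thesis using pq by simp
  qed
  show ?thesis
  proof (cases "p \<le> q + 1")
    case True
    have "cmod (1 - echar x) * cmod (\<Sum>s\<in>{p..q}. echar (of_int s * x)) \<le> 2"
      unfolding norm_mult[symmetric] *[OF True] using norm_triangle_ineq4[of "echar (of_int p * x)" "echar (of_int (q+1) * x)"] by simp
    moreover have "4 * nint x * cmod (\<Sum>s\<in>{p..q}. echar (of_int s * x)) \<le> cmod (1 - echar x) * cmod (\<Sum>s\<in>{p..q}. echar (of_int s * x))"
      by (intro mult_right_mono norm_one_minus_echar_ge norm_ge_zero)
    ultimately have "4 * nint x * cmod (\<Sum>s\<in>{p..q}. echar (of_int s * x)) \<le> 2"
      by (rule order.trans[rotated])
    moreover have "4 * nint x * c = 2 * (c * (2 * nint x))" for c :: real by simp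
    ultimately show ?thesis by (simp add: mult.left_commute mult.commute)
  qed simp
qed

lemma avg_swap22:
  "avg S (\<lambda>x. avg S' (\<lambda>x'. avg T (\<lambda>t. avg T' (\<lambda>t'. F x x' t t'))))
    = avg T (\<lambda>t. avg T' (\<lambda>t'. avg S (\<lambda>x. avg S' (\<lambda>x'. F x x' t t'))))"
proof -
  have "avg S (\<lambda>x. avg S' (\<lambda>x'. avg T (\<lambda>t. avg T' (\<lambda>t'. F x x' t t'))))
      = avg S (\<lambda>x. avg T (\<lambda>t. avg S' (\<lambda>x'. avg T' (\<lambda>t'. F x x' t t'))))"
    by (rule avg_cong, rule avg_swap)
  also have "\<dots> = avg T (\<lambda>t. avg S (\<lambda>x. avg S' (\<lambda>x'. avg T' (\<lambda>t'. F x x' t t'))))"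
    by (rule avg_swap)
  also have "\<dots> = avg T (\<lambda>t. avg S (\<lambda>x. avg T' (\<lambda>t'. avg S' (\<lambda>x'. F x x' t t'))))"
    by (rule avg_cong, rule avg_cong, rule avg_swap)
  also have "\<dots> = avg T (\<lambda>t. avg T' (\<lambda>t'. avg S (\<lambda>x. avg S' (\<lambda>x'. F x x' t t'))))"
    by (rule avg_cong, rule avg_swap)
  finally show ?thesis .
qed

subsection \<open>Periodic functions and their Fourier coefficients\<close>

locale cyclic =
  fixes P :: nat
  assumes P_pos: "P > 0"
begin

text \<open>Functions on the cyclic group are represented by periodic functions on the integers.
  Shifts and quadratic phases then stay ordinary integer arithmetic.\<close>

definition per :: "(int \<Rightarrow> 'b) \<Rightarrow> bool" where
  "per f \<longleftrightarrow> (\<forall>y. f (y + int P) = f y)"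

text \<open>The class of functions that may be discarded by Cauchy-Schwarz. It is closed under
  shifts, conjugation, products and averages, so every auxiliary function produced later stays in
  it.\<close>

definition adm :: "(int \<Rightarrow> complex) \<Rightarrow> bool" where
  "adm f \<longleftrightarrow> per f \<and> (\<forall>y. cmod (f y) \<le> 1)"

abbreviation U :: "int set" where "U \<equiv> {0..<int P}"

abbreviation A :: "(int \<Rightarrow> 'b) \<Rightarrow> 'b::real_normed_field" where "A f \<equiv> avg U f"

lemma U_ne: "U \<noteq> {}" and finite_U: "finite U" and card_U: "card U = P"
  using P_pos by auto

lemma perD: "per f \<Longrightarrow> f (y + int P) = f y" by (simp add: per_def)

lemma per_mult_int: "per f \<Longrightarrow> f (y + int P * k) = f y"
proof -
  assume f: "per f"
  have *: "f (y + int P * int n) = f y" for n y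
  proof (induction n)
    case (Suc n)
    have "y + int P * int (Suc n) = (y + int P * int n) + int P" by (simp add: algebra_simps)
    then show ?case using Suc perD[OF f, of "y + int P * int n"] by (simp only:)
  qed simp
  show ?thesis
  proof (cases "k \<ge> 0")
    case True
    then show ?thesis using *[of y "nat k"] by simp
  next
    case False
    then show ?thesis using *[of "y + int P * k" "nat (- k)"] by (simp add: algebra_simps)
  qed
qed

lemma per_mod: "per f \<Longrightarrow> f (y mod int P) = f y"
  using per_mult_int[of f "y mod int P" "y div int P"] by (simp add: add.commute)

lemma per_cong: "per f \<Longrightarrow> y mod int P = z mod int P \<Longrightarrow> f y = f z"
  using per_mod[of f y] per_mod[of f z] by simp

lemma bij_shift: "bij_betw (\<lambda>y. (y + h) mod int P) U U"
proof (rule bij_betwI[where g = "\<lambda>y. (y - h) mod int P"])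
  show "(\<lambda>y. (y + h) mod int P) \<in> U \<rightarrow> U" "(\<lambda>y. (y - h) mod int P) \<in> U \<rightarrow> U"
    using P_pos by auto
next
  fix x assume "x \<in> U"
  then show "((x + h) mod int P - h) mod int P = x" "((x - h) mod int P + h) mod int P = x"
    by (simp_all add: mod_simps)
qed

lemma A_shift: "per f \<Longrightarrow> A (\<lambda>y. f (y + h)) = A f"
proof -
  assume f: "per f"
  have "A (\<lambda>y. f ((y + h) mod int P)) = A f" by (rule avg_reindex_bij[OF bij_shift])
  then show ?thesis by (simp add: per_mod[OF f])
qed

lemma A_const [simp]: "A (\<lambda>_. c) = c"
  by (rule avg_const) (use P_pos in auto)

lemma admI: "(\<And>y. f (y + int P) = f y) \<Longrightarrow> (\<And>y. cmod (f y) \<le> 1) \<Longrightarrow> adm f"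
  by (simp add: adm_def per_def)

lemma adm_per: "adm f \<Longrightarrow> per f" by (simp add: adm_def)
lemma adm_norm: "adm f \<Longrightarrow> cmod (f y) \<le> 1" by (simp add: adm_def)

lemma adm_shift: "adm f \<Longrightarrow> adm (\<lambda>y. f (y + h))"
  by (simp add: adm_def per_def) (metis add.commute add.left_commute)

lemma adm_cnj: "adm f \<Longrightarrow> adm (\<lambda>y. cnj (f y))"
  by (simp add: adm_def per_def)

lemma adm_mult: "adm f \<Longrightarrow> adm g \<Longrightarrow> adm (\<lambda>y. f y * g y)"
  by (simp add: adm_def per_def norm_mult mult_le_one)

lemma adm_one: "adm (\<lambda>_. 1)" by (simp add: adm_def per_def)

lemma adm_avg: "(\<And>x. x \<in> S \<Longrightarrow> adm (f x)) \<Longrightarrow> adm (\<lambda>y. avg S (\<lambda>x. f x y))"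
  unfolding adm_def per_def by (auto intro!: norm_avg_le1 avg_cong)

definition chr :: "int \<Rightarrow> int \<Rightarrow> complex" where
  "chr r y = echar (of_int r * of_int y / of_nat P)"

lemma chr_add: "chr r (y + z) = chr r y * chr r z"
  by (simp add: chr_def echar_add[symmetric] add_divide_distrib distrib_left)

lemma chr_add_left: "chr (r + r') y = chr r y * chr r' y"
  by (simp add: chr_def echar_add[symmetric] add_divide_distrib distrib_right)

lemma chr_0 [simp]: "chr r 0 = 1" "chr 0 y = 1" by (simp_all add: chr_def)

lemma chr_P: "chr r (int P * k) = 1"
proof -
  have "of_int r * of_int (int P * k) / real P = of_int (r * k)" using P_pos by simp
  then show ?thesis unfolding chr_def by (simp only: echar_of_int)
qed

lemma chr_commute: "chr r y = chr y r" by (simp add: chr_def mult.commute)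

lemma norm_chr [simp]: "cmod (chr r y) = 1" by (simp add: chr_def)

lemma cnj_chr: "cnj (chr r y) = chr r (- y)" "cnj (chr r y) = chr (- r) y"
  by (simp_all add: chr_def cnj_echar)

lemma chr_diff: "chr r (y - z) = chr r y * cnj (chr r z)"
  using chr_add[of r y "- z"] by (simp add: cnj_chr)

lemma chr_mult_cnj [simp]: "chr r y * cnj (chr r y) = 1"
  using chr_diff[of r y y] by simp

lemma adm_chr: "adm (chr r)"
  by (rule admI) (use chr_add[of r _ "int P"] chr_P[of r 1] in simp_all)

lemma per_chr_left: "chr (r + int P * k) y = chr r y"
  by (simp only: chr_commute[of _ y] chr_add chr_P) simp

lemma sum_chr: "(\<Sum>r\<in>U. chr r y) = (if y mod int P = 0 then of_nat P else 0)"
proof (cases "y mod int P = 0")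
  case True
  then obtain k where "y = int P * k" by auto
  then show ?thesis using P_pos by (simp add: chr_P)
next
  case False
  define x where "x = of_int y / real P"
  have sumU: "(\<Sum>r\<in>U. chr r y) = (\<Sum>r<P. echar x ^ r)"
  proof -
    have "echar x ^ r = echar (of_nat r * x)" for r
      by (induction r) (simp_all add: echar_add distrib_right)
    then have pow: "echar x ^ r = chr (int r) y" for r by (simp add: chr_def x_def)
    have "(\<Sum>r<P. echar x ^ r) = (\<Sum>r\<in>int ` {..<P}. chr r y)"
      by (subst sum.reindex) (simp_all add: pow inj_on_def)
    moreover have "int ` {..<P} = U" by (simp add: image_int_atLeastLessThan lessThan_atLeast0)
    ultimately show ?thesis by simp
  qed
  have powP: "echar x ^ P = 1"
  proof -
    have "echar x ^ r = echar (of_nat r * x)" for r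
      by (induction r) (simp_all add: echar_add distrib_right)
    moreover have "of_nat P * x = of_int y" using P_pos by (simp add: x_def)
    ultimately show ?thesis by simp
  qed
  \<comment> \<open>The lower bound for |1 - echar x| turns \<open>echar x = 1\<close> into
    \<open>nint x = 0\<close>, that is, into divisibility of \<open>y\<close> by
    \<open>P\<close>.\<close>
  have "echar x \<noteq> 1"
  proof
    assume "echar x = 1"
    then have "4 * nint x \<le> 0" using norm_one_minus_echar_ge[of x] by simp
    then have "nint x = 0" using nint_nonneg[of x] by linarith
    then have "x = of_int (round x)" by (simp add: nint_def)
    then have "real_of_int y = of_int (round x) * of_nat P" using P_pos by (simp add: x_def field_simps)
    then have "real_of_int y = real_of_int (round x * int P)" by simp
    then have "y = round x * int P" by (simp only: of_int_eq_iff)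
    with False show False by simp
  qed
  moreover have "(1 - echar x) * (\<Sum>r<P. echar x ^ r) = 0"
    using powP by (simp add: one_diff_power_eq[symmetric])
  ultimately have "(\<Sum>r<P. echar x ^ r) = 0" by simp
  with False show ?thesis by (simp only: sumU) simp
qed

text \<open>Averages on the physical side and plain sums over \<open>U\<close> on the frequency
  side, so that Parseval holds without a factor \<open>P\<close>.\<close>

definition hat :: "(int \<Rightarrow> complex) \<Rightarrow> int \<Rightarrow> complex" where
  "hat f r = A (\<lambda>y. f y * cnj (chr r y))"

lemma hat_inversion:
  assumes f: "per f"
  shows "f y = (\<Sum>r\<in>U. hat f r * chr r y)"
proof -
  have "(\<Sum>r\<in>U. hat f r * chr r y) = A (\<lambda>z. f z * (\<Sum>r\<in>U. chr r (y - z)))"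
    unfolding hat_def
    by (simp only: avg_multc[symmetric] sum_avg sum_distrib_left chr_diff mult.assoc mult.commute[of "chr _ _"])
  also have "\<dots> = (\<Sum>z\<in>U. f z * (\<Sum>r\<in>U. chr r (y - z))) / of_nat P"
    by (simp add: avg_def)
  also have "(\<Sum>z\<in>U. f z * (\<Sum>r\<in>U. chr r (y - z))) = (\<Sum>z\<in>U. if z = y mod int P then f z * of_nat P else 0)"
  proof (rule sum.cong[OF refl])
    fix z assume z: "z \<in> U"
    have "(y - z) mod int P = 0 \<longleftrightarrow> y mod int P = z mod int P"
      by (simp add: mod_eq_dvd_iff mod_eq_0_iff_dvd)
    then have "(y - z) mod int P = 0 \<longleftrightarrow> z = y mod int P" using z by auto
    then show "f z * (\<Sum>r\<in>U. chr r (y - z)) = (if z = y mod int P then f z * of_nat P else 0)"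
      by (simp add: sum_chr)
  qed
  also have "\<dots> = f (y mod int P) * of_nat P"
    using P_pos by (subst sum.delta) auto
  finally show ?thesis using P_pos per_mod[OF f, of y] by simp
qed

lemma parseval2:
  assumes f: "per f" and g: "per g"
  shows "A (\<lambda>y. f y * cnj (g y)) = (\<Sum>r\<in>U. hat f r * cnj (hat g r))"
proof -
  have "A (\<lambda>y. f y * cnj (g y)) = A (\<lambda>y. \<Sum>r\<in>U. hat f r * (chr r y * cnj (g y)))"
    by (subst hat_inversion[OF f]) (simp only: sum_distrib_right mult.assoc)
  also have "\<dots> = (\<Sum>r\<in>U. hat f r * cnj (hat g r))"
    by (simp only: avg_sum avg_cmult hat_def[of g] avg_cnj[symmetric] complex_cnj_mult complex_cnj_cnj mult.commute[of "chr _ _"])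
  finally show ?thesis .
qed

lemma parseval:
  assumes f: "per f"
  shows "A (\<lambda>y. (cmod (f y))\<^sup>2) = (\<Sum>r\<in>U. (cmod (hat f r))\<^sup>2)"
proof -
  have "complex_of_real (A (\<lambda>y. (cmod (f y))\<^sup>2)) = of_real (\<Sum>r\<in>U. (cmod (hat f r))\<^sup>2)"
    using parseval2[OF f f] by (simp add: avg_of_real[symmetric] complex_norm_square[symmetric] del: of_real_power)
  then show ?thesis by (simp only: of_real_eq_iff)
qed

lemma hat_shift: "per f \<Longrightarrow> hat (\<lambda>y. f (y + h)) r = chr r h * hat f r"
proof -
  assume f: "per f"
  have p: "per (\<lambda>y. f y * cnj (chr r (y - h)))"
    using f adm_per[OF adm_chr[of r]] by (auto simp: per_def) (metis add_diff_eq diff_add_eq)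
  have "hat (\<lambda>y. f (y + h)) r = A (\<lambda>y. f (y + h) * cnj (chr r (y + h - h)))" by (simp add: hat_def)
  also have "\<dots> = A (\<lambda>y. f y * cnj (chr r (y - h)))" by (rule A_shift[OF p])
  also have "\<dots> = chr r h * hat f r"
    by (simp add: hat_def chr_diff avg_cmult[symmetric] mult_ac)
  finally show ?thesis .
qed

lemma norm_hat_le: "adm f \<Longrightarrow> cmod (hat f r) \<le> 1"
  unfolding hat_def by (rule norm_avg_le1) (simp add: norm_mult adm_norm)

lemma sum_hat_le:
  assumes "adm f"
  shows "(\<Sum>r\<in>U. (cmod (hat f r))\<^sup>2) \<le> 1"
  unfolding parseval[OF adm_per[OF assms], symmetric]
  by (rule avg_le) (use adm_norm[OF assms] in \<open>auto simp: power_le_one\<close>)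

lemma hat_periodic: "hat f (r + int P * k) = hat f r"
  by (simp add: hat_def per_chr_left)

text \<open>A linear combination of translates acts on frequencies as multiplication by its symbol.
  Fejer averages, Weyl sums and the kernel of the conclusion all enter through this
  identity.\<close>

lemma parseval_comb:
  assumes f: "per f" and I: "finite I"
  shows "A (\<lambda>y. (cmod (\<Sum>s\<in>I. c s * f (y + v s)))\<^sup>2)
    = (\<Sum>r\<in>U. (cmod (hat f r))\<^sup>2 * (cmod (\<Sum>s\<in>I. c s * chr r (v s)))\<^sup>2)"
proof -
  have p: "per (\<lambda>y. \<Sum>s\<in>I. c s * f (y + v s))"
    using f by (auto simp: per_def) (metis add.commute add.left_commute)
  have "hat (\<lambda>y. \<Sum>s\<in>I. c s * f (y + v s)) r = hat f r * (\<Sum>s\<in>I. c s * chr r (v s))" for r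
  proof -
    have "hat (\<lambda>y. \<Sum>s\<in>I. c s * f (y + v s)) r = (\<Sum>s\<in>I. c s * hat (\<lambda>y. f (y + v s)) r)"
      by (simp add: hat_def sum_distrib_right avg_sum avg_cmult[symmetric] mult.assoc)
    also have "\<dots> = hat f r * (\<Sum>s\<in>I. c s * chr r (v s))"
      by (simp add: hat_shift[OF f] sum_distrib_left mult_ac)
    finally show ?thesis .
  qed
  then show ?thesis by (simp add: parseval[OF p] norm_mult power_mult_distrib)
qed

subsection \<open>Multiplicative derivatives and box norms\<close>

definition dif :: "int \<Rightarrow> (int \<Rightarrow> complex) \<Rightarrow> int \<Rightarrow> complex" where
  "dif h f y = f y * cnj (f (y + h))"

lemma adm_dif: "adm f \<Longrightarrow> adm (dif h f)"
  unfolding dif_def[abs_def] by (intro adm_mult adm_cnj adm_shift)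

lemma dif_dif: "dif h (dif k f) = dif k (dif h f)"
  by (rule ext) (simp add: dif_def add_ac mult_ac)

lemma dif_shift: "dif h (\<lambda>y. f (y + k)) = (\<lambda>y. dif h f (y + k))"
  by (rule ext) (simp add: dif_def add_ac)

lemma dif_one [simp]: "dif h (\<lambda>_. 1) = (\<lambda>_. 1)"
  by (rule ext) (simp add: dif_def)

lemma dif_per_h: "per f \<Longrightarrow> dif (h + int P) f = dif h f"
  by (rule ext) (simp add: dif_def perD add.assoc[symmetric])

text \<open>The mean square of the average over the translates by \<open>v x\<close>. By
  \<open>fej_corr\<close> it averages correlations over the differences \<open>v x' - v x\<close>;
  by \<open>fej_spec\<close> it is a nonnegative multiplier applied to the power spectrum.\<close>

definition fej :: "'s set \<Rightarrow> ('s \<Rightarrow> int) \<Rightarrow> (int \<Rightarrow> complex) \<Rightarrow> real" where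
  "fej S v f = A (\<lambda>y. (cmod (avg S (\<lambda>x. f (y + v x))))\<^sup>2)"

text \<open>The fourth power of a box norm, and \<open>box3\<close> the eighth power of a
  three-dimensional one. A direction is an indexed family of points, counted with multiplicity and
  used through its differences, so that two-parameter directions fit the same definition.\<close>

definition box2 :: "'s set \<Rightarrow> ('s \<Rightarrow> int) \<Rightarrow> 't set \<Rightarrow> ('t \<Rightarrow> int) \<Rightarrow> (int \<Rightarrow> complex) \<Rightarrow> real" where
  "box2 S v T u f = avg S (\<lambda>x. avg S (\<lambda>x'. fej T u (dif (v x' - v x) f)))"

definition box3 :: "'r set \<Rightarrow> ('r \<Rightarrow> int) \<Rightarrow> 's set \<Rightarrow> ('s \<Rightarrow> int) \<Rightarrow> 't set \<Rightarrow> ('t \<Rightarrow> int) \<Rightarrow> (int \<Rightarrow> complex) \<Rightarrow> real" where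
  "box3 R w S v T u f = avg R (\<lambda>x. avg R (\<lambda>x'. box2 S v T u (dif (w x' - w x) f)))"

lemma fej_nonneg: "0 \<le> fej S v f"
  unfolding fej_def by (rule avg_nonneg) simp

lemma box2_nonneg: "0 \<le> box2 S v T u f"
  unfolding box2_def by (intro avg_nonneg fej_nonneg)

lemma box3_nonneg: "0 \<le> box3 R w S v T u f"
  unfolding box3_def by (intro avg_nonneg box2_nonneg)

lemma fej_le1: "adm f \<Longrightarrow> fej S v f \<le> 1"
  unfolding fej_def by (intro avg_le power_le_one norm_avg_le1 adm_norm norm_ge_zero) auto

lemma box2_le1: "adm f \<Longrightarrow> box2 S v T u f \<le> 1"
  unfolding box2_def by (intro avg_le fej_le1 adm_dif) auto

lemma box3_le1: "adm f \<Longrightarrow> box3 R w S v T u f \<le> 1"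
  unfolding box3_def by (intro avg_le box2_le1 adm_dif) auto

lemma fej_corr:
  assumes f: "per f"
  shows "complex_of_real (fej S v f) = avg S (\<lambda>x. avg S (\<lambda>x'. A (dif (v x' - v x) f)))"
proof -
  have "complex_of_real (fej S v f) = A (\<lambda>y. avg S (\<lambda>x. avg S (\<lambda>x'. f (y + v x) * cnj (f (y + v x')))))"
    unfolding fej_def by (simp only: avg_of_real[symmetric] norm_avg_square)
  also have "\<dots> = avg S (\<lambda>x. avg S (\<lambda>x'. A (\<lambda>y. dif (v x' - v x) f (y + v x))))"
    by (subst avg_swap, rule avg_cong, subst avg_swap, rule avg_cong) (simp add: dif_def add_ac)
  also have "\<dots> = avg S (\<lambda>x. avg S (\<lambda>x'. A (dif (v x' - v x) f)))"
  proof -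
    have "per (dif h f)" for h
      using f by (auto simp: per_def dif_def) (metis add.commute add.left_commute)
    then show ?thesis by (simp only: A_shift)
  qed
  finally show ?thesis .
qed

lemma fej_spec:
  assumes f: "per f" and S: "finite S"
  shows "fej S v f = (\<Sum>r\<in>U. (cmod (hat f r))\<^sup>2 * (cmod (avg S (\<lambda>x. chr r (v x))))\<^sup>2)"
  using parseval_comb[OF f S, of "\<lambda>_. 1 / of_nat (card S)" v]
  by (simp add: fej_def avg_def sum_divide_distrib)

text \<open>Expanded into correlations, both sides average the same double derivative, and
  multiplicative derivatives commute.\<close>

lemma box2_swap:
  assumes f: "adm f"
  shows "box2 S v T u f = box2 T u S v f"
proof -
  have eq: "complex_of_real (box2 S v T u f) =
     avg S (\<lambda>x. avg S (\<lambda>x'. avg T (\<lambda>t. avg T (\<lambda>t'. A (dif (u t' - u t) (dif (v x' - v x) f))))))"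
    for S :: "'c set" and v and T :: "'d set" and u
    unfolding box2_def by (simp only: avg_of_real[symmetric] fej_corr[OF adm_per[OF adm_dif[OF f]]])
  have "complex_of_real (box2 S v T u f) = of_real (box2 T u S v f)"
    unfolding eq avg_swap22[of S S T T] by (simp only: dif_dif)
  then show ?thesis by (simp only: of_real_eq_iff)
qed

lemma box3_swap23:
  assumes f: "adm f"
  shows "box3 R w S v T u f = box3 R w T u S v f"
  unfolding box3_def by (simp only: box2_swap[OF adm_dif[OF f], of S v T u])

lemma box3_swap12: "box3 R w S v T u f = box3 S v R w T u f"
  unfolding box3_def box2_def avg_swap22[of R R S S] by (simp only: dif_dif)

lemma fej_shift: "adm f \<Longrightarrow> fej S v (\<lambda>y. f (y + h)) = fej S v f"
proof -
  assume f: "adm f"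
  have "per (\<lambda>y. (cmod (avg S (\<lambda>x. f (y + v x))))\<^sup>2)"
    using adm_per[OF adm_avg[of S "\<lambda>x y. f (y + v x)"], OF adm_shift[OF f]] by (simp add: per_def)
  from A_shift[OF this, of h] show ?thesis by (simp add: fej_def add_ac)
qed

lemma box3_shift: "adm f \<Longrightarrow> box3 R w S v T u (\<lambda>y. f (y + h)) = box3 R w S v T u f"
  unfolding box3_def box2_def by (simp add: dif_shift fej_shift adm_dif)

text \<open>If the points \<open>v x\<close> hit no residue class modulo \<open>P\<close> much more often than average, then, by positivity,
  the differences \<open>v x' - v x\<close> can be replaced by a uniformly distributed shift.\<close>

lemma dominate:
  fixes X :: "int \<Rightarrow> real" and \<kappa> :: real
  assumes X: "per X" "\<And>h. 0 \<le> X h" and S: "finite S" "S \<noteq> {}"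
    and card: "\<And>z. real (card {x \<in> S. (v x - z) mod int P = 0}) \<le> \<kappa> * card S / P"
  shows "avg S (\<lambda>x. avg S (\<lambda>x'. X (v x' - v x))) \<le> \<kappa> * A X"
proof -
  have inner: "avg S (\<lambda>x'. X (v x' - v x)) \<le> \<kappa> * A X" for x
  proof -
    have "(\<Sum>x'\<in>S. X (v x' - v x)) = (\<Sum>z\<in>U. \<Sum>x'\<in>{x' \<in> S. v x' mod int P = z}. X (v x' - v x))"
      using P_pos by (intro sum.group[symmetric] S(1) finite_U) auto
    also have "\<dots> = (\<Sum>z\<in>U. card {x' \<in> S. v x' mod int P = z} * X (z - v x))"
    proof (rule sum.cong[OF refl])
      fix z
      have "(\<Sum>x'\<in>{x' \<in> S. v x' mod int P = z}. X (v x' - v x)) = (\<Sum>x'\<in>{x' \<in> S. v x' mod int P = z}. X (z - v x))"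
        by (rule sum.cong[OF refl], rule per_cong[OF X(1)]) (auto simp: mod_simps)
      then show "(\<Sum>x'\<in>{x' \<in> S. v x' mod int P = z}. X (v x' - v x)) = card {x' \<in> S. v x' mod int P = z} * X (z - v x)"
        by simp
    qed
    also have "\<dots> \<le> (\<Sum>z\<in>U. \<kappa> * card S / P * X (z - v x))"
    proof (rule sum_mono)
      fix z assume z: "z \<in> U"
      have "{x' \<in> S. v x' mod int P = z} = {x' \<in> S. (v x' - z) mod int P = 0}"
        using z by (auto simp: mod_eq_0_iff_dvd mod_eq_dvd_iff[symmetric])
      then show "card {x' \<in> S. v x' mod int P = z} * X (z - v x) \<le> \<kappa> * card S / P * X (z - v x)"
        using mult_right_mono[OF card X(2)] by simp
    qed
    also have "\<dots> = \<kappa> * card S * A (\<lambda>z. X (z + (- v x)))"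
      by (simp add: avg_def sum_distrib_left sum_divide_distrib)
    also have "\<dots> = card S * (\<kappa> * A X)" by (simp only: A_shift[OF X(1)] mult_ac)
    finally show ?thesis using S by (simp add: avg_def divide_le_eq mult.commute card_gt_0_iff)
  qed
  have "avg S (\<lambda>x. avg S (\<lambda>x'. X (v x' - v x))) \<le> avg S (\<lambda>_. \<kappa> * A X)"
    by (rule avg_mono) (rule inner)
  then show ?thesis using S by (simp add: avg_const)
qed

text \<open>Cauchy-Schwarz with respect to the power spectrum, whose total mass is at most 1. The
  product of the multipliers of two directions is the multiplier of their sum, so a one-parameter
  direction is traded for a two-parameter one at the price of a square.\<close>

lemma avg_fej_power2_le:
  assumes f: "adm f" and I: "finite I" and S: "\<And>i. i \<in> I \<Longrightarrow> finite (S i)"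
  shows "(avg I (\<lambda>i. fej (S i) (v i) f))\<^sup>2
    \<le> avg I (\<lambda>i. avg I (\<lambda>j. fej (S i \<times> S j) (\<lambda>p. v i (fst p) + v j (snd p)) f))"
proof -
  define a where "a r = (cmod (hat f r))\<^sup>2" for r
  define \<kappa> where "\<kappa> i r = (cmod (avg (S i) (\<lambda>x. chr r (v i x))))\<^sup>2" for i r
  have a0: "0 \<le> a r" for r by (simp add: a_def)
  have a1: "(\<Sum>r\<in>U. a r) \<le> 1" using sum_hat_le[OF f] by (simp add: a_def)
  have e1: "avg I (\<lambda>i. fej (S i) (v i) f) = (\<Sum>r\<in>U. a r * avg I (\<lambda>i. \<kappa> i r))"
    using S by (simp add: fej_spec[OF adm_per[OF f]] a_def \<kappa>_def avg_sum avg_cmult cong: avg_cong)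
  have "(\<Sum>r\<in>U. a r * avg I (\<lambda>i. \<kappa> i r))\<^sup>2 = (\<Sum>r\<in>U. sqrt (a r) * (sqrt (a r) * avg I (\<lambda>i. \<kappa> i r)))\<^sup>2"
    using a0 by (simp add: mult.assoc[symmetric])
  also have "\<dots> \<le> (\<Sum>r\<in>U. (sqrt (a r))\<^sup>2) * (\<Sum>r\<in>U. (sqrt (a r) * avg I (\<lambda>i. \<kappa> i r))\<^sup>2)"
    by (rule Cauchy_Schwarz_ineq_sum)
  also have "\<dots> \<le> 1 * (\<Sum>r\<in>U. (sqrt (a r) * avg I (\<lambda>i. \<kappa> i r))\<^sup>2)"
    using a0 a1 by (intro mult_right_mono sum_nonneg) auto
  also have "\<dots> = (\<Sum>r\<in>U. a r * (avg I (\<lambda>i. \<kappa> i r))\<^sup>2)"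
    using a0 by (simp add: power_mult_distrib)
  also have "\<dots> = (\<Sum>r\<in>U. a r * avg I (\<lambda>i. avg I (\<lambda>j. \<kappa> i r * \<kappa> j r)))"
    by (simp only: power2_eq_square avg_cmult avg_multc)
  also have "\<dots> = avg I (\<lambda>i. avg I (\<lambda>j. \<Sum>r\<in>U. a r * (\<kappa> i r * \<kappa> j r)))"
    by (simp only: avg_sum avg_cmult)
  also have "\<dots> = avg I (\<lambda>i. avg I (\<lambda>j. fej (S i \<times> S j) (\<lambda>p. v i (fst p) + v j (snd p)) f))"
  proof (intro avg_cong)
    fix i j assume ij: "i \<in> I" "j \<in> I"
    have "avg (S i \<times> S j) (\<lambda>p. chr r (v i (fst p) + v j (snd p)))
        = avg (S i) (\<lambda>x. chr r (v i x)) * avg (S j) (\<lambda>x. chr r (v j x))" for r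
      using avg_pair[of "S i" "S j" "\<lambda>x y. chr r (v i x) * chr r (v j y)"]
      by (simp only: chr_add avg_cmult avg_multc)
    then show "(\<Sum>r\<in>U. a r * (\<kappa> i r * \<kappa> j r)) = fej (S i \<times> S j) (\<lambda>p. v i (fst p) + v j (snd p)) f"
      using S ij by (simp add: fej_spec[OF adm_per[OF f]] a_def \<kappa>_def norm_mult power_mult_distrib)
  qed
  finally show ?thesis by (simp only: e1)
qed

end

subsection \<open>Van der Corput differencing\<close>

text \<open>Only an upper bound for the length is recorded. The class is then closed under the
  intersections of an interval with a translate that differencing creates, while the normalisation
  by \<open>M\<close> never changes.\<close>

definition ivl :: "nat \<Rightarrow> int set \<Rightarrow> bool" where
  "ivl M I \<longleftrightarrow> (\<exists>p q. I = {p..q}) \<and> card I \<le> M"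

lemma ivl_finite: "ivl M I \<Longrightarrow> finite I"
  by (auto simp: ivl_def)

lemma ivl_card: "ivl M I \<Longrightarrow> card I \<le> M"
  by (simp add: ivl_def)

lemma ivl_Int_shift: "ivl M I \<Longrightarrow> ivl M {s \<in> I. s + h \<in> I}"
proof -
  assume I: "ivl M I"
  then obtain p q where pq: "I = {p..q}" by (auto simp: ivl_def)
  have "{s \<in> I. s + h \<in> I} = {max p (p - h)..min q (q - h)}" by (auto simp: pq)
  moreover have "card {s \<in> I. s + h \<in> I} \<le> card I"
    by (rule card_mono[OF ivl_finite[OF I]]) auto
  ultimately show ?thesis using ivl_card[OF I] unfolding ivl_def by (intro conjI) (blast, simp)
qed

lemma sum_shift_interval:
  fixes X :: "int \<Rightarrow> complex"
  assumes X: "\<And>k. cmod (X k) \<le> 1"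
  shows "cmod ((\<Sum>k\<in>{p..q}. X (k + j)) - sum X {p..q}) \<le> 2 * real_of_int \<bar>j\<bar>"
proof (cases "p \<le> q")
  case True
  define K where "K = nat (q - p + 1)"
  have K: "K > 0" "int K = q - p + 1" using True by (auto simp: K_def)
  have r: "(\<Sum>k\<in>{1..int K}. F (k + (p - 1))) = sum F {p..q}" for F :: "int \<Rightarrow> complex"
    by (rule sum.reindex_bij_witness[of _ "\<lambda>k. k - (p-1)" "\<lambda>k. k + (p-1)"]) (auto simp: K)
  have "cmod (avg {1..int K} (\<lambda>k. X (k + j + (p-1))) - avg {1..int K} (\<lambda>k. X (k + (p-1)))) \<le> 2 * real_of_int \<bar>j\<bar> / K"
    using avg_shift_interval[of "\<lambda>k. X (k + (p-1))" K j] X by simp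
  moreover have "avg {1..int K} (\<lambda>k. X (k + j + (p-1))) - avg {1..int K} (\<lambda>k. X (k + (p-1)))
      = ((\<Sum>k\<in>{p..q}. X (k + j)) - sum X {p..q}) / of_nat K"
    using r[of "\<lambda>k. X (k + j)"] r[of X] by (simp add: avg_def diff_divide_distrib add_ac)
  ultimately show ?thesis using K(1) by (simp add: norm_divide divide_le_cancel)
qed simp

text \<open>The sum over \<open>I\<close> equals its average over all shifts
  \<open>\<sigma> x\<close>; Cauchy-Schwarz over the common range of the shifted intervals then
  opens the square. The shifts form an arbitrary family in [0, M], which later permits multiples of
  a dilation \<open>w\<close>.\<close>

lemma van_der_corput:
  fixes \<phi> :: "int \<Rightarrow> complex" and \<sigma> :: "'x \<Rightarrow> int"
  assumes I: "ivl M I" and X: "finite X" "X \<noteq> {}" and \<sigma>: "\<And>x. x \<in> X \<Longrightarrow> 0 \<le> \<sigma> x \<and> \<sigma> x \<le> int M"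
  shows "(cmod (\<Sum>s\<in>I. \<phi> s))\<^sup>2 \<le> 2 * real M * Re (avg X (\<lambda>x. avg X (\<lambda>x'.
    \<Sum>s\<in>{s\<in>I. s + (\<sigma> x' - \<sigma> x) \<in> I}. \<phi> s * cnj (\<phi> (s + (\<sigma> x' - \<sigma> x))))))"
proof -
  obtain p q where pq: "I = {p..q}" using I by (auto simp: ivl_def)
  define \<psi> where "\<psi> s = (if s \<in> I then \<phi> s else 0)" for s
  \<comment> \<open>Long enough to contain \<open>I - \<sigma> x\<close> for every admissible shift;
    its length is at most 2 M because \<open>I\<close> has at most M points.\<close>
  define N where "N = {p - int M..q}"
  have cN: "card N \<le> 2 * M" if "p \<le> q" using ivl_card[OF I] that by (simp add: N_def pq)
  have fN: "finite N" by (simp add: N_def)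
  have re: "(\<Sum>n\<in>N. F (n + \<sigma> x)) = (\<Sum>s\<in>I. F s)" if "x \<in> X" "\<And>s. s \<notin> I \<Longrightarrow> F s = 0" for x and F :: "int \<Rightarrow> complex"
  proof -
    have "(\<Sum>s\<in>I. F s) = (\<Sum>n\<in>(\<lambda>s. s - \<sigma> x) ` I. F (n + \<sigma> x))"
      by (subst sum.reindex) (auto simp: inj_on_def)
    also have "\<dots> = (\<Sum>n\<in>N. F (n + \<sigma> x))"
    proof (rule sum.mono_neutral_left[OF fN])
      show "(\<lambda>s. s - \<sigma> x) ` I \<subseteq> N" using \<sigma>[OF that(1)] by (auto simp: pq N_def)
      show "\<forall>i\<in>N - (\<lambda>s. s - \<sigma> x) ` I. F (i + \<sigma> x) = 0"
      proof
        fix i assume i: "i \<in> N - (\<lambda>s. s - \<sigma> x) ` I"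
        have "i + \<sigma> x \<notin> I"
        proof
          assume "i + \<sigma> x \<in> I"
          then have "i + \<sigma> x - \<sigma> x \<in> (\<lambda>s. s - \<sigma> x) ` I" by (rule imageI)
          then show False using i by simp
        qed
        then show "F (i + \<sigma> x) = 0" by (rule that(2))
      qed
    qed
    finally show ?thesis by simp
  qed
  show ?thesis
  proof (cases "p \<le> q")
    case True
    have "(\<Sum>s\<in>I. \<phi> s) = (\<Sum>s\<in>I. \<psi> s)" by (simp add: \<psi>_def)
    also have "\<dots> = avg X (\<lambda>x. \<Sum>s\<in>I. \<psi> s)" using X by (simp add: avg_const)
    also have "\<dots> = avg X (\<lambda>x. \<Sum>n\<in>N. \<psi> (n + \<sigma> x))"
      by (rule avg_cong, rule re[symmetric]) (auto simp: \<psi>_def)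
    also have "\<dots> = (\<Sum>n\<in>N. avg X (\<lambda>x. \<psi> (n + \<sigma> x)))" by (simp add: avg_sum)
    finally have "cmod (\<Sum>s\<in>I. \<phi> s) \<le> (\<Sum>n\<in>N. cmod (avg X (\<lambda>x. \<psi> (n + \<sigma> x))) * 1)"
      using norm_sum by fastforce
    then have "(cmod (\<Sum>s\<in>I. \<phi> s))\<^sup>2 \<le> (\<Sum>n\<in>N. cmod (avg X (\<lambda>x. \<psi> (n + \<sigma> x))) * 1)\<^sup>2"
      by (rule power_mono) simp
    also have "\<dots> \<le> (\<Sum>n\<in>N. (cmod (avg X (\<lambda>x. \<psi> (n + \<sigma> x))))\<^sup>2) * (\<Sum>n\<in>N. 1\<^sup>2)"
      by (rule Cauchy_Schwarz_ineq_sum)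
    also have "\<dots> \<le> (\<Sum>n\<in>N. (cmod (avg X (\<lambda>x. \<psi> (n + \<sigma> x))))\<^sup>2) * (2 * real M)"
      using cN[OF True] by (intro mult_left_mono sum_nonneg) auto
    also have "\<dots> = 2 * real M * Re (complex_of_real (\<Sum>n\<in>N. (cmod (avg X (\<lambda>x. \<psi> (n + \<sigma> x))))\<^sup>2))" by simp
    also have "complex_of_real (\<Sum>n\<in>N. (cmod (avg X (\<lambda>x. \<psi> (n + \<sigma> x))))\<^sup>2)
        = avg X (\<lambda>x. avg X (\<lambda>x'. \<Sum>n\<in>N. \<psi> (n + \<sigma> x) * cnj (\<psi> (n + \<sigma> x'))))"
      by (simp only: of_real_sum norm_avg_square avg_sum)
    also have "\<dots> = avg X (\<lambda>x. avg X (\<lambda>x'.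
        \<Sum>s\<in>{s\<in>I. s + (\<sigma> x' - \<sigma> x) \<in> I}. \<phi> s * cnj (\<phi> (s + (\<sigma> x' - \<sigma> x)))))"
    proof (intro avg_cong)
      fix x x' assume x: "x \<in> X" "x' \<in> X"
      have "(\<Sum>n\<in>N. \<psi> (n + \<sigma> x) * cnj (\<psi> (n + \<sigma> x')))
          = (\<Sum>n\<in>N. \<psi> (n + \<sigma> x) * cnj (\<psi> (n + \<sigma> x + (\<sigma> x' - \<sigma> x))))" by simp
      also have "\<dots> = (\<Sum>s\<in>I. \<psi> s * cnj (\<psi> (s + (\<sigma> x' - \<sigma> x))))"
        by (rule re[OF x(1), of "\<lambda>s. \<psi> s * cnj (\<psi> (s + (\<sigma> x' - \<sigma> x)))"]) (simp add: \<psi>_def)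
      also have "\<dots> = (\<Sum>s\<in>{s\<in>I. s + (\<sigma> x' - \<sigma> x) \<in> I}. \<phi> s * cnj (\<phi> (s + (\<sigma> x' - \<sigma> x))))"
        unfolding \<psi>_def by (rule sum.mono_neutral_cong_right[OF ivl_finite[OF I]]) auto
      finally show "(\<Sum>n\<in>N. \<psi> (n + \<sigma> x) * cnj (\<psi> (n + \<sigma> x')))
        = (\<Sum>s\<in>{s\<in>I. s + (\<sigma> x' - \<sigma> x) \<in> I}. \<phi> s * cnj (\<phi> (s + (\<sigma> x' - \<sigma> x))))" .
    qed
    finally show ?thesis .
  qed (simp add: pq)
qed

context cyclic
begin

lemma van_der_corput_avg:
  fixes \<phi> :: "int \<Rightarrow> int \<Rightarrow> complex" and \<sigma> :: "'x \<Rightarrow> int"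
  assumes u: "\<And>y. cmod (u y) \<le> 1" and M: "M > 0"
    and I: "ivl M I" and X: "finite X" "X \<noteq> {}" and \<sigma>: "\<And>x. x \<in> X \<Longrightarrow> 0 \<le> \<sigma> x \<and> \<sigma> x \<le> int M"
  shows "(cmod (A (\<lambda>y. u y * ((\<Sum>s\<in>I. \<phi> s y) / of_nat M))))\<^sup>2 \<le> 2 * avg X (\<lambda>x. avg X (\<lambda>x'.
    cmod (A (\<lambda>y. (\<Sum>s\<in>{s\<in>I. s + (\<sigma> x' - \<sigma> x) \<in> I}. \<phi> s y * cnj (\<phi> (s + (\<sigma> x' - \<sigma> x)) y)) / of_nat M))))"
    (is "_ \<le> 2 * avg X (\<lambda>x. avg X (\<lambda>x'. cmod (A (\<lambda>y. ?S x x' y / _))))")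
proof -
  have "(cmod (A (\<lambda>y. u y * ((\<Sum>s\<in>I. \<phi> s y) / of_nat M))))\<^sup>2 \<le> A (\<lambda>y. (cmod ((\<Sum>s\<in>I. \<phi> s y) / of_nat M))\<^sup>2)"
    by (rule norm_avg_mult_power2_le) (rule u)
  also have "\<dots> \<le> A (\<lambda>y. 2 * Re (avg X (\<lambda>x. avg X (\<lambda>x'. ?S x x' y / of_nat M))))"
  proof (rule avg_mono)
    fix y
    have e: "avg X (\<lambda>x. avg X (\<lambda>x'. ?S x x' y / of_nat M)) = avg X (\<lambda>x. avg X (\<lambda>x'. ?S x x' y)) / of_nat M"
      by (simp only: divide_inverse avg_multc)
    have "(cmod ((\<Sum>s\<in>I. \<phi> s y) / of_nat M))\<^sup>2 = (cmod (\<Sum>s\<in>I. \<phi> s y))\<^sup>2 / (real M)\<^sup>2"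
      by (simp add: norm_divide power_divide)
    also have "\<dots> \<le> 2 * real M * Re (avg X (\<lambda>x. avg X (\<lambda>x'. ?S x x' y))) / (real M)\<^sup>2"
      by (intro divide_right_mono van_der_corput I X \<sigma>) auto
    also have "\<dots> = 2 * Re (avg X (\<lambda>x. avg X (\<lambda>x'. ?S x x' y / of_nat M)))"
      unfolding e using M by (simp add: power2_eq_square Re_divide_of_nat)
    finally show "(cmod ((\<Sum>s\<in>I. \<phi> s y) / of_nat M))\<^sup>2 \<le> \<dots>" .
  qed
  also have "\<dots> = 2 * Re (A (\<lambda>y. avg X (\<lambda>x. avg X (\<lambda>x'. ?S x x' y / of_nat M))))"
    by (simp only: avg_cmult avg_Re)
  also have "A (\<lambda>y. avg X (\<lambda>x. avg X (\<lambda>x'. ?S x x' y / of_nat M)))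
      = avg X (\<lambda>x. avg X (\<lambda>x'. A (\<lambda>y. ?S x x' y / of_nat M)))"
    by (subst avg_swap, rule avg_cong, rule avg_swap)
  also have "2 * Re \<dots> \<le> 2 * avg X (\<lambda>x. avg X (\<lambda>x'. cmod (A (\<lambda>y. ?S x x' y / of_nat M))))"
    by (intro mult_left_mono order.trans[OF complex_Re_le_cmod order.trans[OF norm_avg_le avg_mono[OF norm_avg_le]]]) simp
  finally show ?thesis .
qed

text \<open>An average over progressions with up to three slopes. Fewer functions are modelled by
  filling the remaining slots with the constant 1.\<close>

definition lin where
  "lin M I f0 f1 f2 f3 a1 a2 a3 =
    A (\<lambda>y. f0 y * ((\<Sum>s\<in>I. f1 (y + a1 * s) * f2 (y + a2 * s) * f3 (y + a3 * s)) / of_nat M))"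

text \<open>One van der Corput step discards \<open>f0\<close>. Translating \<open>y\<close> by
  \<open>- a1 * s\<close> frees the derivative of \<open>f1\<close> from \<open>s\<close>; it
  becomes the new weight, and all other slopes drop by \<open>a1\<close>.\<close>

lemma lin_step:
  assumes f: "adm f0" "adm f1" "adm f2" "adm f3" and I: "ivl M I" and K: "0 < K" "K \<le> M"
  shows "(cmod (lin M I f0 f1 f2 f3 a1 a2 a3))\<^sup>2 \<le> 2 * avg {1..int K} (\<lambda>k. avg {1..int K} (\<lambda>k'.
    cmod (lin M {s\<in>I. s + (k' - k) \<in> I} (dif (a1 * (k' - k)) f1) (dif (a2 * (k' - k)) f2)
      (dif (a3 * (k' - k)) f3) (\<lambda>_. 1) (a2 - a1) (a3 - a1) 0)))"
proof -
  define \<phi> where "\<phi> s y = f1 (y + a1 * s) * f2 (y + a2 * s) * f3 (y + a3 * s)" for s y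
  have "(cmod (lin M I f0 f1 f2 f3 a1 a2 a3))\<^sup>2 \<le> 2 * avg {1..int K} (\<lambda>k. avg {1..int K} (\<lambda>k'.
    cmod (A (\<lambda>y. (\<Sum>s\<in>{s\<in>I. s + (k' - k) \<in> I}. \<phi> s y * cnj (\<phi> (s + (k' - k)) y)) / of_nat M))))"
    unfolding lin_def \<phi>_def[symmetric]
    by (rule van_der_corput_avg) (use f(1) I K in \<open>auto simp: adm_norm\<close>)
  moreover have "A (\<lambda>y. (\<Sum>s\<in>J. \<phi> s y * cnj (\<phi> (s + h) y)) / of_nat M)
     = lin M J (dif (a1 * h) f1) (dif (a2 * h) f2) (dif (a3 * h) f3) (\<lambda>_. 1) (a2 - a1) (a3 - a1) 0" for h J
  proof -
    define g where "g s y = dif (a1 * h) f1 (y + 0) * (dif (a2 * h) f2 (y + (a2 - a1) * s) * dif (a3 * h) f3 (y + (a3 - a1) * s))" for s y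
    have g: "adm (g s)" for s
      unfolding g_def[abs_def] by (intro adm_mult adm_shift adm_dif f)
    \<comment> \<open>After translation by \<open>a1 * s\<close> the first factor no longer involves
      \<open>s\<close>. The \<open>+ 0\<close> keeps it in the shape expected by
      \<open>adm_shift\<close>.\<close>
    have e: "\<phi> s y * cnj (\<phi> (s + h) y) = g s (y + a1 * s)" for s y
      by (simp add: \<phi>_def g_def dif_def algebra_simps)
    have "A (\<lambda>y. (\<Sum>s\<in>J. \<phi> s y * cnj (\<phi> (s + h) y)) / of_nat M) = (\<Sum>s\<in>J. A (\<lambda>y. g s (y + a1 * s))) / of_nat M"
      unfolding e by (simp only: divide_inverse avg_multc avg_sum)
    also have "\<dots> = A (\<lambda>y. (\<Sum>s\<in>J. g s y) / of_nat M)"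
      by (simp only: A_shift[OF adm_per[OF g]] divide_inverse avg_multc avg_sum)
    also have "\<dots> = lin M J (dif (a1 * h) f1) (dif (a2 * h) f2) (dif (a3 * h) f3) (\<lambda>_. 1) (a2 - a1) (a3 - a1) 0"
      by (simp add: lin_def g_def sum_distrib_left sum_divide_distrib mult.assoc)
    finally show ?thesis .
  qed
  ultimately show ?thesis by simp
qed

text \<open>With one function left, the sum over \<open>I\<close> is compared with its translates by
  \<open>k\<close> at most \<open>K\<close>: boundary terms cost 2 K / M, and the inner average over
  \<open>k\<close> no longer depends on \<open>s\<close> once \<open>y\<close> is
  translated.\<close>

lemma lin_last:
  assumes f: "adm f0" "adm f1" and I: "ivl M I" and K: "0 < K" "0 < M"
  shows "cmod (lin M I f0 f1 (\<lambda>_. 1) (\<lambda>_. 1) a1 a2 a3)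
    \<le> 2 * real K / real M + A (\<lambda>y. cmod (avg {1..int K} (\<lambda>k. f1 (y + a1 * k))))"
proof -
  define g where "g y = cmod (avg {1..int K} (\<lambda>k. f1 (y + a1 * k)))" for y
  have gper: "per g"
    using adm_per[OF adm_avg[of "{1..int K}" "\<lambda>k y. f1 (y + a1 * k)"], OF adm_shift[OF f(2)]]
    by (auto simp: per_def g_def)
  have "cmod (lin M I f0 f1 (\<lambda>_. 1) (\<lambda>_. 1) a1 a2 a3) \<le> A (\<lambda>y. cmod (f0 y * ((\<Sum>s\<in>I. f1 (y + a1 * s)) / of_nat M)))"
    unfolding lin_def by (simp add: norm_avg_le)
  also have "\<dots> \<le> A (\<lambda>y. 2 * real K / real M + (\<Sum>s\<in>I. g (y + a1 * s)) / M)"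
  proof (rule avg_mono)
    fix y
    obtain p q where pq: "I = {p..q}" using I by (auto simp: ivl_def)
    have d: "cmod ((\<Sum>s\<in>I. f1 (y + a1 * s)) - (\<Sum>s\<in>I. f1 (y + a1 * (s + k)))) \<le> 2 * real K" if "k \<in> {1..int K}" for k
    proof -
      have "cmod ((\<Sum>s\<in>{p..q}. f1 (y + a1 * (s + k))) - (\<Sum>s\<in>{p..q}. f1 (y + a1 * s))) \<le> 2 * real_of_int \<bar>k\<bar>"
        by (rule sum_shift_interval) (rule adm_norm[OF f(2)])
      also have "2 * real_of_int \<bar>k\<bar> \<le> 2 * real K" using that by auto
      finally show ?thesis by (simp add: pq norm_minus_commute)
    qed
    have "cmod ((\<Sum>s\<in>I. f1 (y + a1 * s)) - (\<Sum>s\<in>I. avg {1..int K} (\<lambda>k. f1 (y + a1 * s + a1 * k))))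
        = cmod (avg {1..int K} (\<lambda>k. (\<Sum>s\<in>I. f1 (y + a1 * s)) - (\<Sum>s\<in>I. f1 (y + a1 * (s + k)))))"
      using K by (simp add: avg_diff avg_const avg_sum distrib_left add.assoc)
    also have "\<dots> \<le> 2 * real K"
      by (rule order.trans[OF norm_avg_le], rule avg_le) (use d in auto)
    finally have "cmod (\<Sum>s\<in>I. f1 (y + a1 * s)) \<le> 2 * real K + cmod (\<Sum>s\<in>I. avg {1..int K} (\<lambda>k. f1 (y + a1 * s + a1 * k)))"
      by (smt (verit) norm_triangle_ineq2)
    also have "cmod (\<Sum>s\<in>I. avg {1..int K} (\<lambda>k. f1 (y + a1 * s + a1 * k))) \<le> (\<Sum>s\<in>I. g (y + a1 * s))"
      unfolding g_def by (rule norm_sum)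
    finally have "cmod (\<Sum>s\<in>I. f1 (y + a1 * s)) \<le> 2 * real K + (\<Sum>s\<in>I. g (y + a1 * s))" by simp
    then have "cmod (\<Sum>s\<in>I. f1 (y + a1 * s)) / M \<le> (2 * real K + (\<Sum>s\<in>I. g (y + a1 * s))) / M"
      by (rule divide_right_mono) simp
    moreover have "cmod (f0 y * ((\<Sum>s\<in>I. f1 (y + a1 * s)) / of_nat M)) \<le> cmod (\<Sum>s\<in>I. f1 (y + a1 * s)) / M"
      using mult_right_mono[OF adm_norm[OF f(1), of y], of "cmod (\<Sum>s\<in>I. f1 (y + a1 * s)) / M"]
      by (simp add: norm_mult norm_divide)
    ultimately show "cmod (f0 y * ((\<Sum>s\<in>I. f1 (y + a1 * s)) / of_nat M)) \<le> 2 * real K / real M + (\<Sum>s\<in>I. g (y + a1 * s)) / M"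
      by (simp add: add_divide_distrib)
  qed
  also have "\<dots> = 2 * real K / real M + (\<Sum>s\<in>I. A g) / M"
    by (simp only: avg_add A_const divide_inverse avg_multc avg_sum A_shift[OF gper])
  also have "\<dots> \<le> 2 * real K / real M + A g"
  proof -
    have "0 \<le> A g" by (rule avg_nonneg) (simp add: g_def)
    then have "real (card I) * A g \<le> real M * A g" using ivl_card[OF I] by (intro mult_right_mono) auto
    then show ?thesis using K by (simp add: divide_le_eq mult.commute)
  qed
  finally show ?thesis unfolding g_def .
qed

text \<open>Two differencing steps discard \<open>f0\<close>, \<open>f1\<close> and
  \<open>f2\<close> as weights; the last step averages \<open>f3\<close> locally. Its slope is
  \<open>a3\<close>, then \<open>a3 - a1\<close>, then \<open>a3 - a2\<close>, and these are the
  three directions.\<close>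

lemma lin_box3:
  assumes f: "adm f0" "adm f1" "adm f2" "adm f3" and I: "ivl M I" and K: "0 < K" "K \<le> M"
  shows "(cmod (lin M I f0 f1 f2 f3 a1 a2 a3)) ^ 8 \<le> 512 * (K / M)\<^sup>2 +
    128 * box3 {1..int K} (\<lambda>k. a3 * k) {1..int K} (\<lambda>k. (a3 - a1) * k) {1..int K} (\<lambda>k. (a3 - a2) * k) f3"
proof -
  let ?K = "{1..int K}"
  have M: "0 < M" using K by simp
  define L1 where "L1 k k' = cmod (lin M {s\<in>I. s + (k' - k) \<in> I} (dif (a1 * (k' - k)) f1) (dif (a2 * (k' - k)) f2)
      (dif (a3 * (k' - k)) f3) (\<lambda>_. 1) (a2 - a1) (a3 - a1) 0)" for k k'
  define F where "F k k' l l' = dif ((a3 - a1) * (l' - l)) (dif (a3 * (k' - k)) f3)" for k k' l l'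
  have admF: "adm (F k k' l l')" for k k' l l' unfolding F_def by (intro adm_dif f)
  have s1: "(cmod (lin M I f0 f1 f2 f3 a1 a2 a3))\<^sup>2 \<le> 2 * avg ?K (\<lambda>k. avg ?K (L1 k))"
    unfolding L1_def by (rule lin_step[OF f I K])
  define L2 where "L2 k k' l l' = 2 * real K / real M + A (\<lambda>y. cmod (avg ?K (\<lambda>m. F k k' l l' (y + (a3 - a2) * m))))" for k k' l l'
  have s2: "(L1 k k')\<^sup>2 \<le> 2 * avg ?K (\<lambda>l. avg ?K (L2 k k' l))" for k k'
  proof -
    have "(L1 k k')\<^sup>2 \<le> 2 * avg ?K (\<lambda>l. avg ?K (\<lambda>l'. cmod (lin M
        {s\<in>{s\<in>I. s + (k' - k) \<in> I}. s + (l' - l) \<in> {s\<in>I. s + (k' - k) \<in> I}}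
        (dif ((a2 - a1) * (l' - l)) (dif (a2 * (k' - k)) f2)) (F k k' l l') (dif (0 * (l' - l)) (\<lambda>_. 1)) (\<lambda>_. 1)
        ((a3 - a1) - (a2 - a1)) (0 - (a2 - a1)) 0)))"
      unfolding L1_def F_def by (rule lin_step) (intro adm_dif f adm_one ivl_Int_shift I K)+
    also have "\<dots> \<le> 2 * avg ?K (\<lambda>l. avg ?K (L2 k k' l))"
    proof (intro mult_left_mono avg_mono)
      fix l l'
      have "cmod (lin M
        {s\<in>{s\<in>I. s + (k' - k) \<in> I}. s + (l' - l) \<in> {s\<in>I. s + (k' - k) \<in> I}}
        (dif ((a2 - a1) * (l' - l)) (dif (a2 * (k' - k)) f2)) (F k k' l l') (\<lambda>_. 1) (\<lambda>_. 1)
        (a3 - a2) (0 - (a2 - a1)) 0) \<le> L2 k k' l l'"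
        unfolding L2_def by (rule lin_last) (intro adm_dif f admF ivl_Int_shift I K M)+
      then show "cmod (lin M
        {s\<in>{s\<in>I. s + (k' - k) \<in> I}. s + (l' - l) \<in> {s\<in>I. s + (k' - k) \<in> I}}
        (dif ((a2 - a1) * (l' - l)) (dif (a2 * (k' - k)) f2)) (F k k' l l') (dif (0 * (l' - l)) (\<lambda>_. 1)) (\<lambda>_. 1)
        ((a3 - a1) - (a2 - a1)) (0 - (a2 - a1)) 0) \<le> L2 k k' l l'" by simp
    qed simp
    finally show ?thesis .
  qed
  have s3: "(L2 k k' l l')\<^sup>2 \<le> 8 * (K / M)\<^sup>2 + 2 * fej ?K (\<lambda>m. (a3 - a2) * m) (F k k' l l')" for k k' l l'
  proof -
    have sq: "(2 * a + b)\<^sup>2 \<le> 8 * a\<^sup>2 + 2 * b\<^sup>2" for a b :: real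
      using zero_le_power2[of "2 * a - b"] by (simp add: power2_eq_square algebra_simps)
    have "(L2 k k' l l')\<^sup>2 \<le> 8 * (K / M)\<^sup>2 + 2 * (A (\<lambda>y. cmod (avg ?K (\<lambda>m. F k k' l l' (y + (a3 - a2) * m)))))\<^sup>2"
      using sq[of "K / M"] by (simp add: L2_def)
    also have "(A (\<lambda>y. cmod (avg ?K (\<lambda>m. F k k' l l' (y + (a3 - a2) * m)))))\<^sup>2 \<le> fej ?K (\<lambda>m. (a3 - a2) * m) (F k k' l l')"
      unfolding fej_def by (rule avg_power2_le)
    finally show ?thesis by simp
  qed
  have L1_0: "0 \<le> L1 k k'" for k k' by (simp add: L1_def)
  have "(cmod (lin M I f0 f1 f2 f3 a1 a2 a3)) ^ 8 = ((cmod (lin M I f0 f1 f2 f3 a1 a2 a3))\<^sup>2) ^ (2 ^ 2)"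
    by (simp flip: power_mult)
  also have "\<dots> \<le> (2 * avg ?K (\<lambda>k. avg ?K (L1 k))) ^ (2 ^ 2)"
    by (rule power_mono[OF s1]) simp
  also have "\<dots> = 16 * avg ?K (\<lambda>k. avg ?K (L1 k)) ^ (2 ^ 2)" by (simp add: power_mult_distrib)
  also have "\<dots> \<le> 16 * avg ?K (\<lambda>k. avg ?K (\<lambda>k'. L1 k k' ^ (2 ^ 2)))"
    by (intro mult_left_mono order.trans[OF avg_power_le] avg_mono avg_nonneg avg_power_le L1_0) simp
  also have "\<dots> \<le> 16 * avg ?K (\<lambda>k. avg ?K (\<lambda>k'. 4 * avg ?K (\<lambda>l. avg ?K (\<lambda>l'. (L2 k k' l l')\<^sup>2))))"
  proof (intro mult_left_mono avg_mono)
    fix k k'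
    have "L1 k k' ^ (2 ^ 2) = ((L1 k k')\<^sup>2)\<^sup>2" by (simp flip: power_mult)
    also have "\<dots> \<le> (2 * avg ?K (\<lambda>l. avg ?K (L2 k k' l)))\<^sup>2"
      by (rule power_mono[OF s2]) simp
    also have "\<dots> = 4 * (avg ?K (\<lambda>l. avg ?K (L2 k k' l)))\<^sup>2" by (simp add: power_mult_distrib)
    also have "\<dots> \<le> 4 * avg ?K (\<lambda>l. avg ?K (\<lambda>l'. (L2 k k' l l')\<^sup>2))"
      by (intro mult_left_mono order.trans[OF avg_power2_le] avg_mono avg_power2_le) simp
    finally show "L1 k k' ^ (2 ^ 2) \<le> \<dots>" .
  qed simp
  also have "\<dots> \<le> 16 * avg ?K (\<lambda>k. avg ?K (\<lambda>k'. 4 * avg ?K (\<lambda>l. avg ?K (\<lambda>l'.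
      8 * (K / M)\<^sup>2 + 2 * fej ?K (\<lambda>m. (a3 - a2) * m) (F k k' l l')))))"
    by (intro mult_left_mono avg_mono s3) simp_all
  \<comment> \<open>The constants are 512 = 16 * 4 * 8 and 128 = 16 * 4 * 2, one factor from each of
    the three rounds.\<close>
  also have "\<dots> = 512 * (K / M)\<^sup>2 +
    128 * box3 ?K (\<lambda>k. a3 * k) ?K (\<lambda>k. (a3 - a1) * k) ?K (\<lambda>k. (a3 - a2) * k) f3"
    using K by (simp add: avg_add avg_cmult avg_const box3_def box2_def F_def right_diff_distrib)
  finally show ?thesis .
qed

end

subsection \<open>Concatenation of two-dimensional box norms\<close>

text \<open>The diagonal has density 1 / card T, and each of its terms is at most 1.\<close>

lemma avg_offdiag:
  fixes x :: "'a \<Rightarrow> 'a \<Rightarrow> real"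
  assumes T: "finite T" "T \<noteq> {}" and x: "\<And>i. i \<in> T \<Longrightarrow> x i i \<le> 1"
  shows "avg T (\<lambda>i. avg T (x i)) \<le> 1 / card T + avg T (\<lambda>i. avg T (\<lambda>j. if i = j then 0 else x i j))"
proof -
  have "avg T (x i) \<le> 1 / card T + avg T (\<lambda>j. if i = j then 0 else x i j)" if i: "i \<in> T" for i
  proof -
    have "sum (x i) T \<le> (\<Sum>j\<in>T. (if i = j then 1 else 0) + (if i = j then 0 else x i j))"
      by (rule sum_mono) (use x[OF i] in auto)
    also have "\<dots> = 1 + (\<Sum>j\<in>T. if i = j then 0 else x i j)" using T i by (simp add: sum.distrib)
    finally show ?thesis unfolding avg_def add_divide_distrib[symmetric] by (rule divide_right_mono) simp
  qed
  then have "avg T (\<lambda>i. avg T (x i)) \<le> avg T (\<lambda>i. 1 / card T + avg T (\<lambda>j. if i = j then 0 else x i j))"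
    by (rule avg_mono)
  then show ?thesis using T by (simp add: avg_add avg_const)
qed

context cyclic
begin

lemma box2_corr:
  assumes f: "adm f"
  shows "complex_of_real (box2 S v T u f) =
     avg S (\<lambda>x. avg S (\<lambda>x'. avg T (\<lambda>t. avg T (\<lambda>t'. A (dif (u t' - u t) (dif (v x' - v x) f))))))"
  unfolding box2_def by (simp only: avg_of_real[symmetric] fej_corr[OF adm_per[OF adm_dif[OF f]]])

text \<open>Pigeonholing freezes \<open>x'\<close> and \<open>t'\<close>. Of the four factors of the
  double derivative only \<open>f\<close> still depends on both \<open>x\<close> and
  \<open>t\<close>; the others become \<open>\<alpha>\<close>, \<open>\<beta>\<close>,
  \<open>\<gamma>\<close>.\<close>

lemma box2_le_correlation:
  assumes f: "adm f" and S: "finite S" "S \<noteq> {}" and T: "finite T" "T \<noteq> {}"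
  obtains \<alpha> \<beta> \<gamma> where "adm \<alpha>" "adm \<beta>" "adm \<gamma>"
    "box2 S v T u f \<le> cmod (avg S (\<lambda>x. avg T (\<lambda>t. A (\<lambda>z. f (z + v x + u t) * \<alpha> (z + u t) * \<beta> (z + v x) * \<gamma> z))))"
proof -
  define G where "G x' t' = avg S (\<lambda>x. avg T (\<lambda>t. A (\<lambda>z. f (z + v x + u t) * cnj (f (z + u t + v x'))
     * cnj (f (z + v x + u t')) * f (z + (v x' + u t')))))" for x' t'
  have e: "A (dif (u t' - u t) (dif (v x' - v x) f)) = A (\<lambda>z. f (z + v x + u t) * cnj (f (z + u t + v x'))
     * cnj (f (z + v x + u t')) * f (z + (v x' + u t')))" for x x' t t'
    by (subst A_shift[OF adm_per[OF adm_dif[OF adm_dif[OF f]]], of _ _ "v x + u t", symmetric])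
       (simp add: dif_def algebra_simps)
  have "complex_of_real (box2 S v T u f) = avg S (\<lambda>x'. avg T (\<lambda>t'. G x' t'))"
  proof -
    have "complex_of_real (box2 S v T u f) = avg S (\<lambda>x'. avg S (\<lambda>x. avg T (\<lambda>t. avg T (\<lambda>t'. A (dif (u t' - u t) (dif (v x' - v x) f))))))"
      unfolding box2_corr[OF f] by (rule avg_swap)
    also have "\<dots> = avg S (\<lambda>x'. avg S (\<lambda>x. avg T (\<lambda>t'. avg T (\<lambda>t. A (dif (u t' - u t) (dif (v x' - v x) f))))))"
      by (rule avg_cong, rule avg_cong, rule avg_swap)
    also have "\<dots> = avg S (\<lambda>x'. avg T (\<lambda>t'. avg S (\<lambda>x. avg T (\<lambda>t. A (dif (u t' - u t) (dif (v x' - v x) f))))))"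
      by (rule avg_cong, rule avg_swap)
    finally show ?thesis by (simp only: e G_def)
  qed
  then have "cmod (complex_of_real (box2 S v T u f)) \<le> avg S (\<lambda>x'. avg T (\<lambda>t'. cmod (G x' t')))"
    by (simp only:) (intro order.trans[OF norm_avg_le] avg_mono norm_avg_le)
  then have le: "box2 S v T u f \<le> avg S (\<lambda>x'. avg T (\<lambda>t'. cmod (G x' t')))"
    by simp
  obtain x' where x': "avg S (\<lambda>x'. avg T (\<lambda>t'. cmod (G x' t'))) \<le> avg T (\<lambda>t'. cmod (G x' t'))"
    using avg_le_ex[OF S] by blast
  obtain t' where t': "avg T (\<lambda>t'. cmod (G x' t')) \<le> cmod (G x' t')"
    using avg_le_ex[OF T] by blast
  show ?thesis
  proof (rule that[of "\<lambda>z. cnj (f (z + v x'))" "\<lambda>z. cnj (f (z + u t'))" "\<lambda>z. f (z + (v x' + u t'))"])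
    show "box2 S v T u f \<le> cmod (avg S (\<lambda>x. avg T (\<lambda>t. A (\<lambda>z. f (z + v x + u t) * cnj (f (z + u t + v x'))
        * cnj (f (z + v x + u t')) * f (z + (v x' + u t'))))))"
      using le x' t' unfolding G_def by linarith
  qed (intro adm_cnj adm_shift f)+
qed

text \<open>If \<open>\<Lambda>\<close> is invariant under a simultaneous translation of \<open>y\<close> and of its two indices, then averaging over
  such translations removes \<open>\<Lambda>\<close>, up to boundary terms.\<close>

lemma shift_absorb:
  assumes \<Lambda>: "\<And>k k'. adm (\<Lambda> k k')" and B: "adm B" and pos: "0 < K0" "0 < K'" "0 < N"
    and inv: "\<And>k k' y m. \<Lambda> (k + j m) (k' + j' m) (y + s m) = \<Lambda> k k' y"
    and J: "\<And>m. m \<in> {1..int N} \<Longrightarrow> real_of_int \<bar>j m\<bar> \<le> J" "\<And>m. m \<in> {1..int N} \<Longrightarrow> real_of_int \<bar>j' m\<bar> \<le> J'"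
  shows "cmod (avg {1..int K0} (\<lambda>k. avg {1..int K'} (\<lambda>k'. A (\<lambda>y. \<Lambda> k k' y * B y))))
    \<le> 2 * J / K0 + 2 * J' / K' + A (\<lambda>y. cmod (avg {1..int N} (\<lambda>m. B (y + s m))))"
proof -
  let ?K = "{1..int K0}" and ?K' = "{1..int K'}" and ?N = "{1..int N}"
  define X where "X k k' = A (\<lambda>y. \<Lambda> k k' y * B y)" for k k'
  have X1: "cmod (X k k') \<le> 1" for k k'
    unfolding X_def by (rule norm_avg_le1) (rule adm_norm[OF adm_mult[OF \<Lambda> B]])
  have Xs: "X (k + j m) (k' + j' m) = A (\<lambda>y. \<Lambda> k k' y * B (y + s m))" for k k' m
  proof -
    have "X (k + j m) (k' + j' m) = A (\<lambda>y. \<Lambda> (k + j m) (k' + j' m) (y + s m) * B (y + s m))"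
      unfolding X_def by (rule A_shift[OF adm_per[OF adm_mult[OF \<Lambda> B]], symmetric])
    then show ?thesis by (simp add: inv)
  qed
  have d: "cmod (avg ?K (\<lambda>k. avg ?K' (X k)) - avg ?K (\<lambda>k. avg ?K' (\<lambda>k'. X (k + j m) (k' + j' m))))
      \<le> 2 * J / K0 + 2 * J' / K'" if m: "m \<in> ?N" for m
  proof -
    have "cmod (avg ?K (\<lambda>k. avg ?K' (X (k + j m))) - avg ?K (\<lambda>k. avg ?K' (X k))) \<le> 2 * real_of_int \<bar>j m\<bar> / K0"
      using avg_shift_interval[of "\<lambda>k. avg ?K' (X k)" K0 "j m"] X1 by (simp add: norm_avg_le1)
    also have "\<dots> \<le> 2 * J / K0" using J(1)[OF m] by (intro divide_right_mono) auto
    finally have 1: "cmod (avg ?K (\<lambda>k. avg ?K' (X (k + j m))) - avg ?K (\<lambda>k. avg ?K' (X k))) \<le> 2 * J / K0" .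
    have "cmod (avg ?K (\<lambda>k. avg ?K' (\<lambda>k'. X (k + j m) (k' + j' m))) - avg ?K (\<lambda>k. avg ?K' (X (k + j m))))
        = cmod (avg ?K (\<lambda>k. avg ?K' (\<lambda>k'. X (k + j m) (k' + j' m)) - avg ?K' (X (k + j m))))"
      by (simp only: avg_diff)
    also have "\<dots> \<le> 2 * J' / K'"
    proof (rule order.trans[OF norm_avg_le], rule avg_le)
      fix k
      have "cmod (avg ?K' (\<lambda>k'. X (k + j m) (k' + j' m)) - avg ?K' (X (k + j m))) \<le> 2 * real_of_int \<bar>j' m\<bar> / K'"
        using avg_shift_interval[of "X (k + j m)" K' "j' m"] X1 by simp
      also have "\<dots> \<le> 2 * J' / K'" using J(2)[OF m] by (intro divide_right_mono) auto
      finally show "cmod (avg ?K' (\<lambda>k'. X (k + j m) (k' + j' m)) - avg ?K' (X (k + j m))) \<le> 2 * J' / K'" .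
    next
      have "0 \<le> J'" using J(2)[OF m] by linarith
      then show "0 \<le> 2 * J' / K'" by simp
    qed
    finally have 2: "cmod (avg ?K (\<lambda>k. avg ?K' (\<lambda>k'. X (k + j m) (k' + j' m))) - avg ?K (\<lambda>k. avg ?K' (X (k + j m)))) \<le> 2 * J' / K'" .
    show ?thesis
      using norm_triangle_ineq[of "avg ?K (\<lambda>k. avg ?K' (\<lambda>k'. X (k + j m) (k' + j' m))) - avg ?K (\<lambda>k. avg ?K' (X (k + j m)))"
          "avg ?K (\<lambda>k. avg ?K' (X (k + j m))) - avg ?K (\<lambda>k. avg ?K' (X k))"] 1 2
      by (simp add: norm_minus_commute)
  qed
  define Y where "Y = avg ?N (\<lambda>m. avg ?K (\<lambda>k. avg ?K' (\<lambda>k'. X (k + j m) (k' + j' m))))"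
  have "cmod (avg ?K (\<lambda>k. avg ?K' (X k)) - Y)
    = cmod (avg ?N (\<lambda>m. avg ?K (\<lambda>k. avg ?K' (X k)) - avg ?K (\<lambda>k. avg ?K' (\<lambda>k'. X (k + j m) (k' + j' m)))))"
    using pos by (simp add: avg_diff avg_const Y_def)
  also have "\<dots> \<le> 2 * J / K0 + 2 * J' / K'"
  proof (rule order.trans[OF norm_avg_le], rule avg_le)
    have "1 \<in> ?N" using pos by auto
    then have "0 \<le> J" "0 \<le> J'" using J[of 1] by linarith+
    then show "0 \<le> 2 * J / K0 + 2 * J' / K'" by simp
  qed (rule d)
  finally have 1: "cmod (avg ?K (\<lambda>k. avg ?K' (X k)) - Y) \<le> 2 * J / K0 + 2 * J' / K'" .
  have "Y = avg ?K (\<lambda>k. avg ?K' (\<lambda>k'. A (\<lambda>y. \<Lambda> k k' y * avg ?N (\<lambda>m. B (y + s m)))))"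
  proof -
    have "Y = avg ?K (\<lambda>k. avg ?N (\<lambda>m. avg ?K' (\<lambda>k'. A (\<lambda>y. \<Lambda> k k' y * B (y + s m)))))"
      unfolding Y_def Xs by (rule avg_swap)
    also have "\<dots> = avg ?K (\<lambda>k. avg ?K' (\<lambda>k'. avg ?N (\<lambda>m. A (\<lambda>y. \<Lambda> k k' y * B (y + s m)))))"
      by (rule avg_cong, rule avg_swap)
    also have "\<dots> = avg ?K (\<lambda>k. avg ?K' (\<lambda>k'. A (\<lambda>y. avg ?N (\<lambda>m. \<Lambda> k k' y * B (y + s m)))))"
      by (rule avg_cong, rule avg_cong, rule avg_swap)
    finally show ?thesis by (simp only: avg_cmult)
  qed
  then have 2: "cmod Y \<le> A (\<lambda>y. cmod (avg ?N (\<lambda>m. B (y + s m))))"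
  proof (simp only:)
    show "cmod (avg ?K (\<lambda>k. avg ?K' (\<lambda>k'. A (\<lambda>y. \<Lambda> k k' y * avg ?N (\<lambda>m. B (y + s m))))))
        \<le> A (\<lambda>y. cmod (avg ?N (\<lambda>m. B (y + s m))))"
    proof (rule order.trans[OF norm_avg_le], rule avg_le, rule order.trans[OF norm_avg_le], rule avg_le,
        rule order.trans[OF norm_avg_le], rule avg_mono)
      fix k k' y
      show "cmod (\<Lambda> k k' y * avg ?N (\<lambda>m. B (y + s m))) \<le> cmod (avg ?N (\<lambda>m. B (y + s m)))"
        using mult_right_mono[OF adm_norm[OF \<Lambda>[of k k'], of y] norm_ge_zero[of "avg ?N (\<lambda>m. B (y + s m))"]]
        by (simp add: norm_mult)
    qed (rule avg_nonneg, simp)+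
  qed
  show ?thesis
    using 1 2 norm_triangle_ineq[of "avg ?K (\<lambda>k. avg ?K' (X k)) - Y" Y] unfolding X_def by simp
qed

text \<open>A first Cauchy-Schwarz turns the average over \<open>S\<close> into derivatives, and a
  translation by \<open>r i\<close> makes the derivative of \<open>\<psi>\<close> independent of
  \<open>i\<close>. A second Cauchy-Schwarz then discards it.\<close>

lemma avg_product_power4_le:
  assumes \<phi>: "adm \<phi>" and \<psi>: "adm \<psi>"
  shows "(avg I (\<lambda>i. A (\<lambda>y. cmod (avg S (\<lambda>m. \<phi> (y + s m + p i) * \<psi> (y + s m + r i)))))) ^ 4
    \<le> avg S (\<lambda>m. avg S (\<lambda>m'. A (\<lambda>x. (cmod (avg I (\<lambda>i. dif (s m' - s m) \<phi> (x + (p i - r i)))))\<^sup>2)))"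
proof -
  define B where "B i y = \<phi> (y + p i) * \<psi> (y + r i)" for i y
  have B: "adm (B i)" for i unfolding B_def[abs_def] by (intro adm_mult adm_shift \<phi> \<psi>)
  define X where "X = avg I (\<lambda>i. A (\<lambda>y. cmod (avg S (\<lambda>m. B i (y + s m)))))"
  have "X\<^sup>2 \<le> avg I (\<lambda>i. fej S s (B i))"
    unfolding X_def fej_def
    by (rule order.trans[OF avg_power2_le], rule avg_mono, rule avg_power2_le)
  also have "\<dots> = Re (complex_of_real (avg I (\<lambda>i. fej S s (B i))))" by simp
  also have "complex_of_real (avg I (\<lambda>i. fej S s (B i)))
      = avg I (\<lambda>i. avg S (\<lambda>m. avg S (\<lambda>m'. A (dif (s m' - s m) (B i)))))"
    by (simp only: avg_of_real[symmetric] fej_corr[OF adm_per[OF B]])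
  also have "\<dots> = avg S (\<lambda>m. avg S (\<lambda>m'. avg I (\<lambda>i. A (dif (s m' - s m) (B i)))))"
    by (subst avg_swap, rule avg_cong, rule avg_swap)
  also have "\<dots> = avg S (\<lambda>m. avg S (\<lambda>m'. A (\<lambda>x. dif (s m' - s m) \<psi> x * avg I (\<lambda>i. dif (s m' - s m) \<phi> (x + (p i - r i))))))"
  proof (rule avg_cong, rule avg_cong)
    fix m m'
    have "A (dif h (B i)) = A (\<lambda>x. dif h \<psi> x * dif h \<phi> (x + (p i - r i)))" for h i
    proof -
      have ad: "adm (\<lambda>x. dif h \<psi> x * dif h \<phi> (x + (p i - r i)))"
        by (intro adm_mult adm_shift adm_dif \<phi> \<psi>)
      have "dif h (B i) = (\<lambda>y. dif h \<psi> (y + r i) * dif h \<phi> (y + r i + (p i - r i)))"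
        by (rule ext) (simp add: dif_def B_def add_ac mult_ac)
      then show ?thesis using A_shift[OF adm_per[OF ad], of "r i"] by simp
    qed
    then have "avg I (\<lambda>i. A (dif (s m' - s m) (B i))) = A (\<lambda>x. avg I (\<lambda>i. dif (s m' - s m) \<psi> x * dif (s m' - s m) \<phi> (x + (p i - r i))))"
      by (simp only: avg_swap[of I])
    then show "avg I (\<lambda>i. A (dif (s m' - s m) (B i))) = A (\<lambda>x. dif (s m' - s m) \<psi> x * avg I (\<lambda>i. dif (s m' - s m) \<phi> (x + (p i - r i))))"
      by (simp only: avg_cmult)
  qed
  also have "Re \<dots> \<le> avg S (\<lambda>m. avg S (\<lambda>m'. cmod (A (\<lambda>x. dif (s m' - s m) \<psi> x * avg I (\<lambda>i. dif (s m' - s m) \<phi> (x + (p i - r i)))))))"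
    by (intro order.trans[OF complex_Re_le_cmod order.trans[OF norm_avg_le avg_mono[OF norm_avg_le]]])
  finally have "(X\<^sup>2)\<^sup>2 \<le> (avg S (\<lambda>m. avg S (\<lambda>m'. cmod (A (\<lambda>x. dif (s m' - s m) \<psi> x * avg I (\<lambda>i. dif (s m' - s m) \<phi> (x + (p i - r i))))))))\<^sup>2"
    by (rule power_mono) simp
  also have "\<dots> \<le> avg S (\<lambda>m. avg S (\<lambda>m'. (cmod (A (\<lambda>x. dif (s m' - s m) \<psi> x * avg I (\<lambda>i. dif (s m' - s m) \<phi> (x + (p i - r i))))))\<^sup>2))"
    by (rule order.trans[OF avg_power2_le], rule avg_mono, rule avg_power2_le)
  also have "\<dots> \<le> avg S (\<lambda>m. avg S (\<lambda>m'. A (\<lambda>x. (cmod (avg I (\<lambda>i. dif (s m' - s m) \<phi> (x + (p i - r i)))))\<^sup>2)))"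
    by (intro avg_mono norm_avg_mult_power2_le adm_norm[OF adm_dif[OF \<psi>]])
  finally show ?thesis by (simp add: X_def B_def add_ac flip: power_mult)
qed

lemma add_power4_le: "0 \<le> a \<Longrightarrow> 0 \<le> b \<Longrightarrow> (a + b) ^ 4 \<le> 8 * (a ^ 4 + b ^ 4)" for a b :: real
proof -
  assume "0 \<le> a" "0 \<le> b"
  have "(a + b)\<^sup>2 \<le> 2 * (a\<^sup>2 + b\<^sup>2)" using sum_squares_bound[of a b] by (simp add: power2_sum)
  then have "((a + b)\<^sup>2)\<^sup>2 \<le> (2 * (a\<^sup>2 + b\<^sup>2))\<^sup>2" by (rule power_mono) simp
  also have "\<dots> = 4 * (a\<^sup>2 + b\<^sup>2)\<^sup>2" by (simp only: power_mult_distrib) simp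
  also have "(a\<^sup>2 + b\<^sup>2)\<^sup>2 \<le> 2 * ((a\<^sup>2)\<^sup>2 + (b\<^sup>2)\<^sup>2)" using sum_squares_bound[of "a\<^sup>2" "b\<^sup>2"] by (simp add: power2_sum)
  finally show ?thesis by (simp flip: power_mult)
qed

lemma power4_le_if:
  fixes x e z Y :: real
  assumes "0 \<le> e" "x \<le> e + z" "z ^ 4 \<le> Y" "0 \<le> z" "0 \<le> x"
  shows "x ^ 4 \<le> 8 * (e ^ 4 + Y)"
proof -
  have "x ^ 4 \<le> (e + z) ^ 4" by (rule power_mono[OF assms(2,5)])
  also have "\<dots> \<le> 8 * (e ^ 4 + z ^ 4)" by (rule add_power4_le[OF assms(1,4)])
  also have "\<dots> \<le> 8 * (e ^ 4 + Y)" using assms(3) by simp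
  finally show ?thesis .
qed

text \<open>Translation by \<open>v x\<close> makes \<open>\<beta>\<close> independent of
  \<open>x\<close> and \<open>t\<close>, so Cauchy-Schwarz removes it. What remains is linear in
  \<open>f\<close> inside the square, which allows the duality argument in
  \<open>concatenation\<close>.\<close>

lemma box2_dual:
  assumes f: "adm f" and S: "finite S" "S \<noteq> {}" and T: "finite T" "T \<noteq> {}"
  obtains \<alpha> \<gamma> where "adm \<alpha>" "adm \<gamma>"
    "(box2 S v T u f)\<^sup>2 \<le> A (\<lambda>y. (cmod (avg S (\<lambda>x. avg T (\<lambda>t. f (y + u t) * \<alpha> (y + u t - v x) * \<gamma> (y - v x)))))\<^sup>2)"
proof -
  obtain \<alpha> \<beta> \<gamma> where adm: "adm \<alpha>" "adm \<beta>" "adm \<gamma>"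
    and le: "box2 S v T u f \<le> cmod (avg S (\<lambda>x. avg T (\<lambda>t. A (\<lambda>z. f (z + v x + u t) * \<alpha> (z + u t) * \<beta> (z + v x) * \<gamma> z))))"
    by (rule box2_le_correlation[OF f S T])
  have e: "A (\<lambda>z. f (z + v x + u t) * \<alpha> (z + u t) * \<beta> (z + v x) * \<gamma> z)
      = A (\<lambda>y. \<beta> y * (f (y + u t) * \<alpha> (y + u t - v x) * \<gamma> (y - v x)))" for x t
  proof -
    have p: "adm (\<lambda>y. \<beta> y * (f (y + u t) * \<alpha> (y + (u t - v x)) * \<gamma> (y + (- v x))))"
      by (intro adm_mult adm_shift adm f)
    show ?thesis using A_shift[OF adm_per[OF p], of "v x"] by (simp add: algebra_simps)
  qed
  have "avg S (\<lambda>x. avg T (\<lambda>t. A (\<lambda>z. f (z + v x + u t) * \<alpha> (z + u t) * \<beta> (z + v x) * \<gamma> z)))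
      = A (\<lambda>y. \<beta> y * avg S (\<lambda>x. avg T (\<lambda>t. f (y + u t) * \<alpha> (y + u t - v x) * \<gamma> (y - v x))))"
    unfolding e avg_cmult[symmetric] by (subst (2) avg_swap) (rule avg_swap)
  with le have "(box2 S v T u f)\<^sup>2 \<le> (cmod (A (\<lambda>y. \<beta> y * avg S (\<lambda>x. avg T (\<lambda>t. f (y + u t) * \<alpha> (y + u t - v x) * \<gamma> (y - v x))))))\<^sup>2"
    by (intro power_mono box2_nonneg) simp
  also have "\<dots> \<le> A (\<lambda>y. (cmod (avg S (\<lambda>x. avg T (\<lambda>t. f (y + u t) * \<alpha> (y + u t - v x) * \<gamma> (y - v x)))))\<^sup>2)"
    by (rule norm_avg_mult_power2_le) (rule adm_norm[OF adm(2)])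
  finally show ?thesis using that adm by blast
qed

text \<open>The off-diagonal terms in the proof of the concatenation lemma. The two difference directions \<open>\<omega> \<tau>\<close> and
  \<open>\<omega> \<tau>'\<close> have the common multiple \<open>\<omega> \<tau> \<tau>'\<close>, along which \<open>\<alpha>\<close>, \<open>\<gamma>\<close>, \<open>\<alpha>'\<close>, \<open>\<gamma>'\<close> can be absorbed at once.\<close>

lemma concatenation_pair:
  fixes \<tau> \<tau>' b b' \<omega> :: int
  assumes adm: "adm f" "adm \<alpha>" "adm \<gamma>" "adm \<alpha>'" "adm \<beta>'" "adm \<gamma>'"
    and K: "0 < K" "0 < K1" "0 < K2" and L: "\<bar>\<tau>\<bar> \<le> int L" "\<bar>\<tau>'\<bar> \<le> int L"
    and \<beta>_def: "\<And>y. \<beta> y = cnj (avg {1..int K} (\<lambda>k. avg {1..int K} (\<lambda>t. f (y + b * t) * \<alpha> (y + b * t - \<omega> * \<tau> * k) * \<gamma> (y - \<omega> * \<tau> * k))))"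
    and err: "err = 4 * real L * real K1 / K + 2 * real K2 / K1 + 2 * real L * real K2 / K" "err \<le> 1"
    and x_def: "x = cmod (avg {1..int K} (\<lambda>k. avg {1..int K} (\<lambda>t. avg {1..int K} (\<lambda>k'. avg {1..int K} (\<lambda>t'. A (\<lambda>y.
       \<alpha> (y - \<omega> * \<tau> * k) * \<beta> (y - b * t) * \<gamma> (y - b * t - \<omega> * \<tau> * k) *
       cnj (\<alpha>' (y - \<omega> * \<tau>' * k') * \<beta>' (y - b' * t') * \<gamma>' (y - b' * t' - \<omega> * \<tau>' * k'))))))))"
  shows "x ^ 16 \<le> 8 ^ 6 * (err + box2 {1..int K2} (\<lambda>k. \<omega> * \<tau> * \<tau>' * k)
    ({1..int K} \<times> {1..int K}) (\<lambda>p. b * fst p + b' * snd p) f)"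
proof -
  let ?K = "{1..int K}" and ?K1 = "{1..int K1}" and ?K2 = "{1..int K2}"
  define s where "s m = \<omega> * \<tau> * \<tau>' * m" for m
  define e1 where "e1 = 4 * real L * real K1 / K"
  define e2 where "e2 = 2 * real K2 / K1 + 2 * real L * real K2 / K"
  have e0: "0 \<le> e1" "0 \<le> e2" "e1 \<le> 1" "e2 \<le> 1" "err = e1 + e2"
  proof -
    show "0 \<le> e1" "0 \<le> e2" by (simp_all add: e1_def e2_def)
    moreover show "err = e1 + e2" by (simp add: err(1) e1_def e2_def)
    ultimately show "e1 \<le> 1" "e2 \<le> 1" using err(2) by linarith+
  qed
  have Jb: "real_of_int \<bar>\<tau>'' * m\<bar> \<le> real L * real N" if "m \<in> {1..int N}" "\<bar>\<tau>''\<bar> \<le> int L" for m \<tau>'' N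
  proof -
    have "\<bar>\<tau>''\<bar> * \<bar>m\<bar> \<le> int L * int N" using that by (intro mult_mono) auto
    then have "real_of_int (\<bar>\<tau>''\<bar> * \<bar>m\<bar>) \<le> real_of_int (int L * int N)" by (simp only: of_int_le_iff)
    then show ?thesis by (simp add: abs_mult)
  qed
  have adm\<beta>: "adm \<beta>"
  proof -
    have "adm (\<lambda>y. cnj (avg ?K (\<lambda>k. avg ?K (\<lambda>t. f (y + b * t) * \<alpha> (y + (b * t - \<omega> * \<tau> * k)) * \<gamma> (y + (- \<omega> * \<tau> * k))))))"
      by (intro adm_cnj adm_avg adm_mult adm_shift adm)
    then show ?thesis by (simp add: \<beta>_def[abs_def] algebra_simps)
  qed
  \<comment> \<open>A first absorption and Cauchy-Schwarz bound \<open>x\<close> by a box norm of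
    \<open>\<beta>\<close>, which is itself an average containing \<open>f\<close>. A second round,
    with the shorter scale \<open>K2\<close>, passes from \<open>\<beta>\<close> to
    \<open>f\<close>.\<close>
  define b5 where "b5 = box2 ?K1 s ?K (\<lambda>t. b' * t) \<beta>"
  define Y where "Y = box2 ?K2 s (?K \<times> ?K) (\<lambda>p. b * fst p + b' * snd p) f"
  have "x \<le> e1 + avg (?K \<times> ?K) (\<lambda>i. A (\<lambda>y. cmod (avg ?K1 (\<lambda>m. \<beta> (y + s m + (- b * fst i)) * cnj (\<beta>' (y + s m + (- b' * snd i)))))))"
  proof -
    define \<Lambda> where "\<Lambda> t t' k k' y = \<alpha> (y + (- \<omega> * \<tau> * k)) * \<gamma> (y + (- b * t - \<omega> * \<tau> * k)) *
      cnj (\<alpha>' (y + (- \<omega> * \<tau>' * k')) * \<gamma>' (y + (- b' * t' - \<omega> * \<tau>' * k')))" for t t' k k' y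
    define B where "B t t' y = \<beta> (y + (- b * t)) * cnj (\<beta>' (y + (- b' * t')))" for t t' y
    have eq: "avg ?K (\<lambda>k. avg ?K (\<lambda>t. avg ?K (\<lambda>k'. avg ?K (\<lambda>t'. F k t k' t'))))
        = avg ?K (\<lambda>t. avg ?K (\<lambda>t'. avg ?K (\<lambda>k. avg ?K (\<lambda>k'. F k t k' t'))))" for F :: "int \<Rightarrow> int \<Rightarrow> int \<Rightarrow> int \<Rightarrow> complex"
      by (subst avg_swap, rule avg_cong, subst (2) avg_swap, rule avg_swap)
    have "\<alpha> (y - \<omega> * \<tau> * k) * \<beta> (y - b * t) * \<gamma> (y - b * t - \<omega> * \<tau> * k) *
       cnj (\<alpha>' (y - \<omega> * \<tau>' * k') * \<beta>' (y - b' * t') * \<gamma>' (y - b' * t' - \<omega> * \<tau>' * k'))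
       = \<Lambda> t t' k k' y * B t t' y" for y t t' k k'
      by (simp add: \<Lambda>_def B_def diff_diff_add add_diff_eq)
    then have "x = cmod (avg ?K (\<lambda>k. avg ?K (\<lambda>t. avg ?K (\<lambda>k'. avg ?K (\<lambda>t'. A (\<lambda>y. \<Lambda> t t' k k' y * B t t' y))))))"
      unfolding x_def by (simp only:)
    also have "\<dots> = cmod (avg ?K (\<lambda>t. avg ?K (\<lambda>t'. avg ?K (\<lambda>k. avg ?K (\<lambda>k'. A (\<lambda>y. \<Lambda> t t' k k' y * B t t' y))))))"
      by (rule arg_cong[where f = cmod], rule eq)
    also have "\<dots> \<le> avg ?K (\<lambda>t. avg ?K (\<lambda>t'. e1 + A (\<lambda>y. cmod (avg ?K1 (\<lambda>m. B t t' (y + s m))))))"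
    proof (rule order.trans[OF norm_avg_le], rule avg_mono, rule order.trans[OF norm_avg_le], rule avg_mono)
      fix t t'
      have "cmod (avg ?K (\<lambda>k. avg ?K (\<lambda>k'. A (\<lambda>y. \<Lambda> t t' k k' y * B t t' y))))
          \<le> 2 * (real L * real K1) / K + 2 * (real L * real K1) / K + A (\<lambda>y. cmod (avg ?K1 (\<lambda>m. B t t' (y + s m))))"
      proof (rule shift_absorb[where j = "\<lambda>m. \<tau>' * m" and j' = "\<lambda>m. \<tau> * m"])
        show "adm (\<Lambda> t t' k k')" for k k' unfolding \<Lambda>_def[abs_def] by (intro adm_mult adm_cnj adm_shift adm)
        show "adm (B t t')" unfolding B_def[abs_def] by (intro adm_mult adm_cnj adm_shift adm adm\<beta>)
        show "\<Lambda> t t' (k + \<tau>' * m) (k' + \<tau> * m) (y + s m) = \<Lambda> t t' k k' y" for k k' y m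
          by (simp add: \<Lambda>_def s_def algebra_simps)
      qed (use K L Jb in auto)
      then show "cmod (avg ?K (\<lambda>k. avg ?K (\<lambda>k'. A (\<lambda>y. \<Lambda> t t' k k' y * B t t' y)))) \<le> e1 + A (\<lambda>y. cmod (avg ?K1 (\<lambda>m. B t t' (y + s m))))"
        by (simp add: e1_def mult.assoc mult.commute[of "real K1"])
    qed
    also have "\<dots> = e1 + avg ?K (\<lambda>t. avg ?K (\<lambda>t'. A (\<lambda>y. cmod (avg ?K1 (\<lambda>m. B t t' (y + s m))))))"
      using K by (simp add: avg_add avg_const)
    finally show ?thesis
      unfolding avg_pair[of ?K ?K "\<lambda>t t'. A (\<lambda>y. cmod (avg ?K1 (\<lambda>m. \<beta> (y + s m + (- b * t)) * cnj (\<beta>' (y + s m + (- b' * t'))))))"]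
      by (simp only: B_def)
  qed
  moreover have "(avg (?K \<times> ?K) (\<lambda>i. A (\<lambda>y. cmod (avg ?K1 (\<lambda>m. \<beta> (y + s m + (- b * fst i)) * cnj (\<beta>' (y + s m + (- b' * snd i)))))))) ^ 4 \<le> b5"
  proof (rule order.trans[OF avg_product_power4_le[OF adm\<beta> adm_cnj[OF adm(5)]]])
    show "avg ?K1 (\<lambda>m. avg ?K1 (\<lambda>m'. A (\<lambda>x. (cmod (avg (?K \<times> ?K)
        (\<lambda>i. dif (s m' - s m) \<beta> (x + (- b * fst i - - b' * snd i)))))\<^sup>2))) \<le> b5"
      unfolding b5_def box2_def
    proof (rule avg_mono, rule avg_mono)
      fix m m'
      let ?d = "dif (s m' - s m) \<beta>"
      have "avg (?K \<times> ?K) (\<lambda>i. ?d (x + (- b * fst i - - b' * snd i))) = avg ?K (\<lambda>t. avg ?K (\<lambda>t'. ?d (x + b' * t' + (- b * t))))" for x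
      proof -
        have "x + (- b * t - - b' * t') = x + b' * t' + (- b * t)" for t t' by simp
        then show ?thesis
          using avg_pair[of ?K ?K "\<lambda>t t'. ?d (x + b' * t' + (- b * t))"] by (simp only:)
      qed
      then have "A (\<lambda>x. (cmod (avg (?K \<times> ?K) (\<lambda>i. ?d (x + (- b * fst i - - b' * snd i)))))\<^sup>2)
          = A (\<lambda>x. (cmod (avg ?K (\<lambda>t. avg ?K (\<lambda>t'. ?d (x + b' * t' + (- b * t))))))\<^sup>2)"
        by (simp only:)
      also have "\<dots> \<le> A (\<lambda>x. avg ?K (\<lambda>t. (cmod (avg ?K (\<lambda>t'. ?d (x + b' * t' + (- b * t)))))\<^sup>2))"
        by (rule avg_mono) (rule norm_avg_power2_le)
      also have "\<dots> = avg ?K (\<lambda>t. fej ?K (\<lambda>t'. b' * t') (\<lambda>y. ?d (y + (- b * t))))"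
        unfolding fej_def by (rule avg_swap)
      also have "\<dots> = fej ?K (\<lambda>t'. b' * t') ?d"
        unfolding fej_shift[OF adm_dif[OF adm\<beta>]] using K by (simp add: avg_const)
      finally show "A (\<lambda>x. (cmod (avg (?K \<times> ?K) (\<lambda>i. ?d (x + (- b * fst i - - b' * snd i)))))\<^sup>2) \<le> fej ?K (\<lambda>t'. b' * t') ?d" .
    qed
  qed
  moreover have "0 \<le> avg (?K \<times> ?K) (\<lambda>i. A (\<lambda>y. cmod (avg ?K1 (\<lambda>m. \<beta> (y + s m + (- b * fst i)) * cnj (\<beta>' (y + s m + (- b' * snd i)))))))"
    by (intro avg_nonneg) simp
  moreover have "0 \<le> x" by (simp add: x_def)
  ultimately have x4: "x ^ 4 \<le> 8 * (e1 ^ 4 + b5)" by (rule power4_le_if[OF e0(1)])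
  obtain \<alpha>2 \<beta>2 \<gamma>2 where adm2: "adm \<alpha>2" "adm \<beta>2" "adm \<gamma>2"
    and le: "b5 \<le> cmod (avg ?K1 (\<lambda>m. avg ?K (\<lambda>t'. A (\<lambda>z. \<beta> (z + s m + b' * t') * \<alpha>2 (z + b' * t') * \<beta>2 (z + s m) * \<gamma>2 z))))"
    unfolding b5_def using K by (rule_tac box2_le_correlation[OF adm\<beta>, of ?K1 ?K s "\<lambda>t. b' * t"]) auto
  \<comment> \<open>Unfolding \<open>\<beta>\<close> exposes \<open>f\<close>. Moving
    \<open>k\<close> by \<open>\<tau>' * j\<close> and \<open>m\<close> by \<open>j\<close>
    compensates the translation \<open>s j\<close> in \<open>\<alpha>\<close>,
    \<open>\<gamma>\<close>, \<open>\<alpha>2\<close> and \<open>\<gamma>2\<close> at once.\<close>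
  have "b5 \<le> e2 + avg (?K \<times> ?K) (\<lambda>i. A (\<lambda>y. cmod (avg ?K2 (\<lambda>j. cnj (f (y + s j + 0)) * \<beta>2 (y + s j + (- b * fst i - b' * snd i))))))"
  proof -
    define \<Lambda> where "\<Lambda> t t' k m y = cnj (\<alpha> (y + (- \<omega> * \<tau> * k)) * \<gamma> (y + (- b * t - \<omega> * \<tau> * k))) *
      (\<alpha>2 (y + (- b * t - s m)) * \<gamma>2 (y + (- b * t - b' * t' - s m)))" for t t' k m y
    define B where "B t t' y = cnj (f (y + 0)) * \<beta>2 (y + (- b * t - b' * t'))" for t t' y
    have adm\<Lambda>: "adm (\<Lambda> t t' k k')" for t t' k k' unfolding \<Lambda>_def[abs_def] by (intro adm_mult adm_cnj adm_shift adm adm2)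
    have admB: "adm (B t t')" for t t' unfolding B_def[abs_def] by (intro adm_mult adm_cnj adm_shift adm adm2)
    have e: "A (\<lambda>z. \<beta> (z + s m + b' * t') * \<alpha>2 (z + b' * t') * \<beta>2 (z + s m) * \<gamma>2 z)
        = avg ?K (\<lambda>k. avg ?K (\<lambda>t. A (\<lambda>y. \<Lambda> t t' k m y * B t t' y)))" for m t'
    proof -
      have "A (\<lambda>z. \<beta> (z + s m + b' * t') * \<alpha>2 (z + b' * t') * \<beta>2 (z + s m) * \<gamma>2 z)
          = A (\<lambda>z. avg ?K (\<lambda>k. avg ?K (\<lambda>t. \<Lambda> t t' k m (z + (s m + b' * t' + b * t)) * B t t' (z + (s m + b' * t' + b * t)))))"
        unfolding \<beta>_def avg_cnj[symmetric] avg_multc[symmetric] \<Lambda>_def B_def by (simp add: algebra_simps)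
      also have "\<dots> = avg ?K (\<lambda>k. avg ?K (\<lambda>t. A (\<lambda>z. \<Lambda> t t' k m (z + (s m + b' * t' + b * t)) * B t t' (z + (s m + b' * t' + b * t)))))"
        by (subst avg_swap, rule avg_cong, rule avg_swap)
      also have "\<dots> = avg ?K (\<lambda>k. avg ?K (\<lambda>t. A (\<lambda>y. \<Lambda> t t' k m y * B t t' y)))"
        by (simp only: A_shift[OF adm_per[OF adm_mult[OF adm\<Lambda> admB]]])
      finally show ?thesis .
    qed
    have eq: "avg ?K1 (\<lambda>m. avg ?K (\<lambda>t'. avg ?K (\<lambda>k. avg ?K (\<lambda>t. F m t' k t))))
        = avg ?K (\<lambda>t. avg ?K (\<lambda>t'. avg ?K (\<lambda>k. avg ?K1 (\<lambda>m. F m t' k t))))" for F :: "int \<Rightarrow> int \<Rightarrow> int \<Rightarrow> int \<Rightarrow> complex"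
    proof -
      have "avg ?K1 (\<lambda>m. avg ?K (\<lambda>t'. avg ?K (\<lambda>k. avg ?K (\<lambda>t. F m t' k t))))
        = avg ?K1 (\<lambda>m. avg ?K (\<lambda>t. avg ?K (\<lambda>t'. avg ?K (\<lambda>k. F m t' k t))))"
        by (rule avg_cong, subst (2) avg_swap, rule avg_swap)
      also have "\<dots> = avg ?K (\<lambda>t. avg ?K (\<lambda>t'. avg ?K1 (\<lambda>m. avg ?K (\<lambda>k. F m t' k t))))"
        by (subst avg_swap, rule avg_cong, rule avg_swap)
      also have "\<dots> = avg ?K (\<lambda>t. avg ?K (\<lambda>t'. avg ?K (\<lambda>k. avg ?K1 (\<lambda>m. F m t' k t))))"
        by (rule avg_cong, rule avg_cong, rule avg_swap)
      finally show ?thesis .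
    qed
    have "b5 \<le> cmod (avg ?K (\<lambda>t. avg ?K (\<lambda>t'. avg ?K (\<lambda>k. avg ?K1 (\<lambda>m. A (\<lambda>y. \<Lambda> t t' k m y * B t t' y))))))"
      using le unfolding e eq .
    also have "\<dots> \<le> avg ?K (\<lambda>t. avg ?K (\<lambda>t'. e2 + A (\<lambda>y. cmod (avg ?K2 (\<lambda>j. B t t' (y + s j))))))"
    proof (rule order.trans[OF norm_avg_le], rule avg_mono, rule order.trans[OF norm_avg_le], rule avg_mono)
      fix t t'
      have "cmod (avg ?K (\<lambda>k. avg ?K1 (\<lambda>m. A (\<lambda>y. \<Lambda> t t' k m y * B t t' y))))
          \<le> 2 * (real L * real K2) / K + 2 * real K2 / K1 + A (\<lambda>y. cmod (avg ?K2 (\<lambda>m. B t t' (y + s m))))"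
      proof (rule shift_absorb[where j = "\<lambda>m. \<tau>' * m" and j' = "\<lambda>m. m"])
        show "\<Lambda> t t' (k + \<tau>' * m) (k' + m) (y + s m) = \<Lambda> t t' k k' y" for k k' y m
          by (simp add: \<Lambda>_def s_def algebra_simps)
      qed (use K L Jb adm\<Lambda> admB in auto)
      then show "cmod (avg ?K (\<lambda>k. avg ?K1 (\<lambda>k'. A (\<lambda>y. \<Lambda> t t' k k' y * B t t' y)))) \<le> e2 + A (\<lambda>y. cmod (avg ?K2 (\<lambda>m. B t t' (y + s m))))"
        by (simp add: e2_def mult.assoc mult.commute[of "real K2"])
    qed
    also have "\<dots> = e2 + avg ?K (\<lambda>t. avg ?K (\<lambda>t'. A (\<lambda>y. cmod (avg ?K2 (\<lambda>m. B t t' (y + s m))))))"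
      using K by (simp add: avg_add avg_const)
    finally show ?thesis
      unfolding avg_pair[of ?K ?K "\<lambda>t t'. A (\<lambda>y. cmod (avg ?K2 (\<lambda>j. cnj (f (y + s j + 0)) * \<beta>2 (y + s j + (- b * t - b' * t')))))"]
      by (simp only: B_def)
  qed
  moreover have "(avg (?K \<times> ?K) (\<lambda>i. A (\<lambda>y. cmod (avg ?K2 (\<lambda>j. cnj (f (y + s j + 0)) * \<beta>2 (y + s j + (- b * fst i - b' * snd i))))))) ^ 4 \<le> Y"
  proof (rule order.trans[OF avg_product_power4_le[OF adm_cnj[OF adm(1)] adm2(2)]])
    have "avg (?K \<times> ?K) (\<lambda>i. dif h (\<lambda>y. cnj (f y)) (x + (0 - (- b * fst i - b' * snd i))))
        = cnj (avg (?K \<times> ?K) (\<lambda>i. dif h f (x + (b * fst i + b' * snd i))))" for h x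
      by (simp add: dif_def avg_cnj[symmetric] add_ac)
    then show "avg ?K2 (\<lambda>m. avg ?K2 (\<lambda>m'. A (\<lambda>x. (cmod (avg (?K \<times> ?K)
        (\<lambda>i. dif (s m' - s m) (\<lambda>y. cnj (f y)) (x + (0 - (- b * fst i - b' * snd i))))))\<^sup>2))) \<le> Y"
      by (simp add: Y_def box2_def fej_def)
  qed
  moreover have "0 \<le> avg (?K \<times> ?K) (\<lambda>i. A (\<lambda>y. cmod (avg ?K2 (\<lambda>j. cnj (f (y + s j + 0)) * \<beta>2 (y + s j + (- b * fst i - b' * snd i))))))"
    by (intro avg_nonneg) simp
  moreover have b50: "0 \<le> b5" unfolding b5_def by (rule box2_nonneg)
  ultimately have b4: "b5 ^ 4 \<le> 8 * (e2 ^ 4 + Y)" by (rule power4_le_if[OF e0(2)])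
  have Y0: "0 \<le> Y" unfolding Y_def by (rule box2_nonneg)
  have p1: "a ^ n \<le> a" if "0 \<le> a" "a \<le> 1" "0 < n" for a :: real and n
    using power_decreasing[of 1 n a] that by simp
  have "x ^ 16 = (x ^ 4) ^ 4" by (simp flip: power_mult)
  also have "\<dots> \<le> (8 * (e1 ^ 4 + b5)) ^ 4" by (rule power_mono[OF x4]) simp
  also have "\<dots> = 8 ^ 4 * (e1 ^ 4 + b5) ^ 4" by (rule power_mult_distrib)
  also have "\<dots> \<le> 8 ^ 4 * (8 * ((e1 ^ 4) ^ 4 + b5 ^ 4))"
    using e0 b50 by (intro mult_left_mono add_power4_le) auto
  also have "\<dots> \<le> 8 ^ 4 * (8 * (e1 + 8 * (e2 + Y)))"
  proof -
    have "(e1 ^ 4) ^ 4 \<le> e1" using p1[of e1 16] e0 by (simp flip: power_mult)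
    moreover have "e2 ^ 4 \<le> e2" using p1[of e2 4] e0 by simp
    ultimately show ?thesis using b4 by (intro mult_left_mono add_mono) auto
  qed
  also have "\<dots> \<le> 8 ^ 6 * (err + Y)" using e0 Y0 by simp
  finally show ?thesis by (simp add: Y_def s_def[abs_def])
qed

text \<open>A duality argument: the average of the box norms is controlled by the correlation of
  \<open>f\<close> with the average of the functions \<open>D \<tau>\<close>. Cauchy-Schwarz drops
  \<open>f\<close> and leaves pairs \<open>D \<tau>\<close>, \<open>D \<tau>'\<close>; the diagonal
  is negligible and \<open>concatenation_pair\<close> treats the rest. The exponent is 64 = 4 * 16,
  the 16 coming from the pair bound.\<close>

lemma concatenation:
  fixes b :: "int \<Rightarrow> int" and \<omega> :: int and T :: "int set"
  assumes f: "adm f" and T: "finite T" "T \<noteq> {}" "\<And>\<tau>. \<tau> \<in> T \<Longrightarrow> \<bar>\<tau>\<bar> \<le> int L"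
    and K: "0 < K" "0 < K1" "0 < K2"
    and err: "err = 4 * real L * real K1 / K + 2 * real K2 / K1 + 2 * real L * real K2 / K" "err \<le> 1"
  shows "(avg T (\<lambda>\<tau>. box2 {1..int K} (\<lambda>k. \<omega> * \<tau> * k) {1..int K} (\<lambda>t. b \<tau> * t) f)) ^ 64
    \<le> 2 ^ 33 * (1 / card T + err + avg T (\<lambda>\<tau>. avg T (\<lambda>\<tau>'. if \<tau> = \<tau>' then 0 else
        box2 {1..int K2} (\<lambda>k. \<omega> * \<tau> * \<tau>' * k) ({1..int K} \<times> {1..int K}) (\<lambda>p. b \<tau> * fst p + b \<tau>' * snd p) f)))"
proof -
  let ?K = "{1..int K}"
  define e where "e \<tau> = box2 ?K (\<lambda>k. \<omega> * \<tau> * k) ?K (\<lambda>t. b \<tau> * t) f" for \<tau>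
  define good where "good \<tau> p \<longleftrightarrow> adm (fst p) \<and> adm (snd p) \<and> (e \<tau>)\<^sup>2 \<le> A (\<lambda>y. (cmod (avg ?K (\<lambda>k. avg ?K (\<lambda>t.
     f (y + b \<tau> * t) * fst p (y + b \<tau> * t - \<omega> * \<tau> * k) * snd p (y - \<omega> * \<tau> * k)))))\<^sup>2)" for \<tau> p
  have "\<exists>p. good \<tau> p" for \<tau>
  proof -
    have ne: "finite ?K" "?K \<noteq> {}" using K by auto
    obtain \<alpha> \<gamma> where "adm \<alpha>" "adm \<gamma>" "(e \<tau>)\<^sup>2 \<le> A (\<lambda>y. (cmod (avg ?K (\<lambda>k. avg ?K (\<lambda>t.
     f (y + b \<tau> * t) * \<alpha> (y + b \<tau> * t - \<omega> * \<tau> * k) * \<gamma> (y - \<omega> * \<tau> * k)))))\<^sup>2)"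
      unfolding e_def by (rule box2_dual[OF f ne ne])
    then have "good \<tau> (\<alpha>, \<gamma>)" by (simp add: good_def)
    then show ?thesis by blast
  qed
  \<comment> \<open>Fixes one choice of weights for every \<open>\<tau>\<close>, so that
    \<open>D \<tau>\<close> is a function of \<open>\<tau>\<close> alone and pairs can be
    formed.\<close>
  then have some: "good \<tau> (SOME p. good \<tau> p)" for \<tau> by (rule someI_ex)
  define \<alpha> where "\<alpha> \<tau> = fst (SOME p. good \<tau> p)" for \<tau>
  define \<gamma> where "\<gamma> \<tau> = snd (SOME p. good \<tau> p)" for \<tau>
  define W where "W \<tau> y = avg ?K (\<lambda>k. avg ?K (\<lambda>t. f (y + b \<tau> * t) * \<alpha> \<tau> (y + b \<tau> * t - \<omega> * \<tau> * k) * \<gamma> \<tau> (y - \<omega> * \<tau> * k)))" for \<tau> y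
  define \<beta> where "\<beta> \<tau> y = cnj (W \<tau> y)" for \<tau> y
  have adm\<alpha>: "adm (\<alpha> \<tau>)" and adm\<gamma>: "adm (\<gamma> \<tau>)" and W: "(e \<tau>)\<^sup>2 \<le> A (\<lambda>y. (cmod (W \<tau> y))\<^sup>2)" for \<tau>
    using some[of \<tau>] unfolding good_def \<alpha>_def \<gamma>_def W_def by blast+
  have adm\<beta>: "adm (\<beta> \<tau>)" for \<tau>
  proof -
    have "adm (\<lambda>y. cnj (avg ?K (\<lambda>k. avg ?K (\<lambda>t. f (y + b \<tau> * t) * \<alpha> \<tau> (y + (b \<tau> * t - \<omega> * \<tau> * k)) * \<gamma> \<tau> (y + (- \<omega> * \<tau> * k))))))"
      by (intro adm_cnj adm_avg adm_mult adm_shift adm\<alpha> adm\<gamma> f)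
    then show ?thesis by (simp add: \<beta>_def[abs_def] W_def algebra_simps)
  qed
  define R where "R \<tau> k t y = \<alpha> \<tau> (y - \<omega> * \<tau> * k) * \<beta> \<tau> (y - b \<tau> * t) * \<gamma> \<tau> (y - b \<tau> * t - \<omega> * \<tau> * k)" for \<tau> k t y
  have admR: "adm (R \<tau> k t)" for \<tau> k t
  proof -
    have "adm (\<lambda>y. \<alpha> \<tau> (y + (- \<omega> * \<tau> * k)) * \<beta> \<tau> (y + (- b \<tau> * t)) * \<gamma> \<tau> (y + (- b \<tau> * t - \<omega> * \<tau> * k)))"
      by (intro adm_mult adm_shift adm\<alpha> adm\<beta> adm\<gamma>)
    then show ?thesis by (simp add: R_def[abs_def] diff_diff_add add_diff_eq)
  qed
  define D where "D \<tau> y = avg ?K (\<lambda>k. avg ?K (\<lambda>t. R \<tau> k t y))" for \<tau> y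
  \<comment> \<open>Translating by \<open>b \<tau> * t\<close> puts \<open>f\<close> at the
    untranslated point: \<open>D \<tau>\<close> is built so that its correlation with
    \<open>f\<close> is the mean square of \<open>W \<tau>\<close>.\<close>
  have fD: "A (\<lambda>y. f y * D \<tau> y) = of_real (A (\<lambda>y. (cmod (W \<tau> y))\<^sup>2))" for \<tau>
  proof -
    have "A (\<lambda>y. f y * D \<tau> y) = avg ?K (\<lambda>k. avg ?K (\<lambda>t. A (\<lambda>y. f y * R \<tau> k t y)))"
      unfolding D_def avg_cmult[symmetric] by (subst avg_swap, rule avg_cong, rule avg_swap)
    also have "\<dots> = avg ?K (\<lambda>k. avg ?K (\<lambda>t. A (\<lambda>y. f (y + b \<tau> * t) * R \<tau> k t (y + b \<tau> * t))))"
      by (intro avg_cong A_shift[symmetric] adm_per adm_mult f admR)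
    also have "\<dots> = avg ?K (\<lambda>k. avg ?K (\<lambda>t. A (\<lambda>y. \<beta> \<tau> y * (f (y + b \<tau> * t) * \<alpha> \<tau> (y + b \<tau> * t - \<omega> * \<tau> * k) * \<gamma> \<tau> (y - \<omega> * \<tau> * k)))))"
      by (simp add: R_def mult_ac)
    also have "\<dots> = A (\<lambda>y. \<beta> \<tau> y * W \<tau> y)"
      unfolding W_def avg_cmult[symmetric] by (rule sym, subst avg_swap, rule avg_cong, rule avg_swap)
    also have "\<dots> = A (\<lambda>y. of_real ((cmod (W \<tau> y))\<^sup>2))"
      by (simp only: \<beta>_def complex_norm_square mult.commute)
    finally show ?thesis by (simp only: avg_of_real)
  qed
  define x where "x \<tau> \<tau>' = cmod (A (\<lambda>y. D \<tau> y * cnj (D \<tau>' y)))" for \<tau> \<tau>'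
  have e0: "0 \<le> e \<tau>" for \<tau> unfolding e_def by (rule box2_nonneg)
  have "(avg T e)\<^sup>2 \<le> avg T (\<lambda>\<tau>. (e \<tau>)\<^sup>2)" by (rule avg_power2_le)
  also have "\<dots> \<le> avg T (\<lambda>\<tau>. A (\<lambda>y. (cmod (W \<tau> y))\<^sup>2))" by (rule avg_mono) (rule W)
  also have "\<dots> = cmod (of_real (avg T (\<lambda>\<tau>. A (\<lambda>y. (cmod (W \<tau> y))\<^sup>2))))"
    using avg_nonneg[of T "\<lambda>\<tau>. A (\<lambda>y. (cmod (W \<tau> y))\<^sup>2)"] by (simp add: avg_nonneg)
  also have "complex_of_real (avg T (\<lambda>\<tau>. A (\<lambda>y. (cmod (W \<tau> y))\<^sup>2))) = A (\<lambda>y. f y * avg T (\<lambda>\<tau>. D \<tau> y))"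
  proof -
    have "complex_of_real (avg T (\<lambda>\<tau>. A (\<lambda>y. (cmod (W \<tau> y))\<^sup>2))) = avg T (\<lambda>\<tau>. A (\<lambda>y. f y * D \<tau> y))"
      by (simp only: avg_of_real[symmetric, of T] fD)
    also have "\<dots> = A (\<lambda>y. avg T (\<lambda>\<tau>. f y * D \<tau> y))" by (rule avg_swap)
    finally show ?thesis by (simp only: avg_cmult)
  qed
  finally have "((avg T e)\<^sup>2)\<^sup>2 \<le> (cmod (A (\<lambda>y. f y * avg T (\<lambda>\<tau>. D \<tau> y))))\<^sup>2"
    by (rule power_mono) simp
  also have "\<dots> \<le> A (\<lambda>y. (cmod (avg T (\<lambda>\<tau>. D \<tau> y)))\<^sup>2)"
    by (rule norm_avg_mult_power2_le) (rule adm_norm[OF f])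
  also have "\<dots> = Re (of_real (A (\<lambda>y. (cmod (avg T (\<lambda>\<tau>. D \<tau> y)))\<^sup>2)))" by simp
  also have "complex_of_real (A (\<lambda>y. (cmod (avg T (\<lambda>\<tau>. D \<tau> y)))\<^sup>2)) = avg T (\<lambda>\<tau>. avg T (\<lambda>\<tau>'. A (\<lambda>y. D \<tau> y * cnj (D \<tau>' y))))"
    unfolding avg_of_real[symmetric] norm_avg_square by (subst avg_swap, rule avg_cong, rule avg_swap)
  also have "Re \<dots> \<le> avg T (\<lambda>\<tau>. avg T (x \<tau>))"
    unfolding x_def by (intro order.trans[OF complex_Re_le_cmod order.trans[OF norm_avg_le avg_mono[OF norm_avg_le]]])
  also have "\<dots> \<le> 1 / card T + avg T (\<lambda>\<tau>. avg T (\<lambda>\<tau>'. if \<tau> = \<tau>' then 0 else x \<tau> \<tau>'))"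
  proof (rule avg_offdiag[OF T(1,2)])
    fix \<tau>
    show "x \<tau> \<tau> \<le> 1"
      unfolding x_def D_def by (rule norm_avg_le1) (rule adm_norm, intro adm_mult adm_cnj adm_avg admR)
  qed
  finally have le4: "(avg T e) ^ 4 \<le> 1 / card T + avg T (\<lambda>\<tau>. avg T (\<lambda>\<tau>'. if \<tau> = \<tau>' then 0 else x \<tau> \<tau>'))"
    by (simp flip: power_mult)
  define Y where "Y \<tau> \<tau>' = box2 {1..int K2} (\<lambda>k. \<omega> * \<tau> * \<tau>' * k) (?K \<times> ?K) (\<lambda>p. b \<tau> * fst p + b \<tau>' * snd p) f" for \<tau> \<tau>'
  have Y0: "0 \<le> Y \<tau> \<tau>'" for \<tau> \<tau>' unfolding Y_def by (rule box2_nonneg)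
  have err0: "0 \<le> err" unfolding err(1) by simp
  have x16: "x \<tau> \<tau>' ^ 16 \<le> 8 ^ 6 * (err + Y \<tau> \<tau>')" if "\<tau> \<in> T" "\<tau>' \<in> T" for \<tau> \<tau>'
    unfolding Y_def
  proof (rule concatenation_pair[of f "\<alpha> \<tau>" "\<gamma> \<tau>" "\<alpha> \<tau>'" "\<beta> \<tau>'" "\<gamma> \<tau>'" K K1 K2 \<tau> L \<tau>' "\<beta> \<tau>"])
    have "A (\<lambda>y. D \<tau> y * cnj (D \<tau>' y)) = avg ?K (\<lambda>k. avg ?K (\<lambda>t. avg ?K (\<lambda>k'. avg ?K (\<lambda>t'. A (\<lambda>y. R \<tau> k t y * cnj (R \<tau>' k' t' y))))))"
    proof -
      have "A (\<lambda>y. D \<tau> y * cnj (D \<tau>' y)) = A (\<lambda>y. avg ?K (\<lambda>k. avg ?K (\<lambda>t. avg ?K (\<lambda>k'. avg ?K (\<lambda>t'. R \<tau> k t y * cnj (R \<tau>' k' t' y))))))"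
        by (simp only: D_def avg_cnj[symmetric] avg_cmult avg_multc)
      also have "\<dots> = avg ?K (\<lambda>k. A (\<lambda>y. avg ?K (\<lambda>t. avg ?K (\<lambda>k'. avg ?K (\<lambda>t'. R \<tau> k t y * cnj (R \<tau>' k' t' y))))))"
        by (rule avg_swap)
      also have "\<dots> = avg ?K (\<lambda>k. avg ?K (\<lambda>t. A (\<lambda>y. avg ?K (\<lambda>k'. avg ?K (\<lambda>t'. R \<tau> k t y * cnj (R \<tau>' k' t' y))))))"
        by (rule avg_cong, rule avg_swap)
      also have "\<dots> = avg ?K (\<lambda>k. avg ?K (\<lambda>t. avg ?K (\<lambda>k'. A (\<lambda>y. avg ?K (\<lambda>t'. R \<tau> k t y * cnj (R \<tau>' k' t' y))))))"
        by (rule avg_cong, rule avg_cong, rule avg_swap)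
      also have "\<dots> = avg ?K (\<lambda>k. avg ?K (\<lambda>t. avg ?K (\<lambda>k'. avg ?K (\<lambda>t'. A (\<lambda>y. R \<tau> k t y * cnj (R \<tau>' k' t' y))))))"
        by (rule avg_cong, rule avg_cong, rule avg_cong, rule avg_swap)
      finally show ?thesis .
    qed
    then show "x \<tau> \<tau>' = cmod (avg ?K (\<lambda>k. avg ?K (\<lambda>t. avg ?K (\<lambda>k'. avg ?K (\<lambda>t'. A (\<lambda>y.
       \<alpha> \<tau> (y - \<omega> * \<tau> * k) * \<beta> \<tau> (y - b \<tau> * t) * \<gamma> \<tau> (y - b \<tau> * t - \<omega> * \<tau> * k) *
       cnj (\<alpha> \<tau>' (y - \<omega> * \<tau>' * k') * \<beta> \<tau>' (y - b \<tau>' * t') * \<gamma> \<tau>' (y - b \<tau>' * t' - \<omega> * \<tau>' * k'))))))))"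
      unfolding x_def R_def by (simp only:)
  qed (use that f adm\<alpha> adm\<beta> adm\<gamma> K T err in \<open>simp_all add: \<beta>_def W_def\<close>)
  let ?B = "avg T (\<lambda>\<tau>. avg T (\<lambda>\<tau>'. if \<tau> = \<tau>' then 0 else x \<tau> \<tau>'))"
  let ?Y = "avg T (\<lambda>\<tau>. avg T (\<lambda>\<tau>'. if \<tau> = \<tau>' then 0 else Y \<tau> \<tau>'))"
  have x0: "0 \<le> (if \<tau> = \<tau>' then 0 else x \<tau> \<tau>')" for \<tau> \<tau>' by (simp add: x_def)
  have B0: "0 \<le> ?B" by (intro avg_nonneg x0)
  have Y0': "0 \<le> ?Y" by (intro avg_nonneg) (simp add: Y0)
  have "?B ^ 16 \<le> avg T (\<lambda>\<tau>. avg T (\<lambda>\<tau>'. (if \<tau> = \<tau>' then 0 else x \<tau> \<tau>') ^ 16))"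
    using order.trans[OF avg_power_le[of T "\<lambda>\<tau>. avg T (\<lambda>\<tau>'. if \<tau> = \<tau>' then 0 else x \<tau> \<tau>')" 4]
      avg_mono[OF avg_power_le[of T "\<lambda>\<tau>'. if _ = \<tau>' then 0 else x _ \<tau>'" 4]]] x0
    by (simp add: avg_nonneg)
  also have "\<dots> \<le> avg T (\<lambda>\<tau>. avg T (\<lambda>\<tau>'. 8 ^ 6 * (err + (if \<tau> = \<tau>' then 0 else Y \<tau> \<tau>'))))"
    by (intro avg_mono) (use x16 err0 in auto)
  also have "\<dots> = 8 ^ 6 * (err + ?Y)" using T by (simp add: avg_cmult avg_add avg_const)
  finally have B16: "?B ^ 16 \<le> 8 ^ 6 * (err + ?Y)" .
  have cT: "0 \<le> 1 / real (card T)" "(1 / real (card T)) ^ 16 \<le> 1 / real (card T)"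
  proof -
    have "1 / real (card T) \<le> 1" using T by (simp add: divide_le_eq card_gt_0_iff Suc_leI)
    then show "(1 / real (card T)) ^ 16 \<le> 1 / real (card T)"
      using power_decreasing[of 1 16 "1 / real (card T)"] by simp
  qed simp
  have "(avg T e) ^ 64 = ((avg T e) ^ 4) ^ 16" by (simp flip: power_mult)
  also have "\<dots> \<le> (1 / card T + ?B) ^ 16" by (rule power_mono[OF le4]) simp
  also have "\<dots> = ((1 / card T + ?B) ^ 4) ^ 4" by (simp flip: power_mult)
  also have "\<dots> \<le> (8 * ((1 / card T) ^ 4 + ?B ^ 4)) ^ 4"
    by (intro power_mono add_power4_le cT B0 zero_le_power add_nonneg_nonneg)
  also have "\<dots> = 8 ^ 4 * ((1 / card T) ^ 4 + ?B ^ 4) ^ 4" by (rule power_mult_distrib)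
  also have "\<dots> \<le> 8 ^ 4 * (8 * (((1 / card T) ^ 4) ^ 4 + (?B ^ 4) ^ 4))"
    by (intro mult_left_mono add_power4_le zero_le_power cT B0) simp
  also have "\<dots> = 8 ^ 5 * ((1 / card T) ^ 16 + ?B ^ 16)" by (simp flip: power_mult)
  also have "\<dots> \<le> 8 ^ 5 * (1 / card T + 8 ^ 6 * (err + ?Y))"
    by (intro mult_left_mono add_mono cT B16) simp
  also have "\<dots> \<le> 2 ^ 33 * (1 / card T + err + ?Y)"
  proof -
    \<comment> \<open>2 ^ 33 is 8 ^ 5 * 8 ^ 6.\<close>
    have "8 ^ 5 * (t + 8 ^ 6 * (e + y)) \<le> 2 ^ 33 * (t + e + y)" if "0 \<le> t" "0 \<le> e" "0 \<le> y" for t e y :: real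
      using that by simp
    then show ?thesis using cT(1) err0 Y0' by blast
  qed
  finally show ?thesis unfolding e_def[abs_def] Y_def .
qed

end

subsection \<open>Counting\<close>

lemma card_congruent_le:
  fixes S :: "int set" and d :: int
  assumes S: "S \<subseteq> {1..int K}" and d: "d > 0" and cong: "\<And>x y. x \<in> S \<Longrightarrow> y \<in> S \<Longrightarrow> d dvd x - y"
  shows "real (card S) \<le> 1 + K / d"
proof -
  have inj: "inj_on (\<lambda>x. x div d) S"
  proof (rule inj_onI)
    fix x y assume "x \<in> S" "y \<in> S" "x div d = y div d"
    moreover from this have "x mod d = y mod d" using cong by (simp add: mod_eq_dvd_iff)
    ultimately show "x = y" by (metis div_mult_mod_eq)
  qed
  have "(\<lambda>x. x div d) ` S \<subseteq> {0..int K div d}"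
    using S d by (auto simp: pos_imp_zdiv_nonneg_iff intro!: zdiv_mono1)
  then have "card S \<le> card {0..int K div d}"
    using card_inj_on_le[OF inj] by blast
  also have "\<dots> = nat (int K div d + 1)" by simp
  finally have "real (card S) \<le> real (nat (int K div d + 1))" by (simp only: of_nat_le_iff)
  also have "\<dots> = real_of_int (int K div d) + 1" using d by (simp add: pos_imp_zdiv_nonneg_iff)
  also have "real_of_int (int K div d) \<le> K / d"
    using real_of_int_div4[of "int K" d] by simp
  finally show ?thesis by simp
qed

text \<open>The size condition on \<open>P\<close> turns the congruence between two solutions into
  an equation. Two solutions with the same first coordinate coincide, and first coordinates differ
  by multiples of \<open>b' / gcd b b'\<close>, so counting them along one progression
  suffices.\<close>

lemma card_linear_form_le:
  fixes b b' z :: int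
  assumes b': "b' \<noteq> 0" and B: "\<bar>b\<bar> \<le> B" "\<bar>b'\<bar> \<le> B" and P: "2 * B * int K \<le> int P" and K: "0 < K"
  shows "real (card {p \<in> {1..int K} \<times> {1..int K}. (b * fst p + b' * snd p - z) mod int P = 0})
    \<le> 1 + K * gcd b b' / \<bar>b'\<bar>"
proof -
  let ?S = "{p \<in> {1..int K} \<times> {1..int K}. (b * fst p + b' * snd p - z) mod int P = 0}"
  have eq: "b * (fst p - fst q) = b' * (snd q - snd p)" if p: "p \<in> ?S" "q \<in> ?S" for p q
  proof -
    have "int P dvd b * fst p + b' * snd p - z" "int P dvd b * fst q + b' * snd q - z"
      using p by (simp_all add: dvd_eq_mod_eq_0)
    then have "int P dvd (b * fst p + b' * snd p - z) - (b * fst q + b' * snd q - z)"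
      by (rule dvd_diff)
    then have dvd: "int P dvd b * (fst p - fst q) + b' * (snd p - snd q)" by (simp add: algebra_simps)
    \<comment> \<open>Differences in {1..K} are at most K - 1; this gives the strict inequality that
      excludes nonzero multiples of \<open>P\<close>.\<close>
    have "\<bar>b * (fst p - fst q)\<bar> \<le> B * (int K - 1)" "\<bar>b' * (snd p - snd q)\<bar> \<le> B * (int K - 1)"
      unfolding abs_mult using p B by (auto intro!: mult_mono)
    moreover have "0 < B" using b' B by linarith
    ultimately have "\<bar>b * (fst p - fst q) + b' * (snd p - snd q)\<bar> < int P"
      using P by (simp add: algebra_simps)
    with dvd have "b * (fst p - fst q) + b' * (snd p - snd q) = 0"
      using dvd_imp_le_int[OF _ dvd] by fastforce
    then show ?thesis by (simp add: algebra_simps)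
  qed
  have g: "gcd b b' > 0" using b' by simp
  define d where "d = \<bar>b'\<bar> div gcd b b'"
  have gd: "\<bar>b'\<bar> = gcd b b' * d" by (simp add: d_def)
  have d: "d > 0"
  proof (rule zero_less_mult_pos[OF _ g])
    show "0 < gcd b b' * d" unfolding gd[symmetric] using b' by simp
  qed
  have inj: "inj_on fst ?S"
  proof (rule inj_onI)
    fix p q assume pq: "p \<in> ?S" "q \<in> ?S" "fst p = fst q"
    then have "b' * (snd q - snd p) = 0" using eq[OF pq(1,2)] by simp
    then show "p = q" using b' pq(3) by (simp add: prod_eq_iff)
  qed
  have "real (card ?S) = real (card (fst ` ?S))" using card_image[OF inj] by simp
  also have "\<dots> \<le> 1 + K / d"
  proof (rule card_congruent_le[OF _ d])
    fix x y assume "x \<in> fst ` ?S" "y \<in> fst ` ?S"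
    then obtain p q where pq: "p \<in> ?S" "q \<in> ?S" "x = fst p" "y = fst q" by (elim imageE) rule
    have "b' div gcd b b' dvd (b div gcd b b') * (x - y)"
    proof -
      have "gcd b b' * ((b div gcd b b') * (x - y)) = b * (x - y)" by (simp add: mult.assoc[symmetric])
      also have "\<dots> = b' * (snd q - snd p)" unfolding pq(3,4) by (rule eq[OF pq(1,2)])
      also have "\<dots> = gcd b b' * ((b' div gcd b b') * (snd q - snd p))" by (simp add: mult.assoc[symmetric])
      finally have "gcd b b' * ((b div gcd b b') * (x - y)) = gcd b b' * ((b' div gcd b b') * (snd q - snd p))" .
      then have "(b div gcd b b') * (x - y) = (b' div gcd b b') * (snd q - snd p)" using b' by simp
      then show ?thesis by simp
    qed
    moreover have "coprime (b' div gcd b b') (b div gcd b b')"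
      using div_gcd_coprime[of b b'] b' by (simp add: coprime_commute)
    ultimately have "b' div gcd b b' dvd x - y" by (simp add: coprime_dvd_mult_right_iff)
    moreover have "d = \<bar>b' div gcd b b'\<bar>" using g by (simp add: d_def abs_div)
    ultimately show "d dvd x - y" by simp
  qed auto
  also have "K / d = K * gcd b b' / \<bar>b'\<bar>" using gd g d by (simp add: field_simps)
  finally show ?thesis .
qed

lemma card_multiples_le:
  fixes d n :: nat
  assumes "d > 0"
  shows "card {x::int. x \<noteq> 0 \<and> \<bar>x\<bar> \<le> int n \<and> int d dvd x} \<le> 2 * (n div d)"
proof -
  have "{x::int. x \<noteq> 0 \<and> \<bar>x\<bar> \<le> int n \<and> int d dvd x}
      \<subseteq> (\<lambda>k. int d * int k) ` {1..n div d} \<union> (\<lambda>k. - (int d * int k)) ` {1..n div d}"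
  proof
    fix x :: int assume x: "x \<in> {x. x \<noteq> 0 \<and> \<bar>x\<bar> \<le> int n \<and> int d dvd x}"
    then obtain k where k: "x = int d * k" by auto
    have "int d * \<bar>k\<bar> \<le> int n" and k0: "k \<noteq> 0" using x k by (auto simp: abs_mult)
    then have "int (nat \<bar>k\<bar> * d) \<le> int n" by (simp add: mult.commute)
    then have "nat \<bar>k\<bar> * d \<le> n" by (simp only: of_nat_le_iff)
    then have "nat \<bar>k\<bar> \<in> {1..n div d}" using assms k0 by (simp add: less_eq_div_iff_mult_less_eq)
    moreover have "x = int d * int (nat \<bar>k\<bar>) \<or> x = - (int d * int (nat \<bar>k\<bar>))" using k by auto
    ultimately show "x \<in> (\<lambda>k. int d * int k) ` {1..n div d} \<union> (\<lambda>k. - (int d * int k)) ` {1..n div d}" by blast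
  qed
  then have "card {x::int. x \<noteq> 0 \<and> \<bar>x\<bar> \<le> int n \<and> int d dvd x}
      \<le> card ((\<lambda>k. int d * int k) ` {1..n div d} \<union> (\<lambda>k. - (int d * int k)) ` {1..n div d})"
    by (rule card_mono[rotated]) simp
  also have "\<dots> \<le> card {1..n div d} + card {1..n div d}"
    by (intro order.trans[OF card_Un_le] add_mono card_image_le) auto
  finally show ?thesis by simp
qed

lemma sum_inverse_squares_le:
  fixes g n :: nat
  assumes "g > 0"
  shows "(\<Sum>d\<in>{g<..n}. 1 / (real d)\<^sup>2) \<le> 1 / g"
proof -
  have *: "(\<Sum>d\<in>{g<..n}. 1 / (real d)\<^sup>2) \<le> 1 / g - 1 / n" if "g \<le> n" for n
    using that
  proof (induction n rule: dec_induct)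
    case (step n)
    have "{g<..Suc n} = insert (Suc n) {g<..n}" using step by auto
    then have "(\<Sum>d\<in>{g<..Suc n}. 1 / (real d)\<^sup>2) \<le> 1 / (real (Suc n))\<^sup>2 + (1 / g - 1 / n)"
      using step by simp
    also have "\<dots> \<le> 1 / g - 1 / real (Suc n)"
    proof -
      have n: "0 < real n" using assms step by simp
      have "1 / (real (Suc n))\<^sup>2 \<le> 1 / (real n * real (Suc n))"
        using n by (intro divide_left_mono) (auto simp: power2_eq_square)
      also have "\<dots> = 1 / n - 1 / real (Suc n)" using n by (simp add: field_simps)
      finally show ?thesis by simp
    qed
    finally show ?case .
  qed simp
  show ?thesis
  proof (cases "g \<le> n")
    case True
    moreover have "0 \<le> 1 / real n" by simp
    ultimately show ?thesis using *[of n] by linarith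
  qed simp
qed

text \<open>A union bound over the common divisor d > g; both coordinates are multiples of d, and
  the sum of 1/d^2 beyond g is at most 1/g.\<close>

lemma card_large_gcd_le:
  fixes g n m :: nat
  assumes g: "g > 0"
  shows "real (card {p. fst p \<noteq> 0 \<and> \<bar>fst p\<bar> \<le> int n \<and> snd p \<noteq> 0 \<and> \<bar>snd p\<bar> \<le> int m \<and> gcd (fst p) (snd p) > int g})
    \<le> 4 * real n * real m / g"
proof -
  let ?D = "\<lambda>n d. {x::int. x \<noteq> 0 \<and> \<bar>x\<bar> \<le> int n \<and> int d dvd x}"
  let ?S = "{p. fst p \<noteq> 0 \<and> \<bar>fst p\<bar> \<le> int n \<and> snd p \<noteq> 0 \<and> \<bar>snd p\<bar> \<le> int m \<and> gcd (fst p) (snd p) > int g}"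
  have fin: "finite (?D n d)" for n d by (rule finite_subset[of _ "{- int n..int n}"]) auto
  have "?S \<subseteq> (\<Union>d\<in>{g<..n}. ?D n d \<times> ?D m d)"
  proof
    fix p assume p: "p \<in> ?S"
    define d where "d = nat (gcd (fst p) (snd p))"
    have d: "int d = gcd (fst p) (snd p)" by (simp add: d_def)
    have "int d \<le> \<bar>fst p\<bar>" unfolding d using p by (intro zdvd_imp_le) auto
    then have "d \<in> {g<..n}" using p d by auto
    moreover have "p \<in> ?D n d \<times> ?D m d" using p d by (cases p) auto
    ultimately show "p \<in> (\<Union>d\<in>{g<..n}. ?D n d \<times> ?D m d)" by blast
  qed
  then have "card ?S \<le> card (\<Union>d\<in>{g<..n}. ?D n d \<times> ?D m d)"
    by (rule card_mono[rotated]) (auto intro: fin)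
  also have "\<dots> \<le> (\<Sum>d\<in>{g<..n}. card (?D n d \<times> ?D m d))" by (rule card_UN_le) simp
  also have "\<dots> \<le> (\<Sum>d\<in>{g<..n}. (2 * (n div d)) * (2 * (m div d)))"
    unfolding card_cartesian_product by (intro sum_mono mult_mono card_multiples_le) auto
  finally have "real (card ?S) \<le> real (\<Sum>d\<in>{g<..n}. (2 * (n div d)) * (2 * (m div d)))" by (simp only: of_nat_le_iff)
  also have "\<dots> \<le> (\<Sum>d\<in>{g<..n}. 4 * real n * real m * (1 / (real d)\<^sup>2))"
    unfolding of_nat_sum
  proof (rule sum_mono)
    fix d assume "d \<in> {g<..n}"
    have "real (n div d) * real (m div d) \<le> (real n / d) * (real m / d)"
      by (intro mult_mono of_nat_div_le_of_nat) auto
    then show "real (2 * (n div d) * (2 * (m div d))) \<le> 4 * real n * real m * (1 / (real d)\<^sup>2)"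
      by (simp add: power2_eq_square)
  qed
  also have "\<dots> \<le> 4 * real n * real m * (1 / g)"
    unfolding sum_distrib_left[symmetric] by (intro mult_left_mono sum_inverse_squares_le g) auto
  finally show ?thesis by simp
qed

lemma avg_good_bad:
  fixes X Y :: "'a \<Rightarrow> real" and \<epsilon> \<kappa> :: real
  assumes I: "finite I" "I \<noteq> {}" and X: "\<And>i. i \<in> I \<Longrightarrow> X i \<le> 1" and Y: "\<And>i. i \<in> I \<Longrightarrow> 0 \<le> Y i"
    and good: "\<And>i. i \<in> I - B \<Longrightarrow> X i \<le> \<kappa> * Y i" and \<kappa>: "0 \<le> \<kappa>"
    and bad: "real (card (I \<inter> B)) \<le> \<epsilon> * real (card I)"
  shows "avg I X \<le> \<epsilon> + \<kappa> * avg I Y"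
proof -
  have "sum X I = sum X (I \<inter> B) + sum X (I - B)" using sum.Int_Diff[OF I(1), of X B] by simp
  also have "\<dots> \<le> real (card (I \<inter> B)) + (\<Sum>i\<in>I - B. \<kappa> * Y i)"
    using sum_mono[of "I \<inter> B" X "\<lambda>_. 1"] X good by (intro add_mono sum_mono) auto
  also have "(\<Sum>i\<in>I - B. \<kappa> * Y i) \<le> (\<Sum>i\<in>I. \<kappa> * Y i)"
    using I Y \<kappa> by (intro sum_mono2) auto
  finally have "sum X I \<le> \<epsilon> * card I + \<kappa> * sum Y I" using bad by (simp add: sum_distrib_left)
  moreover have "0 < real (card I)" using I by (simp add: card_gt_0_iff)
  ultimately show ?thesis by (simp add: avg_def field_simps)
qed

subsection \<open>The counting operator and its control by the third uniformity norm\<close>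

text \<open>A pair is recorded by its first entry and its difference, and |b| is at most M because
  \<open>J\<close> has at most M elements.\<close>

lemma sum_by_difference:
  fixes X :: "int \<Rightarrow> int \<Rightarrow> 'a::comm_monoid_add"
  assumes J: "ivl M J"
  shows "(\<Sum>s\<in>J. \<Sum>s'\<in>J. X s s') = (\<Sum>b\<in>{- int M..int M}. \<Sum>s\<in>{s\<in>J. s + b \<in> J}. X s (s + b))"
proof -
  obtain p q where pq: "J = {p..q}" using J by (auto simp: ivl_def)
  have fin: "finite J" by (rule ivl_finite[OF J])
  have "(\<Sum>b\<in>{- int M..int M}. \<Sum>s\<in>{s\<in>J. s + b \<in> J}. X s (s + b))
      = (\<Sum>b\<in>{- int M..int M}. \<Sum>s\<in>J. if s + b \<in> J then X s (s + b) else 0)"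
    by (simp add: sum.inter_filter[OF fin, symmetric])
  also have "\<dots> = (\<Sum>s\<in>J. \<Sum>b\<in>{- int M..int M}. if s + b \<in> J then X s (s + b) else 0)"
    by (rule sum.swap)
  also have "\<dots> = (\<Sum>s\<in>J. \<Sum>s'\<in>J. X s s')"
  proof (rule sum.cong[OF refl])
    fix s assume s: "s \<in> J"
    have "(\<Sum>b\<in>{- int M..int M}. if s + b \<in> J then X s (s + b) else 0)
        = (\<Sum>b\<in>{b\<in>{- int M..int M}. s + b \<in> J}. X s (s + b))"
      by (simp add: sum.inter_filter[symmetric])
    also have "\<dots> = (\<Sum>s'\<in>J. X s s')"
    proof (rule sum.reindex_bij_witness[of _ "\<lambda>s'. s' - s" "\<lambda>b. s + b"])
      fix s' assume s': "s' \<in> J"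
      have "card J = nat (q + 1 - p)" by (simp add: pq)
      then have "q + 1 - p \<le> int M" using ivl_card[OF J] by simp
      then have "\<bar>s' - s\<bar> \<le> int M" using s s' by (auto simp: pq)
      then show "s' - s \<in> {b \<in> {- int M..int M}. s + b \<in> J}" using s' by auto
    qed auto
    finally show "(\<Sum>b\<in>{- int M..int M}. if s + b \<in> J then X s (s + b) else 0) = (\<Sum>s'\<in>J. X s s')" .
  qed
  finally show ?thesis by simp
qed

context cyclic
begin

text \<open>Squares of \<open>s\<close> and \<open>s'\<close> are the only polynomial shifts left.
  The index \<open>s' - s\<close> of \<open>g\<close> and \<open>F\<close> stands for the displaced
  abscissa \<open>x + q (s' - s)\<close>.\<close>

definition lam :: "nat \<Rightarrow> int set \<Rightarrow> (int \<Rightarrow> int \<Rightarrow> complex) \<Rightarrow> (int \<Rightarrow> int \<Rightarrow> complex) \<Rightarrow> (int \<Rightarrow> complex) \<Rightarrow> complex" where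
  "lam M J g F G = (\<Sum>s\<in>J. \<Sum>s'\<in>J. A (\<lambda>y. g (s' - s) y * F (s' - s) (y + s\<^sup>2) * G (y + s'\<^sup>2))) / (of_nat M)\<^sup>2"

definition slice where
  "slice M J g F G b = A (\<lambda>y. g b y * ((\<Sum>s\<in>{s\<in>J. s + b \<in> J}. F b (y + s\<^sup>2) * G (y + (s + b)\<^sup>2)) / of_nat M))"

text \<open>The eighth power of the third Gowers uniformity norm on the cyclic group; one of the
  three derivatives has already been averaged out, which produces the squared modulus.\<close>

definition U3 :: "(int \<Rightarrow> complex) \<Rightarrow> real" where
  "U3 f = A (\<lambda>h. A (\<lambda>k. (cmod (A (dif k (dif h f))))\<^sup>2))"

lemma lam_slices:
  assumes J: "ivl M J"
  shows "lam M J g F G = (\<Sum>b\<in>{- int M..int M}. slice M J g F G b) / of_nat M"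
proof -
  have "slice M J g F G b = (\<Sum>s\<in>{s\<in>J. s + b \<in> J}. A (\<lambda>y. g b y * F b (y + s\<^sup>2) * G (y + (s + b)\<^sup>2))) / of_nat M" for b
    unfolding slice_def times_divide_eq_right by (simp only: divide_inverse avg_multc avg_sum sum_distrib_left mult.assoc)
  then show ?thesis
    unfolding lam_def sum_by_difference[OF J] by (simp add: sum_divide_distrib power2_eq_square)
qed

text \<open>There are 2 M + 1 differences against a normalisation by M, hence the factor 3.\<close>

lemma norm_lam_le_avg_slice:
  assumes J: "ivl M J" and M: "0 < M"
  shows "cmod (lam M J g F G) / 3 \<le> avg {- int M..int M} (\<lambda>b. cmod (slice M J g F G b))"
proof -
  have "cmod (lam M J g F G) \<le> (\<Sum>b\<in>{- int M..int M}. cmod (slice M J g F G b)) / M"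
    unfolding lam_slices[OF J] by (simp add: norm_divide divide_right_mono norm_sum)
  moreover have "(\<Sum>b\<in>{- int M..int M}. cmod (slice M J g F G b)) / M \<le> 3 * avg {- int M..int M} (\<lambda>b. cmod (slice M J g F G b))"
  proof -
    define S where "S = (\<Sum>b\<in>{- int M..int M}. cmod (slice M J g F G b))"
    have S: "0 \<le> S" unfolding S_def by (intro sum_nonneg) simp
    have "S * (2 * real M + 1) \<le> S * (3 * real M)" using M S by (intro mult_left_mono) auto
    moreover have "card {- int M..int M} = 2 * M + 1" by simp
    ultimately show ?thesis unfolding avg_def S_def[symmetric] using M by (simp add: field_simps)
  qed
  ultimately show ?thesis by simp
qed

text \<open>For fixed difference \<open>b\<close> one van der Corput step with shifts
  \<open>w * \<alpha>\<close> discards \<open>g b\<close>. Differencing a square in \<open>s\<close>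
  leaves a linear phase, so \<open>lin_box3\<close> applies. The exponent is 16 = 2 * 8, and 1 / L
  is the diagonal \<open>\<alpha> = \<alpha>'\<close>.\<close>

lemma slice_power_le:
  assumes g: "\<And>b. adm (g b)" and F: "\<And>b. adm (F b)" and G: "adm G" and J: "ivl M J"
    and K: "0 < K" "K \<le> M" and w: "0 < w" "w * L \<le> M" and L: "0 < L"
  shows "(cmod (slice M J g F G b)) ^ 16 \<le> 2 ^ 8 * (1 / L + avg {1..int L} (\<lambda>\<alpha>. avg {1..int L} (\<lambda>\<alpha>'.
    if \<alpha> = \<alpha>' then 0 else 512 * (K / M)\<^sup>2 + 128 * box3 {1..int K} (\<lambda>k. 2 * (b + int w * (\<alpha>' - \<alpha>)) * k)
      {1..int K} (\<lambda>k. 2 * b * k) {1..int K} (\<lambda>k. 2 * (int w * (\<alpha>' - \<alpha>)) * k) (\<lambda>y. cnj (G y)))))"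
proof -
  let ?L = "{1..int L}" and ?K = "{1..int K}" and ?J = "{s\<in>J. s + b \<in> J}"
  have M: "0 < M" using K by simp
  define \<phi> where "\<phi> s y = F b (y + s\<^sup>2) * G (y + (s + b)\<^sup>2)" for s y
  have adm\<phi>: "adm (\<phi> s)" for s unfolding \<phi>_def[abs_def] by (intro adm_mult adm_shift F G)
  define q where "q a = cmod (A (\<lambda>y. (\<Sum>s\<in>{s\<in>?J. s + a \<in> ?J}. \<phi> s y * cnj (\<phi> (s + a) y)) / of_nat M))" for a
  have J': "ivl M {s\<in>?J. s + a \<in> ?J}" for a by (intro ivl_Int_shift J)
  have q1: "q a \<le> 1" for a
    unfolding q_def
  proof (rule norm_avg_le1)
    fix y
    have "cmod (\<Sum>s\<in>{s\<in>?J. s + a \<in> ?J}. \<phi> s y * cnj (\<phi> (s + a) y)) \<le> real (card {s\<in>?J. s + a \<in> ?J}) * 1"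
      by (rule sum_norm_bound) (use adm_norm[OF adm\<phi>] in \<open>auto simp: norm_mult intro!: mult_le_one\<close>)
    also have "\<dots> \<le> real M" using ivl_card[OF J'] by simp
    finally show "cmod ((\<Sum>s\<in>{s\<in>?J. s + a \<in> ?J}. \<phi> s y * cnj (\<phi> (s + a) y)) / of_nat M) \<le> 1"
      by (simp add: norm_divide divide_le_eq)
  qed
  have q0: "0 \<le> q a" for a by (simp add: q_def)
  have sq: "(cmod (slice M J g F G b))\<^sup>2 \<le> 2 * avg ?L (\<lambda>\<alpha>. avg ?L (\<lambda>\<alpha>'. q (int w * \<alpha>' - int w * \<alpha>)))"
    unfolding slice_def \<phi>_def[symmetric] q_def
  proof (rule van_der_corput_avg[where \<sigma> = "\<lambda>\<alpha>. int w * \<alpha>"])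
    fix \<alpha> assume "\<alpha> \<in> ?L"
    then have "int w * \<alpha> \<le> int w * int L" by (intro mult_left_mono) auto
    also have "\<dots> \<le> int M" using w by (simp flip: of_nat_mult)
    finally show "0 \<le> int w * \<alpha> \<and> int w * \<alpha> \<le> int M" using \<open>\<alpha> \<in> ?L\<close> by simp
  qed (use g M J L in \<open>auto simp: adm_norm ivl_Int_shift\<close>)
  have q8: "q a ^ 8 \<le> 512 * (K / M)\<^sup>2 + 128 * box3 ?K (\<lambda>k. 2 * (b + a) * k) ?K (\<lambda>k. 2 * b * k) ?K (\<lambda>k. 2 * a * k) (\<lambda>y. cnj (G y))" for a
  proof -
    define f1 where "f1 y = cnj (F b (y + a\<^sup>2))" for y
    define f2 where "f2 y = G (y + b\<^sup>2)" for y
    define f3 where "f3 y = cnj (G (y + (a + b)\<^sup>2))" for y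
    have f: "adm f1" "adm f2" "adm f3"
      unfolding f1_def[abs_def] f2_def[abs_def] f3_def[abs_def] by (intro adm_cnj adm_shift F G)+
    \<comment> \<open>Translating \<open>y\<close> by \<open>- s\<^sup>2\<close> linearises: (s +
      a)^2, (s + b)^2 and (s + a + b)^2 become progressions of slopes 2 a, 2 b and 2 (a + b). The
      constant terms are hidden in \<open>f1\<close>, \<open>f2\<close>, \<open>f3\<close>.\<close>
    define e where "e s y = F b y * (f1 (y + 2 * a * s) * f2 (y + 2 * b * s) * f3 (y + 2 * (a + b) * s))" for s y
    have adme: "adm (e s)" for s unfolding e_def[abs_def] by (intro adm_mult adm_shift F f)
    have "A (\<lambda>y. (\<Sum>s\<in>{s\<in>?J. s + a \<in> ?J}. \<phi> s y * cnj (\<phi> (s + a) y)) / of_nat M)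
        = (\<Sum>s\<in>{s\<in>?J. s + a \<in> ?J}. A (\<lambda>y. e s (y + s\<^sup>2))) / of_nat M"
    proof -
      have "\<phi> s y * cnj (\<phi> (s + a) y) = e s (y + s\<^sup>2)" for s y
        by (simp add: \<phi>_def e_def f1_def f2_def f3_def power2_eq_square algebra_simps)
      then show ?thesis by (simp only: divide_inverse avg_multc avg_sum)
    qed
    also have "\<dots> = lin M {s\<in>?J. s + a \<in> ?J} (F b) f1 f2 f3 (2 * a) (2 * b) (2 * (a + b))"
      unfolding A_shift[OF adm_per[OF adme]] unfolding lin_def times_divide_eq_right
      by (simp only: divide_inverse avg_multc avg_sum sum_distrib_left e_def[abs_def])
    finally have eq: "A (\<lambda>y. (\<Sum>s\<in>{s\<in>?J. s + a \<in> ?J}. \<phi> s y * cnj (\<phi> (s + a) y)) / of_nat M)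
        = lin M {s\<in>?J. s + a \<in> ?J} (F b) f1 f2 f3 (2 * a) (2 * b) (2 * (a + b))" .
    have "q a ^ 8 \<le> 512 * (K / M)\<^sup>2 + 128 * box3 ?K (\<lambda>k. 2 * (a + b) * k) ?K (\<lambda>k. (2 * (a + b) - 2 * a) * k)
        ?K (\<lambda>k. (2 * (a + b) - 2 * b) * k) f3"
      unfolding q_def eq by (rule lin_box3[OF F f J' K])
    moreover have "box3 R r S v T u f3 = box3 R r S v T u (\<lambda>y. cnj (G y))"
      for R :: "int set" and r and S :: "int set" and v and T :: "int set" and u
      unfolding f3_def[abs_def] by (rule box3_shift[OF adm_cnj[OF G]])
    ultimately show ?thesis by (simp add: add.commute)
  qed
  have "(cmod (slice M J g F G b)) ^ 16 = ((cmod (slice M J g F G b))\<^sup>2) ^ (2 ^ 3)" by (simp flip: power_mult)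
  also have "\<dots> \<le> (2 * avg ?L (\<lambda>\<alpha>. avg ?L (\<lambda>\<alpha>'. q (int w * \<alpha>' - int w * \<alpha>)))) ^ (2 ^ 3)"
    by (rule power_mono[OF sq]) simp
  also have "\<dots> = 2 ^ 8 * (avg ?L (\<lambda>\<alpha>. avg ?L (\<lambda>\<alpha>'. q (int w * \<alpha>' - int w * \<alpha>)))) ^ (2 ^ 3)"
    unfolding power_mult_distrib by simp
  also have "\<dots> \<le> 2 ^ 8 * avg ?L (\<lambda>\<alpha>. avg ?L (\<lambda>\<alpha>'. q (int w * \<alpha>' - int w * \<alpha>) ^ (2 ^ 3)))"
    by (intro mult_left_mono order.trans[OF avg_power_le avg_mono[OF avg_power_le]] avg_nonneg q0) simp
  also have "\<dots> \<le> 2 ^ 8 * (1 / card ?L + avg ?L (\<lambda>\<alpha>. avg ?L (\<lambda>\<alpha>'. if \<alpha> = \<alpha>' then 0 else q (int w * \<alpha>' - int w * \<alpha>) ^ (2 ^ 3))))"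
    using L q0 q1 by (intro mult_left_mono avg_offdiag power_le_one) auto
  also have "\<dots> \<le> 2 ^ 8 * (1 / L + avg ?L (\<lambda>\<alpha>. avg ?L (\<lambda>\<alpha>'.
    if \<alpha> = \<alpha>' then 0 else 512 * (K / M)\<^sup>2 + 128 * box3 ?K (\<lambda>k. 2 * (b + int w * (\<alpha>' - \<alpha>)) * k)
      ?K (\<lambda>k. 2 * b * k) ?K (\<lambda>k. 2 * (int w * (\<alpha>' - \<alpha>)) * k) (\<lambda>y. cnj (G y)))))"
  proof -
    have "q (int w * \<alpha>' - int w * \<alpha>) ^ (2 ^ 3) \<le> 512 * (K / M)\<^sup>2 + 128 * box3 ?K (\<lambda>k. 2 * (b + int w * (\<alpha>' - \<alpha>)) * k)
      ?K (\<lambda>k. 2 * b * k) ?K (\<lambda>k. 2 * (int w * (\<alpha>' - \<alpha>)) * k) (\<lambda>y. cnj (G y))" for \<alpha> \<alpha>'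
      using q8[of "int w * (\<alpha>' - \<alpha>)"] by (simp add: right_diff_distrib)
    then show ?thesis by (intro mult_left_mono add_mono avg_mono) auto
  qed
  finally show ?thesis .
qed

text \<open>The substitution c = b + w \<tau> with \<tau> = \<alpha>' - \<alpha> makes one of the
  three directions independent of \<open>\<tau>\<close>. The concatenation in \<open>\<tau>\<close>
  requires exactly such a frozen direction.\<close>

lemma lam_box3:
  assumes g: "\<And>b. adm (g b)" and F: "\<And>b. adm (F b)" and G: "adm G" and J: "ivl M J"
    and K: "0 < K" "K \<le> M" and w: "0 < w" "w * L \<le> M" and L: "0 < L"
  shows "(cmod (lam M J g F G) / 3) ^ 16 \<le> 2 ^ 8 / L + 2 ^ 17 * (K / M)\<^sup>2 +
    2 ^ 17 * avg {- 2 * int M..2 * int M} (\<lambda>c. avg ({- int L..int L} - {0}) (\<lambda>\<tau>.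
      box3 {1..int K} (\<lambda>k. 2 * c * k) {1..int K} (\<lambda>k. 2 * (c - int w * \<tau>) * k) {1..int K} (\<lambda>k. 2 * int w * \<tau> * k) (\<lambda>y. cnj (G y))))"
proof -
  let ?L = "{1..int L}" and ?K = "{1..int K}" and ?T = "{- int L..int L} - {0}" and ?B = "{- int M..int M}" and ?C = "{- 2 * int M..2 * int M}"
  have M: "0 < M" using K by simp
  define X where "X c \<tau> = box3 ?K (\<lambda>k. 2 * c * k) ?K (\<lambda>k. 2 * (c - int w * \<tau>) * k) ?K (\<lambda>k. 2 * int w * \<tau> * k) (\<lambda>y. cnj (G y))" for c \<tau>
  have X0: "0 \<le> X c \<tau>" for c \<tau> unfolding X_def by (rule box3_nonneg)
  define y where "y b = cmod (slice M J g F G b)" for b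
  define Z where "Z b = avg ?L (\<lambda>\<alpha>. avg ?L (\<lambda>\<alpha>'. if \<alpha> = \<alpha>' then 0 else X (b + int w * (\<alpha>' - \<alpha>)) (\<alpha>' - \<alpha>)))" for b
  have y16: "y b ^ 16 \<le> 2 ^ 8 * (1 / L + (512 * (K / M)\<^sup>2 + 128 * Z b))" for b
  proof -
    have "y b ^ 16 \<le> 2 ^ 8 * (1 / L + avg ?L (\<lambda>\<alpha>. avg ?L (\<lambda>\<alpha>'. if \<alpha> = \<alpha>' then 0 else 512 * (K / M)\<^sup>2 + 128 * X (b + int w * (\<alpha>' - \<alpha>)) (\<alpha>' - \<alpha>))))"
    proof -
      have "X (b + int w * (\<alpha>' - \<alpha>)) (\<alpha>' - \<alpha>) = box3 ?K (\<lambda>k. 2 * (b + int w * (\<alpha>' - \<alpha>)) * k)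
          ?K (\<lambda>k. 2 * b * k) ?K (\<lambda>k. 2 * (int w * (\<alpha>' - \<alpha>)) * k) (\<lambda>y. cnj (G y))" for \<alpha> \<alpha>'
        by (simp add: X_def mult.assoc)
      then show ?thesis
        using slice_power_le[where g = g and F = F and b = b, OF g F G J K w L] unfolding y_def by (simp only:)
    qed
    also have "\<dots> \<le> 2 ^ 8 * (1 / L + avg ?L (\<lambda>\<alpha>. avg ?L (\<lambda>\<alpha>'. 512 * (K / M)\<^sup>2 + 128 * (if \<alpha> = \<alpha>' then 0 else X (b + int w * (\<alpha>' - \<alpha>)) (\<alpha>' - \<alpha>)))))"
      by (intro mult_left_mono add_mono avg_mono) auto
    also have "\<dots> = 2 ^ 8 * (1 / L + (512 * (K / M)\<^sup>2 + 128 * Z b))"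
      using L by (simp add: Z_def avg_add avg_const avg_cmult)
    finally show ?thesis .
  qed
  have "(cmod (lam M J g F G) / 3) ^ 16 \<le> (avg ?B y) ^ (2 ^ 4)"
    using power_mono[OF norm_lam_le_avg_slice[OF J M], of g F G 16] by (simp add: y_def[abs_def])
  also have "\<dots> \<le> avg ?B (\<lambda>b. y b ^ (2 ^ 4))" by (rule avg_power_le) (simp add: y_def)
  also have "\<dots> \<le> avg ?B (\<lambda>b. 2 ^ 8 * (1 / L + (512 * (K / M)\<^sup>2 + 128 * Z b)))"
    by (rule avg_mono) (use y16 in simp)
  also have "\<dots> = 2 ^ 8 / L + 2 ^ 17 * (K / M)\<^sup>2 + 2 ^ 15 * avg ?B Z"
    by (simp add: avg_add avg_const avg_cmult distrib_left)
  also have "\<dots> \<le> 2 ^ 8 / L + 2 ^ 17 * (K / M)\<^sup>2 + 2 ^ 15 * (4 * avg ?C (\<lambda>c. avg ?T (X c)))"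
  proof (intro add_left_mono mult_left_mono)
    have inner: "(\<Sum>\<alpha>'\<in>?L. if \<alpha> = \<alpha>' then 0 else X (b + int w * (\<alpha>' - \<alpha>)) (\<alpha>' - \<alpha>)) \<le> (\<Sum>\<tau>\<in>?T. X (b + int w * \<tau>) \<tau>)"
      if "\<alpha> \<in> ?L" for b \<alpha>
    proof -
      have "(\<Sum>\<alpha>'\<in>?L. if \<alpha> = \<alpha>' then 0 else X (b + int w * (\<alpha>' - \<alpha>)) (\<alpha>' - \<alpha>))
          = (\<Sum>\<alpha>'\<in>?L - {\<alpha>}. X (b + int w * (\<alpha>' - \<alpha>)) (\<alpha>' - \<alpha>))"
        by (rule sum.mono_neutral_cong_right) auto
      also have "\<dots> = (\<Sum>\<tau>\<in>(\<lambda>\<alpha>'. \<alpha>' - \<alpha>) ` (?L - {\<alpha>}). X (b + int w * \<tau>) \<tau>)"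
        by (subst sum.reindex) (auto simp: inj_on_def)
      also have "\<dots> \<le> (\<Sum>\<tau>\<in>?T. X (b + int w * \<tau>) \<tau>)"
        by (rule sum_mono2) (use that X0 in auto)
      finally show ?thesis .
    qed
    have Z: "Z b \<le> (\<Sum>\<tau>\<in>?T. X (b + int w * \<tau>) \<tau>) / L" for b
    proof -
      have "Z b \<le> avg ?L (\<lambda>_. (\<Sum>\<tau>\<in>?T. X (b + int w * \<tau>) \<tau>) / L)"
        unfolding Z_def
      proof (rule avg_mono)
        fix \<alpha> assume "\<alpha> \<in> ?L"
        from inner[OF this, of b]
        show "avg ?L (\<lambda>\<alpha>'. if \<alpha> = \<alpha>' then 0 else X (b + int w * (\<alpha>' - \<alpha>)) (\<alpha>' - \<alpha>)) \<le> (\<Sum>\<tau>\<in>?T. X (b + int w * \<tau>) \<tau>) / L"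
          unfolding avg_def by (simp add: divide_right_mono)
      qed
      then show ?thesis using L by (simp add: avg_const)
    qed
    \<comment> \<open>Since w L is at most M, the translates of {-M..M} by w \<tau> stay in
      {-2M..2M}. By nonnegativity all \<open>c\<close> there may be included, for every
      \<open>\<tau>\<close> alike.\<close>
    have sB: "(\<Sum>b\<in>?B. X (b + int w * \<tau>) \<tau>) \<le> (\<Sum>c\<in>?C. X c \<tau>)" if "\<tau> \<in> ?T" for \<tau>
    proof -
      have "\<bar>int w * \<tau>\<bar> \<le> int w * int L" using that by (auto simp: abs_mult intro!: mult_left_mono)
      also have "\<dots> \<le> int M" using w by (simp flip: of_nat_mult)
      finally have "(\<lambda>b. b + int w * \<tau>) ` ?B \<subseteq> ?C" by auto
      then have "(\<Sum>c\<in>(\<lambda>b. b + int w * \<tau>) ` ?B. X c \<tau>) \<le> (\<Sum>c\<in>?C. X c \<tau>)"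
        by (intro sum_mono2 X0) auto
      then show ?thesis by (subst (asm) sum.reindex) (auto simp: inj_on_def)
    qed
    have "sum Z ?B \<le> (\<Sum>b\<in>?B. (\<Sum>\<tau>\<in>?T. X (b + int w * \<tau>) \<tau>) / L)" by (rule sum_mono) (rule Z)
    also have "\<dots> = (\<Sum>\<tau>\<in>?T. \<Sum>b\<in>?B. X (b + int w * \<tau>) \<tau>) / L"
      by (subst sum.swap) (simp add: sum_divide_distrib)
    also have "\<dots> \<le> (\<Sum>\<tau>\<in>?T. \<Sum>c\<in>?C. X c \<tau>) / L"
      by (intro divide_right_mono sum_mono sB) auto
    also have "\<dots> = (\<Sum>c\<in>?C. \<Sum>\<tau>\<in>?T. X c \<tau>) / L" by (subst sum.swap) simp
    finally have s: "sum Z ?B \<le> (\<Sum>c\<in>?C. \<Sum>\<tau>\<in>?T. X c \<tau>) / L" .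
    define S where "S = (\<Sum>c\<in>?C. \<Sum>\<tau>\<in>?T. X c \<tau>)"
    have S0: "0 \<le> S" unfolding S_def by (intro sum_nonneg X0)
    have cT: "card ?T = 2 * L" using L by simp
    have cC: "card ?C = 4 * M + 1" "card ?B = 2 * M + 1" by auto
    have e: "avg ?C (\<lambda>c. avg ?T (X c)) = S / ((2 * real L) * (4 * real M + 1))"
      unfolding S_def avg_def cT cC by (simp add: sum_divide_distrib[symmetric] add.commute)
    have "avg ?B Z = sum Z ?B / (2 * real M + 1)" unfolding avg_def cC by simp
    also have "\<dots> \<le> (S / L) / (2 * real M + 1)" using s unfolding S_def by (rule divide_right_mono) simp
    also have "\<dots> \<le> 4 * (S / ((2 * real L) * (4 * real M + 1)))"
    proof -
      have "s / l / z = 4 * (s / ((2 * l) * (2 * z)))" for s l z :: real by simp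
      then have "(S / L) / (2 * real M + 1) = 4 * (S / ((2 * real L) * (2 * (2 * real M + 1))))" .
      also have "\<dots> \<le> 4 * (S / ((2 * real L) * (4 * real M + 1)))"
        using S0 L by (intro mult_left_mono divide_left_mono) auto
      finally show ?thesis .
    qed
    finally show "avg ?B Z \<le> 4 * avg ?C (\<lambda>c. avg ?T (X c))" unfolding e .
  qed simp
  finally show ?thesis by (simp add: X_def[abs_def])
qed

text \<open>The derivative in direction 2 c is taken first and kept fixed. Concatenation is then
  applied to the two directions 2 w \<tau> and 2 (c - w \<tau>) of that derivative, and Jensen's
  inequality carries the power through the outer averages.\<close>

lemma box3_concatenation:
  assumes H: "adm H" and L: "0 < L" and K: "0 < K" "0 < K1" "0 < K2" and C: "finite C" "C \<noteq> {}"
    and err: "err = 4 * real L * real K1 / K + 2 * real K2 / K1 + 2 * real L * real K2 / K" "err \<le> 1"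
  shows "(avg C (\<lambda>c. avg ({- int L..int L} - {0}) (\<lambda>\<tau>.
      box3 {1..int K} (\<lambda>k. 2 * c * k) {1..int K} (\<lambda>k. 2 * (c - w * \<tau>) * k) {1..int K} (\<lambda>k. 2 * w * \<tau> * k) H))) ^ 64
    \<le> 2 ^ 33 * (1 / (2 * real L) + err + avg C (\<lambda>c. avg ({- int L..int L} - {0}) (\<lambda>\<tau>. avg ({- int L..int L} - {0}) (\<lambda>\<tau>'.
        if \<tau> = \<tau>' then 0 else box3 {1..int K} (\<lambda>k. 2 * c * k) {1..int K2} (\<lambda>k. 2 * w * \<tau> * \<tau>' * k)
          ({1..int K} \<times> {1..int K}) (\<lambda>p. 2 * (c - w * \<tau>) * fst p + 2 * (c - w * \<tau>') * snd p) H))))"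
proof -
  let ?K = "{1..int K}" and ?T = "{- int L..int L} - {0}"
  define f where "f c l l' = dif (2 * c * l' - 2 * c * l) H" for c l l'
  have admf: "adm (f c l l')" for c l l' unfolding f_def by (rule adm_dif[OF H])
  define e where "e c l l' \<tau> = box2 ?K (\<lambda>k. 2 * w * \<tau> * k) ?K (\<lambda>t. 2 * (c - w * \<tau>) * t) (f c l l')" for c l l' \<tau>
  define Y where "Y c l l' \<tau> \<tau>' = box2 {1..int K2} (\<lambda>k. 2 * w * \<tau> * \<tau>' * k) (?K \<times> ?K) (\<lambda>p. 2 * (c - w * \<tau>) * fst p + 2 * (c - w * \<tau>') * snd p) (f c l l')" for c l l' \<tau> \<tau>'
  have T: "finite ?T" "?T \<noteq> {}" "card ?T = 2 * L" using L by (auto intro!: exI[of _ 1])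
  have conc: "(avg ?T (e c l l')) ^ 64 \<le> 2 ^ 33 * (1 / card ?T + err + avg ?T (\<lambda>\<tau>. avg ?T (\<lambda>\<tau>'. if \<tau> = \<tau>' then 0 else Y c l l' \<tau> \<tau>')))" for c l l'
    unfolding e_def[abs_def] Y_def
    by (rule concatenation[OF admf T(1,2) _ K err]) auto
  have e0: "0 \<le> e c l l' \<tau>" for c l l' \<tau> unfolding e_def by (rule box2_nonneg)
  have box: "box3 ?K (\<lambda>k. 2 * c * k) ?K (\<lambda>k. 2 * (c - w * \<tau>) * k) ?K (\<lambda>k. 2 * w * \<tau> * k) H = avg ?K (\<lambda>l. avg ?K (\<lambda>l'. e c l l' \<tau>))" for c \<tau>
    by (subst box3_swap23[OF H]) (simp add: box3_def e_def f_def)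
  have "avg C (\<lambda>c. avg ?T (\<lambda>\<tau>. box3 ?K (\<lambda>k. 2 * c * k) ?K (\<lambda>k. 2 * (c - w * \<tau>) * k) ?K (\<lambda>k. 2 * w * \<tau> * k) H))
      = avg C (\<lambda>c. avg ?K (\<lambda>l. avg ?K (\<lambda>l'. avg ?T (e c l l'))))"
    unfolding box by (rule avg_cong, subst avg_swap, rule avg_cong, rule avg_swap)
  moreover have "(avg C (\<lambda>c. avg ?K (\<lambda>l. avg ?K (\<lambda>l'. avg ?T (e c l l'))))) ^ (2 ^ 6)
      \<le> avg C (\<lambda>c. avg ?K (\<lambda>l. avg ?K (\<lambda>l'. (avg ?T (e c l l')) ^ (2 ^ 6))))"
    by (intro order.trans[OF avg_power_le avg_mono[OF order.trans[OF avg_power_le avg_mono[OF avg_power_le]]]] avg_nonneg e0)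
  moreover have "\<dots> \<le> avg C (\<lambda>c. avg ?K (\<lambda>l. avg ?K (\<lambda>l'. 2 ^ 33 * (1 / card ?T + err + avg ?T (\<lambda>\<tau>. avg ?T (\<lambda>\<tau>'. if \<tau> = \<tau>' then 0 else Y c l l' \<tau> \<tau>'))))))"
    by (intro avg_mono) (use conc in simp)
  moreover have "\<dots> = 2 ^ 33 * (1 / card ?T + err + avg C (\<lambda>c. avg ?K (\<lambda>l. avg ?K (\<lambda>l'. avg ?T (\<lambda>\<tau>. avg ?T (\<lambda>\<tau>'. if \<tau> = \<tau>' then 0 else Y c l l' \<tau> \<tau>'))))))"
    using C K by (simp add: avg_cmult avg_add avg_const)
  moreover have "avg C (\<lambda>c. avg ?K (\<lambda>l. avg ?K (\<lambda>l'. avg ?T (\<lambda>\<tau>. avg ?T (\<lambda>\<tau>'. if \<tau> = \<tau>' then 0 else Y c l l' \<tau> \<tau>')))))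
      = avg C (\<lambda>c. avg ?T (\<lambda>\<tau>. avg ?T (\<lambda>\<tau>'. if \<tau> = \<tau>' then 0 else box3 ?K (\<lambda>k. 2 * c * k) {1..int K2} (\<lambda>k. 2 * w * \<tau> * \<tau>' * k)
          (?K \<times> ?K) (\<lambda>p. 2 * (c - w * \<tau>) * fst p + 2 * (c - w * \<tau>') * snd p) H)))"
    unfolding avg_swap22[of ?K ?K ?T ?T]
    by (intro avg_cong) (simp add: box3_def Y_def f_def)
  ultimately show ?thesis using T(3) by simp
qed

lemma per_box2_dif: "per f \<Longrightarrow> per (\<lambda>h. box2 S v T u (dif h f))"
  by (simp add: per_def[of "\<lambda>h. box2 S v T u (dif h f)"] dif_per_h)

lemma per_fej_dif: "per f \<Longrightarrow> per (\<lambda>h. fej S v (dif h f))"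
  by (simp add: per_def[of "\<lambda>h. fej S v (dif h f)"] dif_per_h)

text \<open>Symmetry brings the equidistributed direction to the front, where
  \<open>dominate\<close> exchanges its differences for a uniform derivative
  \<open>h\<close>.\<close>

lemma box3_dominate:
  fixes \<kappa> :: real
  assumes f: "adm f" and T: "finite T" "T \<noteq> {}"
    and card: "\<And>z. real (card {x \<in> T. (u x - z) mod int P = 0}) \<le> \<kappa> * real (card T) / real P"
  shows "box3 R r S v T u f \<le> \<kappa> * A (\<lambda>h. box2 R r S v (dif h f))"
proof -
  have "box3 R r S v T u f = box3 T u R r S v f"
    by (subst box3_swap23[OF f], subst box3_swap12, rule refl)
  also have "\<dots> \<le> \<kappa> * A (\<lambda>h. box2 R r S v (dif h f))"
    unfolding box3_def by (rule dominate[OF per_box2_dif[OF adm_per[OF f]] box2_nonneg T card])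
  finally show ?thesis .
qed

lemma box2_dominate:
  fixes \<kappa> :: real
  assumes f: "adm f" and T: "finite T" "T \<noteq> {}"
    and card: "\<And>z. real (card {x \<in> T. (u x - z) mod int P = 0}) \<le> \<kappa> * real (card T) / real P"
  shows "box2 S v T u f \<le> \<kappa> * A (\<lambda>h. fej S v (dif h f))"
  unfolding box2_swap[OF f, of S v T u] unfolding box2_def
  by (rule dominate[OF per_fej_dif[OF adm_per[OF f]] fej_nonneg T card])

lemma fej_dominate_U3:
  fixes \<kappa> :: real
  assumes f: "adm f" and S: "finite S" "S \<noteq> {}"
    and card: "\<And>z. real (card {x \<in> S. (v x - z) mod int P = 0}) \<le> \<kappa> * real (card S) / real P"
  shows "A (\<lambda>h. A (\<lambda>h'. fej S v (dif h' (dif h f)))) \<le> \<kappa> * U3 f"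
proof -
  define X where "X k = A (\<lambda>h. (cmod (A (dif k (dif h f))))\<^sup>2)" for k
  have X: "per X"
    by (simp add: per_def X_def dif_per_h[OF adm_per[OF adm_dif[OF f]]])
  have X0: "0 \<le> X k" for k unfolding X_def by (intro avg_nonneg) simp
  \<comment> \<open>Averaging the correlations of a derivative over all shifts of one of its two
    copies factorises them into a squared mean; this is how \<open>U3\<close> acquires its squared
    modulus.\<close>
  have e: "A (\<lambda>h'. A (dif k (dif h' g))) = of_real ((cmod (A (dif k g)))\<^sup>2)" if g: "adm g" for g k
  proof -
    let ?u = "dif k g"
    have "A (\<lambda>h'. A (dif k (dif h' g))) = A (\<lambda>y. ?u y * cnj (A (\<lambda>h'. ?u (h' + y))))"
      unfolding dif_dif[of k] dif_def[of _ ?u] by (subst avg_swap) (simp add: avg_cmult avg_cnj add.commute)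
    also have "\<dots> = A (\<lambda>y. ?u y * cnj (A ?u))"
      by (simp only: A_shift[OF adm_per[OF adm_dif[OF g]]])
    finally show ?thesis by (simp only: avg_multc complex_norm_square)
  qed
  have "complex_of_real (A (\<lambda>h. A (\<lambda>h'. fej S v (dif h' (dif h f)))))
      = A (\<lambda>h. A (\<lambda>h'. avg S (\<lambda>x. avg S (\<lambda>x'. A (dif (v x' - v x) (dif h' (dif h f)))))))"
    by (simp only: avg_of_real[symmetric] fej_corr[OF adm_per[OF adm_dif[OF adm_dif[OF f]]]])
  also have "\<dots> = avg S (\<lambda>x. avg S (\<lambda>x'. A (\<lambda>h. A (\<lambda>h'. A (dif (v x' - v x) (dif h' (dif h f)))))))"
    by (rule avg_swap22)
  also have "\<dots> = of_real (avg S (\<lambda>x. avg S (\<lambda>x'. X (v x' - v x))))"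
    by (simp only: e[OF adm_dif[OF f]] X_def avg_of_real)
  finally have "A (\<lambda>h. A (\<lambda>h'. fej S v (dif h' (dif h f)))) = avg S (\<lambda>x. avg S (\<lambda>x'. X (v x' - v x)))"
    by (simp only: of_real_eq_iff)
  also have "\<dots> \<le> \<kappa> * A X" by (rule dominate[OF X X0 S card])
  also have "A X = U3 f" unfolding X_def U3_def by (rule avg_swap)
  finally show ?thesis .
qed

end

section \<open>Replacing the three directions by uniform derivatives, with explicit powers of
  Q\<close>

lemma mult_power_le:
  fixes q :: real
  assumes q: "1024 \<le> q" and c: "c \<le> 1024 ^ j" "a + j \<le> b"
  shows "c * q ^ a \<le> q ^ b"
proof -
  have "c * q ^ a \<le> q ^ j * q ^ a"
    using order.trans[OF c(1) power_mono[OF q, of j]] q by (intro mult_right_mono) auto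
  also have "\<dots> = q ^ (a + j)" by (simp add: power_add)
  also have "\<dots> \<le> q ^ b" using q c by (intro power_increasing) auto
  finally show ?thesis .
qed

text \<open>Numerical constants are paid for in powers: a constant up to 1024^j costs j powers of q.
  This and \<open>mult_power_le\<close> account for most of the exponents below.\<close>

lemma divide_power_le:
  fixes q :: real
  assumes q: "1024 \<le> q" and c: "c \<le> 1024 ^ j" "a + j \<le> b"
  shows "c / q ^ b \<le> 1 / q ^ a"
  using mult_power_le[OF q c] q by (simp add: field_simps)

lemma div_nat_bounds:
  fixes n d :: nat
  assumes d: "0 < d" "d \<le> n"
  shows "1 \<le> n div d" "real (n div d) \<le> n / d" "n / (2 * real d) \<le> real (n div d)"
proof -
  show 1: "1 \<le> n div d" using d by (simp add: Suc_le_eq div_greater_zero_iff)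
  show "real (n div d) \<le> n / d" by (rule of_nat_div_le_of_nat)
  have "n < d * (n div d) + d" using d by (metis add.commute add_less_cancel_right div_mult_mod_eq mod_less_divisor mult.commute add_left_mono nat_add_left_cancel_less)
  also have "\<dots> \<le> d * (n div d) + d * (n div d)" using 1 by simp
  finally have "real n \<le> real (2 * d * (n div d))" by (simp only: of_nat_le_iff)
  then show "n / (2 * real d) \<le> real (n div d)" using d by (simp add: field_simps)
qed

text \<open>The gcd divides w (t - t'). Its common part with w also divides c, hence is at most g;
  the complementary factor divides t - t'.\<close>

lemma gcd_arith_progression_le:
  fixes c w t t' :: int
  assumes "gcd c w \<le> g" "t \<noteq> t'" "0 < gcd c w"
  shows "gcd (c - w * t) (c - w * t') \<le> g * \<bar>t - t'\<bar>"
proof -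
  define h where "h = gcd (c - w * t) (c - w * t')"
  define h1 where "h1 = gcd h w"
  have "h1 dvd c"
  proof -
    have h1: "h1 dvd h" "h1 dvd w" by (simp_all add: h1_def)
    have "h dvd c - w * t" unfolding h_def by (rule gcd_dvd1)
    with h1 have "h1 dvd (c - w * t) + w * t" by (intro dvd_add dvd_mult2) (auto intro: dvd_trans)
    then show ?thesis by simp
  qed
  then have "h1 dvd gcd c w" by (simp add: h1_def)
  then have h1: "h1 \<le> g" using assms zdvd_imp_le by fastforce
  have hw: "h dvd w * (t - t')"
  proof -
    have "h dvd (c - w * t') - (c - w * t)" unfolding h_def by (intro dvd_diff gcd_dvd1 gcd_dvd2)
    then show ?thesis by (simp add: right_diff_distrib)
  qed
  show ?thesis
  proof (cases "h = 0")
    case True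
    have "0 \<le> g" using assms(1,3) by linarith
    then have "0 \<le> g * \<bar>t - t'\<bar>" by simp
    with True show ?thesis by (simp add: h_def)
  next
    case False
    have pos: "0 < h" "0 < h1" using False by (auto simp: h_def h1_def less_le)
    have "h div h1 dvd (w div h1) * (t - t')"
    proof -
      have "h1 * (h div h1) dvd h1 * ((w div h1) * (t - t'))"
        using hw by (simp add: h1_def mult.assoc[symmetric])
      then show ?thesis using pos by simp
    qed
    moreover have "coprime (h div h1) (w div h1)"
      unfolding h1_def using False by (intro div_gcd_coprime) auto
    ultimately have "h div h1 dvd t - t'" by (simp add: coprime_dvd_mult_right_iff)
    then have "h div h1 dvd \<bar>t - t'\<bar>" by simp
    then have "h div h1 \<le> \<bar>t - t'\<bar>" using assms by (intro zdvd_imp_le) auto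
    moreover have "0 \<le> h div h1" using pos by (simp add: pos_imp_zdiv_nonneg_iff)
    ultimately have "h1 * (h div h1) \<le> g * \<bar>t - t'\<bar>" using h1 pos by (intro mult_mono) auto
    moreover have "h1 * (h div h1) = h" by (simp add: h1_def)
    ultimately show ?thesis by (simp add: h_def)
  qed
qed

context cyclic
begin

lemma card_pair_condition:
  fixes b b' B :: int and G D \<kappa> :: real
  assumes "0 < K" "\<bar>b\<bar> \<le> B" "\<bar>b'\<bar> \<le> B" "2 * B * int K \<le> int P"
    and G: "real_of_int (gcd b b') \<le> G" and D: "0 < D" "D \<le> real_of_int \<bar>b'\<bar>"
    and \<kappa>: "1 + K * G / D \<le> \<kappa> * (real K)\<^sup>2 / P"
  shows "real (card {p \<in> {1..int K} \<times> {1..int K}. (b * fst p + b' * snd p - z) mod int P = 0})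
    \<le> \<kappa> * real (card ({1..int K} \<times> {1..int K})) / real P"
proof -
  have "b' \<noteq> 0" using D by auto
  then have "real (card {p \<in> {1..int K} \<times> {1..int K}. (b * fst p + b' * snd p - z) mod int P = 0})
      \<le> 1 + K * gcd b b' / \<bar>b'\<bar>"
    by (rule card_linear_form_le) (use assms in auto)
  also have "\<dots> \<le> 1 + K * G / D"
  proof -
    have "0 \<le> real_of_int (gcd b b')" by simp
    then have "0 \<le> G" using G by linarith
    moreover have "real K * real_of_int (gcd b b') \<le> real K * G" using G by (rule mult_left_mono) simp
    ultimately show ?thesis using D by (intro add_left_mono frac_le) auto
  qed
  also have "\<dots> \<le> \<kappa> * (real K)\<^sup>2 / P" by (rule \<kappa>)
  finally show ?thesis by (simp add: power2_eq_square)
qed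

lemma card_short_interval_le:
  fixes X :: "'a set" and f :: "'a \<Rightarrow> int" and T :: real
  assumes T: "0 \<le> T" and inj: "inj_on f X" and X: "\<And>x. x \<in> X \<Longrightarrow> \<bar>real_of_int (f x)\<bar> < T"
  shows "real (card X) \<le> 2 * T + 1"
proof -
  have "f ` X \<subseteq> {- \<lfloor>T\<rfloor>..\<lfloor>T\<rfloor>}"
  proof
    fix y assume "y \<in> f ` X"
    then obtain x where x: "x \<in> X" "y = f x" by blast
    from X[OF x(1)] have "real_of_int y \<le> T" "real_of_int (- y) \<le> T" by (auto simp: x)
    then have "y \<le> \<lfloor>T\<rfloor>" "- y \<le> \<lfloor>T\<rfloor>" by (simp_all only: le_floor_iff)
    then show "y \<in> {- \<lfloor>T\<rfloor>..\<lfloor>T\<rfloor>}" by auto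
  qed
  then have "card X \<le> card {- \<lfloor>T\<rfloor>..\<lfloor>T\<rfloor>}" by (rule card_inj_on_le[OF inj]) simp
  then have "real (card X) \<le> real (card {- \<lfloor>T\<rfloor>..\<lfloor>T\<rfloor>})" by simp
  also have "\<dots> = 2 * real_of_int \<lfloor>T\<rfloor> + 1" using T by simp
  also have "\<dots> \<le> 2 * T + 1" by simp
  finally show ?thesis .
qed

text \<open>With K = M div Q^12 the boundary term (K/M)^2 is at most Q^-24, and 1/L is Q^-1412; both
  are small against the main term, which is at least Q^-19. The bound holds for every admissible
  dilation \<open>w\<close> separately, so it may later be averaged over \<open>w\<close>.\<close>

lemma box3_lower_bound:
  fixes g F :: "int \<Rightarrow> int \<Rightarrow> complex"
  assumes adm: "\<And>b. adm (g b)" "\<And>b. adm (F b)" "adm G" and J: "ivl M J"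
    and Q: "1024 \<le> Q" "Q ^ 11000 \<le> M" and L: "L = Q ^ 1412" and K: "K = M div Q ^ 12"
    and w: "0 < w" "w * L \<le> M" and lam: "1 / Q \<le> cmod (lam M J g F G)"
  shows "1 / real Q ^ 21 \<le> avg {- 2 * int M..2 * int M} (\<lambda>c. avg ({- int L..int L} - {0}) (\<lambda>\<tau>.
      box3 {1..int K} (\<lambda>k. 2 * c * k) {1..int K} (\<lambda>k. 2 * (c - int w * \<tau>) * k) {1..int K} (\<lambda>k. 2 * int w * \<tau> * k) (\<lambda>y. cnj (G y))))"
    (is "_ \<le> ?X")
proof -
  define q where "q = real Q"
  have q: "1024 \<le> q" using Q by (simp add: q_def)
  have Q12: "Q ^ 12 \<le> M" using Q by (intro order.trans[OF power_increasing Q(2)]) auto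
  have Qp: "0 < Q ^ n" for n using Q by simp
  note Kb = div_nat_bounds[OF Qp Q12, folded K]
  have M: "0 < M" using Q12 Qp[of 12] by linarith
  have KM: "real K / M \<le> 1 / q ^ 12" using Kb(2) M q by (simp add: q_def field_simps)
  have "(1 / q / 3) ^ 16 \<le> (cmod (lam M J g F G) / 3) ^ 16"
    using lam q by (intro power_mono divide_right_mono) (auto simp: q_def)
  also have "\<dots> \<le> 2 ^ 8 / L + 2 ^ 17 * (K / M)\<^sup>2 + 2 ^ 17 * ?X"
    by (rule lam_box3) (use adm J Kb K M w L Qp in auto)
  finally have main: "1 / (3 ^ 16 * q ^ 16) \<le> 2 ^ 8 / L + 2 ^ 17 * (K / M)\<^sup>2 + 2 ^ 17 * ?X"
    by (simp add: power_divide mult.commute)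
  have a1: "1 / q ^ 19 \<le> 1 / (3 ^ 16 * q ^ 16)"
    using mult_power_le[OF q, of "3 ^ 16" 3 16 19] q by (intro divide_left_mono) auto
  have a2: "2 ^ 8 / real L \<le> 1 / 4 * (1 / q ^ 19)"
    using divide_power_le[OF q, of "2 ^ 10" 1 19 1412] by (simp add: L q_def)
  have "(K / M)\<^sup>2 \<le> (1 / q ^ 12)\<^sup>2" using KM by (intro power_mono) auto
  also have "\<dots> = 1 / q ^ 24" by (simp add: power_divide flip: power_mult)
  finally have a3: "2 ^ 17 * (K / M)\<^sup>2 \<le> 1 / 4 * (1 / q ^ 19)"
    using divide_power_le[OF q, of "2 ^ 19" 2 19 24] by simp
  have a4: "1 / q ^ 21 \<le> 1 / 2 ^ 18 * (1 / q ^ 19)"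
    using divide_power_le[OF q, of "2 ^ 18" 2 19 21] by simp
  have "a \<le> X" if "m \<le> e1 + e2 + 2 ^ 17 * X" "u \<le> m" "e1 \<le> 1 / 4 * u" "e2 \<le> 1 / 4 * u" "a \<le> 1 / 2 ^ 18 * u"
    for a m u e1 e2 X :: real
  proof -
    have "(2::real) ^ 17 = 131072" "(2::real) ^ 18 = 262144" by simp_all
    with that show ?thesis by (simp only:)
  qed
  from this[OF main a1 a2 a3 a4] show ?thesis unfolding q_def .
qed

text \<open>The 64th power turns Q^-21 into Q^-1344. The scales are nested so that each boundary
  ratio in \<open>err\<close> is at most 4 Q^-1418: L K1 / K gives 1412 - 2830 = -1418, and K2 / K1
  gives -1420.\<close>

lemma box3_pair_lower_bound:
  assumes H: "adm H" and Q: "1024 \<le> Q" "Q ^ 11000 \<le> M" and L: "L = Q ^ 1412" and K: "K = M div Q ^ 12"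
    and K1: "K1 = K div Q ^ 2830" and K2: "K2 = K1 div Q ^ 1420"
    and X: "1 / real Q ^ 21 \<le> avg {- 2 * int M..2 * int M} (\<lambda>c. avg ({- int L..int L} - {0}) (\<lambda>\<tau>.
      box3 {1..int K} (\<lambda>k. 2 * c * k) {1..int K} (\<lambda>k. 2 * (c - w * \<tau>) * k) {1..int K} (\<lambda>k. 2 * w * \<tau> * k) H))"
      (is "_ \<le> ?X")
  shows "1 / real Q ^ 1348 \<le> avg {- 2 * int M..2 * int M} (\<lambda>c. avg ({- int L..int L} - {0}) (\<lambda>\<tau>. avg ({- int L..int L} - {0}) (\<lambda>\<tau>'.
        if \<tau> = \<tau>' then 0 else box3 {1..int K} (\<lambda>k. 2 * c * k) {1..int K2} (\<lambda>k. 2 * w * \<tau> * \<tau>' * k)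
          ({1..int K} \<times> {1..int K}) (\<lambda>p. 2 * (c - w * \<tau>) * fst p + 2 * (c - w * \<tau>') * snd p) H)))"
    (is "_ \<le> ?Z")
    and "real M / (2 * real Q ^ 12) \<le> K" "real M / (8 * real Q ^ 4262) \<le> K2" "real K \<le> M / real Q ^ 12" "real K2 \<le> M / real Q ^ 4262"
    "0 < K" "0 < K1" "0 < K2"
proof -
  define q where "q = real Q"
  have q: "1024 \<le> q" "0 < q" using Q by (simp_all add: q_def)
  have Qp: "0 < Q ^ n" for n using Q by simp
  have Qle: "Q ^ n \<le> M" if "n \<le> 11000" for n
    using Q that by (intro order.trans[OF power_increasing Q(2)]) auto
  note Kb = div_nat_bounds[OF Qp Qle[of 12], folded K, simplified]
  have MK: "Q ^ 4250 \<le> K" unfolding K using Qle[of 4262] Qp[of 12]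
    by (simp add: less_eq_div_iff_mult_less_eq flip: power_add)
  have Q2830: "Q ^ 2830 \<le> K" using Q by (intro order.trans[OF power_increasing MK]) auto
  note K1b = div_nat_bounds[OF Qp Q2830, folded K1]
  have MK1: "Q ^ 1420 \<le> K1" unfolding K1 using MK Qp[of 2830]
    by (simp add: less_eq_div_iff_mult_less_eq flip: power_add)
  note K2b = div_nat_bounds[OF Qp MK1, folded K2]
  show pos: "0 < K" "0 < K1" "0 < K2" using Kb K1b K2b by linarith+
  show lo: "real M / (2 * real Q ^ 12) \<le> K" using Kb by simp
  show up: "real K \<le> M / real Q ^ 12" using Kb by simp
  have K1up: "real K1 \<le> K / q ^ 2830" and K2up: "real K2 \<le> K1 / q ^ 1420"
    and K1lo: "K / (2 * q ^ 2830) \<le> K1" and K2lo: "K1 / (2 * q ^ 1420) \<le> K2"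
    using K1b K2b by (simp_all add: q_def)
  have K2K: "real K2 \<le> K / q ^ 4250"
  proof -
    have "K1 / q ^ 1420 \<le> (K / q ^ 2830) / q ^ 1420" using K1up q by (intro divide_right_mono) auto
    also have "\<dots> = K / q ^ 4250" by (simp add: divide_divide_eq_left flip: power_add)
    finally show ?thesis using K2up by linarith
  qed
  show "real K2 \<le> M / real Q ^ 4262"
  proof -
    have "K / q ^ 4250 \<le> (M / q ^ 12) / q ^ 4250" using up q by (intro divide_right_mono) (auto simp: q_def)
    also have "\<dots> = M / q ^ 4262" by (simp add: divide_divide_eq_left flip: power_add)
    finally show ?thesis using K2K by (simp add: q_def)
  qed
  show "real M / (8 * real Q ^ 4262) \<le> K2"
  proof -
    have "real M / (8 * q ^ 4262) = ((M / (2 * q ^ 12)) / (2 * q ^ 2830)) / (2 * q ^ 1420)"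
      by (simp add: divide_divide_eq_left mult_ac flip: power_add)
    also have "\<dots> \<le> (K / (2 * q ^ 2830)) / (2 * q ^ 1420)"
      using lo q by (intro divide_right_mono) (auto simp: q_def)
    also have "\<dots> \<le> K1 / (2 * q ^ 1420)" using K1lo q by (intro divide_right_mono) auto
    finally show ?thesis using K2lo by (simp add: q_def)
  qed
  define err where "err = 4 * real L * real K1 / K + 2 * real K2 / K1 + 2 * real L * real K2 / K"
  have canc: "c * (a / (a * b)) = c / b" if "a \<noteq> 0" for a b c :: real using that by simp
  have Lq: "real L = q ^ 1412" by (simp add: L q_def)
  have "4 * real L * real K1 / K \<le> 4 * q ^ 1412 * (K / q ^ 2830) / K"
    unfolding Lq using K1up q by (intro divide_right_mono mult_left_mono) auto
  also have "\<dots> = 4 * (q ^ 1412 / q ^ 2830)" using pos by simp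
  also have "q ^ 2830 = q ^ 1412 * q ^ 1418" by (simp flip: power_add)
  also have "4 * (q ^ 1412 / (q ^ 1412 * q ^ 1418)) = 4 / q ^ 1418" by (rule canc) (use q in simp)
  finally have e1: "4 * real L * real K1 / K \<le> 4 / q ^ 1418" .
  have e2: "2 * real K2 / K1 \<le> 4 / q ^ 1418"
  proof -
    have "2 * real K2 / K1 \<le> 2 * (K1 / q ^ 1420) / K1" using K2up by (intro divide_right_mono mult_left_mono) auto
    also have "\<dots> = 2 / q ^ 1420" using pos by simp
    also have "\<dots> \<le> 1 / q ^ 1418" using divide_power_le[OF q(1), of 2 1 1418 1420] by simp
    also have "\<dots> \<le> 4 / q ^ 1418" using q by (intro divide_right_mono) auto
    finally show ?thesis .
  qed
  have e3: "2 * real L * real K2 / K \<le> 4 / q ^ 1418"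
  proof -
    have "2 * real L * real K2 / K \<le> 2 * q ^ 1412 * (K / q ^ 4250) / K"
      unfolding Lq using K2K q by (intro divide_right_mono mult_left_mono) auto
    also have "\<dots> = 2 * (q ^ 1412 / q ^ 4250)" using pos by simp
    also have "q ^ 4250 = q ^ 1412 * q ^ 2838" by (simp flip: power_add)
    also have "2 * (q ^ 1412 / (q ^ 1412 * q ^ 2838)) = 2 / q ^ 2838" by (rule canc) (use q in simp)
    also have "\<dots> \<le> 1 / q ^ 1418" using divide_power_le[OF q(1), of 2 1 1418 2838] by simp
    also have "\<dots> \<le> 4 / q ^ 1418" using q by (intro divide_right_mono) auto
    finally show ?thesis .
  qed
  have err: "err \<le> 12 / q ^ 1418" unfolding err_def using e1 e2 e3 by simp
  have err1: "err \<le> 1"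
    using order.trans[OF err divide_power_le[OF q(1), of 12 1 0 1418]] by simp
  have c1: "?X ^ 64 \<le> 2 ^ 33 * (1 / (2 * real L) + err + ?Z)"
    by (rule box3_concatenation[OF H _ pos _ _ err_def err1]) (use Qp in \<open>auto simp: L\<close>)
  have c2: "(1 / q ^ 21) ^ 64 \<le> ?X ^ 64"
    using X q by (intro power_mono) (auto simp: q_def)
  have c3: "(1 / q ^ 21) ^ 64 = 1 / q ^ 1344" by (simp add: power_divide flip: power_mult)
  have c4: "2 ^ 33 * (1 / (2 * real L)) \<le> 1 / 4 * (1 / q ^ 1344)"
    using divide_power_le[OF q(1), of "2 ^ 34" 4 1344 1412] by (simp add: Lq)
  have c5: "2 ^ 33 * err \<le> 1 / 4 * (1 / q ^ 1344)"
    using err divide_power_le[OF q(1), of "2 ^ 35 * 12" 4 1344 1418] by simp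
  have c6: "1 / q ^ 1348 \<le> 1 / 2 ^ 34 * (1 / q ^ 1344)"
    using divide_power_le[OF q(1), of "2 ^ 34" 4 1344 1348] by simp
  have "a \<le> Z" if "x \<le> 2 ^ 33 * (l + e + Z)" "u' \<le> x" "u' = u" "2 ^ 33 * l \<le> 1 / 4 * u" "2 ^ 33 * e \<le> 1 / 4 * u" "a \<le> 1 / 2 ^ 34 * u"
    for a x u u' l e Z :: real
  proof -
    have "u \<le> 2 ^ 33 * l + 2 ^ 33 * e + 2 ^ 33 * Z" using that(1-3) by (simp add: distrib_left)
    then have "1 / 2 * u \<le> 2 ^ 33 * Z" using that(4,5) by simp
    then show ?thesis using that(6) by simp
  qed
  from this[OF c1 c2 c3 c4 c5 c6] show "1 / real Q ^ 1348 \<le> ?Z" unfolding q_def .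
qed

text \<open>The constant is 9 = 1 + 1 + 3 + 4: a vanishing first or second coordinate,
  \<open>t\<close> too close to \<open>s * \<tau>\<close>, and a large gcd.\<close>

lemma card_bad_pairs:
  fixes S T :: "int set" and n m R :: nat
  assumes S: "finite S" "\<And>s. s \<in> S \<Longrightarrow> \<bar>s\<bar> \<le> int n" "n \<le> card S" "R \<le> card S"
    and T: "finite T" "\<And>t. t \<in> T \<Longrightarrow> \<bar>t\<bar> \<le> int m" "m \<le> card T" "R \<le> card T" and R: "0 < R"
  shows "real (card (S \<times> T \<inter> {p. fst p = 0 \<or> snd p = 0 \<or> \<bar>snd p - fst p * \<tau>\<bar> * int R < int m \<or> gcd (fst p) (snd p) > int R}))
    \<le> 9 / real R * real (card (S \<times> T))"
proof -
  let ?Z1 = "({0} \<inter> S) \<times> T" and ?Z2 = "S \<times> ({0} \<inter> T)"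
    and ?Z3 = "SIGMA s:S. {t\<in>T. \<bar>t - s * \<tau>\<bar> * int R < int m}"
    and ?Z4 = "{p. fst p \<noteq> 0 \<and> \<bar>fst p\<bar> \<le> int n \<and> snd p \<noteq> 0 \<and> \<bar>snd p\<bar> \<le> int m \<and> gcd (fst p) (snd p) > int R}"
  have fin: "finite ?Z4"
    by (rule finite_subset[of _ "{- int n..int n} \<times> {- int m..int m}"]) auto
  have "S \<times> T \<inter> {p. fst p = 0 \<or> snd p = 0 \<or> \<bar>snd p - fst p * \<tau>\<bar> * int R < int m \<or> gcd (fst p) (snd p) > int R}
      \<subseteq> (?Z1 \<union> ?Z2) \<union> (?Z3 \<union> ?Z4)"
    using S(2) T(2) by auto
  then have "card (S \<times> T \<inter> {p. fst p = 0 \<or> snd p = 0 \<or> \<bar>snd p - fst p * \<tau>\<bar> * int R < int m \<or> gcd (fst p) (snd p) > int R})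
      \<le> card ((?Z1 \<union> ?Z2) \<union> (?Z3 \<union> ?Z4))"
    using S(1) T(1) fin by (intro card_mono) auto
  also have "\<dots> \<le> (card ?Z1 + card ?Z2) + (card ?Z3 + card ?Z4)"
    by (intro order.trans[OF card_Un_le] add_mono card_Un_le)
  finally have le: "real (card (S \<times> T \<inter> {p. fst p = 0 \<or> snd p = 0 \<or> \<bar>snd p - fst p * \<tau>\<bar> * int R < int m \<or> gcd (fst p) (snd p) > int R}))
      \<le> real (card ?Z1) + real (card ?Z2) + real (card ?Z3) + real (card ?Z4)"
    by (simp flip: of_nat_add)
  define s where "s = real (card S)"
  define t where "t = real (card T)"
  define r where "r = real R"
  have st: "r \<le> s" "r \<le> t" "0 < r" "real n \<le> s" "real m \<le> t" using S T R by (simp_all add: s_def t_def r_def)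
  have one: "card ({0} \<inter> X) \<le> 1" for X :: "int set"
    using card_mono[of "{0::int}" "{0} \<inter> X"] by simp
  have "real (card ?Z1) \<le> 1 * t"
    unfolding t_def card_cartesian_product of_nat_mult by (rule mult_right_mono) (use one in auto)
  moreover have "t * r \<le> t * s" "s * r \<le> s * t" using st by (intro mult_left_mono; linarith)+
  then have ts: "t \<le> s * t / r" "s \<le> s * t / r" using st by (simp_all add: field_simps)
  ultimately have z1: "real (card ?Z1) \<le> s * t / r" by linarith
  have "real (card ?Z2) \<le> s * 1"
    unfolding s_def card_cartesian_product of_nat_mult by (rule mult_left_mono) (use one in auto)
  then have z2: "real (card ?Z2) \<le> s * t / r" using ts by linarith
  have z3: "real (card ?Z3) \<le> 3 * (s * t / r)"
  proof -
    have "real (card {t\<in>T. \<bar>t - x * \<tau>\<bar> * int R < int m}) \<le> 3 * t / r" for x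
    proof -
      have "real (card {t\<in>T. \<bar>t - x * \<tau>\<bar> * int R < int m}) \<le> 2 * (m / r) + 1"
      proof (rule card_short_interval_le[where f = "\<lambda>t. t - x * \<tau>"])
        fix y assume "y \<in> {t\<in>T. \<bar>t - x * \<tau>\<bar> * int R < int m}"
        then have "real_of_int (\<bar>y - x * \<tau>\<bar> * int R) < real_of_int (int m)" by (simp only: of_int_less_iff) simp
        then show "\<bar>real_of_int (y - x * \<tau>)\<bar> < real m / r" using R by (simp add: r_def field_simps)
      qed (use st in \<open>auto simp: inj_on_def\<close>)
      also have "\<dots> = (2 * m + r) / r" using st by (simp add: field_simps)
      also have "\<dots> \<le> 3 * t / r" using st by (intro divide_right_mono) auto
      finally show ?thesis .
    qed
    then have "(\<Sum>x\<in>S. real (card {t\<in>T. \<bar>t - x * \<tau>\<bar> * int R < int m})) \<le> s * (3 * t / r)"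
      unfolding s_def by (intro sum_bounded_above) auto
    then have "real (card ?Z3) \<le> s * (3 * t / r)" using S(1) T(1) by (simp add: card_SigmaI)
    then show ?thesis by (simp add: mult_ac)
  qed
  have z4: "real (card ?Z4) \<le> 4 * (s * t / r)"
  proof -
    have "real (card ?Z4) \<le> 4 * real n * real m / real R" by (rule card_large_gcd_le[OF R])
    also have "\<dots> \<le> 4 * s * t / r" unfolding r_def[symmetric]
      using st by (intro divide_right_mono mult_mono) auto
    finally show ?thesis by simp
  qed
  have "real (card ?Z1) + real (card ?Z2) + real (card ?Z3) + real (card ?Z4) \<le> 9 * (s * t / r)"
    using z1 z2 z3 z4 by linarith
  then show ?thesis using le unfolding s_def t_def r_def card_cartesian_product by simp
qed

text \<open>The bad pairs have density at most 9 / Q^(a + 2), less than half of the assumed average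
  Q^-a, so the pointwise bound is needed only on good pairs. The extra power in
  \<open>a + j + 1\<close> pays for that half.\<close>

lemma avg_good_pairs:
  fixes S T :: "int set" and n m Q :: nat
  assumes Q: "1024 \<le> Q" and S: "finite S" "\<And>s. s \<in> S \<Longrightarrow> \<bar>s\<bar> \<le> int n" "n \<le> card S" "Q ^ (a + 2) \<le> card S"
    and T: "finite T" "\<And>t. t \<in> T \<Longrightarrow> \<bar>t\<bar> \<le> int m" "m \<le> card T" "Q ^ (a + 2) \<le> card T"
    and X: "\<And>s t. s \<in> S \<Longrightarrow> t \<in> T \<Longrightarrow> X s t \<le> 1" and Y: "\<And>s t. 0 \<le> Y s t"
    and good: "\<And>s t. s \<in> S \<Longrightarrow> t \<in> T \<Longrightarrow> s \<noteq> 0 \<Longrightarrow> t \<noteq> 0 \<Longrightarrow> int m \<le> \<bar>t - s * \<tau>\<bar> * int (Q ^ (a + 2)) \<Longrightarrow>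
      gcd s t \<le> int (Q ^ (a + 2)) \<Longrightarrow> X s t \<le> real Q ^ j * Y s t"
    and avg: "1 / real Q ^ a \<le> avg S (\<lambda>s. avg T (X s))"
  shows "1 / real Q ^ (a + j + 1) \<le> avg S (\<lambda>s. avg T (Y s))"
proof -
  let ?R = "Q ^ (a + 2)"
  let ?B = "{p. fst p = 0 \<or> snd p = 0 \<or> \<bar>snd p - fst p * \<tau>\<bar> * int ?R < int m \<or> gcd (fst p) (snd p) > int ?R}"
  have R: "0 < ?R" using Q by simp
  have Q': "1024 \<le> real Q" using Q by simp
  have "0 < card S" "0 < card T" using R S(4) T(4) by linarith+
  then have ne: "S \<times> T \<noteq> {}" by auto
  have "1 / real Q ^ a \<le> avg (S \<times> T) (\<lambda>p. X (fst p) (snd p))" unfolding avg_pair by (rule avg)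
  also have "\<dots> \<le> 9 / real ?R + real Q ^ j * avg (S \<times> T) (\<lambda>p. Y (fst p) (snd p))"
  proof (rule avg_good_bad[where B = ?B])
    show "real (card (S \<times> T \<inter> ?B)) \<le> 9 / real ?R * real (card (S \<times> T))"
      by (rule card_bad_pairs[OF S T R])
  qed (use S(1) T(1) ne X Y good in \<open>auto simp: not_less\<close>)
  finally have m: "1 / real Q ^ a \<le> 9 / real ?R + real Q ^ j * avg S (\<lambda>s. avg T (Y s))" unfolding avg_pair .
  have "9 / real ?R \<le> 1 / 2 * (1 / real Q ^ a)"
    using divide_power_le[OF Q', of 18 1 a "a + 2"] by simp
  with m have "1 / 2 * (1 / real Q ^ a) \<le> real Q ^ j * avg S (\<lambda>s. avg T (Y s))" by linarith
  then have "1 / (2 * real Q ^ (a + j)) \<le> avg S (\<lambda>s. avg T (Y s))"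
    using Q by (simp add: power_add field_simps)
  moreover have "1 / real Q ^ (a + j + 1) \<le> 1 / (2 * real Q ^ (a + j))"
    using mult_power_le[OF Q', of 2 1 "a + j" "a + j + 1"] Q by (intro divide_left_mono) auto
  ultimately show ?thesis by linarith
qed

text \<open>The spectral Cauchy-Schwarz inequality applied to every derivative in the direction
  \<open>v\<close>, which stays untouched while the other direction is doubled.\<close>

lemma avg_box2_power2_le:
  assumes f: "adm f" and I: "finite I" and T: "\<And>i. i \<in> I \<Longrightarrow> finite (T i)"
  shows "(avg I (\<lambda>i. box2 S v (T i) (u i) f))\<^sup>2
    \<le> avg I (\<lambda>i. avg I (\<lambda>j. box2 S v (T i \<times> T j) (\<lambda>p. u i (fst p) + u j (snd p)) f))"
proof -
  have "avg I (\<lambda>i. box2 S v (T i) (u i) f) = avg S (\<lambda>x. avg S (\<lambda>x'. avg I (\<lambda>i. fej (T i) (u i) (dif (v x' - v x) f))))"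
    unfolding box2_def by (subst avg_swap, rule avg_cong, rule avg_swap)
  also have "(\<dots>)\<^sup>2 \<le> avg S (\<lambda>x. avg S (\<lambda>x'. (avg I (\<lambda>i. fej (T i) (u i) (dif (v x' - v x) f)))\<^sup>2))"
    by (rule order.trans[OF avg_power2_le avg_mono[OF avg_power2_le]])
  also have "\<dots> \<le> avg S (\<lambda>x. avg S (\<lambda>x'. avg I (\<lambda>i. avg I (\<lambda>j. fej (T i \<times> T j) (\<lambda>p. u i (fst p) + u j (snd p)) (dif (v x' - v x) f)))))"
    by (rule avg_mono[OF avg_mono[OF avg_fej_power2_le[OF adm_dif[OF f] I T]]])
  also have "\<dots> = avg I (\<lambda>i. avg I (\<lambda>j. box2 S v (T i \<times> T j) (\<lambda>p. u i (fst p) + u j (snd p)) f))"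
    unfolding box2_def by (rule avg_swap22)
  finally show ?thesis .
qed

text \<open>One pair of parameters is chosen for the whole average over \<open>W\<close>, so that
  \<open>W\<close> remains free for later Cauchy-Schwarz steps. Positivity of \<open>e\<close>
  excludes the diagonal.\<close>

lemma pick_off_diagonal:
  fixes Z :: "'c \<Rightarrow> 'a \<Rightarrow> 'a \<Rightarrow> real"
  assumes "0 < e" "finite T" "T \<noteq> {}" and "e \<le> avg W (\<lambda>w. avg T (\<lambda>\<tau>. avg T (\<lambda>\<tau>'. if \<tau> = \<tau>' then 0 else Z w \<tau> \<tau>')))"
  shows "\<exists>\<tau>\<in>T. \<exists>\<tau>'\<in>T. \<tau> \<noteq> \<tau>' \<and> e \<le> avg W (\<lambda>w. Z w \<tau> \<tau>')"
proof -
  define V where "V \<tau> \<tau>' = avg W (\<lambda>w. if \<tau> = \<tau>' then 0 else Z w \<tau> \<tau>')" for \<tau> \<tau>'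
  have "avg W (\<lambda>w. avg T (\<lambda>\<tau>. avg T (\<lambda>\<tau>'. if \<tau> = \<tau>' then 0 else Z w \<tau> \<tau>'))) = avg T (\<lambda>\<tau>. avg T (V \<tau>))"
    unfolding V_def[abs_def] by (subst avg_swap, rule avg_cong, rule avg_swap)
  then have le: "e \<le> avg T (\<lambda>\<tau>. avg T (V \<tau>))" using assms by simp
  obtain \<tau> where \<tau>: "\<tau> \<in> T" "avg T (\<lambda>\<tau>. avg T (V \<tau>)) \<le> avg T (V \<tau>)" using avg_le_ex[OF assms(2,3)] by blast
  obtain \<tau>' where \<tau>': "\<tau>' \<in> T" "avg T (V \<tau>) \<le> V \<tau> \<tau>'" using avg_le_ex[OF assms(2,3)] by blast
  have e: "e \<le> V \<tau> \<tau>'" using le \<tau> \<tau>' by linarith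
  then have "\<tau> \<noteq> \<tau>'" using assms(1) by (auto simp: V_def)
  then show ?thesis using e \<tau> \<tau>' by (auto simp: V_def)
qed

lemma power_quotient:
  fixes q :: real
  assumes "q \<noteq> 0" "n = a + b"
  shows "q ^ n / q ^ a = q ^ b" "q ^ a / q ^ n = 1 / q ^ b"
  using assms by (simp_all add: power_add)

lemma pair_density_condition:
  fixes q K M c c' X :: real
  assumes q: "1024 \<le> q" and M: "0 < M" and K: "M / (c * q ^ e) \<le> K" "0 < c" and X: "X \<le> c' * q ^ f" "0 \<le> c'"
    and j: "4 * c\<^sup>2 * (1 + c') \<le> 1024 ^ i" "2 * e + f + i \<le> j"
  shows "1 + X \<le> q ^ j * K\<^sup>2 / (4 * M\<^sup>2)"
proof -
  have "1 + X \<le> (1 + c') * q ^ f"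
  proof -
    have "1 \<le> q ^ f" using q by (intro one_le_power) auto
    then show ?thesis using X(1) unfolding distrib_right by linarith
  qed
  also have "\<dots> = (4 * c\<^sup>2 * (1 + c') * q ^ (2 * e + f)) * ((M / (c * q ^ e))\<^sup>2 / (4 * M\<^sup>2))"
    using K M q by (simp add: power_mult_distrib power_divide power_add power_mult mult.commute[of 2 e])
  also have "\<dots> \<le> q ^ j * (K\<^sup>2 / (4 * M\<^sup>2))"
    using mult_power_le[OF q j] K M q by (intro mult_mono divide_right_mono power_mono) auto
  finally show ?thesis by simp
qed

text \<open>For good (w, c) the numbers c - w \<tau> and c - w \<tau>' have gcd at most 2 L Q^1350,
  so the two-parameter direction equidistributes. The exponent is 4126 = 2 * 12 + 4100 + 2 with 4100
  = 1350 + 1412 + 1350 - 12.\<close>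

lemma box3_step:
  assumes H: "adm H" and P: "P = 4 * M\<^sup>2" and Q: "1024 \<le> Q" and M: "0 < M" and K: "real M / (2 * real Q ^ 12) \<le> K" "real K \<le> M / real Q ^ 12" "0 < K"
    and L: "L = Q ^ 1412" and w: "0 < w" "w * L \<le> M" and \<tau>: "\<bar>\<tau>\<bar> \<le> int L" "\<bar>\<tau>'\<bar> \<le> int L" "\<tau> \<noteq> \<tau>'" and c: "\<bar>c\<bar> \<le> 2 * int M"
    and good: "2 * int M \<le> \<bar>c - int w * \<tau>'\<bar> * int (Q ^ 1350)" "gcd (int w) c \<le> int (Q ^ 1350)"
  shows "box3 {1..int K} (\<lambda>k. 2 * c * k) S v ({1..int K} \<times> {1..int K}) (\<lambda>p. 2 * (c - int w * \<tau>) * fst p + 2 * (c - int w * \<tau>') * snd p) H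
    \<le> real Q ^ 4126 * A (\<lambda>h. box2 {1..int K} (\<lambda>k. 2 * c * k) S v (dif h H))"
proof (rule box3_dominate[OF H])
  define q where "q = real Q"
  have q: "1024 \<le> q" "0 < q" using Q by (simp_all add: q_def)
  let ?R = "Q ^ 1350"
  have abs: "\<bar>c - int w * t\<bar> \<le> 3 * int M" if "\<bar>t\<bar> \<le> int L" for t
  proof -
    have "\<bar>int w * t\<bar> \<le> int w * int L" using that by (auto simp: abs_mult intro!: mult_left_mono)
    also have "\<dots> \<le> int M" using w by (simp flip: of_nat_mult)
    finally show ?thesis using c by linarith
  qed
  have KM: "4096 * real K \<le> real M"
  proof -
    have "real M / q ^ 12 \<le> real M / 4096"
      using mult_power_le[OF q(1), of 4096 2 0 12] M q by (intro divide_left_mono) auto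
    moreover have "real K \<le> real M / q ^ 12" using K(2) by (simp add: q_def)
    ultimately show ?thesis by linarith
  qed
  fix z
  show "real (card {x \<in> {1..int K} \<times> {1..int K}. (2 * (c - int w * \<tau>) * fst x + 2 * (c - int w * \<tau>') * snd x - z) mod int P = 0})
      \<le> real Q ^ 4126 * real (card ({1..int K} \<times> {1..int K})) / real P"
  proof (rule card_pair_condition[OF K(3)])
    show "\<bar>2 * (c - int w * \<tau>)\<bar> \<le> 6 * int M" "\<bar>2 * (c - int w * \<tau>')\<bar> \<le> 6 * int M"
      unfolding abs_mult using abs[OF \<tau>(1)] abs[OF \<tau>(2)] by simp_all
    have "real (3 * K) \<le> real M" using KM by simp
    then have "3 * K \<le> M" by (simp only: of_nat_le_iff)
    then have "4 * (M * (3 * K)) \<le> 4 * (M * M)" by simp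
    then have "12 * (M * K) \<le> 4 * M\<^sup>2" by (simp add: power2_eq_square)
    then have "int (12 * (M * K)) \<le> int (4 * M\<^sup>2)" by (simp only: of_nat_le_iff)
    then show "2 * (6 * int M) * int K \<le> int P" by (simp add: P)
    have "gcd (2 * (c - int w * \<tau>)) (2 * (c - int w * \<tau>')) = 2 * gcd (c - int w * \<tau>) (c - int w * \<tau>')"
      using gcd_mult_distrib_int[of 2 "c - int w * \<tau>" "c - int w * \<tau>'"] by simp
    also have "\<dots> \<le> 2 * (int ?R * \<bar>\<tau> - \<tau>'\<bar>)"
      using gcd_arith_progression_le[of c "int w" "int ?R" \<tau> \<tau>'] good(2) \<tau>(3) w by (simp add: gcd.commute)
    also have "\<dots> \<le> 2 * (int ?R * (2 * int L))" using \<tau> by (intro mult_left_mono) auto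
    finally have "real_of_int (gcd (2 * (c - int w * \<tau>)) (2 * (c - int w * \<tau>'))) \<le> real_of_int (2 * (int ?R * (2 * int L)))"
      by (simp only: of_int_le_iff)
    then show "real_of_int (gcd (2 * (c - int w * \<tau>)) (2 * (c - int w * \<tau>'))) \<le> 4 * (q ^ 1350 * q ^ 1412)"
      by (simp add: L q_def)
    show "0 < 4 * real M / q ^ 1350" using M q by simp
    have "real_of_int (2 * int M) \<le> real_of_int (\<bar>c - int w * \<tau>'\<bar> * int ?R)" using good(1) by (simp only: of_int_le_iff)
    then have "2 * real M \<le> real_of_int \<bar>c - int w * \<tau>'\<bar> * q ^ 1350" by (simp add: q_def)
    moreover have "real_of_int \<bar>2 * (c - int w * \<tau>')\<bar> = 2 * real_of_int \<bar>c - int w * \<tau>'\<bar>"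
      by (simp only: abs_mult of_int_mult)
    ultimately show "4 * real M / q ^ 1350 \<le> real_of_int \<bar>2 * (c - int w * \<tau>')\<bar>"
      using q by (simp add: divide_le_eq)
    have "K * (4 * (q ^ 1350 * q ^ 1412)) / (4 * real M / q ^ 1350) = (K / M) * q ^ 4112"
      using M q by (simp flip: power_add)
    also have "\<dots> \<le> (1 / q ^ 12) * q ^ 4112"
      using K(2) M q by (intro mult_right_mono) (auto simp: q_def field_simps)
    also have "\<dots> = q ^ 4112 / q ^ 12" by simp
    also have "\<dots> = 1 * q ^ 4100" unfolding mult_1 by (rule power_quotient) (use q in auto)
    finally have X: "K * (4 * (q ^ 1350 * q ^ 1412)) / (4 * real M / q ^ 1350) \<le> 1 * q ^ 4100" .
    have "1 + K * (4 * (q ^ 1350 * q ^ 1412)) / (4 * real M / q ^ 1350) \<le> q ^ 4126 * (real K)\<^sup>2 / (4 * (real M)\<^sup>2)"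
      by (rule pair_density_condition[OF q(1) _ K(1)[folded q_def] _ X, where i = 2]) (use M in auto)
    then show "1 + K * (4 * (q ^ 1350 * q ^ 1412)) / (4 * real M / q ^ 1350) \<le> real Q ^ 4126 * (real K)\<^sup>2 / real P"
      by (simp add: P q_def)
  qed
qed (use K in auto)

text \<open>The same count for the doubled direction 2 c, 2 c', this time for generic pairs (c, c').
  The exponent is 21918 = 2 * 12 + 21892 + 2 with 21892 = 2 * 10952 - 12.\<close>

lemma box2_step:
  assumes H: "adm H" and P: "P = 4 * M\<^sup>2" and Q: "1024 \<le> Q" and M: "0 < M" and K: "real M / (2 * real Q ^ 12) \<le> K" "real K \<le> M / real Q ^ 12" "0 < K"
    and c: "\<bar>c\<bar> \<le> 2 * int M" "\<bar>c'\<bar> \<le> 2 * int M"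
    and good: "2 * int M \<le> \<bar>c'\<bar> * int (Q ^ 10952)" "gcd c c' \<le> int (Q ^ 10952)"
  shows "box2 S v ({1..int K} \<times> {1..int K}) (\<lambda>p. 2 * c * fst p + 2 * c' * snd p) H
    \<le> real Q ^ 21918 * A (\<lambda>h. fej S v (dif h H))"
proof (rule box2_dominate[OF H])
  define q where "q = real Q"
  have q: "1024 \<le> q" "0 < q" using Q by (simp_all add: q_def)
  let ?R = "Q ^ 10952"
  have KM: "4096 * real K \<le> real M"
  proof -
    have "real M / q ^ 12 \<le> real M / 4096"
      using mult_power_le[OF q(1), of 4096 2 0 12] M q by (intro divide_left_mono) auto
    moreover have "real K \<le> real M / q ^ 12" using K(2) by (simp add: q_def)
    ultimately show ?thesis by linarith
  qed
  fix z
  show "real (card {x \<in> {1..int K} \<times> {1..int K}. (2 * c * fst x + 2 * c' * snd x - z) mod int P = 0})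
      \<le> real Q ^ 21918 * real (card ({1..int K} \<times> {1..int K})) / real P"
  proof (rule card_pair_condition[OF K(3)])
    show "\<bar>2 * c\<bar> \<le> 6 * int M" "\<bar>2 * c'\<bar> \<le> 6 * int M" using c by linarith+
    have "real (3 * K) \<le> real M" using KM by simp
    then have "3 * K \<le> M" by (simp only: of_nat_le_iff)
    then have "4 * (M * (3 * K)) \<le> 4 * (M * M)" by simp
    then have "12 * (M * K) \<le> 4 * M\<^sup>2" by (simp add: power2_eq_square)
    then have "int (12 * (M * K)) \<le> int (4 * M\<^sup>2)" by (simp only: of_nat_le_iff)
    then show "2 * (6 * int M) * int K \<le> int P" by (simp add: P)
    have "gcd (2 * c) (2 * c') = 2 * gcd c c'"
      using gcd_mult_distrib_int[of 2 c c'] by simp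
    also have "\<dots> \<le> 4 * int ?R" using good(2) by (simp del: of_nat_power)
    finally have "real_of_int (gcd (2 * c) (2 * c')) \<le> real_of_int (4 * int ?R)"
      by (simp only: of_int_le_iff)
    then show "real_of_int (gcd (2 * c) (2 * c')) \<le> 4 * q ^ 10952"
      by (simp add: q_def)
    show "0 < 4 * real M / q ^ 10952" using M q by simp
    have "real_of_int (2 * int M) \<le> real_of_int (\<bar>c'\<bar> * int ?R)" using good(1) by (simp only: of_int_le_iff)
    then have "2 * real M \<le> real_of_int \<bar>c'\<bar> * q ^ 10952" by (simp add: q_def)
    moreover have "real_of_int \<bar>2 * c'\<bar> = 2 * real_of_int \<bar>c'\<bar>" by (simp add: abs_mult)
    ultimately show "4 * real M / q ^ 10952 \<le> real_of_int \<bar>2 * c'\<bar>"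
      using q by (simp add: divide_le_eq)
    have "K * (4 * q ^ 10952) / (4 * real M / q ^ 10952) = (K / M) * q ^ 21904"
      using M q by (simp flip: power_add)
    also have "\<dots> \<le> (1 / q ^ 12) * q ^ 21904"
      using K(2) M q by (intro mult_right_mono) (auto simp: q_def field_simps)
    also have "\<dots> = q ^ 21904 / q ^ 12" by simp
    also have "\<dots> = 1 * q ^ 21892" unfolding mult_1 by (rule power_quotient) (use q in auto)
    finally have X: "K * (4 * q ^ 10952) / (4 * real M / q ^ 10952) \<le> 1 * q ^ 21892" .
    have "1 + K * (4 * q ^ 10952) / (4 * real M / q ^ 10952) \<le> q ^ 21918 * (real K)\<^sup>2 / (4 * (real M)\<^sup>2)"
      by (rule pair_density_condition[OF q(1) _ K(1)[folded q_def] _ X, where i = 2]) (use M in auto)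
    then show "1 + K * (4 * q ^ 10952) / (4 * real M / q ^ 10952) \<le> real Q ^ 21918 * (real K)\<^sup>2 / real P"
      by (simp add: P q_def)
  qed
qed (use K in auto)

text \<open>The last direction is doubled in the dilation. The fixed factor n is at most 2 L^2, and
  W L at most M keeps n w below 2 L M, so L K at most M prevents wrap-around. The exponent is 139980
  = 2 * 4262 + 131454 + 2.\<close>

lemma fej_step:
  assumes H: "adm H" and P: "P = 4 * M\<^sup>2" and Q: "1024 \<le> Q" and M: "0 < M"
    and K: "real M / (8 * real Q ^ 4262) \<le> K" "real K \<le> M / real Q ^ 4262" "0 < K"
    and L: "L = Q ^ 1412" and W: "W * L \<le> M" "real M / (2 * real L) \<le> W" and n: "n \<noteq> 0" "\<bar>n\<bar> \<le> 2 * (int L)\<^sup>2"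
    and w: "\<bar>w\<bar> \<le> int W" "\<bar>w'\<bar> \<le> int W"
    and good: "int W \<le> \<bar>w'\<bar> * int (Q ^ 65740)" "gcd w w' \<le> int (Q ^ 65740)"
  shows "A (\<lambda>h. A (\<lambda>h'. fej ({1..int K} \<times> {1..int K}) (\<lambda>p. n * w * fst p + n * w' * snd p) (dif h' (dif h H))))
    \<le> real Q ^ 139980 * U3 H"
proof (rule fej_dominate_U3[OF H])
  define q where "q = real Q"
  have q: "1024 \<le> q" "0 < q" using Q by (simp_all add: q_def)
  let ?R = "Q ^ 65740"
  have Lq: "real L = q ^ 1412" by (simp add: L q_def)
  have W0: "0 < real W" using W(2) M q by (intro less_le_trans[OF _ W(2)]) (auto simp: Lq)
  have KM: "real L * real K \<le> real M"
  proof -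
    have "q ^ 1412 * real K \<le> q ^ 4262 * real K" using q by (intro mult_right_mono power_increasing) auto
    also have "\<dots> \<le> real M" using K(2) q by (simp add: q_def field_simps)
    finally show ?thesis by (simp add: Lq)
  qed
  fix z
  show "real (card {x \<in> {1..int K} \<times> {1..int K}. (n * w * fst x + n * w' * snd x - z) mod int P = 0})
      \<le> real Q ^ 139980 * real (card ({1..int K} \<times> {1..int K})) / real P"
  proof (rule card_pair_condition[OF K(3)])
    have "\<bar>n * x\<bar> \<le> 2 * int L * int M" if "\<bar>x\<bar> \<le> int W" for x
    proof -
      have "\<bar>n * x\<bar> \<le> (2 * (int L)\<^sup>2) * int W" unfolding abs_mult using n that by (intro mult_mono) auto
      also have "\<dots> = 2 * int L * int (W * L)" by (simp add: power2_eq_square)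
      also have "\<dots> \<le> 2 * int L * int M" using W(1) by (intro mult_left_mono) (simp_all del: of_nat_mult)
      finally show ?thesis .
    qed
    with w show "\<bar>n * w\<bar> \<le> 2 * int L * int M" "\<bar>n * w'\<bar> \<le> 2 * int L * int M" by blast+
    have "real (L * K) \<le> real M" using KM by simp
    then have "L * K \<le> M" by (simp only: of_nat_le_iff)
    then have "4 * (M * (L * K)) \<le> 4 * (M * M)" by simp
    then have "int (4 * (M * (L * K))) \<le> int (4 * M\<^sup>2)" by (simp only: of_nat_le_iff power2_eq_square)
    then show "2 * (2 * int L * int M) * int K \<le> int P" by (simp add: P mult_ac)
    have "gcd (n * w) (n * w') = \<bar>n\<bar> * gcd w w'"
      by (simp add: gcd_mult_left abs_mult)
    also have "\<dots> \<le> (2 * (int L)\<^sup>2) * int ?R" using good(2) n by (intro mult_mono) auto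
    finally have "real_of_int (gcd (n * w) (n * w')) \<le> real_of_int ((2 * (int L)\<^sup>2) * int ?R)"
      by (simp only: of_int_le_iff)
    then show "real_of_int (gcd (n * w) (n * w')) \<le> 2 * (q ^ 1412)\<^sup>2 * q ^ 65740"
      by (simp add: q_def L)
    show "0 < real W / q ^ 65740" using W0 q by simp
    have "real_of_int (int W) \<le> real_of_int (\<bar>w'\<bar> * int ?R)" using good(1) by (simp only: of_int_le_iff)
    then have a: "real W / q ^ 65740 \<le> real_of_int \<bar>w'\<bar>" using q by (simp add: q_def divide_le_eq)
    have "1 * \<bar>w'\<bar> \<le> \<bar>n\<bar> * \<bar>w'\<bar>" using n by (intro mult_right_mono) auto
    then have "real_of_int (\<bar>w'\<bar>) \<le> real_of_int \<bar>n * w'\<bar>" by (simp only: of_int_le_iff abs_mult)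
    with a show "real W / q ^ 65740 \<le> real_of_int \<bar>n * w'\<bar>" by linarith
    have KW: "real K / real W \<le> 2 / q ^ 2850"
    proof -
      have "real K / real W \<le> (M / q ^ 4262) / (real M / (2 * q ^ 1412))"
        using W(2) K(2) M q by (intro frac_le) (auto simp: q_def Lq)
      also have "\<dots> = 2 * (q ^ 1412 / q ^ 4262)" using M q by simp
      also have "q ^ 1412 / q ^ 4262 = 1 / q ^ 2850" by (rule power_quotient) (use q in auto)
      finally show ?thesis by simp
    qed
    have "K * (2 * (q ^ 1412)\<^sup>2 * q ^ 65740) / (real W / q ^ 65740) = (K / W) * (2 * q ^ 134304)"
      by (simp flip: power_add power_mult)
    also have "\<dots> \<le> (2 / q ^ 2850) * (2 * q ^ 134304)"
      using KW q by (intro mult_right_mono) auto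
    also have "\<dots> = 4 * (q ^ 134304 / q ^ 2850)" by simp
    also have "q ^ 134304 / q ^ 2850 = q ^ 131454" by (rule power_quotient) (use q in auto)
    finally have X: "K * (2 * (q ^ 1412)\<^sup>2 * q ^ 65740) / (real W / q ^ 65740) \<le> 4 * q ^ 131454" .
    have "1 + K * (2 * (q ^ 1412)\<^sup>2 * q ^ 65740) / (real W / q ^ 65740) \<le> q ^ 139980 * (real K)\<^sup>2 / (4 * (real M)\<^sup>2)"
      by (rule pair_density_condition[OF q(1) _ K(1)[folded q_def] _ X, where i = 2]) (use M in auto)
    then show "1 + K * (2 * (q ^ 1412)\<^sup>2 * q ^ 65740) / (real W / q ^ 65740) \<le> real Q ^ 139980 * (real K)\<^sup>2 / real P"
      by (simp add: P q_def)
  qed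
qed (use K in auto)

text \<open>Three rounds, each making one direction generic: pairs (w, c) for c - w \<tau>, then
  pairs (c, c') for c, then pairs (w, w') for n w. Each round applies \<open>avg_good_pairs\<close>
  and puts a uniform derivative in place of the direction; together the three derivatives form
  \<open>U3\<close>.\<close>

lemma lam_control_U3:
  assumes adm: "\<And>b. adm (g b)" "\<And>b. adm (F b)" "adm G" and J: "ivl M J" and P: "P = 4 * M\<^sup>2"
    and Q: "1024 \<le> Q" "Q ^ 70000 \<le> M" and lam: "1 / Q \<le> cmod (lam M J g F G)"
  shows "1 / real Q ^ 205719 \<le> U3 (\<lambda>y. cnj (G y))"
proof -
  define L where "L = Q ^ 1412"
  define K where "K = M div Q ^ 12"
  define K1 where "K1 = K div Q ^ 2830"
  define K2 where "K2 = K1 div Q ^ 1420"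
  define W where "W = M div L"
  define H where "H y = cnj (G y)" for y
  have H: "adm H" unfolding H_def[abs_def] by (rule adm_cnj[OF adm(3)])
  have Qp: "0 < Q ^ n" for n using Q by simp
  have Qle: "Q ^ n \<le> M" if "n \<le> 70000" for n
    using Q that by (intro order.trans[OF power_increasing Q(2)]) auto
  have Q': "Q ^ 11000 \<le> M" by (rule Qle) simp
  have M: "0 < M" using Q' Qp[of 11000] by linarith
  have L: "0 < L" "L \<le> M" unfolding L_def by (rule Qp, rule Qle, simp)
  have WL: "W * L \<le> M" by (simp add: W_def)
  note Wb = div_nat_bounds[OF L, folded W_def]
  have QW: "Q ^ n \<le> W" if "n \<le> 65740" for n
  proof -
    have "Q ^ n * L = Q ^ (n + 1412)" by (simp add: L_def power_add)
    also have "\<dots> \<le> M" by (rule Qle) (use that in simp)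
    finally show ?thesis using L by (simp add: W_def less_eq_div_iff_mult_less_eq)
  qed
  let ?W = "{1..int W}" and ?C = "{- 2 * int M..2 * int M}" and ?T = "{- int L..int L} - {0}" and ?K = "{1..int K}" and ?K2 = "{1..int K2}"
  have cC: "card ?C = 4 * M + 1" "card ?W = W" by auto
  have T: "finite ?T" "?T \<noteq> {}" using L by (auto intro!: exI[of _ 1])
  have W: "?W \<noteq> {}" using Wb(1) by simp
  define X3 where "X3 w c \<tau> \<tau>' = box3 ?K (\<lambda>k. 2 * c * k) ?K2 (\<lambda>k. 2 * w * \<tau> * \<tau>' * k)
          (?K \<times> ?K) (\<lambda>p. 2 * (c - w * \<tau>) * fst p + 2 * (c - w * \<tau>') * snd p) H" for w c \<tau> \<tau>'
  have wL: "0 < nat w" "nat w * L \<le> M" "int (nat w) = w" if "w \<in> ?W" for w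
  proof -
    have "nat w * L \<le> W * L" using that by (intro mult_right_mono) auto
    then show "nat w * L \<le> M" using WL by linarith
  qed (use that in auto)
  have st1: "1 / real Q ^ 21 \<le> avg ?C (\<lambda>c. avg ?T (\<lambda>\<tau>.
      box3 ?K (\<lambda>k. 2 * c * k) ?K (\<lambda>k. 2 * (c - w * \<tau>) * k) ?K (\<lambda>k. 2 * w * \<tau> * k) H))" if "w \<in> ?W" for w
    using box3_lower_bound[OF adm J Q(1) Q' L_def K_def wL(1,2)[OF that] lam] unfolding wL(3)[OF that] H_def[abs_def] .
  note st2 = box3_pair_lower_bound[OF H Q(1) Q' L_def K_def K1_def K2_def st1, folded X3_def]
  have "1 \<in> ?W" using Wb(1) by simp
  note K = st2(2-8)[OF this]
  have "avg ?W (\<lambda>_. 1 / real Q ^ 1348) \<le> avg ?W (\<lambda>w. avg ?C (\<lambda>c. avg ?T (\<lambda>\<tau>. avg ?T (\<lambda>\<tau>'. if \<tau> = \<tau>' then 0 else X3 w c \<tau> \<tau>'))))"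
    by (rule avg_mono) (rule st2(1))
  then have "1 / real Q ^ 1348 \<le> avg (?W \<times> ?C) (\<lambda>p. avg ?T (\<lambda>\<tau>. avg ?T (\<lambda>\<tau>'. if \<tau> = \<tau>' then 0 else X3 (fst p) (snd p) \<tau> \<tau>')))"
    using W by (simp add: avg_const avg_pair[where f = "\<lambda>w c. avg ?T (\<lambda>\<tau>. avg ?T (\<lambda>\<tau>'. if \<tau> = \<tau>' then 0 else X3 w c \<tau> \<tau>'))"])
  \<comment> \<open>From here \<open>\<tau>\<close> and \<open>\<tau>'\<close> are constants, and
    the direction 2 w \<tau> \<tau>' depends on the averaging variables only through
    \<open>w\<close>.\<close>
  then have "\<exists>\<tau>\<in>?T. \<exists>\<tau>'\<in>?T. \<tau> \<noteq> \<tau>' \<and> 1 / real Q ^ 1348 \<le> avg (?W \<times> ?C) (\<lambda>p. X3 (fst p) (snd p) \<tau> \<tau>')"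
    by (intro pick_off_diagonal T) (use Q in auto)
  then obtain \<tau> \<tau>' where \<tau>: "\<tau> \<in> ?T" "\<tau>' \<in> ?T" "\<tau> \<noteq> \<tau>'" and "1 / real Q ^ 1348 \<le> avg (?W \<times> ?C) (\<lambda>p. X3 (fst p) (snd p) \<tau> \<tau>')"
    by blast
  then have X3: "1 / real Q ^ 1348 \<le> avg ?W (\<lambda>w. avg ?C (\<lambda>c. X3 w c \<tau> \<tau>'))"
    unfolding avg_pair[where f = "\<lambda>w c. X3 w c \<tau> \<tau>'"] by simp
  have \<tau>L: "\<bar>\<tau>\<bar> \<le> int L" "\<bar>\<tau>'\<bar> \<le> int L" using \<tau> by auto
  define n where "n = 2 * \<tau> * \<tau>'"
  have n: "n \<noteq> 0" "\<bar>n\<bar> \<le> 2 * (int L)\<^sup>2"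
  proof -
    have "\<bar>\<tau>\<bar> * \<bar>\<tau>'\<bar> \<le> int L * int L" using \<tau>L by (intro mult_mono) auto
    then show "\<bar>n\<bar> \<le> 2 * (int L)\<^sup>2" by (simp add: n_def abs_mult power2_eq_square)
  qed (use \<tau> in \<open>auto simp: n_def\<close>)
  have nw: "2 * w * \<tau> * \<tau>' * k = n * w * k" for w k by (simp add: n_def)
  define Y3 where "Y3 w c = A (\<lambda>h. box2 ?K (\<lambda>k. 2 * c * k) ?K2 (\<lambda>k. n * w * k) (dif h H))" for w c
  have st3: "1 / real Q ^ (1348 + 4126 + 1) \<le> avg ?W (\<lambda>w. avg ?C (Y3 w))"
  proof (rule avg_good_pairs[OF Q(1), where n = W and m = "2 * M" and \<tau> = \<tau>' and X = "\<lambda>w c. X3 w c \<tau> \<tau>'"])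
    fix w c assume wc: "w \<in> ?W" "c \<in> ?C" "int (2 * M) \<le> \<bar>c - w * \<tau>'\<bar> * int (Q ^ (1348 + 2))" "gcd w c \<le> int (Q ^ (1348 + 2))"
    show "X3 w c \<tau> \<tau>' \<le> real Q ^ 4126 * Y3 w c"
      unfolding X3_def Y3_def nw
      by (rule box3_step[OF H P Q(1) M K(1,3,5) L_def wL(1,2)[OF wc(1)] \<tau>L \<tau>(3), of c, unfolded wL(3)[OF wc(1)]]) (use wc in auto)
  qed (use X3 cC QW[of 1350] Qle[of 1350] Q in \<open>auto simp: X3_def Y3_def intro!: box3_le1[OF H] avg_nonneg box2_nonneg\<close>)
  define X4 where "X4 c c' = avg ?W (\<lambda>w. A (\<lambda>h. box2 ?K2 (\<lambda>k. n * w * k) (?K \<times> ?K) (\<lambda>p. 2 * c * fst p + 2 * c' * snd p) (dif h H)))" for c c'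
  define Y4 where "Y4 = avg ?W (\<lambda>w. A (\<lambda>h. A (\<lambda>h'. fej ?K2 (\<lambda>k. n * w * k) (dif h' (dif h H)))))"
  \<comment> \<open>Here 5475 = 1348 + 4126 + 1. The square is the cost of doubling the direction
    \<open>c\<close>, after which 10950 = 2 * 5475.\<close>
  have "(1 / real Q ^ 5475)\<^sup>2 \<le> (avg ?W (\<lambda>w. avg ?C (Y3 w)))\<^sup>2"
    using st3 by (intro power_mono) auto
  also have "avg ?W (\<lambda>w. avg ?C (Y3 w)) = avg ?W (\<lambda>w. A (\<lambda>h. avg ?C (\<lambda>c. box2 ?K2 (\<lambda>k. n * w * k) ?K (\<lambda>k. 2 * c * k) (dif h H))))"
    unfolding Y3_def[abs_def] box2_swap[OF adm_dif[OF H], of ?K _ ?K2] by (rule avg_cong, rule avg_swap)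
  also have "(\<dots>)\<^sup>2 \<le> avg ?W (\<lambda>w. A (\<lambda>h. (avg ?C (\<lambda>c. box2 ?K2 (\<lambda>k. n * w * k) ?K (\<lambda>k. 2 * c * k) (dif h H)))\<^sup>2))"
    by (rule order.trans[OF avg_power2_le avg_mono[OF avg_power2_le]])
  also have "\<dots> \<le> avg ?W (\<lambda>w. A (\<lambda>h. avg ?C (\<lambda>c. avg ?C (\<lambda>c'. box2 ?K2 (\<lambda>k. n * w * k) (?K \<times> ?K) (\<lambda>p. 2 * c * fst p + 2 * c' * snd p) (dif h H)))))"
    by (rule avg_mono[OF avg_mono[OF avg_box2_power2_le[OF adm_dif[OF H]]]]) auto
  also have "\<dots> = avg ?C (\<lambda>c. avg ?C (X4 c))"
    unfolding X4_def[abs_def] by (rule avg_swap22)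
  finally have X4: "1 / real Q ^ 10950 \<le> avg ?C (\<lambda>c. avg ?C (X4 c))"
    by (simp add: power_divide flip: power_mult)
  have "1 / real Q ^ (10950 + 21918 + 1) \<le> avg ?C (\<lambda>c. avg ?C (\<lambda>_. Y4))"
  proof (rule avg_good_pairs[OF Q(1), where n = "2 * M" and m = "2 * M" and \<tau> = 0 and X = X4])
    fix c c' assume c: "c \<in> ?C" "c' \<in> ?C" "int (2 * M) \<le> \<bar>c' - c * 0\<bar> * int (Q ^ (10950 + 2))" "gcd c c' \<le> int (Q ^ (10950 + 2))"
    have "box2 ?K2 (\<lambda>k. n * w * k) (?K \<times> ?K) (\<lambda>p. 2 * c * fst p + 2 * c' * snd p) (dif h H)
        \<le> real Q ^ 21918 * A (\<lambda>h'. fej ?K2 (\<lambda>k. n * w * k) (dif h' (dif h H)))" for w h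
      by (rule box2_step[OF adm_dif[OF H] P Q(1) M K(1,3,5)]) (use c in auto)
    then show "X4 c c' \<le> real Q ^ 21918 * Y4"
      unfolding X4_def Y4_def avg_cmult[symmetric] by (intro avg_mono)
  qed (use X4 cC Qle[of 10952] Q in \<open>auto simp: X4_def Y4_def intro!: avg_le box2_le1 adm_dif H avg_nonneg fej_nonneg\<close>)
  then have Y4: "1 / real Q ^ 32869 \<le> Y4" by (simp add: avg_const)
  define X5 where "X5 w w' = A (\<lambda>h. A (\<lambda>h'. fej (?K2 \<times> ?K2) (\<lambda>p. n * w * fst p + n * w' * snd p) (dif h' (dif h H))))" for w w'
  \<comment> \<open>Here 32869 = 10950 + 21918 + 1; the last square doubles the direction
    \<open>n * w\<close>.\<close>
  have "(1 / real Q ^ 32869)\<^sup>2 \<le> Y4\<^sup>2" using Y4 by (intro power_mono) auto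
  also have "Y4 = A (\<lambda>h. A (\<lambda>h'. avg ?W (\<lambda>w. fej ?K2 (\<lambda>k. n * w * k) (dif h' (dif h H)))))"
    unfolding Y4_def by (subst avg_swap, rule avg_cong, rule avg_swap)
  also have "(\<dots>)\<^sup>2 \<le> A (\<lambda>h. A (\<lambda>h'. (avg ?W (\<lambda>w. fej ?K2 (\<lambda>k. n * w * k) (dif h' (dif h H))))\<^sup>2))"
    by (rule order.trans[OF avg_power2_le avg_mono[OF avg_power2_le]])
  also have "\<dots> \<le> A (\<lambda>h. A (\<lambda>h'. avg ?W (\<lambda>w. avg ?W (\<lambda>w'. fej (?K2 \<times> ?K2) (\<lambda>p. n * w * fst p + n * w' * snd p) (dif h' (dif h H))))))"
    by (rule avg_mono[OF avg_mono[OF avg_fej_power2_le[OF adm_dif[OF adm_dif[OF H]]]]]) auto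
  also have "\<dots> = avg ?W (\<lambda>w. avg ?W (X5 w))" unfolding X5_def[abs_def] by (rule avg_swap22)
  finally have X5: "1 / real Q ^ 65738 \<le> avg ?W (\<lambda>w. avg ?W (X5 w))"
    by (simp add: power_divide flip: power_mult)
  have "1 / real Q ^ (65738 + 139980 + 1) \<le> avg ?W (\<lambda>w. avg ?W (\<lambda>_. U3 H))"
  proof (rule avg_good_pairs[OF Q(1), where n = W and m = W and \<tau> = 0 and X = X5])
    fix w w' assume w: "w \<in> ?W" "w' \<in> ?W" "int W \<le> \<bar>w' - w * 0\<bar> * int (Q ^ (65738 + 2))" "gcd w w' \<le> int (Q ^ (65738 + 2))"
    show "X5 w w' \<le> real Q ^ 139980 * U3 H"
      unfolding X5_def by (rule fej_step[OF H P Q(1) M K(2,4,7) L_def WL Wb(3) n]) (use w in auto)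
  qed (use X5 cC QW[of 65740] in \<open>auto simp: X5_def U3_def intro!: avg_le fej_le1 adm_dif H avg_nonneg\<close>)
  then show ?thesis using W by (simp add: avg_const H_def[abs_def])
qed

end

subsection \<open>Vinogradov's lemma\<close>

lemma ex_large_fibre:
  assumes "finite S" "finite T" "T \<noteq> {}" "f ` S \<subseteq> T"
  shows "\<exists>y\<in>T. card S \<le> card T * card {x\<in>S. f x = y}"
proof (rule ccontr)
  assume n: "\<not> ?thesis"
  have "card S = (\<Sum>y\<in>T. card {x\<in>S. f x = y})"
    using sum.group[OF assms(1,2,4), of "\<lambda>_. 1::nat"] by simp
  then have "card T * card S = (\<Sum>y\<in>T. card T * card {x\<in>S. f x = y})" by (simp add: sum_distrib_left)
  also have "\<dots> < (\<Sum>y\<in>T. card S)"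
    using n assms by (intro sum_strict_mono) (auto simp: not_le)
  finally show False by simp
qed

text \<open>Two close points of S in a short block give some n below 8 R with n \<phi> within 2 R /
  M of an integer. To gain the second factor M, two far-apart points of S congruent modulo n are
  compared: their difference is n j with j of order M up to powers of R, and j times the error in n
  \<phi> is still at most 2 R / M.\<close>

lemma vinogradov_large:
  fixes S :: "int set" and \<phi> :: real and M R :: nat
  assumes S: "S \<subseteq> {- int M..int M}" "2 * M + 1 \<le> 2 * R * card S" and R: "0 < R"
    and near: "\<And>k. k \<in> S \<Longrightarrow> nint (of_int k * \<phi>) \<le> R / M" and M: "2048 * R ^ 3 \<le> M"
  shows "\<exists>n. 0 < n \<and> n \<le> 8 * R \<and> nint (of_nat n * \<phi>) \<le> 4096 * real R ^ 4 / (real M)\<^sup>2"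
proof -
  define L where "L = M div (16 * R)"
  have fin: "finite S" using S(1) by (rule finite_subset) simp
  have M0: "0 < M"
  proof -
    have "0 < 2048 * R ^ 3" using R by simp
    then show ?thesis using M by linarith
  qed
  have "2048 * R ^ 3 = 128 * R\<^sup>2 * (16 * R)" by (simp add: power2_eq_square power3_eq_cube)
  then have "128 * R\<^sup>2 * (16 * R) \<le> M" using M by simp
  moreover have R16: "0 < 16 * R" using R by simp
  ultimately have L: "128 * R\<^sup>2 \<le> L" by (simp only: L_def less_eq_div_iff_mult_less_eq)
  have R1: "1 \<le> real R" using R by simp
  then have "real R ^ 1 \<le> real R ^ 2" by (intro power_increasing) auto
  then have R1: "real R \<le> (real R)\<^sup>2" "1 \<le> real R" using R1 by simp_all
  have "real (128 * R\<^sup>2) \<le> real L" using L by (simp only: of_nat_le_iff)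
  then have Lr: "128 * (real R)\<^sup>2 \<le> real L" by simp
  have L0: "0 < real L" using Lr R1 by linarith
  have "R * 16 \<le> M"
  proof -
    have "0 < L" using L0 by simp
    then show ?thesis by (simp add: L_def div_greater_zero_iff)
  qed
  then have LM: "real L \<le> M / (16 * real R)" "M / (32 * real R) \<le> real L"
    using div_nat_bounds[of "16 * R" M] R by (simp_all add: L_def mult.commute)
  have LM1: "real L \<le> real M" by (simp add: L_def)
  have "\<exists>y\<in>{- int M div int L..int M div int L}.
      card S \<le> card {- int M div int L..int M div int L} * card {k\<in>S. k div int L = y}"
  proof (rule ex_large_fibre[OF fin])
    show "(\<lambda>k. k div int L) ` S \<subseteq> {- int M div int L..int M div int L}"
    proof (rule image_subsetI)
      fix k assume "k \<in> S"
      then have "- int M \<le> k" "k \<le> int M" using S(1) by auto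
      then show "k div int L \<in> {- int M div int L..int M div int L}" using L0 by (simp add: zdiv_mono1)
    qed
    show "{- int M div int L..int M div int L} \<noteq> {}"
      using zdiv_mono1[of "- int M" "int M" "int L"] L0 by auto
  qed simp
  then obtain y where y: "card S \<le> card {- int M div int L..int M div int L} * card {k\<in>S. k div int L = y}"
    by blast
  define S1 where "S1 = {k\<in>S. k div int L = y}"
  have fin1: "finite S1" using fin by (simp add: S1_def)
  have m: "real L / (4 * R) \<le> real (card S1)"
  proof -
    have "real (card {- int M div int L..int M div int L}) = real_of_int (int M div int L - (- int M) div int L + 1)"
    proof -
      have "- int M div int L \<le> int M div int L" by (rule zdiv_mono1) (use L0 in auto)
      then show ?thesis by simp
    qed
    also have "\<dots> \<le> 2 * M / L + 2"
    proof -
      have "real_of_int (k div int L) \<le> real_of_int k / L \<and> real_of_int k / L < real_of_int (k div int L) + 1" for k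
        using floor_correct[of "real_of_int k / real_of_int (int L)"] unfolding floor_divide_of_int_eq by simp
      from this[of "int M"] this[of "- int M"] show ?thesis by simp
    qed
    also have "\<dots> \<le> 4 * M / L" using LM1 L0 by (simp add: field_simps)
    finally have c: "real (card {- int M div int L..int M div int L}) \<le> 4 * M / L" .
    have "real (2 * M + 1) \<le> real (2 * R * card S)" using S(2) by (simp only: of_nat_le_iff)
    then have "real M / R \<le> real (card S)" using R by (simp add: field_simps)
    also have "\<dots> \<le> real (card {- int M div int L..int M div int L}) * real (card S1)"
      using y by (simp add: S1_def flip: of_nat_mult)
    also have "\<dots> \<le> 4 * M / L * real (card S1)" using c by (rule mult_right_mono) simp
    finally show ?thesis using L0 M0 R1 by (simp add: field_simps)
  qed
  have blk: "y * int L \<le> k \<and> k < y * int L + int L" if "k \<in> S1" for k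
  proof -
    have "y * int L + k mod int L = k" using that div_mult_mod_eq[of k "int L"] by (simp add: S1_def)
    moreover have "0 < int L" using L0 by simp
    ultimately show ?thesis using pos_mod_bound[of "int L" k] pos_mod_sign[of "int L" k] by linarith
  qed
  define D where "D = 8 * int R"
  have D: "0 < D" using R by (simp add: D_def)
  \<comment> \<open>Otherwise S1 would have at most one point in each cell of length 8 R, hence at
    most L/(8R) + 1 points, against the lower bound L/(4R).\<close>
  have "\<not> inj_on (\<lambda>k. (k - y * int L) div D) S1"
  proof
    assume inj: "inj_on (\<lambda>k. (k - y * int L) div D) S1"
    have "(\<lambda>k. (k - y * int L) div D) ` S1 \<subseteq> {0..int L div D}"
    proof (intro image_subsetI)
      fix k assume "k \<in> S1"
      then have k: "0 \<le> k - y * int L" "k - y * int L \<le> int L" using blk by fastforce+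
      show "(k - y * int L) div D \<in> {0..int L div D}"
        using zdiv_mono1[OF k(2) D] k(1) D by (simp add: pos_imp_zdiv_nonneg_iff)
    qed
    then have "card S1 \<le> card {0..int L div D}" by (rule card_inj_on_le[OF inj]) simp
    moreover have "0 \<le> int L div D" using D by (simp add: pos_imp_zdiv_nonneg_iff)
    ultimately have "real (card S1) \<le> real_of_int (int L div D) + 1" by simp
    also have "\<dots> \<le> real L / (8 * R) + 1"
    proof -
      have "int L div D = \<lfloor>real L / (8 * R)\<rfloor>"
        using floor_divide_of_int_eq[of "int L" D, where ?'a = real] by (simp add: D_def)
      then show ?thesis by (simp only: of_int_floor_le add_right_mono)
    qed
    finally have "real L / (4 * R) \<le> real L / (8 * R) + 1" using m by linarith
    then have "real L \<le> 8 * R" using R1 by (simp add: field_simps)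
    then show False using Lr R1 by linarith
  qed
  then obtain k1 k2 where k: "k1 \<in> S1" "k2 \<in> S1" "k1 < k2" "(k1 - y * int L) div D = (k2 - y * int L) div D"
  proof -
    assume not_inj: "\<not> inj_on (\<lambda>k. (k - y * int L) div D) S1"
      and rule: "\<And>k1 k2. k1 \<in> S1 \<Longrightarrow> k2 \<in> S1 \<Longrightarrow> k1 < k2 \<Longrightarrow> (k1 - y * int L) div D = (k2 - y * int L) div D \<Longrightarrow> thesis"
    obtain a b where "a \<in> S1" "b \<in> S1" "a \<noteq> b" "(a - y * int L) div D = (b - y * int L) div D"
      using not_inj unfolding inj_on_def by blast
    then show thesis using rule[of a b] rule[of b a] by (cases "a < b") auto
  qed
  define n where "n = k2 - k1"
  have n: "0 < n" "n < D"
  proof -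
    show "0 < n" using k by (simp add: n_def)
    have "(k2 - y * int L) - (k1 - y * int L) = (k2 - y * int L) mod D - (k1 - y * int L) mod D"
      using div_mult_mod_eq[of "k1 - y * int L" D] div_mult_mod_eq[of "k2 - y * int L" D] unfolding k(4) by linarith
    then show "n < D"
      using pos_mod_bound[OF D, of "k2 - y * int L"] pos_mod_sign[OF D, of "k1 - y * int L"] unfolding n_def by linarith
  qed
  have nearS: "nint (of_int (k' - k) * \<phi>) \<le> 2 * R / M" if "k \<in> S1" "k' \<in> S1" for k k'
    using nint_diff[of "of_int k' * \<phi>" "of_int k * \<phi>"] near[of k] near[of k'] that
    by (simp add: S1_def left_diff_distrib)
  have "\<exists>c\<in>{0..<n}. card S1 \<le> card {0..<n} * card {k\<in>S1. k mod n = c}"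
    by (rule ex_large_fibre[OF fin1]) (use n in auto)
  then obtain c where c: "card S1 \<le> card {0..<n} * card {k\<in>S1. k mod n = c}" by blast
  define S2 where "S2 = {k\<in>S1. k mod n = c}"
  have fin2: "finite S2" using fin1 by (simp add: S2_def)
  have c2: "real L / (32 * (real R)\<^sup>2) \<le> real (card S2)"
  proof -
    have "card S1 \<le> nat n * card S2" using c by (simp add: S2_def)
    then have "real (card S1) \<le> real (nat n * card S2)" by (simp only: of_nat_le_iff)
    also have "\<dots> = real_of_int n * real (card S2)" using n by simp
    also have "\<dots> \<le> real_of_int D * real (card S2)" using n by (intro mult_right_mono) auto
    finally have "real L / (4 * R) \<le> 8 * R * real (card S2)" using m unfolding D_def by simp
    then show ?thesis using R1 by (simp add: field_simps power2_eq_square)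
  qed
  have L32: "4 \<le> real L / (32 * (real R)\<^sup>2)" using Lr R1 by (simp add: field_simps)
  then have "S2 \<noteq> {}" using c2 by auto
  \<comment> \<open>The extreme points of a rich residue class modulo n. Their distance is n j with
    j at least L/(64 R^2), since the class has at least L/(32 R^2) points.\<close>
  define u where "u = Min S2"
  define v where "v = Max S2"
  have uv: "u \<in> S2" "v \<in> S2" "\<And>k. k \<in> S2 \<Longrightarrow> u \<le> k \<and> k \<le> v"
    using fin2 \<open>S2 \<noteq> {}\<close> by (auto simp: u_def v_def)
  define j where "j = (v - u) div n"
  have nj: "v - u = n * j" and nd: "\<And>k. k \<in> S2 \<Longrightarrow> n dvd k - u"
  proof -
    show "n dvd k - u" if "k \<in> S2" for k
    proof -
      have "k mod n = u mod n" using that uv(1) by (simp add: S2_def)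
      then show ?thesis by (simp add: mod_eq_dvd_iff)
    qed
    from this[OF uv(2)] show "v - u = n * j" by (simp add: j_def)
  qed
  have "card S2 \<le> card {0..j}"
  proof (rule card_inj_on_le[where f = "\<lambda>k. (k - u) div n"])
    show "inj_on (\<lambda>k. (k - u) div n) S2"
    proof (rule inj_onI)
      fix x y assume xy: "x \<in> S2" "y \<in> S2" "(x - u) div n = (y - u) div n"
      have "n * ((x - u) div n) = x - u" "n * ((y - u) div n) = y - u"
        by (rule dvd_mult_div_cancel[OF nd[OF xy(1)]], rule dvd_mult_div_cancel[OF nd[OF xy(2)]])
      then show "x = y" unfolding xy(3) by linarith
    qed
    show "(\<lambda>k. (k - u) div n) ` S2 \<subseteq> {0..j}"
      using uv(3) n by (auto simp: j_def pos_imp_zdiv_nonneg_iff intro!: zdiv_mono1)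
  qed simp
  then have j1: "real (card S2) \<le> real_of_int (j + 1)"
    using c2 L32 by (cases "0 \<le> j + 1") auto
  have jlow: "real L / (64 * (real R)\<^sup>2) \<le> real_of_int j"
  proof -
    have "real L / (64 * (real R)\<^sup>2) = (real L / (32 * (real R)\<^sup>2)) / 2" by simp
    then show ?thesis using j1 c2 L32 by linarith
  qed
  have jpos: "0 < real_of_int j" using jlow L0 R1 by (intro less_le_trans[OF _ jlow]) auto
  have jup: "real_of_int j \<le> real L"
  proof -
    have "1 * j \<le> n * j" using n jpos by (intro mult_right_mono) auto
    then have "j \<le> v - u" using nj by simp
    also have "\<dots> \<le> int L" using blk[of u] blk[of v] uv by (auto simp: S2_def)
    finally show ?thesis by linarith
  qed
  obtain N where N: "\<bar>of_int n * \<phi> - of_int N\<bar> = nint (of_int n * \<phi>)" by (rule nint_obtain)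
  define t where "t = of_int n * \<phi> - of_int N"
  have t: "\<bar>t\<bar> \<le> 2 * R / M" using nearS[OF k(1,2)] N by (simp add: t_def n_def)
  \<comment> \<open>The block length L was taken at most M / (16 R) so that j t stays below 1/2 in
    modulus. Its distance to the nearest integer is then its absolute value, and dividing by j
    becomes legitimate.\<close>
  have "\<bar>of_int j * t\<bar> \<le> L * (2 * R / M)"
    unfolding abs_mult using t jup jpos by (intro mult_mono) auto
  also have "\<dots> \<le> M / (16 * real R) * (2 * R / M)" using LM by (intro mult_right_mono) auto
  also have "\<dots> = 1 / 8" using M0 R1 by simp
  finally have jt: "nint (of_int j * t) = \<bar>of_int j * t\<bar>" by (intro nint_eq_abs) linarith
  have "of_int (v - u) * \<phi> = of_int j * t + of_int (j * N)"
    unfolding nj t_def by (simp add: algebra_simps)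
  then have "nint (of_int (v - u) * \<phi>) = \<bar>of_int j * t\<bar>" by (simp only: nint_add_int jt)
  then have "\<bar>of_int j * t\<bar> \<le> 2 * R / M" using nearS[of u v] uv by (simp add: S2_def)
  then have "real_of_int j * \<bar>t\<bar> \<le> 2 * R / M" using jpos by (simp add: abs_mult)
  then have "(real L / (64 * (real R)\<^sup>2)) * \<bar>t\<bar> \<le> 2 * R / M"
    using mult_right_mono[OF jlow, of "\<bar>t\<bar>"] by simp
  moreover have "((M / (32 * real R)) / (64 * (real R)\<^sup>2)) * \<bar>t\<bar> \<le> (real L / (64 * (real R)\<^sup>2)) * \<bar>t\<bar>"
    using LM by (intro mult_right_mono divide_right_mono) auto
  ultimately have "(M / (32 * real R)) / (64 * (real R)\<^sup>2) * \<bar>t\<bar> \<le> 2 * R / M" by linarith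
  then have "\<bar>t\<bar> \<le> 4096 * real R ^ 4 / (real M)\<^sup>2"
    using M0 R1 by (simp add: field_simps power2_eq_square power4_eq_xxxx)
  moreover have "nint (of_nat (nat n) * \<phi>) = \<bar>t\<bar>" using n N by (simp add: t_def)
  ultimately show ?thesis using n by (intro exI[of _ "nat n"]) (auto simp: D_def)
qed

text \<open>By \<open>decay\<close>, the k with a k at least 1/(2R) have k \<phi> within R / M of an
  integer, and a large average makes them dense. This is the abstract last step of Weyl's
  inequality.\<close>

lemma vinogradov:
  fixes a :: "int \<Rightarrow> real" and \<phi> :: real and M R :: nat
  assumes M: "0 < M" and R: "0 < R" and a: "\<And>k. a k \<le> 1"
    and decay: "\<And>k. a k * (2 * real M * nint (of_int k * \<phi>)) \<le> 1"
    and avg: "1 / R \<le> avg {- int M..int M} a"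
  shows "\<exists>n. 0 < n \<and> n \<le> 8 * R \<and> nint (of_nat n * \<phi>) \<le> 2 ^ 22 * real R ^ 6 / (real M)\<^sup>2"
proof (cases "2048 * R ^ 3 \<le> M")
  case True
  define I where "I = {- int M..int M}"
  define S where "S = {k\<in>I. 1 \<le> 2 * R * a k}"
  have I: "finite I" "card I = 2 * M + 1" by (simp_all add: I_def)
  have "sum a I \<le> (\<Sum>k\<in>I. (if k \<in> S then 1 else 0) + 1 / (2 * real R))"
  proof (rule sum_mono)
    fix k assume "k \<in> I"
    then show "a k \<le> (if k \<in> S then 1 else 0) + 1 / (2 * real R)"
      using order.trans[OF a[of k], of "1 + 1 / (2 * real R)"] R by (cases "k \<in> S") (auto simp: S_def field_simps)
  qed
  also have "\<dots> = real (card S) + (2 * real M + 1) / (2 * real R)"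
  proof -
    have "S \<subseteq> I" by (auto simp: S_def)
    then show ?thesis using I by (simp add: sum.distrib sum.If_cases Int_absorb1)
  qed
  finally have "sum a I \<le> real (card S) + (2 * real M + 1) / (2 * real R)" .
  moreover have "(2 * real M + 1) / R \<le> sum a I"
    using avg I unfolding avg_def I_def[symmetric] by (simp add: field_simps)
  ultimately have "(2 * real M + 1) / (2 * real R) \<le> real (card S)" by (simp add: field_simps)
  then have "real (2 * M + 1) \<le> real (2 * R * card S)" using R by (simp add: field_simps)
  then have "2 * M + 1 \<le> 2 * R * card S" by (simp only: of_nat_le_iff)
  moreover have "nint (of_int k * \<phi>) \<le> R / M" if "k \<in> S" for k
  proof -
    have "1 / (2 * real R) \<le> a k" using that R by (simp add: S_def field_simps)
    then have "1 / (2 * real R) * (2 * real M * nint (of_int k * \<phi>)) \<le> a k * (2 * real M * nint (of_int k * \<phi>))"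
      by (intro mult_right_mono) auto
    then have "1 / (2 * real R) * (2 * real M * nint (of_int k * \<phi>)) \<le> 1" using decay[of k] by linarith
    then show ?thesis using R M by (simp add: field_simps)
  qed
  moreover have "S \<subseteq> {- int M..int M}" by (auto simp: S_def I_def)
  ultimately obtain n where n: "0 < n" "n \<le> 8 * R" "nint (of_nat n * \<phi>) \<le> 4096 * real R ^ 4 / (real M)\<^sup>2"
    using vinogradov_large[of S M R \<phi>] True R by blast
  have "4096 * real R ^ 4 \<le> 2 ^ 22 * real R ^ 6"
    using R by (intro mult_mono power_increasing) auto
  then have "4096 * real R ^ 4 / (real M)\<^sup>2 \<le> 2 ^ 22 * real R ^ 6 / (real M)\<^sup>2" by (rule divide_right_mono) simp
  with n show ?thesis by (intro exI[of _ n]) auto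
next
  case False
  then have "real M \<le> real (2048 * R ^ 3)" by (simp only: of_nat_le_iff)
  then have "(real M)\<^sup>2 \<le> (2048 * real R ^ 3)\<^sup>2" by (intro power_mono) auto
  also have "\<dots> = 2 ^ 22 * real R ^ 6" by (simp add: power_mult_distrib flip: power_mult)
  \<comment> \<open>For small M the claimed bound exceeds 1, so n = 1 serves.\<close>
  finally have "1 \<le> 2 ^ 22 * real R ^ 6 / (real M)\<^sup>2" using M by simp
  then show ?thesis using R nint_le_half[of \<phi>] by (intro exI[of _ 1]) auto
qed

subsection \<open>Major arcs\<close>

context cyclic
begin

text \<open>One parameter N bounds both the denominator and the width, in units of M^-2. Differences
  and changes of denominator then only enlarge N.\<close>

definition major :: "nat \<Rightarrow> nat \<Rightarrow> int \<Rightarrow> bool" where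
  "major M N z \<longleftrightarrow> (\<exists>n. 0 < n \<and> n \<le> N \<and> nint (of_nat n * (of_int z / of_nat P)) \<le> N / (real M)\<^sup>2)"

lemma major_mono: "major M N z \<Longrightarrow> N \<le> N' \<Longrightarrow> major M N' z"
proof -
  assume "major M N z" and N: "N \<le> N'"
  then obtain n where n: "0 < n" "n \<le> N" "nint (of_nat n * (of_int z / of_nat P)) \<le> N / (real M)\<^sup>2"
    unfolding major_def by blast
  have "N / (real M)\<^sup>2 \<le> N' / (real M)\<^sup>2" using N by (intro divide_right_mono) auto
  with n N show ?thesis unfolding major_def by (intro exI[of _ n]) auto
qed

lemma major_periodic: "major M N (z + int P * k) = major M N z"
proof -
  have "of_nat n * (of_int (z + int P * k) / of_nat P) = of_nat n * (of_int z / of_nat P) + real_of_int (int n * k)" for n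
    using P_pos by (simp add: field_simps)
  then show ?thesis unfolding major_def by (simp only: nint_add_int)
qed

text \<open>From n z = P m + j the frequency is recovered by division, and |j| is at most 4 N
  because P = 4 M^2. The bound does not depend on M, so pigeonholing over major frequencies costs
  only powers of N.\<close>

lemma card_major_le:
  assumes P: "P = 4 * M\<^sup>2"
  shows "card {z\<in>U. major M N z} \<le> N * (N + 1) * (8 * N + 1)"
proof -
  let ?T = "{1..int N} \<times> {0..int N} \<times> {- 4 * int N..4 * int N}"
  have M: "0 < real M" using P P_pos by (cases M) auto
  have "{z\<in>U. major M N z} \<subseteq> (\<lambda>(n, m, j). (int P * m + j) div n) ` ?T"
  proof
    fix z assume z: "z \<in> {z\<in>U. major M N z}"
    then obtain n where n: "0 < n" "n \<le> N" "nint (of_nat n * (of_int z / of_nat P)) \<le> N / (real M)\<^sup>2"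
      by (auto simp: major_def)
    define x where "x = of_nat n * (real_of_int z / of_nat P)"
    obtain m where m: "\<bar>x - of_int m\<bar> = nint x" by (rule nint_obtain)
    have x: "0 \<le> x" "x < n" using z n P_pos by (auto simp: x_def divide_less_eq field_simps)
    have "real_of_int m > -1" "real_of_int m < n + 1" using m nint_le_half[of x] x by linarith+
    then have m1: "0 \<le> m" "m \<le> int n" by linarith+
    define j where "j = int n * z - int P * m"
    have "real_of_int j = P * (x - m)" using P_pos by (simp add: j_def x_def field_simps)
    then have "real_of_int \<bar>j\<bar> = P * nint x" using m by (simp add: abs_mult)
    also have "\<dots> \<le> P * (N / (real M)\<^sup>2)" using n(3) by (intro mult_left_mono) (auto simp: x_def)
    also have "\<dots> = 4 * N" using M by (simp add: P)
    finally have "\<bar>j\<bar> \<le> 4 * int N" by linarith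
    moreover have "z = (int P * m + j) div int n" using n by (simp add: j_def)
    ultimately show "z \<in> (\<lambda>(n, m, j). (int P * m + j) div n) ` ?T"
      using n m1 by (intro image_eqI[of _ _ "(int n, m, j)"]) auto
  qed
  then have "card {z\<in>U. major M N z} \<le> card ?T"
    by (rule surj_card_le[rotated]) simp
  also have "\<dots> = N * ((N + 1) * (8 * N + 1))" 
  proof -
    have "card {- 4 * int N..4 * int N} = 8 * N + 1" unfolding card_atLeastAtMost_int by arith
    then show ?thesis by (simp add: card_cartesian_product nat_add_distrib)
  qed
  finally show ?thesis by (simp only: mult.assoc)
qed

subsection \<open>Quadratic Weyl sums\<close>

definition weyl :: "nat \<Rightarrow> int set \<Rightarrow> int \<Rightarrow> int \<Rightarrow> int \<Rightarrow> complex" where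
  "weyl M J r b \<rho> = (\<Sum>s\<in>{s\<in>J. s + b \<in> J}. chr r ((s + b)\<^sup>2) * chr \<rho> (s\<^sup>2)) / of_nat M"

lemma norm_weyl_le1: "ivl M J \<Longrightarrow> cmod (weyl M J r b \<rho>) \<le> 1"
proof -
  assume J: "ivl M J"
  have "cmod (\<Sum>s\<in>{s\<in>J. s + b \<in> J}. chr r ((s + b)\<^sup>2) * chr \<rho> (s\<^sup>2)) \<le> real (card {s\<in>J. s + b \<in> J}) * 1"
    by (rule sum_norm_bound) (simp add: norm_mult)
  also have "\<dots> \<le> real M" using ivl_card[OF ivl_Int_shift[OF J]] by simp
  finally show ?thesis by (simp add: weyl_def norm_divide divide_le_eq)
qed

text \<open>When G is a character its value at the moving point factors out. The weight is
  discarded, and what acts on \<open>F b\<close> is the multiplier \<open>weyl\<close>.\<close>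

lemma slice_chr_power2_le:
  assumes g: "adm (g b)" and F: "adm (F b)" and J: "ivl M J"
  shows "(cmod (slice M J g F (chr r) b))\<^sup>2 \<le> (\<Sum>\<rho>\<in>U. (cmod (hat (F b) \<rho>))\<^sup>2 * (cmod (weyl M J r b \<rho>))\<^sup>2)"
proof -
  let ?S = "{s\<in>J. s + b \<in> J}"
  have fin: "finite ?S" by (rule ivl_finite[OF ivl_Int_shift[OF J]])
  have eq: "slice M J g F (chr r) b = A (\<lambda>y. (g b y * chr r y) * (\<Sum>s\<in>?S. (chr r ((s + b)\<^sup>2) / of_nat M) * F b (y + s\<^sup>2)))"
    unfolding slice_def sum_divide_distrib sum_distrib_left
    by (intro avg_cong sum.cong refl) (simp add: chr_add)
  have "(cmod (slice M J g F (chr r) b))\<^sup>2 \<le> A (\<lambda>y. (cmod (\<Sum>s\<in>?S. (chr r ((s + b)\<^sup>2) / of_nat M) * F b (y + s\<^sup>2)))\<^sup>2)"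
    unfolding eq by (rule norm_avg_mult_power2_le) (simp add: norm_mult adm_norm[OF g])
  also have "\<dots> = (\<Sum>\<rho>\<in>U. (cmod (hat (F b) \<rho>))\<^sup>2 * (cmod (\<Sum>s\<in>?S. (chr r ((s + b)\<^sup>2) / of_nat M) * chr \<rho> (s\<^sup>2)))\<^sup>2)"
    by (rule parseval_comb[OF adm_per[OF F] fin])
  also have "\<dots> = (\<Sum>\<rho>\<in>U. (cmod (hat (F b) \<rho>))\<^sup>2 * (cmod (weyl M J r b \<rho>))\<^sup>2)"
    unfolding weyl_def sum_divide_distrib by simp
  finally show ?thesis .
qed

text \<open>Differencing leaves phases linear in \<open>s\<close> with frequency \<rho> + r, and
  linear in \<open>b\<close> with frequency r. Summing over \<open>s\<close> thus tests \<rho> + r,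
  and summing over \<open>b\<close> tests r itself.\<close>

lemma norm_weyl_square:
  assumes J: "ivl M J"
  shows "complex_of_real ((cmod (weyl M J r b \<rho>))\<^sup>2) = (\<Sum>k\<in>{- int M..int M}.
    \<Sum>s\<in>{s\<in>{s\<in>J. s + b \<in> J}. s + k \<in> {s\<in>J. s + b \<in> J}}. chr (\<rho> + r) (- (2 * k * s + k\<^sup>2)) * chr r (- (2 * k * b))) / (of_nat M)\<^sup>2"
proof -
  let ?S = "{s\<in>J. s + b \<in> J}"
  define \<phi> where "\<phi> s = chr r ((s + b)\<^sup>2) * chr \<rho> (s\<^sup>2)" for s
  have \<phi>: "\<phi> s * cnj (\<phi> (s + k)) = chr (\<rho> + r) (- (2 * k * s + k\<^sup>2)) * chr r (- (2 * k * b))" for s k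
  proof -
    have "\<phi> s * cnj (\<phi> (s + k)) = (chr r ((s + b)\<^sup>2 - (s + k + b)\<^sup>2)) * (chr \<rho> (s\<^sup>2 - (s + k)\<^sup>2))"
      by (simp add: \<phi>_def chr_diff)
    also have "(s + b)\<^sup>2 - (s + k + b)\<^sup>2 = - (2 * k * s + k\<^sup>2) + (- (2 * k * b))" by (simp add: power2_eq_square algebra_simps)
    also have "s\<^sup>2 - (s + k)\<^sup>2 = - (2 * k * s + k\<^sup>2)" by (simp add: power2_eq_square algebra_simps)
    finally show ?thesis by (simp only: chr_add chr_add_left mult_ac)
  qed
  have "complex_of_real ((cmod (\<Sum>s\<in>?S. \<phi> s))\<^sup>2) = (\<Sum>s\<in>?S. \<Sum>s'\<in>?S. \<phi> s * cnj (\<phi> s'))"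
    unfolding complex_norm_square by (simp add: sum_product)
  also have "\<dots> = (\<Sum>k\<in>{- int M..int M}. \<Sum>s\<in>{s\<in>?S. s + k \<in> ?S}. \<phi> s * cnj (\<phi> (s + k)))"
    by (rule sum_by_difference[OF ivl_Int_shift[OF J]])
  finally show ?thesis
    unfolding weyl_def \<phi>_def[symmetric] \<phi> by (simp add: norm_divide power_divide)
qed

lemma norm_geometric_chr:
  "cmod (\<Sum>s\<in>{p..q}. chr z (- (2 * k * s))) * (2 * nint (of_int k * (of_int (2 * z) / of_nat P))) \<le> 1"
proof -
  define x where "x = of_int k * (real_of_int (2 * z) / of_nat P)"
  have "chr z (- (2 * k * s)) = echar (of_int s * (- x))" for s by (simp add: chr_def x_def mult_ac)
  then show ?thesis using norm_geometric_echar[of "- x" p q] by (simp add: nint_minus x_def)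
qed

text \<open>The factor 2 of the differenced phase is moved into the denominator: n * 2 z = 2 n * z.
  The constant 2 ^ 32 exceeds 2 ^ 22 * 3 ^ 6.\<close>

lemma major_if_decay:
  fixes a :: "int \<Rightarrow> real"
  assumes M: "0 < M" and R: "0 < R" and a: "\<And>k. a k \<le> 1"
    and decay: "\<And>k. a k * (2 * real M * nint (of_int k * (of_int (2 * z) / of_nat P))) \<le> 1"
    and avg: "1 / (3 * real R) \<le> avg {- int M..int M} a"
  shows "major M (2 ^ 32 * R ^ 6) z"
proof -
  obtain n where n: "0 < n" "n \<le> 8 * (3 * R)" "nint (of_nat n * (of_int (2 * z) / of_nat P)) \<le> 2 ^ 22 * real (3 * R) ^ 6 / (real M)\<^sup>2"
    using vinogradov[OF M _ a decay, of "3 * R"] R avg by auto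
  have "R \<le> R ^ 6" using R by (intro self_le_power) auto
  then have "2 * n \<le> 2 ^ 32 * R ^ 6" using n(2) by simp
  moreover have "2 ^ 22 * real (3 * R) ^ 6 / (real M)\<^sup>2 \<le> real (2 ^ 32 * R ^ 6) / (real M)\<^sup>2"
    by (intro divide_right_mono) (auto simp: power_mult_distrib)
  moreover have "of_nat (2 * n) * (real_of_int z / of_nat P) = of_nat n * (of_int (2 * z) / of_nat P)" by simp
  ultimately have "2 * n \<le> 2 ^ 32 * R ^ 6" "nint (of_nat (2 * n) * (real_of_int z / of_nat P)) \<le> real (2 ^ 32 * R ^ 6) / (real M)\<^sup>2"
    using order.trans[OF n(3)] by (simp_all only:)
  moreover have "0 < 2 * n" using n by simp
  ultimately show ?thesis unfolding major_def by blast
qed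

text \<open>The geometric sum over \<open>s\<close> has frequency \<rho> + r, so a large Weyl sum at
  a single \<open>b\<close> makes this sum of frequencies major.\<close>

lemma large_weyl_major:
  assumes J: "ivl M J" and M: "0 < M" and R: "0 < R" and W: "1 / real R \<le> (cmod (weyl M J r b \<rho>))\<^sup>2"
  shows "major M (2 ^ 32 * R ^ 6) (\<rho> + r)"
proof -
  define S where "S k = {s\<in>{s\<in>J. s + b \<in> J}. s + k \<in> {s\<in>J. s + b \<in> J}}" for k
  have S: "ivl M (S k)" for k unfolding S_def by (intro ivl_Int_shift J)
  define a where "a k = cmod (\<Sum>s\<in>S k. chr (\<rho> + r) (- (2 * k * s))) / M" for k
  have "complex_of_real ((cmod (weyl M J r b \<rho>))\<^sup>2) = (\<Sum>k\<in>{- int M..int M}.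
      (\<Sum>s\<in>S k. chr (\<rho> + r) (- (2 * k * s))) * (chr (\<rho> + r) (- k\<^sup>2) * chr r (- (2 * k * b)))) / (of_nat M)\<^sup>2"
    unfolding norm_weyl_square[OF J] S_def[symmetric] sum_distrib_right
    by (simp only: minus_add_distrib chr_add mult.assoc)
  note eq = this
  have "(cmod (weyl M J r b \<rho>))\<^sup>2 = cmod (complex_of_real ((cmod (weyl M J r b \<rho>))\<^sup>2))" by (simp only: norm_of_real abs_power2)
  also have "\<dots> = cmod ((\<Sum>k\<in>{- int M..int M}.
      (\<Sum>s\<in>S k. chr (\<rho> + r) (- (2 * k * s))) * (chr (\<rho> + r) (- k\<^sup>2) * chr r (- (2 * k * b)))) / (of_nat M)\<^sup>2)"
    unfolding eq ..
  also have "\<dots> \<le> (\<Sum>k\<in>{- int M..int M}. cmod (\<Sum>s\<in>S k. chr (\<rho> + r) (- (2 * k * s)))) / (real M)\<^sup>2"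
    unfolding norm_divide norm_power norm_of_nat
    by (intro divide_right_mono order.trans[OF norm_sum] sum_mono) (auto simp: norm_mult)
  also have "\<dots> = (\<Sum>k\<in>{- int M..int M}. a k) / M" by (simp add: a_def sum_divide_distrib power2_eq_square)
  also have "\<dots> = (2 * real M + 1) / M * avg {- int M..int M} a"
  proof -
    have "s / m = (2 * m + 1) / m * (s / (2 * m + 1))" if "0 < m" for s m :: real using that by simp
    from this[of "real M"] show ?thesis using M by (simp add: avg_def)
  qed
  also have "\<dots> \<le> 3 * avg {- int M..int M} a"
    using M by (intro mult_right_mono avg_nonneg) (auto simp: a_def field_simps)
  finally have avg: "1 / (3 * real R) \<le> avg {- int M..int M} a" using W by simp
  show ?thesis
  proof (rule major_if_decay[OF M R _ _ avg])
    fix k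
    have "cmod (\<Sum>s\<in>S k. chr (\<rho> + r) (- (2 * k * s))) \<le> real (card (S k)) * 1"
      by (rule sum_norm_bound) simp
    also have "\<dots> \<le> M" using ivl_card[OF S] by simp
    finally show "a k \<le> 1" using M by (simp add: a_def)
    obtain p q where "S k = {p..q}" using S[of k] by (auto simp: ivl_def)
    then show "a k * (2 * real M * nint (of_int k * (of_int (2 * (\<rho> + r)) / of_nat P))) \<le> 1"
      using norm_geometric_chr[of "\<rho> + r" k p q] M by (simp add: a_def mult_ac)
  qed
qed

text \<open>Averaging over \<open>b\<close> gives more: with \<open>k\<close> and \<open>s\<close>
  fixed the sum over \<open>b\<close> is geometric with frequency 2 k r, so r alone is
  major.\<close>

lemma avg_weyl_major:
  assumes J: "ivl M J" and M: "0 < M" and R: "0 < R"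
    and W: "1 / real R \<le> avg {- int M..int M} (\<lambda>b. (cmod (weyl M J r b \<rho>))\<^sup>2)"
  shows "major M (2 ^ 32 * R ^ 6) r"
proof -
  let ?I = "{- int M..int M}"
  have fin: "finite J" by (rule ivl_finite[OF J])
  define S where "S k = {s\<in>J. s + k \<in> J}" for k
  have S: "ivl M (S k)" for k unfolding S_def by (rule ivl_Int_shift[OF J])
  define B where "B k s = {b. s + b \<in> S k}" for k s
  have cardB: "card (B k s) \<le> M" and Bint: "\<exists>p q. B k s = {p..q}" for k s
  proof -
    obtain p q where pq: "S k = {p..q}" using S[of k] by (auto simp: ivl_def)
    then have eq: "B k s = {p - s..q - s}" by (auto simp: B_def)
    show "\<exists>p q. B k s = {p..q}" unfolding eq by blast
    have "card (B k s) = card (S k)" unfolding eq pq by simp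
    then show "card (B k s) \<le> M" using ivl_card[OF S[of k]] by simp
  qed
  define a where "a k = (\<Sum>s\<in>S k. cmod (\<Sum>b\<in>B k s. chr r (- (2 * k * b)))) / (real M)\<^sup>2" for k
  define X where "X k s b = chr (\<rho> + r) (- (2 * k * s + k\<^sup>2)) * chr r (- (2 * k * b))" for k s b
  have "complex_of_real (\<Sum>b\<in>?I. (cmod (weyl M J r b \<rho>))\<^sup>2)
      = (\<Sum>b\<in>?I. \<Sum>k\<in>?I. \<Sum>s\<in>{s\<in>{s\<in>J. s + b \<in> J}. s + k \<in> {s\<in>J. s + b \<in> J}}. X k s b) / (of_nat M)\<^sup>2"
    unfolding of_real_sum norm_weyl_square[OF J] X_def by (simp add: sum_divide_distrib)
  \<comment> \<open>The sum over \<open>b\<close> is moved innermost. For fixed \<open>k\<close> and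
    \<open>s\<close> the admissible \<open>b\<close> form a translate of \<open>S k\<close>, and
    they lie in {-M..M} automatically.\<close>
  also have "(\<Sum>b\<in>?I. \<Sum>k\<in>?I. \<Sum>s\<in>{s\<in>{s\<in>J. s + b \<in> J}. s + k \<in> {s\<in>J. s + b \<in> J}}. X k s b)
      = (\<Sum>k\<in>?I. \<Sum>s\<in>S k. \<Sum>b\<in>B k s. X k s b)"
  proof (rule trans[OF sum.swap], rule sum.cong[OF refl])
    fix k assume "k \<in> ?I"
    have small: "b \<in> ?I" if "s \<in> J" "s + b \<in> J" for s b
    proof -
      obtain p q where pq: "J = {p..q}" using J by (auto simp: ivl_def)
      have "card J = nat (q + 1 - p)" by (simp add: pq)
      then show ?thesis using that ivl_card[OF J] by (auto simp: pq)
    qed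
    have "(\<Sum>b\<in>?I. \<Sum>s\<in>{s\<in>{s\<in>J. s + b \<in> J}. s + k \<in> {s\<in>J. s + b \<in> J}}. X k s b)
        = (\<Sum>b\<in>?I. \<Sum>s\<in>S k. if b \<in> B k s then X k s b else 0)"
    proof (rule sum.cong[OF refl])
      fix b
      have "{s\<in>{s\<in>J. s + b \<in> J}. s + k \<in> {s\<in>J. s + b \<in> J}} = {s\<in>S k. b \<in> B k s}"
        by (auto simp: S_def B_def add_ac)
      then show "(\<Sum>s\<in>{s\<in>{s\<in>J. s + b \<in> J}. s + k \<in> {s\<in>J. s + b \<in> J}}. X k s b) = (\<Sum>s\<in>S k. if b \<in> B k s then X k s b else 0)"
        using ivl_finite[OF S] by (simp add: sum.inter_filter)
    qed
    also have "\<dots> = (\<Sum>s\<in>S k. \<Sum>b\<in>?I. if b \<in> B k s then X k s b else 0)" by (rule sum.swap)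
    also have "\<dots> = (\<Sum>s\<in>S k. \<Sum>b\<in>B k s. X k s b)"
    proof (rule sum.cong[OF refl])
      fix s assume "s \<in> S k"
      then have "{b \<in> ?I. b \<in> B k s} = B k s" using small[of s] by (auto simp: S_def B_def)
      then show "(\<Sum>b\<in>?I. if b \<in> B k s then X k s b else 0) = (\<Sum>b\<in>B k s. X k s b)"
        by (simp add: sum.inter_filter[symmetric])
    qed
    finally show "(\<Sum>b\<in>?I. \<Sum>s\<in>{s\<in>{s\<in>J. s + b \<in> J}. s + k \<in> {s\<in>J. s + b \<in> J}}. X k s b) = (\<Sum>s\<in>S k. \<Sum>b\<in>B k s. X k s b)" .
  qed
  finally have eq: "complex_of_real (\<Sum>b\<in>?I. (cmod (weyl M J r b \<rho>))\<^sup>2) = (\<Sum>k\<in>?I. \<Sum>s\<in>S k. \<Sum>b\<in>B k s. X k s b) / (of_nat M)\<^sup>2" .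
  have "(\<Sum>b\<in>?I. (cmod (weyl M J r b \<rho>))\<^sup>2) = cmod (complex_of_real (\<Sum>b\<in>?I. (cmod (weyl M J r b \<rho>))\<^sup>2))"
    unfolding norm_of_real by (rule abs_of_nonneg[symmetric], rule sum_nonneg) simp
  also have "\<dots> \<le> (\<Sum>k\<in>?I. \<Sum>s\<in>S k. cmod (\<Sum>b\<in>B k s. X k s b)) / (real M)\<^sup>2"
    unfolding eq norm_divide norm_power norm_of_nat
    by (intro divide_right_mono order.trans[OF norm_sum sum_mono[OF norm_sum]]) simp
  also have "\<dots> = sum a ?I"
    unfolding a_def X_def sum_distrib_left[symmetric] by (simp add: norm_mult sum_divide_distrib)
  finally have "avg ?I (\<lambda>b. (cmod (weyl M J r b \<rho>))\<^sup>2) \<le> avg ?I a"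
    unfolding avg_def by (intro divide_right_mono) auto
  moreover have "1 / (3 * real R) \<le> 1 / real R" using R by (intro divide_left_mono) auto
  ultimately have avg: "1 / (3 * real R) \<le> avg ?I a" using W by linarith
  show ?thesis
  proof (rule major_if_decay[OF M R _ _ avg])
    fix k
    have card: "real (card (S k)) \<le> M" using ivl_card[OF S] by simp
    have "(\<Sum>s\<in>S k. cmod (\<Sum>b\<in>B k s. chr r (- (2 * k * b)))) \<le> real (card (S k)) * real M"
    proof (rule sum_bounded_above)
      fix s
      have "cmod (\<Sum>b\<in>B k s. chr r (- (2 * k * b))) \<le> real (card (B k s)) * 1"
        by (rule sum_norm_bound) simp
      then show "cmod (\<Sum>b\<in>B k s. chr r (- (2 * k * b))) \<le> real M" using cardB[of k s] by linarith
    qed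
    also have "\<dots> \<le> real M * real M" using card by (intro mult_right_mono) auto
    finally show "a k \<le> 1" using M by (simp add: a_def power2_eq_square)
    define t where "t = nint (of_int k * (of_int (2 * r) / of_nat P))"
    have "(\<Sum>s\<in>S k. cmod (\<Sum>b\<in>B k s. chr r (- (2 * k * b))) * (2 * t)) \<le> real (card (S k)) * 1"
    proof (rule sum_bounded_above)
      fix s
      obtain p q where "B k s = {p..q}" using Bint by blast
      then show "cmod (\<Sum>b\<in>B k s. chr r (- (2 * k * b))) * (2 * t) \<le> 1"
        using norm_geometric_chr[of r k p q] by (simp add: t_def)
    qed
    also have "\<dots> \<le> real M" using card by simp
    finally have "(\<Sum>s\<in>S k. cmod (\<Sum>b\<in>B k s. chr r (- (2 * k * b)))) * (2 * t) \<le> real M"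
      unfolding sum_distrib_right .
    then have "(\<Sum>s\<in>S k. cmod (\<Sum>b\<in>B k s. chr r (- (2 * k * b)))) * (2 * t) * real M \<le> (real M)\<^sup>2"
      unfolding power2_eq_square by (rule mult_right_mono) simp
    then show "a k * (2 * real M * t) \<le> 1" using M by (simp add: a_def mult_ac)
  qed
qed

text \<open>Frequencies with a small Weyl sum contribute at most Q^-3 in total, so the mass of
  \<open>F\<close> sits where \<rho> + r is major. There are few such \<rho>, so one of them has a
  large Weyl sum on average over \<open>b\<close>, and then r is major. The exponents are 22 = 3 * 6
  + 4 and 424 = 70 * 6 + 4, where 2 ^ 32 costs four powers.\<close>

lemma lam_chr_major:
  assumes adm: "\<And>b. adm (g b)" "\<And>b. adm (F b)" and J: "ivl M J" and P: "P = 4 * M\<^sup>2"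
    and Q: "1024 \<le> Q" and lam: "1 / Q \<le> cmod (lam M J g F (chr r))"
  shows "major M (Q ^ 424) r"
    and "1 / real Q ^ 3 \<le> avg {- int M..int M} (\<lambda>b. \<Sum>\<rho>\<in>{\<rho>\<in>U. major M (Q ^ 22) (\<rho> + r)}. (cmod (hat (F b) \<rho>))\<^sup>2)"
proof -
  let ?I = "{- int M..int M}" and ?Z = "{\<rho>\<in>U. major M (Q ^ 22) (\<rho> + r)}"
  have M: "0 < M" using P P_pos by (cases M) auto
  have q: "1024 \<le> real Q" using Q by simp
  define \<Phi> where "\<Phi> b \<rho> = (cmod (hat (F b) \<rho>))\<^sup>2" for b \<rho>
  define w where "w b \<rho> = (cmod (weyl M J r b \<rho>))\<^sup>2" for b \<rho>
  have \<Phi>: "0 \<le> \<Phi> b \<rho>" "\<Phi> b \<rho> \<le> 1" "(\<Sum>\<rho>\<in>U. \<Phi> b \<rho>) \<le> 1" for b \<rho>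
    using norm_hat_le[OF adm(2)] sum_hat_le[OF adm(2)] by (auto simp: \<Phi>_def power_le_one)
  have w: "0 \<le> w b \<rho>" "w b \<rho> \<le> 1" for b \<rho>
    using norm_weyl_le1[OF J] by (auto simp: w_def power_le_one)
  have "(1 / real Q / 3)\<^sup>2 \<le> (avg ?I (\<lambda>b. cmod (slice M J g F (chr r) b)))\<^sup>2"
    using norm_lam_le_avg_slice[OF J M, of g F "chr r"] lam by (intro power_mono) auto
  also have "\<dots> \<le> avg ?I (\<lambda>b. (cmod (slice M J g F (chr r) b))\<^sup>2)" by (rule avg_power2_le)
  also have "\<dots> \<le> avg ?I (\<lambda>b. \<Sum>\<rho>\<in>U. \<Phi> b \<rho> * w b \<rho>)"
    unfolding \<Phi>_def w_def by (intro avg_mono slice_chr_power2_le adm J)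
  also have "\<dots> \<le> avg ?I (\<lambda>b. 1 / real Q ^ 3 + (\<Sum>\<rho>\<in>?Z. \<Phi> b \<rho> * w b \<rho>))"
  proof (rule avg_mono)
    fix b
    have "(\<Sum>\<rho>\<in>U. \<Phi> b \<rho> * w b \<rho>) \<le> (\<Sum>\<rho>\<in>U. \<Phi> b \<rho> * (1 / real Q ^ 3) + (if \<rho> \<in> ?Z then \<Phi> b \<rho> * w b \<rho> else 0))"
    proof (rule sum_mono)
      fix \<rho> assume \<rho>: "\<rho> \<in> U"
      show "\<Phi> b \<rho> * w b \<rho> \<le> \<Phi> b \<rho> * (1 / real Q ^ 3) + (if \<rho> \<in> ?Z then \<Phi> b \<rho> * w b \<rho> else 0)"
      proof (cases "w b \<rho> \<le> 1 / real Q ^ 3")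
        case True
        then have "\<Phi> b \<rho> * w b \<rho> \<le> \<Phi> b \<rho> * (1 / real Q ^ 3)" using \<Phi> by (intro mult_left_mono)
        then show ?thesis using \<Phi> w by auto
      next
        case False
        then have "major M (2 ^ 32 * (Q ^ 3) ^ 6) (\<rho> + r)"
          using Q by (intro large_weyl_major[OF J M, where b = b]) (auto simp: w_def)
        moreover have "real (2 ^ 32 * (Q ^ 3) ^ 6) \<le> real (Q ^ 22)"
          using mult_power_le[OF q, of "2 ^ 32" 4 18 22] by (simp flip: power_mult)
        then have "2 ^ 32 * (Q ^ 3) ^ 6 \<le> Q ^ 22" by (simp only: of_nat_le_iff)
        ultimately have "\<rho> \<in> ?Z" using \<rho> by (simp add: major_mono)
        then show ?thesis using \<Phi> by simp
      qed
    qed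
    also have "\<dots> = (\<Sum>\<rho>\<in>U. \<Phi> b \<rho>) * (1 / real Q ^ 3) + (\<Sum>\<rho>\<in>?Z. \<Phi> b \<rho> * w b \<rho>)"
      unfolding sum.distrib sum_distrib_right by (simp add: sum.inter_filter[OF finite_U, symmetric])
    also have "\<dots> \<le> 1 * (1 / real Q ^ 3) + (\<Sum>\<rho>\<in>?Z. \<Phi> b \<rho> * w b \<rho>)"
      using \<Phi> by (intro add_mono mult_right_mono) auto
    finally show "(\<Sum>\<rho>\<in>U. \<Phi> b \<rho> * w b \<rho>) \<le> 1 / real Q ^ 3 + (\<Sum>\<rho>\<in>?Z. \<Phi> b \<rho> * w b \<rho>)" by simp
  qed
  also have "\<dots> = 1 / real Q ^ 3 + avg ?I (\<lambda>b. \<Sum>\<rho>\<in>?Z. \<Phi> b \<rho> * w b \<rho>)"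
    by (simp add: avg_add avg_const)
  finally have "1 / (9 * real Q ^ 2) \<le> 1 / real Q ^ 3 + avg ?I (\<lambda>b. \<Sum>\<rho>\<in>?Z. \<Phi> b \<rho> * w b \<rho>)"
    by (simp add: power_divide power_mult_distrib)
  moreover have "2 / real Q ^ 3 \<le> 1 / 9 * (1 / real Q ^ 2)"
    using divide_power_le[OF q, of 18 1 2 3] by simp
  ultimately have main: "1 / real Q ^ 3 \<le> avg ?I (\<lambda>b. \<Sum>\<rho>\<in>?Z. \<Phi> b \<rho> * w b \<rho>)" by simp
  also have "\<dots> \<le> avg ?I (\<lambda>b. \<Sum>\<rho>\<in>?Z. \<Phi> b \<rho>)"
    using \<Phi> w by (intro avg_mono sum_mono) (simp add: mult_left_le)
  finally show "1 / real Q ^ 3 \<le> avg ?I (\<lambda>b. \<Sum>\<rho>\<in>?Z. (cmod (hat (F b) \<rho>))\<^sup>2)" by (simp add: \<Phi>_def)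
  have "avg ?I (\<lambda>b. \<Sum>\<rho>\<in>?Z. \<Phi> b \<rho> * w b \<rho>) \<le> avg ?I (\<lambda>b. \<Sum>\<rho>\<in>?Z. w b \<rho>)"
    using \<Phi> w by (intro avg_mono sum_mono) (simp add: mult_left_le_one_le)
  with main have s: "1 / real Q ^ 3 \<le> (\<Sum>\<rho>\<in>?Z. avg ?I (\<lambda>b. w b \<rho>))" by (simp add: avg_sum)
  have card: "real (card ?Z) \<le> real Q ^ 67"
  proof -
    have "card ?Z \<le> card {z\<in>U. major M (Q ^ 22) z}"
    proof (rule card_inj_on_le[where f = "\<lambda>\<rho>. (\<rho> + r) mod int P"])
      show "inj_on (\<lambda>\<rho>. (\<rho> + r) mod int P) ?Z"
        by (rule inj_on_subset[OF bij_betw_imp_inj_on[OF bij_shift]]) auto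
      show "(\<lambda>\<rho>. (\<rho> + r) mod int P) ` ?Z \<subseteq> {z\<in>U. major M (Q ^ 22) z}"
      proof (rule image_subsetI)
        fix \<rho> assume \<rho>: "\<rho> \<in> ?Z"
        have "(\<rho> + r) mod int P = (\<rho> + r) + int P * (- ((\<rho> + r) div int P))"
          by (simp add: minus_div_mult_eq_mod[symmetric] mult.commute)
        then have "major M (Q ^ 22) ((\<rho> + r) mod int P)" using \<rho> by (simp only: major_periodic) simp
        then show "(\<rho> + r) mod int P \<in> {z\<in>U. major M (Q ^ 22) z}" using P_pos by simp
      qed
      show "finite {z\<in>U. major M (Q ^ 22) z}" by (rule finite_subset[OF _ finite_U]) auto
    qed
    also have "\<dots> \<le> Q ^ 22 * (Q ^ 22 + 1) * (8 * Q ^ 22 + 1)" by (rule card_major_le[OF P])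
    also have "\<dots> \<le> Q ^ 22 * (2 * Q ^ 22) * (9 * Q ^ 22)"
      using Q by (intro mult_mono) auto
    also have "\<dots> = 18 * Q ^ 66" by (simp flip: power_add)
    finally have "real (card ?Z) \<le> real (18 * Q ^ 66)" by (simp only: of_nat_le_iff)
    also have "\<dots> \<le> real Q ^ 67" using mult_power_le[OF q, of 18 1 66 67] by simp
    finally show ?thesis .
  qed
  \<comment> \<open>At most Q^67 frequencies share a total of Q^-3, hence the threshold
    Q^-70.\<close>
  have "\<exists>\<rho>. 1 / real Q ^ 70 \<le> avg ?I (\<lambda>b. w b \<rho>)"
  proof (rule ccontr)
    assume "\<not> ?thesis"
    then have less: "avg ?I (\<lambda>b. w b \<rho>) < 1 / real Q ^ 70" for \<rho> by (auto simp: not_le)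
    have ne: "?Z \<noteq> {}"
    proof
      assume "?Z = {}"
      then have "1 / real Q ^ 3 \<le> 0" using s by (simp only: sum.empty)
      then show False using Q by (simp add: divide_le_0_iff)
    qed
    have "(\<Sum>\<rho>\<in>?Z. avg ?I (\<lambda>b. w b \<rho>)) < (\<Sum>\<rho>\<in>?Z. 1 / real Q ^ 70)"
      using ne less by (intro sum_strict_mono finite_subset[OF _ finite_U]) auto
    also have "\<dots> = real (card ?Z) / real Q ^ 70" by simp
    also have "\<dots> \<le> real Q ^ 67 / real Q ^ 70" using card by (rule divide_right_mono) simp
    also have "\<dots> = 1 / real Q ^ 3" by (rule power_quotient) (use Q in auto)
    finally show False using s by simp
  qed
  then obtain \<rho> where "1 / real (Q ^ 70) \<le> avg ?I (\<lambda>b. (cmod (weyl M J r b \<rho>))\<^sup>2)" by (auto simp: w_def)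
  then have "major M (2 ^ 32 * (Q ^ 70) ^ 6) r" using Q by (intro avg_weyl_major[OF J M]) auto
  moreover have "real (2 ^ 32 * (Q ^ 70) ^ 6) \<le> real (Q ^ 424)"
    using mult_power_le[OF q, of "2 ^ 32" 4 420 424] by (simp flip: power_mult)
  then have "2 ^ 32 * (Q ^ 70) ^ 6 \<le> Q ^ 424" by (simp only: of_nat_le_iff)
  ultimately show "major M (Q ^ 424) r" by (rule major_mono)
qed

end

subsection \<open>From the third uniformity norm of a dual function to its Fourier coefficients\<close>

context cyclic
begin

text \<open>The function that represents the functional G |-> \<open>lam M J g F G\<close>, obtained
  by moving the point s'^2 of G to the origin; see \<open>avg_dual\<close>.\<close>

definition dual :: "nat \<Rightarrow> int set \<Rightarrow> (int \<Rightarrow> int \<Rightarrow> complex) \<Rightarrow> (int \<Rightarrow> int \<Rightarrow> complex) \<Rightarrow> int \<Rightarrow> complex" where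
  "dual M J g F z = (\<Sum>s\<in>J. \<Sum>s'\<in>J. g (s' - s) (z - s'\<^sup>2) * F (s' - s) (z - s'\<^sup>2 + s\<^sup>2)) / (of_nat M)\<^sup>2"

lemma avg_dual:
  assumes g: "\<And>b. adm (g b)" and F: "\<And>b. adm (F b)" and G: "adm G"
  shows "A (\<lambda>z. dual M J g F z * G z) = lam M J g F G"
proof -
  define e where "e s s' y = g (s' - s) y * F (s' - s) (y + s\<^sup>2) * G (y + s'\<^sup>2)" for s s' y
  have adm: "adm (e s s')" for s s' unfolding e_def[abs_def] by (intro adm_mult adm_shift g F G)
  have "A (\<lambda>z. dual M J g F z * G z) = A (\<lambda>z. (\<Sum>s\<in>J. \<Sum>s'\<in>J. e s s' (z + (- s'\<^sup>2))) / (of_nat M)\<^sup>2)"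
    by (rule avg_cong) (simp add: dual_def e_def sum_distrib_right)
  also have "\<dots> = (\<Sum>s\<in>J. \<Sum>s'\<in>J. A (\<lambda>z. e s s' (z + (- s'\<^sup>2)))) / (of_nat M)\<^sup>2"
    by (simp only: divide_inverse avg_multc avg_sum)
  also have "\<dots> = (\<Sum>s\<in>J. \<Sum>s'\<in>J. A (e s s')) / (of_nat M)\<^sup>2"
    by (simp only: A_shift[OF adm_per[OF adm]])
  finally show ?thesis by (simp add: lam_def e_def[abs_def])
qed

lemma adm_dual:
  assumes g: "\<And>b. adm (g b)" and F: "\<And>b. adm (F b)" and J: "ivl M J"
  shows "adm (dual M J g F)"
proof (rule admI)
  fix y
  have g': "g b (y + int P - z) = g b (y - z)" for b z
    using perD[OF adm_per[OF g[of b]], of "y - z"] by (simp add: algebra_simps)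
  have F': "F b (y + int P - z + w) = F b (y - z + w)" for b z w
    using perD[OF adm_per[OF F[of b]], of "y - z + w"] by (simp add: algebra_simps)
  show "dual M J g F (y + int P) = dual M J g F y" by (simp add: dual_def g' F')
  have c: "real (card J) \<le> M" using ivl_card[OF J] by simp
  have "cmod (\<Sum>s\<in>J. \<Sum>s'\<in>J. g (s' - s) (y - s'\<^sup>2) * F (s' - s) (y - s'\<^sup>2 + s\<^sup>2)) \<le> real (card J) * (real (card J) * 1)"
    by (intro sum_norm_bound) (simp add: norm_mult mult_le_one adm_norm[OF g] adm_norm[OF F])
  also have "\<dots> \<le> real M * (real M * 1)" using c by (intro mult_mono) auto
  also have "\<dots> = (real M)\<^sup>2" by (simp add: power2_eq_square)
  finally show "cmod (dual M J g F y) \<le> 1"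
    unfolding dual_def norm_divide norm_power norm_of_nat by (simp add: divide_le_eq)
qed

lemma A_chr: "A (\<lambda>h. chr k h) = (if k mod int P = 0 then 1 else 0)"
proof -
  have "(\<Sum>h\<in>U. chr k h) = (\<Sum>h\<in>U. chr h k)" by (intro sum.cong refl chr_commute)
  then show ?thesis using P_pos by (simp add: avg_def sum_chr)
qed

lemma correlation_spec:
  assumes u: "adm u" and v: "adm v"
  shows "A (\<lambda>h. (cmod (A (\<lambda>y. u y * cnj (v (y + h)))))\<^sup>2) = (\<Sum>r\<in>U. (cmod (hat u r))\<^sup>2 * (cmod (hat v r))\<^sup>2)"
proof -
  define c where "c r = hat u r * cnj (hat v r)" for r
  have e: "A (\<lambda>y. u y * cnj (v (y + h))) = (\<Sum>r\<in>U. c r * cnj (chr r h))" for h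
  proof -
    have "A (\<lambda>y. u y * cnj (v (y + h))) = (\<Sum>r\<in>U. hat u r * cnj (hat (\<lambda>y. v (y + h)) r))"
      by (rule parseval2[OF adm_per[OF u] adm_per[OF adm_shift[OF v]]])
    then show ?thesis by (simp add: hat_shift[OF adm_per[OF v]] c_def mult_ac)
  qed
  have "complex_of_real (A (\<lambda>h. (cmod (\<Sum>r\<in>U. c r * cnj (chr r h)))\<^sup>2))
      = A (\<lambda>h. \<Sum>r\<in>U. \<Sum>r'\<in>U. (c r * cnj (c r')) * chr (r' - r) h)"
    unfolding avg_of_real[symmetric] norm_sum_square
  proof (intro avg_cong sum.cong refl)
    fix h r r'
    have "chr (r' - r) h = chr r' h * cnj (chr r h)"
      unfolding diff_conv_add_uminus[of r' r] chr_add_left cnj_chr(2) ..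
    then show "c r * cnj (chr r h) * cnj (c r' * cnj (chr r' h)) = c r * cnj (c r') * chr (r' - r) h"
      by simp
  qed
  also have "\<dots> = (\<Sum>r\<in>U. \<Sum>r'\<in>U. (c r * cnj (c r')) * (if (r' - r) mod int P = 0 then 1 else 0))"
    by (simp only: avg_sum avg_cmult A_chr)
  also have "\<dots> = (\<Sum>r\<in>U. \<Sum>r'\<in>U. if r' = r then c r * cnj (c r) else 0)"
  proof (intro sum.cong refl)
    fix r r' assume "r \<in> U" "r' \<in> U"
    then have "(r' - r) mod int P = 0 \<longleftrightarrow> r' = r"
      unfolding mod_eq_0_iff_dvd mod_eq_dvd_iff[symmetric] by simp
    then show "(c r * cnj (c r')) * (if (r' - r) mod int P = 0 then 1 else 0) = (if r' = r then c r * cnj (c r) else 0)"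
      by simp
  qed
  also have "\<dots> = complex_of_real (\<Sum>r\<in>U. (cmod (hat u r))\<^sup>2 * (cmod (hat v r))\<^sup>2)"
  proof -
    have "c x * cnj (c x) = complex_of_real ((cmod (hat u x))\<^sup>2 * (cmod (hat v x))\<^sup>2)" for x
      unfolding of_real_mult complex_norm_square by (simp add: c_def mult_ac)
    then show ?thesis using finite_U by (simp only: sum.delta' sum.delta of_real_sum) simp
  qed
  finally show ?thesis unfolding e by (simp only: of_real_eq_iff)
qed

text \<open>The inverse theorem for the second uniformity norm, in a bilinear form: the mean square
  correlation is a sum of products of power spectra, at most the largest coefficient of one factor
  times the total mass of the other.\<close>

lemma correlation_le_hat:
  assumes u: "adm u" and v: "adm v"
  shows "\<exists>r\<in>U. A (\<lambda>h. (cmod (A (\<lambda>y. u y * cnj (v (y + h)))))\<^sup>2) \<le> (cmod (hat v r))\<^sup>2"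
proof -
  define S where "S = (\<lambda>r. (cmod (hat v r))\<^sup>2) ` U"
  have S: "finite S" "S \<noteq> {}" using finite_U U_ne by (auto simp: S_def)
  from Max_in[OF S] obtain r where r: "r \<in> U" "Max S = (cmod (hat v r))\<^sup>2" by (auto simp: S_def)
  have "(\<Sum>r'\<in>U. (cmod (hat u r'))\<^sup>2 * (cmod (hat v r'))\<^sup>2) \<le> (\<Sum>r'\<in>U. (cmod (hat u r'))\<^sup>2 * Max S)"
    using S by (intro sum_mono mult_left_mono Max_ge) (auto simp: S_def)
  also have "\<dots> \<le> 1 * Max S"
    unfolding sum_distrib_right[symmetric] by (rule mult_right_mono[OF sum_hat_le[OF u]]) (simp add: r)
  finally show ?thesis unfolding correlation_spec[OF u v] using r by auto
qed

text \<open>In D(y) cnj D(y + h) only the second copy is unfolded as an average over p = (s, s').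
  Cauchy-Schwarz over (p, y) then removes D(y) and doubles h into h, h'. Summed over p, the result
  is again a counting operator, with multiplicative derivatives as weights and a character of
  frequency r h' - r h.\<close>

lemma dual_cross_correlation:
  fixes c :: "int \<Rightarrow> complex" and r :: "int \<Rightarrow> int"
  assumes g: "\<And>b. adm (g b)" and F: "\<And>b. adm (F b)" and J: "ivl M J"
    and c: "\<And>h. c h = hat (dif h (dual M J g F)) (r h)"
  shows "(A (\<lambda>h. (cmod (c h))\<^sup>2))\<^sup>2 \<le> A (\<lambda>h'. A (\<lambda>h. cmod (c h) *
    cmod (lam M J (\<lambda>b x. g b (x + h') * cnj (g b (x + h))) (\<lambda>b x. F b (x + h') * cnj (F b (x + h))) (chr (r h' - r h)))))"
proof -
  let ?D = "dual M J g F"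
  have D: "adm ?D" by (rule adm_dual[OF g F J])
  have c1: "cmod (c h) \<le> 1" for h unfolding c by (rule norm_hat_le[OF adm_dif[OF D]])
  have cJ: "real (card J) \<le> M" using ivl_card[OF J] by simp
  define \<phi> where "\<phi> p y = g (snd p - fst p) (y - (snd p)\<^sup>2) * F (snd p - fst p) (y - (snd p)\<^sup>2 + (fst p)\<^sup>2)" for p y
  have \<phi>: "?D y = (\<Sum>p\<in>J \<times> J. \<phi> p y) / (of_nat M)\<^sup>2" for y
    by (simp add: dual_def \<phi>_def sum.cartesian_product case_prod_unfold)
  \<comment> \<open>Collects everything that depends on h; D(y) is the only factor left outside,
    ready to be discarded.\<close>
  define Z where "Z p y = A (\<lambda>h. cnj (c h) * cnj (\<phi> p (y + h)) * cnj (chr (r h) y))" for p y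
  define X where "X p = A (\<lambda>y. ?D y * Z p y)" for p
  define G where "G h h' = (\<lambda>b x. g b (x + h') * cnj (g b (x + h)))" for h h'
  define F' where "F' h h' = (\<lambda>b x. F b (x + h') * cnj (F b (x + h)))" for h h'
  have G: "adm (G h h' b)" and F': "adm (F' h h' b)" for h h' b
    unfolding G_def F'_def by (intro adm_mult adm_cnj adm_shift g F)+
  have "complex_of_real (A (\<lambda>h. (cmod (c h))\<^sup>2)) = A (\<lambda>h. cnj (c h) * c h)"
    unfolding avg_of_real[symmetric] complex_norm_square by (simp only: mult.commute)
  also have "\<dots> = A (\<lambda>h. A (\<lambda>y. \<Sum>p\<in>J \<times> J. ?D y * (cnj (c h) * cnj (\<phi> p (y + h)) * cnj (chr (r h) y)) / (of_nat M)\<^sup>2))"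
  proof (rule avg_cong)
    fix h
    have "c h = A (\<lambda>y. dif h ?D y * cnj (chr (r h) y))" by (simp only: c hat_def)
    then have "cnj (c h) * c h = A (\<lambda>y. cnj (c h) * (dif h ?D y * cnj (chr (r h) y)))" by (simp only: avg_cmult)
    also have "\<dots> = A (\<lambda>y. \<Sum>p\<in>J \<times> J. ?D y * (cnj (c h) * cnj (\<phi> p (y + h)) * cnj (chr (r h) y)) / (of_nat M)\<^sup>2)"
    proof (rule avg_cong)
      fix y
      have "cnj (?D (y + h)) = (\<Sum>p\<in>J \<times> J. cnj (\<phi> p (y + h))) / (of_nat M)\<^sup>2" unfolding \<phi> by simp
      then have "cnj (c h) * (dif h ?D y * cnj (chr (r h) y))
          = (?D y * cnj (c h) * cnj (chr (r h) y) / (of_nat M)\<^sup>2) * (\<Sum>p\<in>J \<times> J. cnj (\<phi> p (y + h)))"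
        by (simp add: dif_def)
      also have "\<dots> = (\<Sum>p\<in>J \<times> J. ?D y * (cnj (c h) * cnj (\<phi> p (y + h)) * cnj (chr (r h) y)) / (of_nat M)\<^sup>2)"
        unfolding sum_distrib_left by (rule sum.cong) (auto simp: mult_ac)
      finally show "cnj (c h) * (dif h ?D y * cnj (chr (r h) y))
          = (\<Sum>p\<in>J \<times> J. ?D y * (cnj (c h) * cnj (\<phi> p (y + h)) * cnj (chr (r h) y)) / (of_nat M)\<^sup>2)" .
    qed
    finally show "cnj (c h) * c h = A (\<lambda>y. \<Sum>p\<in>J \<times> J. ?D y * (cnj (c h) * cnj (\<phi> p (y + h)) * cnj (chr (r h) y)) / (of_nat M)\<^sup>2)" .
  qed
  also have "\<dots> = A (\<lambda>y. A (\<lambda>h. \<Sum>p\<in>J \<times> J. ?D y * (cnj (c h) * cnj (\<phi> p (y + h)) * cnj (chr (r h) y)) / (of_nat M)\<^sup>2))"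
    by (rule avg_swap)
  also have "\<dots> = (\<Sum>p\<in>J \<times> J. X p) / (of_nat M)\<^sup>2"
    by (simp only: divide_inverse avg_sum avg_multc avg_cmult X_def Z_def sum_distrib_right)
  finally have main: "complex_of_real (A (\<lambda>h. (cmod (c h))\<^sup>2)) = (\<Sum>p\<in>J \<times> J. X p) / (of_nat M)\<^sup>2" .
  have XZ: "(cmod (X p))\<^sup>2 \<le> A (\<lambda>y. (cmod (Z p y))\<^sup>2)" for p
    unfolding X_def by (rule norm_avg_mult_power2_le) (rule adm_norm[OF D])
  have "0 \<le> A (\<lambda>h. (cmod (c h))\<^sup>2)" by (rule avg_nonneg) simp
  then have "A (\<lambda>h. (cmod (c h))\<^sup>2) = cmod (complex_of_real (A (\<lambda>h. (cmod (c h))\<^sup>2)))" by simp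
  then have "A (\<lambda>h. (cmod (c h))\<^sup>2) \<le> (\<Sum>p\<in>J \<times> J. cmod (X p)) / (real M)\<^sup>2"
    unfolding main norm_divide norm_power norm_of_nat by (simp add: divide_right_mono norm_sum)
  then have "(A (\<lambda>h. (cmod (c h))\<^sup>2))\<^sup>2 \<le> ((\<Sum>p\<in>J \<times> J. cmod (X p)) / (real M)\<^sup>2)\<^sup>2"
    by (rule power_mono) (rule avg_nonneg, simp)
  also have "\<dots> \<le> (\<Sum>p\<in>J \<times> J. (cmod (X p))\<^sup>2) / (real M)\<^sup>2"
  proof -
    have "(\<Sum>p\<in>J \<times> J. cmod (X p))\<^sup>2 \<le> (\<Sum>p\<in>J \<times> J. (cmod (X p))\<^sup>2) * card (J \<times> J)"
      by (rule sum_squared_le_sum_of_squares)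
    also have "\<dots> \<le> (\<Sum>p\<in>J \<times> J. (cmod (X p))\<^sup>2) * (real M)\<^sup>2"
      using cJ by (intro mult_left_mono sum_nonneg) (auto simp: card_cartesian_product power2_eq_square intro!: mult_mono)
    finally have "(\<Sum>p\<in>J \<times> J. cmod (X p))\<^sup>2 / ((real M)\<^sup>2 * (real M)\<^sup>2) \<le> (\<Sum>p\<in>J \<times> J. (cmod (X p))\<^sup>2) * (real M)\<^sup>2 / ((real M)\<^sup>2 * (real M)\<^sup>2)"
      by (rule divide_right_mono) simp
    then show ?thesis by (cases "M = 0") (simp_all add: power_divide power2_eq_square)
  qed
  also have "\<dots> \<le> (\<Sum>p\<in>J \<times> J. A (\<lambda>y. (cmod (Z p y))\<^sup>2)) / (real M)\<^sup>2"
    by (intro divide_right_mono sum_mono XZ) simp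
  finally have le: "(A (\<lambda>h. (cmod (c h))\<^sup>2))\<^sup>2 \<le> (\<Sum>p\<in>J \<times> J. A (\<lambda>y. (cmod (Z p y))\<^sup>2)) / (real M)\<^sup>2" .
  have Z2: "complex_of_real (A (\<lambda>y. (cmod (Z p y))\<^sup>2))
      = A (\<lambda>h'. A (\<lambda>h. c h' * cnj (c h) * A (\<lambda>y. (\<phi> p (y + h') * cnj (\<phi> p (y + h))) * chr (r h' - r h) y)))" for p
  proof -
    have "complex_of_real ((cmod (Z p y))\<^sup>2) = A (\<lambda>h'. A (\<lambda>h. c h' * cnj (c h) * ((\<phi> p (y + h') * cnj (\<phi> p (y + h))) * chr (r h' - r h) y)))" for y
    proof -
      have "complex_of_real ((cmod (Z p y))\<^sup>2) = cnj (Z p y) * Z p y" by (simp only: complex_norm_square mult.commute)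
      also have "\<dots> = A (\<lambda>h'. A (\<lambda>h. cnj (cnj (c h') * cnj (\<phi> p (y + h')) * cnj (chr (r h') y)) * (cnj (c h) * cnj (\<phi> p (y + h)) * cnj (chr (r h) y))))"
        unfolding Z_def avg_cnj[symmetric] avg_multc[symmetric] avg_cmult[symmetric] by (rule avg_swap)
      also have "\<dots> = A (\<lambda>h'. A (\<lambda>h. c h' * cnj (c h) * ((\<phi> p (y + h') * cnj (\<phi> p (y + h))) * chr (r h' - r h) y)))"
      proof (intro avg_cong)
        fix h' h
        have "chr (r h' - r h) y = chr (r h') y * cnj (chr (r h) y)"
          unfolding diff_conv_add_uminus[of "r h'" "r h"] chr_add_left cnj_chr(2) ..
        then show "cnj (cnj (c h') * cnj (\<phi> p (y + h')) * cnj (chr (r h') y)) * (cnj (c h) * cnj (\<phi> p (y + h)) * cnj (chr (r h) y))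
          = c h' * cnj (c h) * ((\<phi> p (y + h') * cnj (\<phi> p (y + h))) * chr (r h' - r h) y)" by simp
      qed
      finally show ?thesis .
    qed
    then have "complex_of_real (A (\<lambda>y. (cmod (Z p y))\<^sup>2))
        = A (\<lambda>y. A (\<lambda>h'. A (\<lambda>h. c h' * cnj (c h) * ((\<phi> p (y + h') * cnj (\<phi> p (y + h))) * chr (r h' - r h) y))))"
      unfolding avg_of_real[symmetric] by simp
    also have "\<dots> = A (\<lambda>h'. A (\<lambda>y. A (\<lambda>h. c h' * cnj (c h) * ((\<phi> p (y + h') * cnj (\<phi> p (y + h))) * chr (r h' - r h) y))))"
      by (rule avg_swap)
    also have "\<dots> = A (\<lambda>h'. A (\<lambda>h. A (\<lambda>y. c h' * cnj (c h) * ((\<phi> p (y + h') * cnj (\<phi> p (y + h))) * chr (r h' - r h) y))))"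
      by (rule avg_cong, rule avg_swap)
    finally show ?thesis by (simp only: avg_cmult)
  qed
  have lamG: "(\<Sum>p\<in>J \<times> J. A (\<lambda>y. (\<phi> p (y + h') * cnj (\<phi> p (y + h))) * chr k y)) / (of_nat M)\<^sup>2 = lam M J (G h h') (F' h h') (chr k)" for h h' k
  proof -
    have "lam M J (G h h') (F' h h') (chr k) = A (\<lambda>z. dual M J (G h h') (F' h h') z * chr k z)"
      by (rule avg_dual[symmetric]) (rule G F' adm_chr)+
    also have "\<dots> = A (\<lambda>z. (\<Sum>p\<in>J \<times> J. (\<phi> p (z + h') * cnj (\<phi> p (z + h))) * chr k z) / (of_nat M)\<^sup>2)"
    proof (rule avg_cong)
      fix z
      have "dual M J (G h h') (F' h h') z = (\<Sum>p\<in>J \<times> J. \<phi> p (z + h') * cnj (\<phi> p (z + h))) / (of_nat M)\<^sup>2"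
        unfolding dual_def sum.cartesian_product case_prod_unfold
        by (intro arg_cong2[where f = "(/)"] sum.cong refl) (simp add: \<phi>_def G_def F'_def algebra_simps)
      then show "dual M J (G h h') (F' h h') z * chr k z = (\<Sum>p\<in>J \<times> J. (\<phi> p (z + h') * cnj (\<phi> p (z + h))) * chr k z) / (of_nat M)\<^sup>2"
        by (simp add: sum_distrib_right)
    qed
    also have "\<dots> = (\<Sum>p\<in>J \<times> J. A (\<lambda>y. (\<phi> p (y + h') * cnj (\<phi> p (y + h))) * chr k y)) / (of_nat M)\<^sup>2"
      by (simp only: divide_inverse avg_multc avg_sum)
    finally show ?thesis by (rule sym)
  qed
  have "complex_of_real ((\<Sum>p\<in>J \<times> J. A (\<lambda>y. (cmod (Z p y))\<^sup>2)) / (real M)\<^sup>2)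
      = (\<Sum>p\<in>J \<times> J. A (\<lambda>h'. A (\<lambda>h. c h' * cnj (c h) * A (\<lambda>y. (\<phi> p (y + h') * cnj (\<phi> p (y + h))) * chr (r h' - r h) y)))) / (of_nat M)\<^sup>2"
    by (simp add: Z2[symmetric])
  also have "\<dots> = A (\<lambda>h'. A (\<lambda>h. c h' * cnj (c h) * lam M J (G h h') (F' h h') (chr (r h' - r h))))"
    unfolding lamG[symmetric] times_divide_eq_right sum_distrib_left by (simp only: divide_inverse avg_sum avg_multc)
  finally have eq: "complex_of_real ((\<Sum>p\<in>J \<times> J. A (\<lambda>y. (cmod (Z p y))\<^sup>2)) / (real M)\<^sup>2)
      = A (\<lambda>h'. A (\<lambda>h. c h' * cnj (c h) * lam M J (G h h') (F' h h') (chr (r h' - r h))))" .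
  have "(\<Sum>p\<in>J \<times> J. A (\<lambda>y. (cmod (Z p y))\<^sup>2)) / (real M)\<^sup>2 \<le> cmod (complex_of_real ((\<Sum>p\<in>J \<times> J. A (\<lambda>y. (cmod (Z p y))\<^sup>2)) / (real M)\<^sup>2))"
    unfolding norm_of_real by (rule abs_ge_self)
  also have "\<dots> \<le> A (\<lambda>h'. A (\<lambda>h. cmod (c h' * cnj (c h) * lam M J (G h h') (F' h h') (chr (r h' - r h)))))"
    unfolding eq by (rule order.trans[OF norm_avg_le avg_mono[OF norm_avg_le]])
  \<comment> \<open>Only |c h'| is bounded by 1. The factor |c h| is kept, since it later becomes a
    correlation at one fixed frequency.\<close>
  also have "\<dots> \<le> A (\<lambda>h'. A (\<lambda>h. cmod (c h) * cmod (lam M J (G h h') (F' h h') (chr (r h' - r h)))))"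
  proof (intro avg_mono)
    fix h' h
    have "cmod (c h') * (cmod (c h) * cmod (lam M J (G h h') (F' h h') (chr (r h' - r h)))) \<le> 1 * (cmod (c h) * cmod (lam M J (G h h') (F' h h') (chr (r h' - r h))))"
      using c1 by (intro mult_right_mono) auto
    then show "cmod (c h' * cnj (c h) * lam M J (G h h') (F' h h') (chr (r h' - r h)))
        \<le> cmod (c h) * cmod (lam M J (G h h') (F' h h') (chr (r h' - r h)))" by (simp add: norm_mult mult.assoc)
  qed
  finally show ?thesis using le unfolding G_def F'_def by linarith
qed

text \<open>Each derivative of D has a large coefficient at some r h. By the cross correlation and
  \<open>lam_chr_major\<close>, r h' - r h is major for many h and one fixed h'. Few values are
  possible, so one frequency r0 serves many h; D times a character then correlates with many
  translates of D, and the second-norm inverse theorem applies.\<close>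

lemma dual_large_hat:
  assumes g: "\<And>b. adm (g b)" and F: "\<And>b. adm (F b)" and J: "ivl M J" and P: "P = 4 * M\<^sup>2"
    and Q: "1024 \<le> Q" and U3: "1 / real Q \<le> U3 (dual M J g F)"
  shows "\<exists>\<rho>. 1 / real Q ^ 3820 \<le> cmod (hat (dual M J g F) \<rho>)"
proof -
  let ?D = "dual M J g F"
  have D: "adm ?D" by (rule adm_dual[OF g F J])
  have q: "1024 \<le> real Q" using Q by simp
  have "\<forall>h. \<exists>r. A (\<lambda>k. (cmod (A (dif k (dif h ?D))))\<^sup>2) \<le> (cmod (hat (dif h ?D) r))\<^sup>2"
  proof
    fix h
    have "A (\<lambda>k. (cmod (A (dif k (dif h ?D))))\<^sup>2) = A (\<lambda>k. (cmod (A (\<lambda>y. dif h ?D y * cnj (dif h ?D (y + k)))))\<^sup>2)"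
      unfolding dif_def[of _ "dif h ?D", abs_def] ..
    then show "\<exists>r. A (\<lambda>k. (cmod (A (dif k (dif h ?D))))\<^sup>2) \<le> (cmod (hat (dif h ?D) r))\<^sup>2"
      using correlation_le_hat[OF adm_dif[OF D, of h] adm_dif[OF D, of h]] by auto
  qed
  then have "\<exists>r. \<forall>h. A (\<lambda>k. (cmod (A (dif k (dif h ?D))))\<^sup>2) \<le> (cmod (hat (dif h ?D) (r h)))\<^sup>2"
    by (rule choice)
  then obtain r where r: "\<forall>h. A (\<lambda>k. (cmod (A (dif k (dif h ?D))))\<^sup>2) \<le> (cmod (hat (dif h ?D) (r h)))\<^sup>2"
    by (rule exE)
  define c where "c h = hat (dif h ?D) (r h)" for h
  have c1: "cmod (c h) \<le> 1" for h unfolding c_def by (rule norm_hat_le[OF adm_dif[OF D]])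
  define G where "G h h' = (\<lambda>b x. g b (x + h') * cnj (g b (x + h)))" for h h'
  define F' where "F' h h' = (\<lambda>b x. F b (x + h') * cnj (F b (x + h)))" for h h'
  have G: "adm (G h h' b)" and F': "adm (F' h h' b)" for h h' b
    unfolding G_def F'_def by (intro adm_mult adm_cnj adm_shift g F)+
  have "1 / real Q \<le> A (\<lambda>h. (cmod (c h))\<^sup>2)"
    using U3 unfolding U3_def c_def by (rule order.trans) (rule avg_mono, rule r[rule_format])
  then have "(1 / real Q)\<^sup>2 \<le> (A (\<lambda>h. (cmod (c h))\<^sup>2))\<^sup>2" by (rule power_mono) simp
  also have "\<dots> \<le> A (\<lambda>h'. A (\<lambda>h. cmod (c h) * cmod (lam M J (G h h') (F' h h') (chr (r h' - r h)))))"
    unfolding G_def F'_def by (rule dual_cross_correlation[OF g F J c_def])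
  finally obtain h' where h': "(1 / real Q)\<^sup>2 \<le> A (\<lambda>h. cmod (c h) * cmod (lam M J (G h h') (F' h h') (chr (r h' - r h))))"
    using avg_le_ex[OF finite_U U_ne, of "\<lambda>h'. A (\<lambda>h. cmod (c h) * cmod (lam M J (G h h') (F' h h') (chr (r h' - r h))))"]
    by (meson order.trans)
  define N where "N = Q ^ 1272"
  define Z where "Z = {z\<in>U. major M N z}"
  have finZ: "finite Z" unfolding Z_def by (rule finite_subset[OF _ finite_U]) auto
  \<comment> \<open>Sorts the h by the residue of r h' - r h, keeping the weight |c h|.\<close>
  define w where "w h z = (if z = (r h' - r h) mod int P then cmod (c h) else 0)" for h z
  have w0: "0 \<le> w h z" for h z by (simp add: w_def)
  have lam1: "cmod (lam M J (G h h') (F' h h') (chr k)) \<le> 1" for h k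
  proof -
    have "cmod (lam M J (G h h') (F' h h') (chr k)) = cmod (A (\<lambda>z. dual M J (G h h') (F' h h') z * chr k z))"
      by (simp only: avg_dual[OF G F' adm_chr])
    also have "\<dots> \<le> 1"
      by (rule norm_avg_le1) (rule adm_norm[OF adm_mult[OF adm_dual[OF G F' J] adm_chr]])
    finally show ?thesis .
  qed
  have "cmod (c h) * cmod (lam M J (G h h') (F' h h') (chr (r h' - r h))) \<le> 1 / real Q ^ 3 + (\<Sum>z\<in>Z. w h z)" for h
  proof (cases "cmod (lam M J (G h h') (F' h h') (chr (r h' - r h))) \<le> 1 / real Q ^ 3")
    case True
    have "cmod (c h) * cmod (lam M J (G h h') (F' h h') (chr (r h' - r h))) \<le> 1 * (1 / real Q ^ 3)"
      using c1 True by (intro mult_mono) auto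
    moreover have "0 \<le> (\<Sum>z\<in>Z. w h z)" by (intro sum_nonneg w0)
    ultimately show ?thesis by linarith
  next
    case False
    then have "1 / real (Q ^ 3) \<le> cmod (lam M J (G h h') (F' h h') (chr (r h' - r h)))" by simp
    moreover have "1024 \<le> Q ^ 3" using order.trans[OF Q self_le_power[of Q 3]] Q by simp
    ultimately have "major M ((Q ^ 3) ^ 424) (r h' - r h)"
      by (intro lam_chr_major(1)[OF G F' J P])
    then have "major M N (r h' - r h)" by (simp add: N_def flip: power_mult)
    moreover have "(r h' - r h) mod int P = (r h' - r h) + int P * (- ((r h' - r h) div int P))"
      by (simp add: minus_div_mult_eq_mod[symmetric] mult.commute)
    ultimately have "major M N ((r h' - r h) mod int P)" by (simp only: major_periodic)
    then have z: "(r h' - r h) mod int P \<in> Z" using P_pos by (simp add: Z_def)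
    have "cmod (c h) * cmod (lam M J (G h h') (F' h h') (chr (r h' - r h))) \<le> cmod (c h) * 1"
      by (intro mult_left_mono lam1) simp
    also have "\<dots> = w h ((r h' - r h) mod int P)" by (simp add: w_def)
    also have "\<dots> \<le> (\<Sum>z\<in>Z. w h z)" by (rule member_le_sum[OF z w0 finZ])
    finally show ?thesis by (simp add: add_increasing)
  qed
  then have "A (\<lambda>h. cmod (c h) * cmod (lam M J (G h h') (F' h h') (chr (r h' - r h)))) \<le> A (\<lambda>h. 1 / real Q ^ 3 + (\<Sum>z\<in>Z. w h z))"
    by (intro avg_mono)
  also have "\<dots> = 1 / real Q ^ 3 + (\<Sum>z\<in>Z. A (\<lambda>h. w h z))" by (simp add: avg_add avg_sum)
  finally have "1 / real Q ^ 2 \<le> 1 / real Q ^ 3 + (\<Sum>z\<in>Z. A (\<lambda>h. w h z))" using h' by (simp add: power_divide)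
  moreover have "2 / real Q ^ 3 \<le> 1 / real Q ^ 2" by (rule divide_power_le[OF q, of _ 1]) auto
  ultimately have s: "1 / real Q ^ 3 \<le> (\<Sum>z\<in>Z. A (\<lambda>h. w h z))" by simp
  have card: "real (card Z) \<le> real Q ^ 3817"
  proof -
    have "card Z \<le> N * (N + 1) * (8 * N + 1)" unfolding Z_def by (rule card_major_le[OF P])
    also have "\<dots> \<le> N * (2 * N) * (9 * N)" using Q by (intro mult_mono) (auto simp: N_def)
    also have "\<dots> = 18 * Q ^ 3816" by (simp add: N_def flip: power_add)
    finally have "real (card Z) \<le> real (18 * Q ^ 3816)" by (simp only: of_nat_le_iff)
    also have "\<dots> \<le> real Q ^ 3817" using mult_power_le[OF q, of 18 1 3816 3817] by simp
    finally show ?thesis .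
  qed
  have "\<exists>z. 1 / real Q ^ 3820 \<le> A (\<lambda>h. w h z)"
  proof (rule ccontr)
    assume "\<not> ?thesis"
    then have less: "A (\<lambda>h. w h z) \<le> 1 / real Q ^ 3820" "A (\<lambda>h. w h z) \<noteq> 1 / real Q ^ 3820" for z
      by (auto simp: not_le less_le)
    have ne: "Z \<noteq> {}" using s Q by auto
    have "(\<Sum>z\<in>Z. A (\<lambda>h. w h z)) < (\<Sum>z\<in>Z. 1 / real Q ^ 3820)"
      using ne less finZ by (intro sum_strict_mono) (simp_all add: less_le)
    also have "\<dots> = real (card Z) / real Q ^ 3820" by simp
    also have "\<dots> \<le> real Q ^ 3817 / real Q ^ 3820" using card by (rule divide_right_mono) simp
    also have "\<dots> = 1 / real Q ^ 3" by (rule power_quotient) (use Q in auto)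
    finally show False using s by simp
  qed
  then obtain z where z: "1 / real Q ^ 3820 \<le> A (\<lambda>h. w h z)" by blast
  \<comment> \<open>The frequency shared by the selected h. Replacing r h by the constant r0 makes
    the derivative coefficient an ordinary correlation of \<open>u\<close> with a translate of
    D.\<close>
  define r0 where "r0 = r h' - z"
  define u where "u y = ?D y * cnj (chr r0 y)" for y
  have u: "adm u" unfolding u_def[abs_def] by (intro adm_mult adm_cnj D adm_chr)
  have "1 / real Q ^ 3820 \<le> A (\<lambda>h. cmod (A (\<lambda>y. u y * cnj (?D (y + h)))))"
  proof (rule order.trans[OF z], rule avg_mono)
    fix h
    have e: "A (\<lambda>y. u y * cnj (?D (y + h))) = hat (dif h ?D) r0"
      unfolding hat_def by (rule avg_cong) (simp add: u_def dif_def)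
    show "w h z \<le> cmod (A (\<lambda>y. u y * cnj (?D (y + h))))"
    proof (cases "z = (r h' - r h) mod int P")
      case True
      then have "r0 = r h + int P * ((r h' - r h) div int P)"
        using mult_div_mod_eq[of "int P" "r h' - r h"] unfolding r0_def True by linarith
      then have "hat (dif h ?D) r0 = c h" by (simp only: hat_periodic c_def)
      then show ?thesis unfolding e by (simp add: w_def)
    qed (simp add: w_def)
  qed
  then have "(1 / real Q ^ 3820)\<^sup>2 \<le> (A (\<lambda>h. cmod (A (\<lambda>y. u y * cnj (?D (y + h))))))\<^sup>2"
    by (rule power_mono) simp
  also have "\<dots> \<le> A (\<lambda>h. (cmod (A (\<lambda>y. u y * cnj (?D (y + h)))))\<^sup>2)" by (rule avg_power2_le)
  finally have "(1 / real Q ^ 3820)\<^sup>2 \<le> A (\<lambda>h. (cmod (A (\<lambda>y. u y * cnj (?D (y + h)))))\<^sup>2)" .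
  then obtain \<rho> where "(1 / real Q ^ 3820)\<^sup>2 \<le> (cmod (hat ?D \<rho>))\<^sup>2"
    using correlation_le_hat[OF u D] by (meson order.trans)
  then have "1 / real Q ^ 3820 \<le> cmod (hat ?D \<rho>)" by (rule power2_le_imp_le) simp
  then show ?thesis ..
qed

text \<open>The product of the two denominators serves both frequencies; each error is multiplied by
  the other denominator, and two such terms add up.\<close>

lemma major_diff:
  assumes "major M N a" "major M N' b"
  shows "major M (2 * N * N') (a - b)"
proof -
  obtain n where n: "0 < n" "n \<le> N" "nint (of_nat n * (of_int a / of_nat P)) \<le> N / (real M)\<^sup>2"
    using assms(1) unfolding major_def by blast
  obtain n' where n': "0 < n'" "n' \<le> N'" "nint (of_nat n' * (of_int b / of_nat P)) \<le> N' / (real M)\<^sup>2"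
    using assms(2) unfolding major_def by blast
  have "of_nat (n * n') * (real_of_int (a - b) / of_nat P)
      = of_nat n' * (of_nat n * (of_int a / of_nat P)) - of_nat n * (of_nat n' * (of_int b / of_nat P))"
    by (simp add: diff_divide_distrib right_diff_distrib mult_ac)
  then have "nint (of_nat (n * n') * (real_of_int (a - b) / of_nat P))
      \<le> nint (of_nat n' * (of_nat n * (of_int a / of_nat P))) + nint (of_nat n * (of_nat n' * (of_int b / of_nat P)))"
    by (simp only: nint_diff)
  also have "\<dots> \<le> real n' * nint (of_nat n * (of_int a / of_nat P)) + real n * nint (of_nat n' * (of_int b / of_nat P))"
    by (intro add_mono nint_mult_nat)
  also have "\<dots> \<le> real N' * (N / (real M)\<^sup>2) + real N * (N' / (real M)\<^sup>2)"
    using n n' by (intro add_mono mult_mono) auto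
  also have "\<dots> = real (2 * N * N') / (real M)\<^sup>2" by simp
  finally have "nint (of_nat (n * n') * (real_of_int (a - b) / of_nat P)) \<le> real (2 * N * N') / (real M)\<^sup>2" .
  moreover have "n * n' \<le> N * N'" using n n' by (intro mult_mono) auto
  moreover have "0 < n * n'" using n n' by simp
  ultimately show ?thesis unfolding major_def by (intro exI[of _ "n * n'"]) auto
qed

text \<open>The character found in the spectrum of D is tested against \<open>lam\<close> once more:
  \<rho>' - \<rho> and \<rho> are both major, so \<rho>' is. The exponent is 2 * 205719 * 3820 *
  447: the square for the passage to D, the uniformity norm, the Fourier coefficient of D, and 447 =
  22 + 424 + 1 for the difference of major frequencies.\<close>

theorem large_major_spectrum:
  assumes g: "\<And>b. adm (g b)" and F: "\<And>b. adm (F b)" and G: "adm G" and J: "ivl M J" and P: "P = 4 * M\<^sup>2"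
    and Q: "1024 \<le> Q" "Q ^ 140000 \<le> M" and lam: "1 / real Q \<le> cmod (lam M J g F G)"
  shows "1 / real Q ^ 702546842520 \<le> avg {- int M..int M} (\<lambda>b. \<Sum>\<rho>\<in>{\<rho>\<in>U. major M (Q ^ 702546842520) \<rho>}. (cmod (hat (F b) \<rho>))\<^sup>2)"
proof -
  let ?D = "dual M J g F"
  have D: "adm ?D" by (rule adm_dual[OF g F J])
  define Q1 where "Q1 = Q ^ 2"
  define Q2 where "Q2 = Q1 ^ 205719"
  define Q3 where "Q3 = Q2 ^ 3820"
  have Q1: "1024 \<le> Q1" unfolding Q1_def by (rule order.trans[OF Q(1)]) (use Q in \<open>auto intro: self_le_power\<close>)
  have Q2: "1024 \<le> Q2" unfolding Q2_def by (rule order.trans[OF Q1]) (use Q1 in \<open>auto intro: self_le_power\<close>)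
  have Q3: "1024 \<le> Q3" unfolding Q3_def by (rule order.trans[OF Q2]) (use Q2 in \<open>auto intro: self_le_power\<close>)
  \<comment> \<open>Cauchy-Schwarz removes G and leaves the mean square of D, which is
    \<open>lam\<close> with G replaced by the conjugate of D.\<close>
  have "(1 / real Q)\<^sup>2 \<le> (cmod (lam M J g F G))\<^sup>2" using lam by (rule power_mono) simp
  also have "lam M J g F G = A (\<lambda>z. G z * ?D z)" by (simp only: avg_dual[OF g F G, symmetric] mult.commute)
  finally have "(1 / real Q)\<^sup>2 \<le> A (\<lambda>z. (cmod (?D z))\<^sup>2)"
    by (rule order.trans) (rule norm_avg_mult_power2_le, rule adm_norm[OF G])
  also have "\<dots> \<le> cmod (complex_of_real (A (\<lambda>z. (cmod (?D z))\<^sup>2)))" by (simp add: abs_ge_self)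
  also have "complex_of_real (A (\<lambda>z. (cmod (?D z))\<^sup>2)) = lam M J g F (\<lambda>z. cnj (?D z))"
    unfolding avg_of_real[symmetric] complex_norm_square by (rule avg_dual[OF g F adm_cnj[OF D]])
  finally have "1 / real Q1 \<le> cmod (lam M J g F (\<lambda>z. cnj (?D z)))" by (simp add: Q1_def power_divide)
  moreover have "Q1 ^ 70000 \<le> M" using Q(2) by (simp add: Q1_def flip: power_mult)
  ultimately have "1 / real Q1 ^ 205719 \<le> U3 (\<lambda>y. cnj (cnj (?D y)))"
    using lam_control_U3[OF g F adm_cnj[OF D] J P Q1] by simp
  then have "1 / real Q2 \<le> U3 ?D" by (simp add: Q2_def)
  then have "\<exists>\<rho>. 1 / real Q2 ^ 3820 \<le> cmod (hat ?D \<rho>)"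
    by (rule dual_large_hat[where g = g and F = F, OF g F J P Q2])
  then obtain \<rho> where "1 / real Q2 ^ 3820 \<le> cmod (hat ?D \<rho>)" ..
  also have "hat ?D \<rho> = lam M J g F (chr (- \<rho>))" unfolding hat_def cnj_chr(2) by (rule avg_dual[OF g F adm_chr])
  finally have "1 / real Q3 \<le> cmod (lam M J g F (chr (- \<rho>)))" by (simp add: Q3_def)
  note C = lam_chr_major[OF g F J P Q3 this]
  have "2 * Q3 ^ 22 * Q3 ^ 424 \<le> Q3 ^ 447"
  proof -
    have "2 * Q3 ^ 22 * Q3 ^ 424 = 2 * Q3 ^ 446" by (simp flip: power_add)
    also have "\<dots> \<le> Q3 * Q3 ^ 446" using Q3 by (intro mult_right_mono) auto
    finally show ?thesis by (simp flip: power_Suc)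
  qed
  also have "Q3 ^ 447 = Q ^ 702546842520" by (simp add: Q1_def Q2_def Q3_def flip: power_mult)
  finally have N: "2 * Q3 ^ 22 * Q3 ^ 424 \<le> Q ^ 702546842520" .
  have sub: "{\<rho>'\<in>U. major M (Q3 ^ 22) (\<rho>' + - \<rho>)} \<subseteq> {\<rho>\<in>U. major M (Q ^ 702546842520) \<rho>}"
  proof
    fix \<rho>' assume \<rho>': "\<rho>' \<in> {\<rho>'\<in>U. major M (Q3 ^ 22) (\<rho>' + - \<rho>)}"
    then have "major M (2 * Q3 ^ 22 * Q3 ^ 424) ((\<rho>' + - \<rho>) - (- \<rho>))" using C(1) by (intro major_diff) auto
    then have "major M (2 * Q3 ^ 22 * Q3 ^ 424) \<rho>'" by simp
    then show "\<rho>' \<in> {\<rho>\<in>U. major M (Q ^ 702546842520) \<rho>}" using \<rho>' major_mono[OF _ N] by blast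
  qed
  have "real (Q3 ^ 3) \<le> real (Q ^ 702546842520)"
  proof -
    have "Q3 ^ 3 \<le> Q3 ^ 447" using Q3 by (intro power_increasing) auto
    also have "Q3 ^ 447 = Q ^ 702546842520" by (simp add: Q1_def Q2_def Q3_def flip: power_mult)
    finally show ?thesis by (simp only: of_nat_le_iff)
  qed
  then have "1 / real Q ^ 702546842520 \<le> 1 / real Q3 ^ 3" using Q Q3 by (intro divide_left_mono) auto
  also have "\<dots> \<le> avg {- int M..int M} (\<lambda>b. \<Sum>\<rho>'\<in>{\<rho>'\<in>U. major M (Q3 ^ 22) (\<rho>' + - \<rho>)}. (cmod (hat (F b) \<rho>'))\<^sup>2)"
    by (rule C(2))
  also have "\<dots> \<le> avg {- int M..int M} (\<lambda>b. \<Sum>\<rho>\<in>{\<rho>\<in>U. major M (Q ^ 702546842520) \<rho>}. (cmod (hat (F b) \<rho>))\<^sup>2)"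
    by (intro avg_mono sum_mono2 sub finite_subset[OF _ finite_U]) auto
  finally show ?thesis .
qed

end

subsection \<open>Reduction to the counting operator\<close>

text \<open>Grouping pairs by difference, b occurs H - |b| times; the kernel is a normalised
  autocorrelation of an interval.\<close>

lemma sum_fejer_kernel:
  fixes \<phi> :: "int \<Rightarrow> complex"
  assumes H: "0 < H"
  shows "(\<Sum>d\<in>{- int H..int H}. of_real (fejer_kernel (real H) d) * \<phi> d)
    = (\<Sum>i\<in>{1..int H}. \<Sum>j\<in>{1..int H}. \<phi> (j - i)) / (of_nat H)\<^sup>2"
proof -
  have "(\<Sum>i\<in>{1..int H}. \<Sum>j\<in>{1..int H}. \<phi> (j - i))
      = (\<Sum>b\<in>{- int H..int H}. \<Sum>s\<in>{s\<in>{1..int H}. s + b \<in> {1..int H}}. \<phi> (s + b - s))"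
    by (rule sum_by_difference) (auto simp: ivl_def)
  also have "\<dots> / (of_nat H)\<^sup>2 = (\<Sum>d\<in>{- int H..int H}. of_real (fejer_kernel (real H) d) * \<phi> d)"
  proof (subst sum_divide_distrib, rule sum.cong[OF refl])
    fix b assume b: "b \<in> {- int H..int H}"
    have "{s\<in>{1..int H}. s + b \<in> {1..int H}} = {max 1 (1 - b)..min (int H) (int H - b)}" by auto
    then have "card {s\<in>{1..int H}. s + b \<in> {1..int H}} = nat (int H - \<bar>b\<bar>)" using b by (auto simp: max_def min_def)
    then have "(\<Sum>s\<in>{s\<in>{1..int H}. s + b \<in> {1..int H}}. \<phi> (s + b - s)) = of_int (int H - \<bar>b\<bar>) * \<phi> b"
      using b by (simp add: of_nat_nat abs_le_iff)
    moreover have "fejer_kernel (real H) b = real_of_int (int H - \<bar>b\<bar>) / (real H)\<^sup>2"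
    proof -
      have "real_of_int \<bar>b\<bar> \<le> real H" using b by auto
      then have "real_of_int \<bar>b\<bar> / real H \<le> 1" using H by simp
      then show ?thesis using H by (simp add: fejer_kernel_def max_def field_simps power2_eq_square)
    qed
    ultimately show "(\<Sum>s\<in>{s\<in>{1..int H}. s + b \<in> {1..int H}}. \<phi> (s + b - s)) / (of_nat H)\<^sup>2
        = of_real (fejer_kernel (real H) b) * \<phi> b"
      by (simp del: of_int_diff)
  qed
  finally show ?thesis by (rule sym)
qed

lemma fejer_kernel_eq_0: "d \<notin> {- int H..int H} \<Longrightarrow> 0 < H \<Longrightarrow> fejer_kernel (real H) d = 0"
proof -
  assume d: "d \<notin> {- int H..int H}" and H: "0 < H"
  have "int H \<le> \<bar>d\<bar>" using d by auto
  then have "real H \<le> real_of_int \<bar>d\<bar>" by linarith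
  then have "1 \<le> real_of_int \<bar>d\<bar> / real H" using H by simp
  then show ?thesis by (simp add: fejer_kernel_def max_def)
qed

lemma infsum_finite_support:
  fixes f :: "'a \<Rightarrow> 'b::{topological_comm_monoid_add, t2_space}"
  assumes "finite S" "\<And>x. x \<notin> S \<Longrightarrow> f x = 0"
  shows "infsum f UNIV = sum f S"
proof -
  have "infsum f UNIV = infsum f S" by (rule infsum_cong_neutral) (use assms in auto)
  then show ?thesis using assms(1) by simp
qed

lemma norm_sum_mult_power2_le:
  fixes u f :: "'a \<Rightarrow> complex"
  assumes S: "finite S" and u: "\<And>x. x \<in> S \<Longrightarrow> cmod (u x) \<le> 1"
  shows "(cmod (\<Sum>x\<in>S. u x * f x))\<^sup>2 \<le> real (card S) * (\<Sum>x\<in>S. (cmod (f x))\<^sup>2)"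
proof -
  have "(\<Sum>x\<in>S. cmod (u x * f x)) \<le> (\<Sum>x\<in>S. cmod (f x))"
    using u by (intro sum_mono) (simp add: norm_mult mult_left_le_one_le)
  then have "cmod (\<Sum>x\<in>S. u x * f x) \<le> (\<Sum>x\<in>S. cmod (f x))" using norm_sum[of "\<lambda>x. u x * f x" S] by linarith
  then have "(cmod (\<Sum>x\<in>S. u x * f x))\<^sup>2 \<le> (\<Sum>x\<in>S. cmod (f x))\<^sup>2" by (rule power_mono) simp
  also have "\<dots> \<le> (\<Sum>x\<in>S. (cmod (f x))\<^sup>2) * card S" by (rule sum_squared_le_sum_of_squares)
  finally show ?thesis by (simp add: mult.commute)
qed

text \<open>Translation of the summation variable when the index sets do not match exactly but the
  supports do.\<close>

lemma sum_shift_support: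
  fixes f g :: "int \<Rightarrow> 'b::comm_monoid_add"
  assumes "finite S" "finite T" and fg: "\<And>x. f (x + h) = g x"
    and "\<And>x. x \<in> S \<Longrightarrow> f x \<noteq> 0 \<Longrightarrow> x - h \<in> T" "\<And>x. x \<in> T \<Longrightarrow> g x \<noteq> 0 \<Longrightarrow> x + h \<in> S"
  shows "sum f S = sum g T"
proof -
  have "sum f S = sum f {x\<in>S. f x \<noteq> 0}" using assms by (intro sum.mono_neutral_right) auto
  also have "\<dots> = sum g {x\<in>T. g x \<noteq> 0}"
  proof (rule sum.reindex_bij_witness[where i = "\<lambda>x. x + h" and j = "\<lambda>x. x - h"])
    have gf: "g (x - h) = f x" for x using fg[of "x - h"] by simp
    show "a - h \<in> {x\<in>T. g x \<noteq> 0}" if "a \<in> {x\<in>S. f x \<noteq> 0}" for a using that assms(4) by (simp add: gf)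
    show "b + h \<in> {x\<in>S. f x \<noteq> 0}" if "b \<in> {x\<in>T. g x \<noteq> 0}" for b using that assms(5) by (simp add: fg)
    show "g (a - h) = f a" for a by (rule gf)
  qed auto
  also have "\<dots> = sum g T" using assms by (intro sum.mono_neutral_left) auto
  finally show ?thesis .
qed

text \<open>The kernel is an average of normalised indicators of intervals {1 - i..M - i}; some
  \<open>i\<close> does at least as well as the average. From here on the weight is flat on an
  interval.\<close>

lemma fejer_pigeonhole:
  fixes \<Theta> :: "int \<Rightarrow> complex"
  assumes M: "0 < M" and e: "e \<le> cmod (\<Sum>d\<in>{- int M..int M}. of_real (fejer_kernel (real M) d) * \<Theta> d)"
  shows "\<exists>J. ivl M J \<and> J \<subseteq> {- int M..int M} \<and> e \<le> cmod ((\<Sum>s\<in>J. \<Theta> s) / of_nat M)"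
proof -
  define X where "X i = (\<Sum>j\<in>{1..int M}. \<Theta> (j - i)) / of_nat M" for i
  have "(\<Sum>d\<in>{- int M..int M}. of_real (fejer_kernel (real M) d) * \<Theta> d) = avg {1..int M} X"
    unfolding sum_fejer_kernel[OF M] by (simp add: avg_def X_def power2_eq_square sum_divide_distrib)
  then have "e \<le> avg {1..int M} (\<lambda>i. cmod (X i))" using e norm_avg_le[of "{1..int M}" X] by simp
  then obtain i where i: "i \<in> {1..int M}" "e \<le> cmod (X i)"
    using avg_le_ex[of "{1..int M}" "\<lambda>i. cmod (X i)"] M by (auto intro: order.trans)
  have "(\<Sum>j\<in>{1..int M}. \<Theta> (j - i)) = (\<Sum>s\<in>{1 - i..int M - i}. \<Theta> s)"
    by (rule sum.reindex_bij_witness[where i = "\<lambda>s. s + i" and j = "\<lambda>j. j - i"]) auto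
  with i show ?thesis
    by (intro exI[of _ "{1 - i..int M - i}"]) (auto simp: X_def ivl_def)
qed

text \<open>Replacing x by x - q s frees \<open>f1\<close> from s, so Cauchy-Schwarz over (x, y)
  removes it. A second translation, by q s', brings one copy of f2 back to x, and everything else
  depends on x through s' - s only. The 9 bounds (2 N1 + 1)(2 N2 + 1) / (N1 N2).\<close>

lemma eliminate_f1:
  fixes f0 f1 f2 :: "int \<Rightarrow> int \<Rightarrow> complex" and N1 N2 q M :: nat
  defines "XS \<equiv> {- int N1..int N1}" and "YS \<equiv> {- int N2..int N2}"
  assumes f: "\<And>x y. cmod (f0 x y) \<le> 1" "\<And>x y. cmod (f1 x y) \<le> 1" "\<And>x y. cmod (f2 x y) \<le> 1"
    and supp: "\<And>x y. f0 x y \<noteq> 0 \<Longrightarrow> x \<in> XS \<and> y \<in> YS" "\<And>x y. f1 x y \<noteq> 0 \<Longrightarrow> x \<in> XS \<and> y \<in> YS"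
    and pos: "0 < N1" "0 < N2" "0 < M" and qM: "q * M \<le> N1" and J: "ivl M J" "J \<subseteq> {- int M..int M}" and \<delta>: "0 < \<delta>"
    and large: "\<delta> * real N1 * real N2 \<le> cmod ((\<Sum>s\<in>J. \<Sum>x\<in>XS. \<Sum>y\<in>YS. f0 x y * f1 (x + int q * s) y * f2 x (y + (int q)\<^sup>2 * s\<^sup>2)) / of_nat M)"
  shows "\<delta>\<^sup>2 * real N1 * real N2 / 9 \<le> cmod (\<Sum>x\<in>XS. \<Sum>y\<in>YS. (\<Sum>s\<in>J. \<Sum>s'\<in>J.
     (f0 (x + int q * (s' - s)) y * cnj (f0 x y)) * f2 (x + int q * (s' - s)) (y + (int q)\<^sup>2 * s\<^sup>2) * cnj (f2 x (y + (int q)\<^sup>2 * s'\<^sup>2))) / (of_nat M)\<^sup>2)"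
proof -
  \<comment> \<open>A wider range for x, so that the translates of XS by q s', of size at most N1,
    stay inside it.\<close>
  define XW where "XW = {- 3 * int N1..3 * int N1}"
  have fin: "finite XS" "finite YS" "finite XW" "finite J" using ivl_finite[OF J(1)] by (simp_all add: XS_def YS_def XW_def)
  have sub: "XS \<subseteq> XW" by (auto simp: XS_def XW_def)
  have qs: "\<bar>int q * s\<bar> \<le> int N1" if "s \<in> J" for s
  proof -
    have "s \<in> {- int M..int M}" using J(2) that by blast
    then have "\<bar>s\<bar> \<le> int M" by auto
    then have "\<bar>int q * s\<bar> \<le> int q * int M" unfolding abs_mult by (intro mult_mono) auto
    also have "\<dots> \<le> int N1" using qM by (simp flip: of_nat_mult)
    finally show ?thesis .
  qed
  define \<psi> where "\<psi> s x y = f0 (x - int q * s) y * f2 (x - int q * s) (y + (int q)\<^sup>2 * s\<^sup>2)" for s x y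
  define \<Psi> where "\<Psi> x y = (\<Sum>s\<in>J. \<psi> s x y) / of_nat M" for x y
  have "(\<Sum>s\<in>J. \<Sum>x\<in>XS. \<Sum>y\<in>YS. f0 x y * f1 (x + int q * s) y * f2 x (y + (int q)\<^sup>2 * s\<^sup>2))
      = (\<Sum>s\<in>J. \<Sum>y\<in>YS. \<Sum>x\<in>XS. f1 x y * \<psi> s x y)"
  proof (rule sum.cong[OF refl], subst sum.swap, rule sum.cong[OF refl])
    fix s y assume s: "s \<in> J" "y \<in> YS"
    show "(\<Sum>x\<in>XS. f0 x y * f1 (x + int q * s) y * f2 x (y + (int q)\<^sup>2 * s\<^sup>2)) = (\<Sum>x\<in>XS. f1 x y * \<psi> s x y)"
      by (rule sym, rule sum_shift_support[where h = "int q * s"]) (use fin supp in \<open>auto simp: \<psi>_def\<close>)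
  qed
  also have "\<dots> / of_nat M = (\<Sum>y\<in>YS. \<Sum>x\<in>XS. f1 x y * \<Psi> x y)"
    unfolding \<Psi>_def sum_divide_distrib sum_distrib_left
    by (rule trans[OF sum.swap], rule sum.cong[OF refl], rule trans[OF sum.swap], rule sum.cong[OF refl], rule sum.cong[OF refl]) simp
  also have "\<dots> = (\<Sum>p\<in>YS \<times> XS. f1 (snd p) (fst p) * \<Psi> (snd p) (fst p))"
    by (simp add: sum.cartesian_product case_prod_unfold)
  finally have eq1: "(\<Sum>s\<in>J. \<Sum>x\<in>XS. \<Sum>y\<in>YS. f0 x y * f1 (x + int q * s) y * f2 x (y + (int q)\<^sup>2 * s\<^sup>2)) / of_nat M
      = (\<Sum>p\<in>YS \<times> XS. f1 (snd p) (fst p) * \<Psi> (snd p) (fst p))" .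
  have card: "real (card (YS \<times> XS)) \<le> 9 * real N1 * real N2"
  proof -
    have "real (card (YS \<times> XS)) = (2 * real N2 + 1) * (2 * real N1 + 1)"
      by (simp add: card_cartesian_product XS_def YS_def)
    also have "\<dots> \<le> (3 * real N2) * (3 * real N1)" using pos by (intro mult_mono) auto
    also have "\<dots> = 9 * real N1 * real N2" by simp
    finally show ?thesis .
  qed
  have "(\<delta> * real N1 * real N2)\<^sup>2 \<le> (cmod (\<Sum>p\<in>YS \<times> XS. f1 (snd p) (fst p) * \<Psi> (snd p) (fst p)))\<^sup>2"
    using large \<delta> unfolding eq1 by (intro power_mono) auto
  also have "\<dots> \<le> real (card (YS \<times> XS)) * (\<Sum>p\<in>YS \<times> XS. (cmod (\<Psi> (snd p) (fst p)))\<^sup>2)"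
    by (rule norm_sum_mult_power2_le) (use fin f in auto)
  also have "\<dots> \<le> (9 * real N1 * real N2) * (\<Sum>p\<in>YS \<times> XS. (cmod (\<Psi> (snd p) (fst p)))\<^sup>2)"
    using card by (intro mult_right_mono sum_nonneg) auto
  also have "(\<Sum>p\<in>YS \<times> XS. (cmod (\<Psi> (snd p) (fst p)))\<^sup>2) = (\<Sum>y\<in>YS. \<Sum>x\<in>XS. (cmod (\<Psi> x y))\<^sup>2)"
    by (simp add: sum.cartesian_product case_prod_unfold)
  also have "(9 * real N1 * real N2) * (\<Sum>y\<in>YS. \<Sum>x\<in>XS. (cmod (\<Psi> x y))\<^sup>2) \<le> (9 * real N1 * real N2) * (\<Sum>y\<in>YS. \<Sum>x\<in>XW. (cmod (\<Psi> x y))\<^sup>2)"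
    by (intro mult_left_mono sum_mono sum_mono2 sub fin) auto
  finally have main: "(\<delta> * real N1 * real N2)\<^sup>2 \<le> (9 * real N1 * real N2) * (\<Sum>y\<in>YS. \<Sum>x\<in>XW. (cmod (\<Psi> x y))\<^sup>2)" .
  have "d\<^sup>2 * n * m / 9 \<le> b" if "(d * n * m)\<^sup>2 \<le> (9 * n * m) * b" "0 < n" "0 < m" for d n m b :: real
  proof -
    have "(9 * n * m) * (d\<^sup>2 * n * m / 9) \<le> (9 * n * m) * b" using that by (simp add: power2_eq_square mult_ac)
    then show ?thesis using that by (simp only: mult_le_cancel_left_pos mult_pos_pos zero_less_numeral)
  qed
  from this[OF main] pos have "\<delta>\<^sup>2 * real N1 * real N2 / 9 \<le> (\<Sum>y\<in>YS. \<Sum>x\<in>XW. (cmod (\<Psi> x y))\<^sup>2)" by simp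
  also have "\<dots> \<le> cmod (complex_of_real (\<Sum>y\<in>YS. \<Sum>x\<in>XW. (cmod (\<Psi> x y))\<^sup>2))" by (simp only: norm_of_real abs_ge_self)
  also have "complex_of_real (\<Sum>y\<in>YS. \<Sum>x\<in>XW. (cmod (\<Psi> x y))\<^sup>2)
      = (\<Sum>y\<in>YS. \<Sum>x\<in>XS. (\<Sum>s\<in>J. \<Sum>s'\<in>J.
     (f0 (x + int q * (s' - s)) y * cnj (f0 x y)) * f2 (x + int q * (s' - s)) (y + (int q)\<^sup>2 * s\<^sup>2) * cnj (f2 x (y + (int q)\<^sup>2 * s'\<^sup>2))) / (of_nat M)\<^sup>2)"
    unfolding of_real_sum
  proof (rule sum.cong[OF refl])
    fix y
    define B where "B s s' x = (f0 (x + int q * (s' - s)) y * cnj (f0 x y)) * f2 (x + int q * (s' - s)) (y + (int q)\<^sup>2 * s\<^sup>2) * cnj (f2 x (y + (int q)\<^sup>2 * s'\<^sup>2))" for s s' x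
    have "complex_of_real ((cmod (\<Psi> x y))\<^sup>2) = (\<Sum>s\<in>J. \<Sum>s'\<in>J. \<psi> s x y * cnj (\<psi> s' x y)) / (of_nat M)\<^sup>2" for x
      by (simp add: \<Psi>_def norm_divide power_divide norm_sum_square[symmetric])
    then have "(\<Sum>x\<in>XW. complex_of_real ((cmod (\<Psi> x y))\<^sup>2)) = (\<Sum>x\<in>XW. \<Sum>s\<in>J. \<Sum>s'\<in>J. \<psi> s x y * cnj (\<psi> s' x y)) / (of_nat M)\<^sup>2"
      by (simp add: sum_divide_distrib)
    also have "(\<Sum>x\<in>XW. \<Sum>s\<in>J. \<Sum>s'\<in>J. \<psi> s x y * cnj (\<psi> s' x y)) = (\<Sum>s\<in>J. \<Sum>s'\<in>J. \<Sum>x\<in>XW. \<psi> s x y * cnj (\<psi> s' x y))"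
      by (rule trans[OF sum.swap], rule sum.cong[OF refl], rule sum.swap)
    also have "\<dots> = (\<Sum>s\<in>J. \<Sum>s'\<in>J. \<Sum>x\<in>XS. B s s' x)"
    proof (rule sum.cong[OF refl], rule sum.cong[OF refl])
      fix s s' assume s: "s \<in> J" "s' \<in> J"
      show "(\<Sum>x\<in>XW. \<psi> s x y * cnj (\<psi> s' x y)) = (\<Sum>x\<in>XS. B s s' x)"
      proof (rule sum_shift_support[where h = "int q * s'", OF fin(3,1)])
        show "\<psi> s (x + int q * s') y * cnj (\<psi> s' (x + int q * s') y) = B s s' x" for x
          by (simp add: \<psi>_def B_def right_diff_distrib add_diff_eq)
        show "x - int q * s' \<in> XS" if "\<psi> s x y * cnj (\<psi> s' x y) \<noteq> 0" for x
          using that supp(1) by (auto simp: \<psi>_def)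
        show "x + int q * s' \<in> XW" if "x \<in> XS" for x
          using that qs[OF s(2)] by (auto simp: XS_def XW_def)
      qed
    qed
    also have "\<dots> = (\<Sum>x\<in>XS. \<Sum>s\<in>J. \<Sum>s'\<in>J. B s s' x)"
      by (rule sym, rule trans[OF sum.swap], rule sum.cong[OF refl], rule sum.swap)
    finally show "(\<Sum>x\<in>XW. complex_of_real ((cmod (\<Psi> x y))\<^sup>2)) = (\<Sum>x\<in>XS. (\<Sum>s\<in>J. \<Sum>s'\<in>J.
       (f0 (x + int q * (s' - s)) y * cnj (f0 x y)) * f2 (x + int q * (s' - s)) (y + (int q)\<^sup>2 * s\<^sup>2) * cnj (f2 x (y + (int q)\<^sup>2 * s'\<^sup>2))) / (of_nat M)\<^sup>2)"
      by (simp add: B_def sum_divide_distrib)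
  qed
  also have "\<dots> = (\<Sum>x\<in>XS. \<Sum>y\<in>YS. (\<Sum>s\<in>J. \<Sum>s'\<in>J.
     (f0 (x + int q * (s' - s)) y * cnj (f0 x y)) * f2 (x + int q * (s' - s)) (y + (int q)\<^sup>2 * s\<^sup>2) * cnj (f2 x (y + (int q)\<^sup>2 * s'\<^sup>2))) / (of_nat M)\<^sup>2)"
    by (rule sum.swap)
  finally show ?thesis .
qed

subsection \<open>Localisation to cells\<close>

lemma sum_cells:
  fixes \<Xi> :: "int \<Rightarrow> 'b::comm_monoid_add" and q m N :: nat
  assumes q: "0 < q" "0 < m" and \<Xi>: "\<And>y. y \<notin> {- int N..int N} \<Longrightarrow> \<Xi> y = 0"
  shows "(\<Sum>y\<in>{- int N..int N}. \<Xi> y) = (\<Sum>k\<in>{- int N div int (q * m)..int N div int (q * m)}. \<Sum>\<rho>\<in>{0..<int q}. \<Sum>v\<in>{0..<int m}. \<Xi> (int q * (int m * k + v) + \<rho>))"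
proof -
  let ?K = "{- int N div int (q * m)..int N div int (q * m)}"
  let ?T = "?K \<times> {0..<int q} \<times> {0..<int m}"
  define t where "t p = int q * (int m * fst p + snd (snd p)) + fst (snd p)" for p :: "int \<times> int \<times> int"
  have dec: "t (k, \<rho>, v) div int q = int m * k + v" "t (k, \<rho>, v) mod int q = \<rho>" if "\<rho> \<in> {0..<int q}" for k \<rho> v
    using that by (simp_all add: t_def)
  have inj: "inj_on t ?T"
  proof (rule inj_onI)
    fix a b assume ab: "a \<in> ?T" "b \<in> ?T" "t a = t b"
    obtain k \<rho> v where a: "a = (k, \<rho>, v)" by (cases a) auto
    obtain k' \<rho>' v' where b: "b = (k', \<rho>', v')" by (cases b) auto
    have r: "\<rho> = \<rho>'" using dec(2)[of \<rho> k v] dec(2)[of \<rho>' k' v'] ab by (auto simp: a b)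
    have e: "int m * k + v = int m * k' + v'" using dec(1)[of \<rho> k v] dec(1)[of \<rho>' k' v'] ab by (auto simp: a b)
    have "(int m * k + v) div int m = k" "(int m * k' + v') div int m = k'" using ab q by (auto simp: a b)
    then have "k = k'" using e by simp
    then show "a = b" using e r by (simp add: a b)
  qed
  have "(\<Sum>k\<in>?K. \<Sum>\<rho>\<in>{0..<int q}. \<Sum>v\<in>{0..<int m}. \<Xi> (int q * (int m * k + v) + \<rho>)) = (\<Sum>p\<in>?T. \<Xi> (t p))"
    unfolding sum.cartesian_product by (rule sum.cong) (auto simp: t_def)
  also have "\<dots> = (\<Sum>y\<in>t ` ?T. \<Xi> y)" by (rule sum.reindex[OF inj, unfolded o_def, symmetric])
  also have "\<dots> = (\<Sum>y\<in>{- int N..int N}. \<Xi> y)"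
  proof (rule sum.mono_neutral_right)
    show "{- int N..int N} \<subseteq> t ` ?T"
    proof
      fix y assume y: "y \<in> {- int N..int N}"
      have "y div int q div int m = y div int (q * m)" by (simp add: zdiv_zmult2_eq)
      then have "(y div int q div int m, y mod int q, (y div int q) mod int m) \<in> ?T"
        using y q zdiv_mono1[of "- int N" y "int (q * m)"] zdiv_mono1[of y "int N" "int (q * m)"] by auto
      moreover have "y = t (y div int q div int m, y mod int q, (y div int q) mod int m)"
        by (simp add: t_def)
      ultimately show "y \<in> t ` ?T" by (rule rev_image_eqI)
    qed
  qed (use \<Xi> in auto)
  finally show ?thesis by (rule sym)
qed

context cyclic
begin

text \<open>Residue class \<rho> modulo q, block number k of length m, made periodic with period P.
  In the uses below m = M^2 and P = 4 m: the window extends past its block, leaving room for the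
  quadratic shifts.\<close>

definition cell :: "(int \<Rightarrow> 'b) \<Rightarrow> nat \<Rightarrow> nat \<Rightarrow> int \<Rightarrow> int \<Rightarrow> int \<Rightarrow> 'b" where
  "cell f q m k \<rho> u = f (int q * (int m * k + u mod int P) + \<rho>)"

lemma adm_cell: "(\<And>y. cmod (f y) \<le> 1) \<Longrightarrow> adm (cell f q m k \<rho>)"
  by (rule admI) (simp_all add: cell_def)

text \<open>Truncating g to the block forces u < M^2, and u + s^2 is then at most 2 M^2, less than
  P. The periodic model therefore agrees with the original functions, the common difference q^2
  being absorbed by the rescaling.\<close>

lemma cell_sum_lam:
  fixes g F :: "int \<Rightarrow> int \<Rightarrow> complex" and q M :: nat
  assumes P: "P = 4 * M\<^sup>2" and J: "J \<subseteq> {- int M..int M}"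
  shows "(\<Sum>v\<in>{0..<int (M\<^sup>2)}. (\<Sum>s\<in>J. \<Sum>s'\<in>J. g (s' - s) (int (q\<^sup>2) * (int (M\<^sup>2) * k + v) + \<rho>)
        * F (s' - s) (int (q\<^sup>2) * (int (M\<^sup>2) * k + v) + \<rho> + (int q)\<^sup>2 * s\<^sup>2) * G (int (q\<^sup>2) * (int (M\<^sup>2) * k + v) + \<rho> + (int q)\<^sup>2 * s'\<^sup>2)) / (of_nat M)\<^sup>2)
    = of_nat P * lam M J (\<lambda>b u. if u mod int P < int (M\<^sup>2) then cell (g b) (q\<^sup>2) (M\<^sup>2) k \<rho> u else 0) (\<lambda>b. cell (F b) (q\<^sup>2) (M\<^sup>2) k \<rho>) (cell G (q\<^sup>2) (M\<^sup>2) k \<rho>)"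
proof -
  define e where "e s s' v = g (s' - s) (int (q\<^sup>2) * (int (M\<^sup>2) * k + v) + \<rho>)
        * F (s' - s) (int (q\<^sup>2) * (int (M\<^sup>2) * k + v) + \<rho> + (int q)\<^sup>2 * s\<^sup>2) * G (int (q\<^sup>2) * (int (M\<^sup>2) * k + v) + \<rho> + (int q)\<^sup>2 * s'\<^sup>2)" for s s' v
  define h where "h s s' u = (if u mod int P < int (M\<^sup>2) then cell (g (s' - s)) (q\<^sup>2) (M\<^sup>2) k \<rho> u else 0) * cell (F (s' - s)) (q\<^sup>2) (M\<^sup>2) k \<rho> (u + s\<^sup>2) * cell G (q\<^sup>2) (M\<^sup>2) k \<rho> (u + s'\<^sup>2)" for s s' u
  have PM: "u < int P" if "u < (int M)\<^sup>2" for u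
  proof -
    have "(int M)\<^sup>2 \<le> int P" by (simp add: P)
    with that show ?thesis by linarith
  qed
  have h: "h s s' u = (if u \<in> {0..<int (M\<^sup>2)} then e s s' u else 0)" if s: "s \<in> J" "s' \<in> J" and u: "u \<in> U" for s s' u
  proof (cases "u < int (M\<^sup>2)")
    case True
    have sq: "(u + x\<^sup>2) mod int P = u + x\<^sup>2" if "x \<in> J" for x
    proof (rule mod_pos_pos_trivial)
      have "x \<in> {- int M..int M}" using J that by blast
      then have "\<bar>x\<bar> \<le> \<bar>int M\<bar>" by auto
      then have "x\<^sup>2 \<le> (int M)\<^sup>2" by (simp only: abs_le_square_iff)
      moreover have "u < (int M)\<^sup>2" "int P = 4 * (int M)\<^sup>2" using True by (simp_all add: P)
      ultimately show "u + x\<^sup>2 < int P" using zero_le_power2[of "int M"] by linarith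
      show "0 \<le> u + x\<^sup>2" using u by simp
    qed
    show ?thesis using True u sq[OF s(1)] sq[OF s(2)]
      by (simp add: h_def e_def cell_def algebra_simps)
  qed (use u in \<open>simp add: h_def\<close>)
  have A: "of_nat P * A (h s s') = (\<Sum>v\<in>{0..<int (M\<^sup>2)}. e s s' v)" if "s \<in> J" "s' \<in> J" for s s'
  proof -
    have "of_nat P * A (h s s') = (\<Sum>u\<in>U. h s s' u)" using P_pos by (simp add: avg_def)
    also have "\<dots> = (\<Sum>u\<in>U. if u \<in> {0..<int (M\<^sup>2)} then e s s' u else 0)"
      by (rule sum.cong[OF refl]) (rule h[OF that])
    also have "\<dots> = (\<Sum>u\<in>{u\<in>U. u \<in> {0..<int (M\<^sup>2)}}. e s s' u)" by (rule sum.inter_filter[OF finite_U, symmetric])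
    also have "{u\<in>U. u \<in> {0..<int (M\<^sup>2)}} = {0..<int (M\<^sup>2)}" using PM by auto
    finally show ?thesis .
  qed
  have "(\<Sum>v\<in>{0..<int (M\<^sup>2)}. (\<Sum>s\<in>J. \<Sum>s'\<in>J. e s s' v) / (of_nat M)\<^sup>2) = (\<Sum>s\<in>J. \<Sum>s'\<in>J. \<Sum>v\<in>{0..<int (M\<^sup>2)}. e s s' v) / (of_nat M)\<^sup>2"
    unfolding sum_divide_distrib[symmetric]
    by (rule arg_cong[where f = "\<lambda>x. x / _"], rule trans[OF sum.swap], rule sum.cong[OF refl], rule sum.swap)
  also have "\<dots> = (\<Sum>s\<in>J. \<Sum>s'\<in>J. of_nat P * A (h s s')) / (of_nat M)\<^sup>2"
    by (intro arg_cong2[where f = "(/)"] sum.cong refl A[symmetric])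
  also have "\<dots> = of_nat P * ((\<Sum>s\<in>J. \<Sum>s'\<in>J. A (h s s')) / (of_nat M)\<^sup>2)"
    by (simp add: sum_distrib_left)
  finally show ?thesis unfolding lam_def e_def h_def[abs_def] .
qed

end

section \<open>Spectral mass of f2 on major arcs, summed over all cells\<close>

definition spectral_exponent :: nat where
  "spectral_exponent = 702546842520"

lemma sum_UN_le:
  fixes f :: "'a \<Rightarrow> real"
  assumes "finite I" "\<And>i. i \<in> I \<Longrightarrow> finite (B i)" and f: "\<And>x. 0 \<le> f x"
  shows "sum f (\<Union>i\<in>I. B i) \<le> (\<Sum>i\<in>I. sum f (B i))"
  using assms(1,2)
proof (induction I rule: finite_induct)
  case (insert i I)
  have "sum f (B i \<union> (\<Union>i\<in>I. B i)) + sum f (B i \<inter> (\<Union>i\<in>I. B i)) = sum f (B i) + sum f (\<Union>i\<in>I. B i)"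
    using insert by (intro sum.union_inter) auto
  moreover have "0 \<le> sum f (B i \<inter> (\<Union>i\<in>I. B i))" using f by (intro sum_nonneg)
  ultimately show ?case using insert by simp
qed simp

text \<open>Windows of length 4 m start m apart, so every y is covered at most four times: the
  quotient v div m, one of 0, 1, 2, 3, determines the representation.\<close>

lemma sum_overlapping_cells:
  fixes \<Phi> :: "int \<Rightarrow> real" and q m :: nat
  assumes q: "0 < q" "0 < m" and \<Phi>: "\<And>y. 0 \<le> \<Phi> y" and S: "finite S" "\<And>y. y \<notin> S \<Longrightarrow> \<Phi> y = 0" and K: "finite K"
  shows "(\<Sum>k\<in>K. \<Sum>\<rho>\<in>{0..<int q}. \<Sum>v\<in>{0..<4 * int m}. \<Phi> (int q * (int m * k + v) + \<rho>)) \<le> 4 * sum \<Phi> S"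
proof -
  let ?T = "K \<times> {0..<int q} \<times> {0..<4 * int m}"
  define t where "t p = int q * (int m * fst p + snd (snd p)) + fst (snd p)" for p :: "int \<times> int \<times> int"
  have finT: "finite ?T" using K by simp
  have fibre: "card {p. p \<in> ?T \<and> t p = y} \<le> 4" for y
  proof -
    have "card {p. p \<in> ?T \<and> t p = y} \<le> card {0..<4::int}"
    proof (rule card_inj_on_le[where f = "\<lambda>p. snd (snd p) div int m"])
      show "inj_on (\<lambda>p. snd (snd p) div int m) {p. p \<in> ?T \<and> t p = y}"
      proof (rule inj_onI)
        fix a b assume ab: "a \<in> {p. p \<in> ?T \<and> t p = y}" "b \<in> {p. p \<in> ?T \<and> t p = y}" "snd (snd a) div int m = snd (snd b) div int m"
        obtain k \<rho> v where a: "a = (k, \<rho>, v)" by (cases a) auto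
        obtain k' \<rho>' v' where b: "b = (k', \<rho>', v')" by (cases b) auto
        have y: "y = int q * (int m * k + v) + \<rho>" "y = int q * (int m * k' + v') + \<rho>'" using ab(1,2) by (simp_all add: a b t_def)
        have \<rho>: "0 \<le> \<rho>" "\<rho> < int q" "0 \<le> \<rho>'" "\<rho>' < int q" using ab(1,2) by (simp_all add: a b)
        have "\<rho> = y mod int q" unfolding y(1) using \<rho> by simp
        moreover have "\<rho>' = y mod int q" unfolding y(2) using \<rho> by simp
        ultimately have r: "\<rho> = \<rho>'" by simp
        then have "int q * (int m * k + v) = int q * (int m * k' + v')" using y by linarith
        then have e: "int m * k + v = int m * k' + v'" using q by simp
        have "v mod int m = (int m * k + v) mod int m" by simp
        also have "\<dots> = v' mod int m" unfolding e by simp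
        finally have "int m * (v div int m) + v mod int m = int m * (v' div int m) + v' mod int m"
          using ab(3) by (simp only: a b snd_conv)
        then have v: "v = v'" by (simp only: mult_div_mod_eq)
        then have "int m * k = int m * k'" using e by linarith
        then have "k = k'" using q by simp
        with r v show "a = b" by (simp only: a b)
      qed
      show "(\<lambda>p. snd (snd p) div int m) ` {p. p \<in> ?T \<and> t p = y} \<subseteq> {0..<4}"
      proof
        fix z assume "z \<in> (\<lambda>p. snd (snd p) div int m) ` {p. p \<in> ?T \<and> t p = y}"
        then obtain v where v: "z = v div int m" "0 \<le> v" "v < 4 * int m" by auto
        have "0 < int m" using q by simp
        then have "0 \<le> z" "0 \<le> v mod int m" using v by (simp_all add: pos_imp_zdiv_nonneg_iff)
        moreover have "int m * z + v mod int m = v" unfolding v(1) by (rule mult_div_mod_eq)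
        ultimately have "int m * z < int m * 4" using v by linarith
        then show "z \<in> {0..<4}" using \<open>0 \<le> z\<close> q by simp
      qed
    qed simp
    then show ?thesis by simp
  qed
  have "(\<Sum>k\<in>K. \<Sum>\<rho>\<in>{0..<int q}. \<Sum>v\<in>{0..<4 * int m}. \<Phi> (int q * (int m * k + v) + \<rho>)) = (\<Sum>p\<in>?T. \<Phi> (t p))"
    unfolding sum.cartesian_product by (rule sum.cong) (auto simp: t_def)
  also have "\<dots> = (\<Sum>y\<in>t ` ?T. \<Sum>p\<in>{p. p \<in> ?T \<and> t p = y}. \<Phi> (t p))"
    by (rule sum.image_gen[OF finT])
  also have "\<dots> \<le> (\<Sum>y\<in>t ` ?T. 4 * \<Phi> y)"
  proof (rule sum_mono)
    fix y
    have "(\<Sum>p\<in>{p. p \<in> ?T \<and> t p = y}. \<Phi> (t p)) = real (card {p. p \<in> ?T \<and> t p = y}) * \<Phi> y" by simp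
    also have "\<dots> \<le> 4 * \<Phi> y" using fibre[of y] by (intro mult_right_mono \<Phi>) simp
    finally show "(\<Sum>p\<in>{p. p \<in> ?T \<and> t p = y}. \<Phi> (t p)) \<le> 4 * \<Phi> y" .
  qed
  also have "\<dots> = 4 * sum \<Phi> (t ` ?T)" by (simp add: sum_distrib_left)
  also have "sum \<Phi> (t ` ?T) = sum \<Phi> (t ` ?T \<inter> S)"
    using finT S by (intro sum.mono_neutral_right) auto
  also have "4 * sum \<Phi> (t ` ?T \<inter> S) \<le> 4 * sum \<Phi> S"
    using S \<Phi> by (intro mult_left_mono sum_mono2) auto
  finally show ?thesis .
qed

lemma card_cells_le:
  fixes N q m :: nat
  assumes "0 < q" "0 < m" "q * m \<le> N"
  shows "real (card {- int N div int (q * m)..int N div int (q * m)}) * q \<le> 4 * real N / m"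
proof -
  define z where "z = int (q * m)"
  have z: "0 < z" "z \<le> int N" using assms by (simp_all add: z_def del: of_nat_mult)
  have "real_of_int (k div z) \<le> real_of_int k / real_of_int z \<and> real_of_int k / real_of_int z < real_of_int (k div z) + 1" for k
    using floor_correct[of "real_of_int k / real_of_int z"] unfolding floor_divide_of_int_eq by simp
  from this[of "int N"] this[of "- int N"]
  have b: "real_of_int (int N div z) \<le> real N / real_of_int z" "- (real N / real_of_int z) - 1 \<le> real_of_int (- int N div z)" by simp_all
  have "- int N div z \<le> int N div z" using z by (intro zdiv_mono1) auto
  then have "real (card {- int N div z..int N div z}) = real_of_int (int N div z) - real_of_int (- int N div z) + 1" by simp
  also have "\<dots> \<le> 2 * (real N / real_of_int z) + 2" using b by linarith
  also have "\<dots> \<le> 4 * (real N / real_of_int z)"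
  proof -
    have "real_of_int z \<le> real_of_int (int N)" using z by (simp only: of_int_le_iff)
    then have "1 \<le> real N / real_of_int z" using z by (simp add: le_divide_eq)
    then show ?thesis by linarith
  qed
  finally have "real (card {- int N div z..int N div z}) * q \<le> 4 * (real N / real_of_int z) * q" by (rule mult_right_mono) simp
  also have "\<dots> = 4 * real N / m" using assms by (simp add: z_def)
  finally show ?thesis unfolding z_def .
qed

context cyclic
begin

lemma norm_lam_le1:
  assumes "\<And>b. adm (g b)" "\<And>b. adm (F b)" "adm G" "ivl M J"
  shows "cmod (lam M J g F G) \<le> 1"
proof -
  have "adm (\<lambda>z. dual M J g F z * G z)" by (intro adm_mult adm_dual assms)
  then show ?thesis
    unfolding avg_dual[OF assms(1-3), symmetric] by (intro norm_avg_le1 adm_norm)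
qed

text \<open>A linearised form of \<open>large_major_spectrum\<close>: either |lam| is below 1/Q, or
  the mass is so large that the second term alone exceeds the trivial bound 1. Being free of case
  distinctions, it can be summed over x and all cells without selecting good ones.\<close>

lemma norm_lam_le_mass:
  assumes g: "\<And>b. adm (g b)" and F: "\<And>b. adm (F b)" and G: "adm G" and J: "ivl M J" and P: "P = 4 * M\<^sup>2"
    and Q: "1024 \<le> Q" "Q ^ 140000 \<le> M"
  shows "cmod (lam M J g F G) \<le> 1 / real Q + real Q ^ spectral_exponent *
    avg {- int M..int M} (\<lambda>b. \<Sum>r\<in>{r\<in>U. major M (Q ^ spectral_exponent) r}. (cmod (hat (F b) r))\<^sup>2)" (is "_ \<le> _ + _ * ?w")
proof (cases "1 / real Q \<le> cmod (lam M J g F G)")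
  case True
  have "1 / real Q ^ spectral_exponent \<le> ?w"
    unfolding spectral_exponent_def by (rule large_major_spectrum[OF g F G J P Q True])
  then have "1 \<le> real Q ^ spectral_exponent * ?w" using Q by (simp add: divide_le_eq mult.commute)
  moreover have "0 \<le> 1 / real Q" by simp
  ultimately show ?thesis using norm_lam_le1[of g F, OF g F G J] by linarith
next
  case False
  have "0 \<le> real Q ^ spectral_exponent * ?w" by (intro mult_nonneg_nonneg avg_nonneg sum_nonneg) auto
  then show ?thesis using False by linarith
qed

text \<open>The linear bound is summed over all cells, the average over b being absorbed by letting
  x range over twice the interval. A pigeonhole over the denominators then yields one n common to
  all x and all cells, as the conclusion demands.\<close>

lemma mass_lower_bound:
  fixes f0 f2 :: "int \<Rightarrow> int \<Rightarrow> complex" and N1 N2 q M Q :: nat and \<delta> :: real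
  defines "XS \<equiv> {- int N1..int N1}" and "YS \<equiv> {- int N2..int N2}" and "KS \<equiv> {- int N2 div int (q\<^sup>2 * M\<^sup>2)..int N2 div int (q\<^sup>2 * M\<^sup>2)}" and "RS \<equiv> {0..<int (q\<^sup>2)}"
  assumes P: "P = 4 * M\<^sup>2" and f: "\<And>x y. cmod (f0 x y) \<le> 1" "\<And>x y. cmod (f2 x y) \<le> 1"
    and supp: "\<And>x y. f0 x y \<noteq> 0 \<Longrightarrow> x \<in> XS \<and> y \<in> YS"
    and pos: "0 < N1" "0 < N2" "0 < q" "0 < M" and qM: "q * M \<le> N1" "q\<^sup>2 * M\<^sup>2 \<le> N2" and J: "ivl M J" "J \<subseteq> {- int M..int M}"
    and \<delta>: "0 < \<delta>" and Q: "1024 \<le> Q" "Q ^ 140000 \<le> M" "864 / \<delta>\<^sup>2 \<le> real Q"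
    and large: "\<delta>\<^sup>2 * real N1 * real N2 / 9 \<le> cmod (\<Sum>x\<in>XS. \<Sum>y\<in>YS. (\<Sum>s\<in>J. \<Sum>s'\<in>J.
     (f0 (x + int q * (s' - s)) y * cnj (f0 x y)) * f2 (x + int q * (s' - s)) (y + (int q)\<^sup>2 * s\<^sup>2) * cnj (f2 x (y + (int q)\<^sup>2 * s'\<^sup>2))) / (of_nat M)\<^sup>2)"
  shows "\<exists>n. 0 < n \<and> n \<le> Q ^ spectral_exponent \<and>
    real N1 * real N2 / ((real M)\<^sup>2 * real Q ^ (2 * spectral_exponent + 1)) \<le> (\<Sum>x\<in>{- 2 * int N1..2 * int N1}. \<Sum>k\<in>KS. \<Sum>\<rho>\<in>RS.
      \<Sum>r\<in>{r\<in>U. nint (of_nat n * (of_int r / of_nat P)) \<le> real (Q ^ spectral_exponent) / (real M)\<^sup>2}. (cmod (hat (cell (f2 x) (q\<^sup>2) (M\<^sup>2) k \<rho>) r))\<^sup>2)"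
proof -
  define N where "N = Q ^ spectral_exponent"
  define g where "g x b y = f0 (x + int q * b) y * cnj (f0 x y)" for x b y
  define F where "F x b y = f2 (x + int q * b) y" for x b y
  define G where "G x y = cnj (f2 x y)" for x y
  define l where "l x k \<rho> = lam M J (\<lambda>b u. if u mod int P < int (M\<^sup>2) then cell (g x b) (q\<^sup>2) (M\<^sup>2) k \<rho> u else 0)
    (\<lambda>b. cell (F x b) (q\<^sup>2) (M\<^sup>2) k \<rho>) (cell (G x) (q\<^sup>2) (M\<^sup>2) k \<rho>)" for x k \<rho>
  define \<Xi> where "\<Xi> x y = (\<Sum>s\<in>J. \<Sum>s'\<in>J. g x (s' - s) y * F x (s' - s) (y + (int q)\<^sup>2 * s\<^sup>2) * G x (y + (int q)\<^sup>2 * s'\<^sup>2)) / (of_nat M)\<^sup>2" for x y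
  have \<Xi>0: "\<Xi> x y = 0" if "y \<notin> YS" for x y
    using that supp by (auto simp: \<Xi>_def g_def intro!: sum.neutral)
  have sum\<Xi>: "(\<Sum>y\<in>YS. \<Xi> x y) = (\<Sum>k\<in>KS. \<Sum>\<rho>\<in>RS. of_nat P * l x k \<rho>)" for x
  proof -
    have "(\<Sum>y\<in>YS. \<Xi> x y) = (\<Sum>k\<in>KS. \<Sum>\<rho>\<in>RS. \<Sum>v\<in>{0..<int (M\<^sup>2)}. \<Xi> x (int (q\<^sup>2) * (int (M\<^sup>2) * k + v) + \<rho>))"
      unfolding YS_def KS_def RS_def by (rule sum_cells) (use pos \<Xi>0 in \<open>auto simp: YS_def\<close>)
    also have "\<dots> = (\<Sum>k\<in>KS. \<Sum>\<rho>\<in>RS. of_nat P * l x k \<rho>)"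
      unfolding \<Xi>_def l_def cell_sum_lam[OF P J(2)] ..
    finally show ?thesis .
  qed
  define h where "h k \<rho> x = (\<Sum>r\<in>{r\<in>U. major M N r}. (cmod (hat (cell (f2 x) (q\<^sup>2) (M\<^sup>2) k \<rho>) r))\<^sup>2)" for k \<rho> x
  have h0: "0 \<le> h k \<rho> x" for k \<rho> x unfolding h_def by (intro sum_nonneg) simp
  define w where "w x k \<rho> = avg {- int M..int M} (\<lambda>b. h k \<rho> (x + int q * b))" for x k \<rho>
  have lw: "cmod (l x k \<rho>) \<le> 1 / real Q + real N * w x k \<rho>" for x k \<rho>
  proof -
    have "\<And>b. adm (\<lambda>u. if u mod int P < int (M\<^sup>2) then cell (g x b) (q\<^sup>2) (M\<^sup>2) k \<rho> u else 0)"
    proof (rule admI)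
      fix b u
      show "cmod (if u mod int P < int (M\<^sup>2) then cell (g x b) (q\<^sup>2) (M\<^sup>2) k \<rho> u else 0) \<le> 1"
        using f by (simp add: cell_def g_def norm_mult mult_le_one)
    qed (simp add: cell_def)
    moreover have "\<And>b. adm (cell (F x b) (q\<^sup>2) (M\<^sup>2) k \<rho>)" by (rule adm_cell) (simp add: F_def f)
    moreover have "adm (cell (G x) (q\<^sup>2) (M\<^sup>2) k \<rho>)" by (rule adm_cell) (simp add: G_def f)
    ultimately have "cmod (l x k \<rho>) \<le> 1 / real Q + real Q ^ spectral_exponent *
      avg {- int M..int M} (\<lambda>b. \<Sum>r\<in>{r\<in>U. major M (Q ^ spectral_exponent) r}. (cmod (hat (cell (F x b) (q\<^sup>2) (M\<^sup>2) k \<rho>) r))\<^sup>2)"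
      unfolding l_def by (rule norm_lam_le_mass[OF _ _ _ J(1) P Q(1,2)])
    moreover have "F x b = f2 (x + int q * b)" for b by (rule ext) (simp add: F_def)
    ultimately show ?thesis by (simp add: w_def h_def N_def)
  qed
  define C where "C = real (card XS) * (real (card KS) * real (card RS))"
  have C: "C \<le> 12 * (real N1 * real N2 / (real M)\<^sup>2)"
  proof -
    have "real (card KS) * real (q\<^sup>2) \<le> 4 * real N2 / real (M\<^sup>2)"
      unfolding KS_def by (rule card_cells_le) (use pos qM in auto)
    then have "real (card KS) * real (card RS) \<le> 4 * real N2 / (real M)\<^sup>2" by (simp add: RS_def)
    moreover have "real (card XS) \<le> 3 * real N1" using pos by (simp add: XS_def)
    ultimately have "C \<le> (3 * real N1) * (4 * real N2 / (real M)\<^sup>2)" unfolding C_def by (intro mult_mono) auto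
    then show ?thesis by simp
  qed
  define S where "S = (\<Sum>x\<in>XS. \<Sum>k\<in>KS. \<Sum>\<rho>\<in>RS. w x k \<rho>)"
  have "\<delta>\<^sup>2 * real N1 * real N2 / 9 \<le> cmod (\<Sum>x\<in>XS. \<Sum>y\<in>YS. \<Xi> x y)"
    using large unfolding \<Xi>_def g_def F_def G_def .
  also have "\<dots> \<le> (\<Sum>x\<in>XS. \<Sum>k\<in>KS. \<Sum>\<rho>\<in>RS. cmod (of_nat P * l x k \<rho>))"
    unfolding sum\<Xi>
    by (rule order.trans[OF norm_sum sum_mono[OF order.trans[OF norm_sum sum_mono[OF norm_sum]]]])
  also have "\<dots> \<le> (\<Sum>x\<in>XS. \<Sum>k\<in>KS. \<Sum>\<rho>\<in>RS. real P * (1 / real Q + real N * w x k \<rho>))"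
    by (intro sum_mono) (simp add: norm_mult lw mult_left_mono)
  also have "\<dots> = real P * (C / real Q + real N * S)"
    unfolding S_def C_def by (simp add: sum.distrib sum_distrib_left distrib_left mult_ac)
  finally have main: "\<delta>\<^sup>2 * real N1 * real N2 / 9 \<le> real P * (C / real Q + real N * S)" .
  define B where "B = real N1 * real N2"
  have B: "0 < B" using pos by (simp add: B_def)
  have M2: "0 < (real M)\<^sup>2" using pos by simp
  have S: "B / ((real M)\<^sup>2 * (real N * real Q)) \<le> S"
  proof -
    have q0: "0 < real Q" using Q by simp
    have N0: "0 < real N" using Q by (simp add: N_def)
    \<comment> \<open>The error term is at most 4 * 12 B / Q, with 4 from P = 4 M^2 and 12 from the
      number of cells. It must be at most half of \<delta>^2 B / 9, and 864 = 2 * 9 * 48.\<close>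
    have dQ: "864 \<le> \<delta>\<^sup>2 * real Q" using Q(3) \<delta> by (simp add: divide_le_eq mult.commute)
    have "\<delta>\<^sup>2 * B / 9 \<le> 4 * ((real M)\<^sup>2 * (C / real Q)) + 4 * ((real M)\<^sup>2 * (real N * S))"
      using main by (simp add: P B_def distrib_left mult.assoc)
    moreover have "(real M)\<^sup>2 * (C / real Q) \<le> 12 * B / real Q"
    proof -
      have "(real M)\<^sup>2 * C \<le> (real M)\<^sup>2 * (12 * (B / (real M)\<^sup>2))" using C M2 unfolding B_def by (intro mult_left_mono) auto
      then have "(real M)\<^sup>2 * C \<le> 12 * B" using M2 by simp
      then show ?thesis using q0 by (simp add: divide_right_mono)
    qed
    moreover have "48 * B / real Q \<le> \<delta>\<^sup>2 * B / 18"
    proof -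
      have "864 * B \<le> \<delta>\<^sup>2 * real Q * B" using dQ B by (intro mult_right_mono) auto
      then show ?thesis using q0 by (simp add: divide_le_eq mult_ac)
    qed
    ultimately have "48 * B / real Q \<le> 4 * ((real M)\<^sup>2 * (real N * S))" by linarith
    then have "48 * (B / real Q) \<le> 4 * ((real M)\<^sup>2 * (real N * S))" by simp
    moreover have "0 \<le> B / real Q" using B q0 by simp
    ultimately have "B / real Q \<le> (real M)\<^sup>2 * (real N * S)" by linarith
    then have "B \<le> (real M)\<^sup>2 * (real N * S) * real Q" using q0 by (simp add: divide_le_eq)
    then show ?thesis using M2 N0 q0 by (simp add: divide_le_eq mult_ac)
  qed
  define X2 where "X2 = {- 2 * int N1..2 * int N1}"
  define T where "T \<phi> = (\<Sum>x\<in>X2. \<Sum>k\<in>KS. \<Sum>\<rho>\<in>RS. \<phi> k \<rho> x)" for \<phi> :: "int \<Rightarrow> int \<Rightarrow> int \<Rightarrow> real"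
  have "S \<le> T h"
  proof -
    have "S = avg {- int M..int M} (\<lambda>b. \<Sum>x\<in>XS. \<Sum>k\<in>KS. \<Sum>\<rho>\<in>RS. h k \<rho> (x + int q * b))"
      unfolding S_def w_def by (simp only: avg_sum)
    also have "\<dots> \<le> T h"
    proof (rule avg_le)
      fix b assume b: "b \<in> {- int M..int M}"
      have "\<bar>b\<bar> \<le> int M" using b by auto
      then have "\<bar>int q * b\<bar> \<le> int q * int M" unfolding abs_mult by (intro mult_mono) auto
      also have "\<dots> \<le> int N1" using qM(1) by (simp flip: of_nat_mult)
      finally have "(\<lambda>x. x + int q * b) ` XS \<subseteq> X2" by (auto simp: XS_def X2_def)
      then have "(\<Sum>x\<in>(\<lambda>x. x + int q * b) ` XS. \<Sum>k\<in>KS. \<Sum>\<rho>\<in>RS. h k \<rho> x) \<le> T h"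
        unfolding T_def by (intro sum_mono2 sum_nonneg h0) (auto simp: X2_def)
      then show "(\<Sum>x\<in>XS. \<Sum>k\<in>KS. \<Sum>\<rho>\<in>RS. h k \<rho> (x + int q * b)) \<le> T h"
        by (subst (asm) sum.reindex) (auto simp: inj_on_def)
    qed (simp add: T_def sum_nonneg h0)
    finally show ?thesis .
  qed
  \<comment> \<open>The major frequencies are the union over n up to N of these sets, so one n
    carries at least a 1/N share of the total mass.\<close>
  define R where "R n = {r\<in>U. nint (of_nat n * (of_int r / of_nat P)) \<le> real N / (real M)\<^sup>2}" for n
  define hn where "hn n k \<rho> x = (\<Sum>r\<in>R n. (cmod (hat (cell (f2 x) (q\<^sup>2) (M\<^sup>2) k \<rho>) r))\<^sup>2)" for n k \<rho> x
  have "h k \<rho> x \<le> (\<Sum>n\<in>{1..N}. hn n k \<rho> x)" for k \<rho> x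
  proof -
    have "{r\<in>U. major M N r} \<subseteq> (\<Union>n\<in>{1..N}. R n)" by (fastforce simp: major_def R_def Suc_le_eq)
    moreover have fin: "finite (R n)" for n unfolding R_def by (rule finite_subset[OF _ finite_U]) auto
    ultimately have "h k \<rho> x \<le> (\<Sum>r\<in>(\<Union>n\<in>{1..N}. R n). (cmod (hat (cell (f2 x) (q\<^sup>2) (M\<^sup>2) k \<rho>) r))\<^sup>2)"
      unfolding h_def by (intro sum_mono2) auto
    also have "\<dots> \<le> (\<Sum>n\<in>{1..N}. hn n k \<rho> x)"
      unfolding hn_def by (rule sum_UN_le) (use fin in auto)
    finally show ?thesis .
  qed
  then have "T h \<le> T (\<lambda>k \<rho> x. \<Sum>n\<in>{1..N}. hn n k \<rho> x)" unfolding T_def by (intro sum_mono)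
  also have "\<dots> = (\<Sum>n\<in>{1..N}. T (hn n))"
  proof -
    have "T (\<lambda>k \<rho> x. \<Sum>n\<in>I. hn n k \<rho> x) = (\<Sum>n\<in>I. T (hn n))" if "finite I" for I
      using that by (induction I rule: finite_induct) (simp_all add: T_def sum.distrib)
    then show ?thesis by simp
  qed
  finally have "S \<le> (\<Sum>n\<in>{1..N}. T (hn n))" using \<open>S \<le> T h\<close> by linarith
  have N1': "1 \<le> N" using Q by (simp add: N_def)
  obtain n where n: "n \<in> {1..N}" "avg {1..N} (\<lambda>n. T (hn n)) \<le> T (hn n)"
    using avg_le_ex[of "{1..N}" "\<lambda>n. T (hn n)"] N1' by auto
  have "B / ((real M)\<^sup>2 * (real N * real Q)) / real N \<le> avg {1..N} (\<lambda>n. T (hn n))"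
    unfolding avg_def card_atLeastAtMost add_diff_cancel_right' Suc_eq_plus1
    by (rule divide_right_mono[OF order.trans[OF S \<open>S \<le> (\<Sum>n\<in>{1..N}. T (hn n))\<close>]]) simp
  moreover have "B / ((real M)\<^sup>2 * (real N * real Q)) / real N = B / ((real M)\<^sup>2 * real Q ^ (2 * spectral_exponent + 1))"
  proof -
    have e: "real Q ^ (2 * spectral_exponent + 1) = real N * real N * real Q" by (simp add: N_def power_add mult_2)
    show ?thesis unfolding e divide_divide_eq_left by (simp only: mult_ac)
  qed
  ultimately have "B / ((real M)\<^sup>2 * real Q ^ (2 * spectral_exponent + 1)) \<le> T (hn n)" using n(2) by linarith
  then show ?thesis using n(1) unfolding B_def T_def hn_def R_def X2_def N_def by (intro exI[of _ n]) auto
qed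

end

section \<open>From mass on major arcs to large Fejer averages\<close>

lemma norm_fejer_sum_le1:
  fixes \<phi> :: "int \<Rightarrow> complex"
  assumes H: "0 < H" and \<phi>: "\<And>d. cmod (\<phi> d) \<le> 1"
  shows "cmod (\<Sum>d\<in>{- int H..int H}. of_real (fejer_kernel (real H) d) * \<phi> d) \<le> 1"
proof -
  have "cmod (\<Sum>i\<in>{1..int H}. \<Sum>j\<in>{1..int H}. \<phi> (j - i)) \<le> real (card {1..int H}) * (real (card {1..int H}) * 1)"
    by (intro sum_norm_bound \<phi>)
  also have "\<dots> = (real H)\<^sup>2" by (simp add: power2_eq_square)
  finally show ?thesis
    unfolding sum_fejer_kernel[OF H] norm_divide norm_power norm_of_nat using H by (simp add: divide_le_eq)
qed

context cyclic
begin

text \<open>The phase is written as (j n) times n r / P: one factor n clears the denominator, the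
  other only multiplies the error, so the square step n^2 is as good as n up to a factor N. All
  phases are within 1/16 of an integer, the mean \<open>a\<close> has modulus at least 1/2, and the
  multiplier is |a|^2.\<close>

lemma norm_fejer_chr_ge:
  fixes H M n N :: nat
  assumes H: "0 < H" and M: "0 < M" and n: "n \<le> N" and HN: "16 * H * N\<^sup>2 \<le> M\<^sup>2"
    and r: "nint (of_nat n * (of_int r / of_nat P)) \<le> N / (real M)\<^sup>2"
  shows "1 / 16 \<le> (cmod (\<Sum>d\<in>{- int H..int H}. of_real (fejer_kernel (real H) d) * chr r ((int n)\<^sup>2 * d)))\<^sup>2"
proof -
  define a where "a = avg {1..int H} (\<lambda>j. chr r ((int n)\<^sup>2 * j))"
  have "(\<Sum>d\<in>{- int H..int H}. of_real (fejer_kernel (real H) d) * chr r ((int n)\<^sup>2 * d)) = a * cnj a"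
  proof -
    have "(\<Sum>i\<in>{1..int H}. \<Sum>j\<in>{1..int H}. chr r ((int n)\<^sup>2 * (j - i)))
        = (\<Sum>i\<in>{1..int H}. \<Sum>j\<in>{1..int H}. chr r ((int n)\<^sup>2 * j) * cnj (chr r ((int n)\<^sup>2 * i)))"
      by (simp only: right_diff_distrib chr_diff)
    also have "\<dots> = (\<Sum>j\<in>{1..int H}. chr r ((int n)\<^sup>2 * j)) * cnj (\<Sum>j\<in>{1..int H}. chr r ((int n)\<^sup>2 * j))"
      by (simp add: sum_distrib_left sum_distrib_right mult.commute)
    finally show ?thesis
      unfolding sum_fejer_kernel[OF H] a_def by (simp add: avg_def power2_eq_square)
  qed
  then have eq: "(cmod (\<Sum>d\<in>{- int H..int H}. of_real (fejer_kernel (real H) d) * chr r ((int n)\<^sup>2 * d)))\<^sup>2 = (cmod a) ^ 4"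
    by (simp add: norm_mult power2_eq_square power4_eq_xxxx)
  have "cmod (1 - chr r ((int n)\<^sup>2 * j)) \<le> 1 / 2" if j: "j \<in> {1..int H}" for j
  proof -
    define x where "x = of_int (j * int n) * (of_nat n * (real_of_int r / of_nat P))"
    have x: "nint x \<le> real H * real N * (N / (real M)\<^sup>2)"
    proof -
      have "nint x \<le> \<bar>real_of_int (j * int n)\<bar> * nint (of_nat n * (real_of_int r / of_nat P))"
        unfolding x_def by (rule nint_mult_int)
      also have "\<dots> \<le> (real H * real N) * (N / (real M)\<^sup>2)"
        using j n r by (intro mult_mono) (auto simp: abs_mult intro!: mult_mono)
      finally show ?thesis .
    qed
    also have "\<dots> \<le> 1 / 16"
    proof -
      have "real (16 * H * N\<^sup>2) \<le> real (M\<^sup>2)" using HN by (simp only: of_nat_le_iff)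
      then show ?thesis using M by (simp add: divide_le_eq power2_eq_square mult_ac)
    qed
    finally have "nint x \<le> 1 / 16" .
    have "chr r ((int n)\<^sup>2 * j) = echar x" by (simp add: chr_def x_def power2_eq_square mult_ac)
    then have "cmod (1 - chr r ((int n)\<^sup>2 * j)) \<le> 2 * pi * nint x" by (simp only: norm_one_minus_echar_le)
    also have "\<dots> \<le> 8 * (1 / 16)" using \<open>nint x \<le> 1 / 16\<close> pi_less_4 by (intro mult_mono) auto
    finally show ?thesis by simp
  qed
  then have "avg {1..int H} (\<lambda>j. cmod (1 - chr r ((int n)\<^sup>2 * j))) \<le> 1 / 2" by (intro avg_le) auto
  moreover have "1 - a = avg {1..int H} (\<lambda>j. 1 - chr r ((int n)\<^sup>2 * j))"
    using H by (simp add: a_def avg_diff avg_const)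
  ultimately have "cmod (1 - a) \<le> 1 / 2" using norm_avg_le[of "{1..int H}" "\<lambda>j. 1 - chr r ((int n)\<^sup>2 * j)"] by simp
  then have "1 / 2 \<le> cmod a" using norm_triangle_ineq2[of 1 "1 - a"] by simp
  then have "(1 / 2) ^ 4 \<le> (cmod a) ^ 4" by (rule power_mono) simp
  then show ?thesis unfolding eq by (simp add: power_divide)
qed

text \<open>On the selected frequencies the squared multiplier is at least 1/16, and Parseval turns
  the spectral sum into a mean square. Since the Fejer averages are bounded by 1, their squares are
  at most their moduli, which gives the first moment of the conclusion.\<close>

lemma mass_le_fejer:
  assumes F: "adm F" and H: "0 < H" and M: "0 < M" and n: "n \<le> N" and HN: "16 * H * N\<^sup>2 \<le> M\<^sup>2"
  shows "(\<Sum>r\<in>{r\<in>U. nint (of_nat n * (of_int r / of_nat P)) \<le> real N / (real M)\<^sup>2}. (cmod (hat F r))\<^sup>2)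
    \<le> 16 * A (\<lambda>v. cmod (\<Sum>d\<in>{- int H..int H}. of_real (fejer_kernel (real H) d) * F (v + (int n)\<^sup>2 * d)))"
proof -
  let ?R = "{r\<in>U. nint (of_nat n * (of_int r / of_nat P)) \<le> real N / (real M)\<^sup>2}"
  define w where "w r = (cmod (\<Sum>d\<in>{- int H..int H}. of_real (fejer_kernel (real H) d) * chr r ((int n)\<^sup>2 * d)))\<^sup>2" for r
  define X where "X v = cmod (\<Sum>d\<in>{- int H..int H}. of_real (fejer_kernel (real H) d) * F (v + (int n)\<^sup>2 * d))" for v
  have X1: "X v \<le> 1" for v unfolding X_def by (rule norm_fejer_sum_le1[OF H]) (rule adm_norm[OF F])
  have "(\<Sum>r\<in>?R. (cmod (hat F r))\<^sup>2) \<le> (\<Sum>r\<in>?R. (cmod (hat F r))\<^sup>2 * (16 * w r))"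
  proof (rule sum_mono)
    fix r assume "r \<in> ?R"
    then have "1 / 16 \<le> w r" unfolding w_def by (intro norm_fejer_chr_ge[OF H M n HN]) simp
    then have "(cmod (hat F r))\<^sup>2 * 1 \<le> (cmod (hat F r))\<^sup>2 * (16 * w r)" by (intro mult_left_mono) auto
    then show "(cmod (hat F r))\<^sup>2 \<le> (cmod (hat F r))\<^sup>2 * (16 * w r)" by simp
  qed
  also have "\<dots> \<le> (\<Sum>r\<in>U. (cmod (hat F r))\<^sup>2 * (16 * w r))"
    by (intro sum_mono2) (auto simp: w_def)
  also have "\<dots> = 16 * (\<Sum>r\<in>U. (cmod (hat F r))\<^sup>2 * w r)" by (simp add: sum_distrib_left mult_ac)
  also have "(\<Sum>r\<in>U. (cmod (hat F r))\<^sup>2 * w r) = A (\<lambda>v. (X v)\<^sup>2)"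
    unfolding w_def X_def by (rule parseval_comb[OF adm_per[OF F], symmetric]) simp
  also have "16 * A (\<lambda>v. (X v)\<^sup>2) \<le> 16 * A X"
  proof (intro mult_left_mono avg_mono)
    fix v
    have "0 \<le> X v" by (simp add: X_def)
    then show "(X v)\<^sup>2 \<le> X v" using X1[of v] by (simp add: power2_eq_square mult_left_le)
  qed simp
  finally show ?thesis unfolding X_def .
qed

text \<open>The periodic cell and f agree unless v + a d leaves the window. This happens only for
  the a H points at either end, where both sides are bounded trivially.\<close>

lemma fejer_cell_le:
  fixes f :: "int \<Rightarrow> complex" and q m H a :: nat
  assumes f: "\<And>y. cmod (f y) \<le> 1" and P: "P = 4 * m" and H: "0 < H"
  shows "real P * A (\<lambda>v. cmod (\<Sum>d\<in>{- int H..int H}. of_real (fejer_kernel (real H) d) * cell f q m k \<rho> (v + int a * d)))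
    \<le> (\<Sum>v\<in>{0..<4 * int m}. cmod (\<Sum>d\<in>{- int H..int H}. of_real (fejer_kernel (real H) d) * f (int q * (int m * k + v) + \<rho> + int q * int a * d))) + 2 * (real a * real H)"
proof -
  define X where "X v = cmod (\<Sum>d\<in>{- int H..int H}. of_real (fejer_kernel (real H) d) * cell f q m k \<rho> (v + int a * d))" for v
  define \<Phi> where "\<Phi> v = cmod (\<Sum>d\<in>{- int H..int H}. of_real (fejer_kernel (real H) d) * f (int q * (int m * k + v) + \<rho> + int q * int a * d))" for v
  define z where "z = int a * int H"
  define B where "B = {v\<in>U. v < z \<or> int P - z \<le> v}"
  have z: "0 \<le> z" by (simp add: z_def)
  have X: "X v \<le> \<Phi> v + (if v \<in> B then 1 else 0)" if v: "v \<in> U" for v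
  proof (cases "v \<in> B")
    case True
    have "X v \<le> 1" unfolding X_def by (rule norm_fejer_sum_le1[OF H]) (simp add: cell_def f)
    moreover have "0 \<le> \<Phi> v" by (simp add: \<Phi>_def)
    ultimately show ?thesis using True by simp
  next
    case False
    have "cell f q m k \<rho> (v + int a * d) = f (int q * (int m * k + v) + \<rho> + int q * int a * d)" if d: "d \<in> {- int H..int H}" for d
    proof -
      have "\<bar>d\<bar> \<le> int H" using d by auto
      then have "\<bar>int a * d\<bar> \<le> z" unfolding abs_mult z_def by (intro mult_mono) auto
      then have "0 \<le> v + int a * d" "v + int a * d < int P" using False v by (auto simp: B_def)
      then have "(v + int a * d) mod int P = v + int a * d" by (rule mod_pos_pos_trivial)
      then show ?thesis by (simp add: cell_def algebra_simps)
    qed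
    then have "X v = \<Phi> v" unfolding X_def \<Phi>_def by (intro arg_cong[where f = cmod] sum.cong refl) simp
    then show ?thesis using False by simp
  qed
  have "real P * A X = (\<Sum>v\<in>U. X v)" using P_pos by (simp add: avg_def)
  also have "\<dots> \<le> (\<Sum>v\<in>U. \<Phi> v + (if v \<in> B then 1 else 0))" by (intro sum_mono X)
  also have "\<dots> = (\<Sum>v\<in>U. \<Phi> v) + real (card B)"
  proof -
    have "B \<subseteq> U" by (auto simp: B_def)
    then show ?thesis using finite_U by (simp add: sum.distrib sum.If_cases Int_absorb1)
  qed
  also have "real (card B) \<le> 2 * (real a * real H)"
  proof -
    have "card B \<le> card ({0..<z} \<union> {int P - z..<int P})" by (intro card_mono) (auto simp: B_def)
    also have "\<dots> \<le> card {0..<z} + card {int P - z..<int P}" by (rule card_Un_le)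
    also have "\<dots> = 2 * (a * H)" by (simp add: z_def flip: of_nat_mult)
    finally have "real (card B) \<le> real (2 * (a * H))" by (simp only: of_nat_le_iff)
    then show ?thesis by simp
  qed
  finally have "real P * A X \<le> (\<Sum>v\<in>U. \<Phi> v) + 2 * (real a * real H)" by simp
  moreover have "U = {0..<4 * int m}" by (simp add: P)
  ultimately show ?thesis unfolding X_def \<Phi>_def by simp
qed

text \<open>Mass in each cell is bounded by the Fejer average over its window plus a boundary term.
  The windows overlap at most four times, and there are at most 20 N1 N2 / M^2 triples (x, k,
  \<rho>), so the boundary terms are negligible.\<close>

lemma fejer_lower_bound:
  fixes f2 :: "int \<Rightarrow> int \<Rightarrow> complex" and N1 N2 q M Q n H :: nat and S :: "int set"
  defines "X2 \<equiv> {- 2 * int N1..2 * int N1}" and "KS \<equiv> {- int N2 div int (q\<^sup>2 * M\<^sup>2)..int N2 div int (q\<^sup>2 * M\<^sup>2)}" and "RS \<equiv> {0..<int (q\<^sup>2)}"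
  defines "\<Phi> \<equiv> \<lambda>x y. cmod (\<Sum>d\<in>{- int H..int H}. of_real (fejer_kernel (real H) d) * f2 x (y + (int q)\<^sup>2 * (int n)\<^sup>2 * d))"
  assumes P: "P = 4 * M\<^sup>2" and f: "\<And>x y. cmod (f2 x y) \<le> 1" and S: "finite S" "\<And>x y. y \<notin> S \<Longrightarrow> \<Phi> x y = 0"
    and pos: "0 < N1" "0 < N2" "0 < q" "0 < M" "0 < H" and qM: "q\<^sup>2 * M\<^sup>2 \<le> N2" and Q: "1024 \<le> Q" and n: "n \<le> Q ^ E"
    and H: "H * Q ^ (4 * E + 2) \<le> M\<^sup>2"
    and mass: "real N1 * real N2 / ((real M)\<^sup>2 * real Q ^ (2 * E + 1)) \<le> (\<Sum>x\<in>X2. \<Sum>k\<in>KS. \<Sum>\<rho>\<in>RS.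
      \<Sum>r\<in>{r\<in>U. nint (of_nat n * (of_int r / of_nat P)) \<le> real (Q ^ E) / (real M)\<^sup>2}. (cmod (hat (cell (f2 x) (q\<^sup>2) (M\<^sup>2) k \<rho>) r))\<^sup>2)"
  shows "real N1 * real N2 / real Q ^ (2 * E + 2) \<le> (\<Sum>x\<in>X2. \<Sum>y\<in>S. \<Phi> x y)"
proof -
  define B where "B = real N1 * real N2"
  have B: "0 < B" using pos by (simp add: B_def)
  define W where "W = (\<Sum>x\<in>X2. \<Sum>y\<in>S. \<Phi> x y)"
  define b where "b = real (n\<^sup>2) * real H"
  have q: "1024 \<le> real Q" using Q by simp
  have M2: "0 < (real M)\<^sup>2" using pos by simp
  have HN: "16 * H * (Q ^ E)\<^sup>2 \<le> M\<^sup>2"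
  proof -
    have "16 * (Q ^ E)\<^sup>2 \<le> Q ^ 2 * Q ^ (4 * E)"
    proof (rule mult_mono)
      show "16 \<le> Q ^ 2" using Q power_mono[of 1024 Q 2] by simp
      show "(Q ^ E)\<^sup>2 \<le> Q ^ (4 * E)" unfolding power_mult[symmetric] using Q by (intro power_increasing) auto
    qed auto
    also have "Q ^ 2 * Q ^ (4 * E) = Q ^ (4 * E + 2)" by (simp only: power_add mult.commute)
    finally have "H * (16 * (Q ^ E)\<^sup>2) \<le> H * Q ^ (4 * E + 2)" by (rule mult_left_mono) simp
    from order.trans[OF this H] show ?thesis by (simp only: mult_ac)
  qed
  have each: "real P * (\<Sum>r\<in>{r\<in>U. nint (of_nat n * (of_int r / of_nat P)) \<le> real (Q ^ E) / (real M)\<^sup>2}. (cmod (hat (cell (f2 x) (q\<^sup>2) (M\<^sup>2) k \<rho>) r))\<^sup>2)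
      \<le> 16 * ((\<Sum>v\<in>{0..<4 * int (M\<^sup>2)}. \<Phi> x (int (q\<^sup>2) * (int (M\<^sup>2) * k + v) + \<rho>)) + 2 * b)" for x k \<rho>
  proof -
    define Y where "Y = A (\<lambda>v. cmod (\<Sum>d\<in>{- int H..int H}. of_real (fejer_kernel (real H) d) * cell (f2 x) (q\<^sup>2) (M\<^sup>2) k \<rho> (v + int (n\<^sup>2) * d)))"
    have "(\<Sum>r\<in>{r\<in>U. nint (of_nat n * (of_int r / of_nat P)) \<le> real (Q ^ E) / (real M)\<^sup>2}. (cmod (hat (cell (f2 x) (q\<^sup>2) (M\<^sup>2) k \<rho>) r))\<^sup>2) \<le> 16 * Y"
      unfolding Y_def of_nat_power by (rule mass_le_fejer[OF adm_cell[where f = "f2 x", OF f] pos(5,4) n HN, unfolded of_nat_power])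
    then have "real P * (\<Sum>r\<in>{r\<in>U. nint (of_nat n * (of_int r / of_nat P)) \<le> real (Q ^ E) / (real M)\<^sup>2}. (cmod (hat (cell (f2 x) (q\<^sup>2) (M\<^sup>2) k \<rho>) r))\<^sup>2) \<le> real P * (16 * Y)"
      by (rule mult_left_mono) simp
    also have "\<dots> = 16 * (real P * Y)" by simp
    also have "real P * Y \<le> (\<Sum>v\<in>{0..<4 * int (M\<^sup>2)}. \<Phi> x (int (q\<^sup>2) * (int (M\<^sup>2) * k + v) + \<rho>)) + 2 * b"
      using fejer_cell_le[where f = "f2 x" and q = "q\<^sup>2" and m = "M\<^sup>2" and k = k and \<rho> = \<rho> and H = H and a = "n\<^sup>2", OF f P pos(5)] unfolding Y_def \<Phi>_def b_def by simp
    finally show ?thesis by simp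
  qed
  define C where "C = real (card X2) * (real (card KS) * real (card RS))"
  have C: "C \<le> 20 * (B / (real M)\<^sup>2)"
  proof -
    have "real (card KS) * real (q\<^sup>2) \<le> 4 * real N2 / real (M\<^sup>2)"
      unfolding KS_def by (rule card_cells_le) (use pos qM in auto)
    then have "real (card KS) * real (card RS) \<le> 4 * real N2 / (real M)\<^sup>2" by (simp add: RS_def)
    moreover have "real (card X2) \<le> 5 * real N1" using pos by (simp add: X2_def)
    ultimately have "C \<le> (5 * real N1) * (4 * real N2 / (real M)\<^sup>2)" unfolding C_def by (intro mult_mono) auto
    then show ?thesis by (simp add: B_def)
  qed
  have "real P * (B / ((real M)\<^sup>2 * real Q ^ (2 * E + 1))) \<le> real P * (\<Sum>x\<in>X2. \<Sum>k\<in>KS. \<Sum>\<rho>\<in>RS.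
      \<Sum>r\<in>{r\<in>U. nint (of_nat n * (of_int r / of_nat P)) \<le> real (Q ^ E) / (real M)\<^sup>2}. (cmod (hat (cell (f2 x) (q\<^sup>2) (M\<^sup>2) k \<rho>) r))\<^sup>2)"
    using mass unfolding B_def by (rule mult_left_mono) simp
  also have "\<dots> = (\<Sum>x\<in>X2. \<Sum>k\<in>KS. \<Sum>\<rho>\<in>RS. real P *
      (\<Sum>r\<in>{r\<in>U. nint (of_nat n * (of_int r / of_nat P)) \<le> real (Q ^ E) / (real M)\<^sup>2}. (cmod (hat (cell (f2 x) (q\<^sup>2) (M\<^sup>2) k \<rho>) r))\<^sup>2))"
    by (simp only: sum_distrib_left[of "real P" _ X2] sum_distrib_left[of "real P" _ KS] sum_distrib_left[of "real P" _ RS])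
  also have "\<dots> \<le> (\<Sum>x\<in>X2. \<Sum>k\<in>KS. \<Sum>\<rho>\<in>RS. 16 * ((\<Sum>v\<in>{0..<4 * int (M\<^sup>2)}. \<Phi> x (int (q\<^sup>2) * (int (M\<^sup>2) * k + v) + \<rho>)) + 2 * b))"
    by (intro sum_mono each)
  also have "\<dots> = 16 * ((\<Sum>x\<in>X2. \<Sum>k\<in>KS. \<Sum>\<rho>\<in>RS. \<Sum>v\<in>{0..<4 * int (M\<^sup>2)}. \<Phi> x (int (q\<^sup>2) * (int (M\<^sup>2) * k + v) + \<rho>)) + C * (2 * b))"
    unfolding C_def by (simp only: sum_distrib_left[symmetric] sum.distrib sum_constant mult_ac)
  also have "\<dots> \<le> 16 * (4 * W + C * (2 * b))"
  proof -
    have "(\<Sum>k\<in>KS. \<Sum>\<rho>\<in>RS. \<Sum>v\<in>{0..<4 * int (M\<^sup>2)}. \<Phi> x (int (q\<^sup>2) * (int (M\<^sup>2) * k + v) + \<rho>)) \<le> 4 * sum (\<Phi> x) S" for x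
      unfolding RS_def by (rule sum_overlapping_cells) (use pos S in \<open>auto simp: KS_def \<Phi>_def\<close>)
    then have "(\<Sum>x\<in>X2. \<Sum>k\<in>KS. \<Sum>\<rho>\<in>RS. \<Sum>v\<in>{0..<4 * int (M\<^sup>2)}. \<Phi> x (int (q\<^sup>2) * (int (M\<^sup>2) * k + v) + \<rho>)) \<le> (\<Sum>x\<in>X2. 4 * sum (\<Phi> x) S)"
      by (rule sum_mono)
    also have "(\<Sum>x\<in>X2. 4 * sum (\<Phi> x) S) = 4 * W" by (simp only: W_def sum_distrib_left[symmetric])
    finally have le: "(\<Sum>x\<in>X2. \<Sum>k\<in>KS. \<Sum>\<rho>\<in>RS. \<Sum>v\<in>{0..<4 * int (M\<^sup>2)}. \<Phi> x (int (q\<^sup>2) * (int (M\<^sup>2) * k + v) + \<rho>)) \<le> 4 * W" .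
    show ?thesis by (rule mult_left_mono[OF add_right_mono[OF le]]) simp
  qed
  finally have main: "real P * (B / ((real M)\<^sup>2 * real Q ^ (2 * E + 1))) \<le> 16 * (4 * W + C * (2 * b))" .
  have l: "real P * (B / ((real M)\<^sup>2 * real Q ^ (2 * E + 1))) = 4 * (B / real Q ^ (2 * E + 1))"
    using M2 by (simp add: P)
  \<comment> \<open>This is where the size condition on H is spent: n^2 costs Q^(2E), and the
    remaining Q^(2E + 2) is a factor Q below the mass bound.\<close>
  have bM: "b / (real M)\<^sup>2 \<le> 1 / real Q ^ (2 * E + 2)"
  proof -
    have "n\<^sup>2 * H * Q ^ (2 * E + 2) \<le> (Q ^ E)\<^sup>2 * H * Q ^ (2 * E + 2)" using n by (intro mult_right_mono power_mono) auto
    also have "\<dots> = H * Q ^ (4 * E + 2)" by (simp add: mult_ac flip: power_mult power_add)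
    also have "\<dots> \<le> M\<^sup>2" by (rule H)
    finally have "real (n\<^sup>2 * H * Q ^ (2 * E + 2)) \<le> real (M\<^sup>2)" by (simp only: of_nat_le_iff)
    then have "b * real Q ^ (2 * E + 2) \<le> (real M)\<^sup>2" by (simp add: b_def)
    then show ?thesis using M2 q by (simp add: divide_le_eq le_divide_eq mult.commute)
  qed
  have "C * (2 * b) \<le> 20 * (B / (real M)\<^sup>2) * (2 * b)" using C by (rule mult_right_mono) (simp add: b_def)
  also have "\<dots> = 40 * B * (b / (real M)\<^sup>2)" by simp
  also have "\<dots> \<le> 40 * B * (1 / real Q ^ (2 * E + 2))" using bM B by (intro mult_left_mono) auto
  finally have Cb: "C * (2 * b) \<le> 40 * (B / real Q ^ (2 * E + 2))" by simp
  have up: "1024 * (B / real Q ^ (2 * E + 2)) \<le> B / real Q ^ (2 * E + 1)"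
  proof -
    have "1024 * (B / real Q ^ (2 * E + 2)) \<le> real Q * (B / real Q ^ (2 * E + 2))" using q B by (intro mult_right_mono) auto
    also have "\<dots> = B / real Q ^ (2 * E + 1)" using q by (simp add: power_add)
    finally show ?thesis .
  qed
  have y: "0 \<le> B / real Q ^ (2 * E + 2)" using B by simp
  have "y \<le> w" if "a \<le> 16 * (4 * w + c)" "a = 4 * y1" "c \<le> 40 * y" "1024 * y \<le> y1" "0 \<le> y" for a c w y y1 :: real
  proof -
    have "4 * y1 \<le> 64 * w + 16 * c" using that(1,2) by simp
    moreover have "16 * c \<le> 640 * y" using that(3) by simp
    moreover have "4096 * y \<le> 4 * y1" using that(4) by simp
    ultimately have "4096 * y \<le> 64 * w + 640 * y" by (meson add_left_mono order.trans)
    then have "54 * y \<le> w" by simp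
    moreover have "1 * y \<le> 54 * y" using that(5) by (intro mult_right_mono) auto
    ultimately show ?thesis by simp
  qed
  from this[OF main l Cb up y] have "B / real Q ^ (2 * E + 2) \<le> W" .
  then show ?thesis by (simp add: B_def W_def)
qed

end

text \<open>The denominator n is chosen before H, matching the order of quantifiers in the goal. The
  set S stands for any finite set outside which the Fejer averages vanish, because this range
  depends on H.\<close>

lemma inverse_theorem:
  fixes f0 f1 f2 :: "int \<Rightarrow> int \<Rightarrow> complex" and N1 N2 q M Q :: nat and \<delta> :: real
  defines "XS \<equiv> {- int N1..int N1}" and "YS \<equiv> {- int N2..int N2}"
  assumes f: "\<And>x y. cmod (f0 x y) \<le> 1" "\<And>x y. cmod (f1 x y) \<le> 1" "\<And>x y. cmod (f2 x y) \<le> 1"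
    and supp: "\<forall>x y. f0 x y \<noteq> 0 \<longrightarrow> x \<in> XS \<and> y \<in> YS" "\<forall>x y. f1 x y \<noteq> 0 \<longrightarrow> x \<in> XS \<and> y \<in> YS"
    and pos: "0 < N1" "0 < N2" "0 < q" "0 < M" and qM: "q * M \<le> N1" "q\<^sup>2 * M\<^sup>2 \<le> N2"
    and \<delta>: "0 < \<delta>" and Q: "1024 \<le> Q" "Q ^ 140000 \<le> M" "864 / \<delta>\<^sup>2 \<le> real Q"
    and large: "\<delta> * real N1 * real N2 \<le> cmod (\<Sum>d\<in>{- int M..int M}. of_real (fejer_kernel (real M) d) *
      (\<Sum>x\<in>XS. \<Sum>y\<in>YS. f0 x y * f1 (x + int q * d) y * f2 x (y + (int q)\<^sup>2 * d\<^sup>2)))"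
  shows "\<exists>n. 0 < n \<and> n \<le> Q ^ spectral_exponent \<and> (\<forall>H S. 0 < H \<longrightarrow> H * Q ^ (4 * spectral_exponent + 2) \<le> M\<^sup>2 \<longrightarrow> finite S \<longrightarrow>
      (\<forall>x y. y \<notin> S \<longrightarrow> cmod (\<Sum>d\<in>{- int H..int H}. of_real (fejer_kernel (real H) d) * f2 x (y + (int q)\<^sup>2 * (int n)\<^sup>2 * d)) = 0) \<longrightarrow>
      real N1 * real N2 / real Q ^ (2 * spectral_exponent + 2)
        \<le> (\<Sum>x\<in>{- 2 * int N1..2 * int N1}. \<Sum>y\<in>S. cmod (\<Sum>d\<in>{- int H..int H}. of_real (fejer_kernel (real H) d) * f2 x (y + (int q)\<^sup>2 * (int n)\<^sup>2 * d))))"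
proof -
  interpret cyclic "4 * M\<^sup>2" by unfold_locales (use pos in simp)
  obtain J where J: "ivl M J" "J \<subseteq> {- int M..int M}"
    and l1: "\<delta> * real N1 * real N2 \<le> cmod ((\<Sum>s\<in>J. \<Sum>x\<in>XS. \<Sum>y\<in>YS. f0 x y * f1 (x + int q * s) y * f2 x (y + (int q)\<^sup>2 * s\<^sup>2)) / of_nat M)"
    using fejer_pigeonhole[OF pos(4) large] by blast
  note l2 = eliminate_f1[OF f supp[unfolded XS_def YS_def, rule_format] pos(1,2,4) qM(1) J \<delta> l1[unfolded XS_def YS_def]]
  obtain n where n: "0 < n" "n \<le> Q ^ spectral_exponent" and mass:
    "real N1 * real N2 / ((real M)\<^sup>2 * real Q ^ (2 * spectral_exponent + 1)) \<le> (\<Sum>x\<in>{- 2 * int N1..2 * int N1}.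
      \<Sum>k\<in>{- int N2 div int (q\<^sup>2 * M\<^sup>2)..int N2 div int (q\<^sup>2 * M\<^sup>2)}. \<Sum>\<rho>\<in>{0..<int (q\<^sup>2)}.
      \<Sum>r\<in>{r\<in>U. nint (of_nat n * (of_int r / of_nat (4 * M\<^sup>2))) \<le> real (Q ^ spectral_exponent) / (real M)\<^sup>2}.
        (cmod (hat (cell (f2 x) (q\<^sup>2) (M\<^sup>2) k \<rho>) r))\<^sup>2)"
    using mass_lower_bound[OF refl f(1,3) supp(1)[unfolded XS_def YS_def, rule_format] pos qM J \<delta> Q l2] by blast
  show ?thesis
    by (intro exI[of _ n] conjI allI impI n) (rule fejer_lower_bound[OF refl f(3) _ _ pos _ qM(2) Q(1) n(2) _ mass]; blast)
qed

section \<open>Choice of Q in terms of \<delta>, and the final deduction\<close>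

lemma choose_parameter:
  fixes \<delta> :: real
  assumes \<delta>: "0 < \<delta>" "\<delta> \<le> 1"
  obtains Q :: nat where "1024 \<le> Q" "864 / \<delta>\<^sup>2 \<le> real Q" "real Q ^ K \<le> 2048 ^ K * \<delta> powr (- (2048 ^ K))"
    "1 / 2048 ^ K * \<delta> powr (2048 ^ K) \<le> 1 / real Q ^ K"
proof -
  \<comment> \<open>With 1024 in the numerator and \<delta> at most 1, the bounds Q >= 1024 and Q >=
    864 / \<delta>^2 both hold; rounding up at most doubles the value, hence 2048.\<close>
  define Q where "Q = nat \<lceil>1024 / \<delta>\<^sup>2\<rceil>"
  have d1: "0 < \<delta>\<^sup>2" "\<delta>\<^sup>2 \<le> 1" using \<delta> by (auto simp: power_le_one)
  have lo: "1024 / \<delta>\<^sup>2 \<le> real Q" unfolding Q_def by (rule real_nat_ceiling_ge)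
  have ge: "1024 \<le> 1024 / \<delta>\<^sup>2" using d1 by (simp add: le_divide_eq)
  have "real Q \<le> 1024 / \<delta>\<^sup>2 + 1"
    unfolding Q_def using ge ceiling_correct[of "1024 / \<delta>\<^sup>2"] by (subst of_nat_nat) linarith+
  also have "\<dots> \<le> 2048 / \<delta>\<^sup>2" using ge by simp
  finally have up: "real Q \<le> 2048 / \<delta>\<^sup>2" .
  \<comment> \<open>One constant 2048 ^ K serves as factor and as exponent. Since 2 K is at most
    2048 ^ K and \<delta> at most 1, the larger exponent only weakens the bounds.\<close>
  have K: "real (2 * K) \<le> 2048 ^ K"
    using Bernoulli_inequality[of "2047::real" K] by simp
  have pw: "\<delta> powr (2048 ^ K) \<le> (\<delta>\<^sup>2) ^ K"
  proof -
    have "\<delta> powr (2048 ^ K) \<le> \<delta> powr (real (2 * K))" using K \<delta> by (intro powr_mono') auto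
    also have "\<dots> = (\<delta>\<^sup>2) ^ K" using \<delta> by (simp only: powr_realpow power_mult)
    finally show ?thesis .
  qed
  have QK: "real Q ^ K \<le> 2048 ^ K / (\<delta>\<^sup>2) ^ K" using power_mono[OF up, of K] by (simp add: power_divide)
  have Q: "0 < real Q" using lo ge by linarith
  show thesis
  proof (rule that)
    have "real 1024 \<le> real Q" using lo ge by simp
    then show "1024 \<le> Q" by (simp only: of_nat_le_iff)
    have "864 / \<delta>\<^sup>2 \<le> 1024 / \<delta>\<^sup>2" using d1 by (intro divide_right_mono) auto
    then show "864 / \<delta>\<^sup>2 \<le> real Q" using lo by linarith
    have "2048 ^ K / (\<delta>\<^sup>2) ^ K \<le> 2048 ^ K / \<delta> powr (2048 ^ K)"
      using pw d1 \<delta> by (intro divide_left_mono) auto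
    from order.trans[OF QK this] show "real Q ^ K \<le> 2048 ^ K * \<delta> powr (- (2048 ^ K))"
      by (simp add: powr_minus divide_inverse)
    have "1 / 2048 ^ K * \<delta> powr (2048 ^ K) \<le> 1 / 2048 ^ K * (\<delta>\<^sup>2) ^ K" using pw by (intro mult_left_mono) auto
    also have "\<dots> = 1 / (2048 ^ K / (\<delta>\<^sup>2) ^ K)" by simp
    also have "\<dots> \<le> 1 / real Q ^ K" using QK Q d1 by (intro divide_left_mono) auto
    finally show "1 / 2048 ^ K * \<delta> powr (2048 ^ K) \<le> 1 / real Q ^ K" .
  qed
qed

theorem theorem5p3:
  "\<exists>C c :: real. C \<ge> 1 \<and> c > 0 \<and>
    (\<forall>(N1::nat) (N2::nat) (\<delta>::real) (f0 :: int \<times> int \<Rightarrow> complex)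
       (f1 :: int \<times> int \<Rightarrow> complex) (f2 :: int \<times> int \<Rightarrow> complex) (q::nat) (M::nat).
      N1 > 0 \<longrightarrow> N2 > 0 \<longrightarrow> real N1 \<ge> sqrt (real N2) \<longrightarrow> \<delta> > 0 \<longrightarrow> \<delta> \<le> 1 \<longrightarrow>
      (\<forall>f \<in> {f0, f1, f2}.
         (\<forall>p. cmod (f p) \<le> 1) \<and>
         {p. f p \<noteq> 0} \<subseteq> {- int N1..int N1} \<times> {- int N2..int N2}) \<longrightarrow>
      q > 0 \<longrightarrow> M > 0 \<longrightarrow> real (q * M) \<le> sqrt (real N2) \<longrightarrow>
      cmod (\<Sum>\<^sub>\<infinity>(x, y, d) \<in> (UNIV :: (int \<times> int \<times> int) set).
              of_real (fejer_kernel (real M) d) * f0 (x, y) * f1 (x + int q * d, y)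
                * f2 (x, y + (int q)\<^sup>2 * d\<^sup>2))
        \<ge> \<delta> * real N1 * real N2 \<longrightarrow>
      (\<exists>q'::nat. q' > 0 \<and> real q' \<le> C * \<delta> powr (- C) \<and>
        (\<forall>M'::nat. M' > 0 \<longrightarrow>
          real M' \<ge> c * \<delta> powr C * real M \<or>
          (\<Sum>\<^sub>\<infinity>(x, y) \<in> (UNIV :: (int \<times> int) set).
             cmod (\<Sum>\<^sub>\<infinity>d' \<in> (UNIV :: int set).
                     of_real (fejer_kernel ((real M')\<^sup>2) d')
                       * f2 (x, y + (int q)\<^sup>2 * (int q')\<^sup>2 * d')))
            \<ge> c * \<delta> powr C * real N1 * real N2)))"
proof -
  define E where "E = spectral_exponent"
  \<comment> \<open>Dominates all exponents that occur: E for the denominator, 2 E + 2 for the lower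
    bound and 140000 for the size of M, while 2 K covers 4 E + 2.\<close>
  define K where "K = 4 * E + 140000"
  define C where "C = (2048::real) ^ K"
  have C1: "1 \<le> C" unfolding C_def by (rule one_le_power) simp
  show ?thesis
  proof (rule exI[of _ C], rule exI[of _ "1 / C"], intro conjI allI impI)
    show "1 \<le> C" "0 < 1 / C" using C1 by simp_all
    fix N1 N2 :: nat and \<delta> :: real and f0 f1 f2 :: "int \<times> int \<Rightarrow> complex" and q M :: nat
    assume pos: "0 < N1" "0 < N2" and N: "sqrt (real N2) \<le> real N1" and \<delta>: "0 < \<delta>" "\<delta> \<le> 1"
      and f: "\<forall>f \<in> {f0, f1, f2}. (\<forall>p. cmod (f p) \<le> 1) \<and> {p. f p \<noteq> 0} \<subseteq> {- int N1..int N1} \<times> {- int N2..int N2}"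
      and qM: "0 < q" "0 < M" "real (q * M) \<le> sqrt (real N2)"
      and large: "\<delta> * real N1 * real N2 \<le> cmod (\<Sum>\<^sub>\<infinity>(x, y, d) \<in> (UNIV :: (int \<times> int \<times> int) set).
              of_real (fejer_kernel (real M) d) * f0 (x, y) * f1 (x + int q * d, y) * f2 (x, y + (int q)\<^sup>2 * d\<^sup>2))"
    obtain Q :: nat where Q: "1024 \<le> Q" "864 / \<delta>\<^sup>2 \<le> real Q" "real Q ^ K \<le> C * \<delta> powr (- C)" "1 / C * \<delta> powr C \<le> 1 / real Q ^ K"
      using choose_parameter[OF \<delta>, of K] unfolding C_def by blast
    have QK: "real Q ^ i \<le> real Q ^ K" if "i \<le> K" for i using Q(1) that by (intro power_increasing) auto
    have Q0: "0 < real Q" using Q(1) by simp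
    let ?X = "{- int N1..int N1}" and ?Y = "{- int N2..int N2}"
    show "\<exists>q'::nat. q' > 0 \<and> real q' \<le> C * \<delta> powr (- C) \<and>
        (\<forall>M'::nat. M' > 0 \<longrightarrow> real M' \<ge> 1 / C * \<delta> powr C * real M \<or>
          (\<Sum>\<^sub>\<infinity>(x, y) \<in> (UNIV :: (int \<times> int) set). cmod (\<Sum>\<^sub>\<infinity>d' \<in> (UNIV :: int set).
                     of_real (fejer_kernel ((real M')\<^sup>2) d') * f2 (x, y + (int q)\<^sup>2 * (int q')\<^sup>2 * d')))
            \<ge> 1 / C * \<delta> powr C * real N1 * real N2)"
    proof (cases "Q ^ 140000 \<le> M")
      case False
      \<comment> \<open>For M below Q ^ 140000 the threshold of the first alternative is at most 1,
        so every positive \<open>M'\<close> satisfies it and the denominator 1 will do.\<close>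
      have small: "1 / C * \<delta> powr C * real M \<le> 1"
      proof -
        have "1 / C * \<delta> powr C * real M \<le> 1 / real Q ^ K * real M" using Q(4) by (rule mult_right_mono) simp
        also have "\<dots> \<le> 1 / real Q ^ K * real Q ^ K"
        proof (rule mult_left_mono)
          have "real M \<le> real (Q ^ 140000)" using False by (simp only: of_nat_le_iff)
          also have "\<dots> \<le> real Q ^ K" using QK[of 140000] by (simp add: K_def)
          finally show "real M \<le> real Q ^ K" .
        qed simp
        finally show ?thesis using Q0 by simp
      qed
      show ?thesis
      proof (intro exI[of _ "1::nat"] conjI allI impI disjI1)
        show "real 1 \<le> C * \<delta> powr (- C)" using QK[of 0] Q(3) by simp
        fix M' :: nat assume "0 < M'"
        then show "1 / C * \<delta> powr C * real M \<le> real M'" using small by linarith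
      qed simp
    next
      case True
      have b: "cmod (f0 p) \<le> 1" "cmod (f1 p) \<le> 1" "cmod (f2 p) \<le> 1" for p using f by blast+
      have s: "f0 (x, y) \<noteq> 0 \<Longrightarrow> x \<in> ?X \<and> y \<in> ?Y" "f1 (x, y) \<noteq> 0 \<Longrightarrow> x \<in> ?X \<and> y \<in> ?Y" "f2 (x, y) \<noteq> 0 \<Longrightarrow> x \<in> ?X \<and> y \<in> ?Y" for x y
        using f by blast+
      have s': "\<forall>x y. f0 (x, y) \<noteq> 0 \<longrightarrow> x \<in> ?X \<and> y \<in> ?Y" "\<forall>x y. f1 (x, y) \<noteq> 0 \<longrightarrow> x \<in> ?X \<and> y \<in> ?Y"
        using s(1,2) by blast+
      have "real (q * M) \<le> real N1" using qM(3) N by (rule order.trans)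
      then have qM1: "q * M \<le> N1" by (simp only: of_nat_le_iff)
      have "(real (q * M))\<^sup>2 \<le> (sqrt (real N2))\<^sup>2" using qM(3) by (rule power_mono) simp
      then have "real (q\<^sup>2 * M\<^sup>2) \<le> real N2" by (simp add: power_mult_distrib)
      then have qM2: "q\<^sup>2 * M\<^sup>2 \<le> N2" by (simp only: of_nat_le_iff)
      have "(\<Sum>\<^sub>\<infinity>(x, y, d) \<in> (UNIV :: (int \<times> int \<times> int) set).
              of_real (fejer_kernel (real M) d) * f0 (x, y) * f1 (x + int q * d, y) * f2 (x, y + (int q)\<^sup>2 * d\<^sup>2))
          = (\<Sum>(x, y, d) \<in> ?X \<times> ?Y \<times> {- int M..int M}.
              of_real (fejer_kernel (real M) d) * f0 (x, y) * f1 (x + int q * d, y) * f2 (x, y + (int q)\<^sup>2 * d\<^sup>2))"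
      proof (rule infsum_finite_support)
        fix p assume p: "p \<notin> ?X \<times> ?Y \<times> {- int M..int M}"
        obtain x y d where p': "p = (x, y, d)" by (cases p) auto
        show "(case p of (x, y, d) \<Rightarrow> of_real (fejer_kernel (real M) d) * f0 (x, y) * f1 (x + int q * d, y) * f2 (x, y + (int q)\<^sup>2 * d\<^sup>2)) = 0"
          using p s(1)[of x y] fejer_kernel_eq_0[OF _ qM(2), of d] unfolding p' by auto
      qed simp
      also have "\<dots> = (\<Sum>x\<in>?X. \<Sum>y\<in>?Y. \<Sum>d\<in>{- int M..int M}.
              of_real (fejer_kernel (real M) d) * f0 (x, y) * f1 (x + int q * d, y) * f2 (x, y + (int q)\<^sup>2 * d\<^sup>2))"
        by (simp only: sum.cartesian_product)
      also have "\<dots> = (\<Sum>d\<in>{- int M..int M}. \<Sum>x\<in>?X. \<Sum>y\<in>?Y.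
              of_real (fejer_kernel (real M) d) * f0 (x, y) * f1 (x + int q * d, y) * f2 (x, y + (int q)\<^sup>2 * d\<^sup>2))"
        by (rule sym, rule trans[OF sum.swap], rule sum.cong[OF refl], rule sum.swap)
      finally have large': "\<delta> * real N1 * real N2 \<le> cmod (\<Sum>d\<in>{- int M..int M}. of_real (fejer_kernel (real M) d) *
          (\<Sum>x\<in>?X. \<Sum>y\<in>?Y. f0 (x, y) * f1 (x + int q * d, y) * f2 (x, y + (int q)\<^sup>2 * d\<^sup>2)))"
        using large by (simp only: sum_distrib_left mult.assoc)
      note inverse_theorem[where ?f0.0 = "\<lambda>x y. f0 (x, y)" and ?f1.0 = "\<lambda>x y. f1 (x, y)" and ?f2.0 = "\<lambda>x y. f2 (x, y)",
          OF b s' pos qM(1,2) qM1 qM2 \<delta>(1) Q(1) True Q(2) large', folded E_def]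
      then obtain n where n: "0 < n" "n \<le> Q ^ E"
        and low: "\<forall>H S. 0 < H \<longrightarrow> H * Q ^ (4 * E + 2) \<le> M\<^sup>2 \<longrightarrow> finite S \<longrightarrow>
          (\<forall>x y. y \<notin> S \<longrightarrow> cmod (\<Sum>d\<in>{- int H..int H}. of_real (fejer_kernel (real H) d) * f2 (x, y + (int q)\<^sup>2 * (int n)\<^sup>2 * d)) = 0) \<longrightarrow>
          real N1 * real N2 / real Q ^ (2 * E + 2)
          \<le> (\<Sum>x\<in>{- 2 * int N1..2 * int N1}. \<Sum>y\<in>S. cmod (\<Sum>d\<in>{- int H..int H}. of_real (fejer_kernel (real H) d) * f2 (x, y + (int q)\<^sup>2 * (int n)\<^sup>2 * d)))"
        by (elim exE conjE)
      show ?thesis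
      proof (intro exI[of _ n] conjI allI impI)
        show "0 < n" by (rule n)
        have "real n \<le> real (Q ^ E)" using n(2) by (simp only: of_nat_le_iff)
        also have "\<dots> \<le> real Q ^ K" using QK[of E] by (simp add: K_def)
        finally show "real n \<le> C * \<delta> powr (- C)" using Q(3) by linarith
        fix M' :: nat assume M': "0 < M'"
        define H where "H = M'\<^sup>2"
        have H: "0 < H" "(real M')\<^sup>2 = real H" using M' by (simp_all add: H_def)
        define \<Phi> where "\<Phi> x y = cmod (\<Sum>d\<in>{- int H..int H}. of_real (fejer_kernel (real H) d) * f2 (x, y + (int q)\<^sup>2 * (int n)\<^sup>2 * d))" for x y
        define z where "z = (int q)\<^sup>2 * (int n)\<^sup>2 * int H"
        \<comment> \<open>The support of f2 in y, enlarged by z, the largest displacement q^2 n^2 d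
          with |d| at most H.\<close>
        define S where "S = {- int N2 - z..int N2 + z}"
        have zero: "\<Phi> x y = 0" if "x \<notin> {- 2 * int N1..2 * int N1} \<or> y \<notin> S" for x y
        proof -
          have "f2 (x, y + (int q)\<^sup>2 * (int n)\<^sup>2 * d) = 0" if d: "d \<in> {- int H..int H}" for d
          proof (rule ccontr)
            assume "f2 (x, y + (int q)\<^sup>2 * (int n)\<^sup>2 * d) \<noteq> 0"
            then have m: "x \<in> ?X" "y + (int q)\<^sup>2 * (int n)\<^sup>2 * d \<in> ?Y" using s(3) by blast+
            have "\<bar>d\<bar> \<le> int H" using d by auto
            then have "\<bar>(int q)\<^sup>2 * (int n)\<^sup>2 * d\<bar> \<le> z" unfolding abs_mult z_def by (intro mult_mono) auto
            with m have "y \<in> S" "x \<in> {- 2 * int N1..2 * int N1}" by (auto simp: S_def)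
            then show False using \<open>x \<notin> {- 2 * int N1..2 * int N1} \<or> y \<notin> S\<close> by blast
          qed
          then show ?thesis by (simp add: \<Phi>_def)
        qed
        have inner: "cmod (\<Sum>\<^sub>\<infinity>d' \<in> (UNIV :: int set). of_real (fejer_kernel (real H) d') * f2 (x, y + (int q)\<^sup>2 * (int n)\<^sup>2 * d')) = \<Phi> x y" for x y
          unfolding \<Phi>_def by (subst infsum_finite_support[of "{- int H..int H}"]) (use fejer_kernel_eq_0[OF _ H(1)] in auto)
        have outer: "(\<Sum>\<^sub>\<infinity>(x, y) \<in> (UNIV :: (int \<times> int) set). \<Phi> x y) = (\<Sum>x\<in>{- 2 * int N1..2 * int N1}. \<Sum>y\<in>S. \<Phi> x y)"
        proof -
          have "(\<Sum>\<^sub>\<infinity>(x, y) \<in> (UNIV :: (int \<times> int) set). \<Phi> x y) = (\<Sum>(x, y) \<in> {- 2 * int N1..2 * int N1} \<times> S. \<Phi> x y)"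
          proof (rule infsum_finite_support)
            fix p assume p: "p \<notin> {- 2 * int N1..2 * int N1} \<times> S"
            obtain x y where xy: "p = (x, y)" by (cases p)
            have "x \<notin> {- 2 * int N1..2 * int N1} \<or> y \<notin> S" using p unfolding xy by blast
            then show "(case p of (x, y) \<Rightarrow> \<Phi> x y) = 0" unfolding xy prod.case by (rule zero)
          qed (simp add: S_def)
          then show ?thesis by (simp only: sum.cartesian_product)
        qed
        show "1 / C * \<delta> powr C * real M \<le> real M' \<or>
          1 / C * \<delta> powr C * real N1 * real N2 \<le> (\<Sum>\<^sub>\<infinity>(x, y) \<in> (UNIV :: (int \<times> int) set). cmod (\<Sum>\<^sub>\<infinity>d' \<in> (UNIV :: int set).
             of_real (fejer_kernel ((real M')\<^sup>2) d') * f2 (x, y + (int q)\<^sup>2 * (int n)\<^sup>2 * d')))"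
        proof (cases "1 / C * \<delta> powr C * real M \<le> real M'")
          case False
          \<comment> \<open>Failure of the first alternative bounds M' Q^K by M; squaring gives the
            size condition on H = M'^2.\<close>
          have "real M' * real Q ^ K \<le> real M"
          proof -
            have "real M' \<le> 1 / real Q ^ K * real M"
              using False mult_right_mono[OF Q(4), of "real M"] by linarith
            then show ?thesis using Q0 by (simp add: le_divide_eq)
          qed
          then have "real (M' * Q ^ K) \<le> real M" by simp
          then have "M' * Q ^ K \<le> M" by (simp only: of_nat_le_iff)
          then have "(M' * Q ^ K)\<^sup>2 \<le> M\<^sup>2" by (rule power_mono) simp
          moreover have "H * Q ^ (4 * E + 2) \<le> (M' * Q ^ K)\<^sup>2"
            unfolding H_def power_mult_distrib power_mult[symmetric] using Q(1) by (intro mult_left_mono power_increasing) (auto simp: K_def)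
          ultimately have "H * Q ^ (4 * E + 2) \<le> M\<^sup>2" by (rule order.trans[rotated])
          moreover have "finite S" by (simp add: S_def)
          moreover have "\<forall>x y. y \<notin> S \<longrightarrow> \<Phi> x y = 0" using zero by blast
          ultimately have "real N1 * real N2 / real Q ^ (2 * E + 2) \<le> (\<Sum>x\<in>{- 2 * int N1..2 * int N1}. \<Sum>y\<in>S. \<Phi> x y)"
            using low H(1) unfolding \<Phi>_def by blast
          moreover have "1 / C * \<delta> powr C * real N1 * real N2 \<le> real N1 * real N2 / real Q ^ (2 * E + 2)"
          proof -
            have "1 / C * \<delta> powr C * (real N1 * real N2) \<le> 1 / real Q ^ K * (real N1 * real N2)"
              using Q(4) by (rule mult_right_mono) simp
            also have "\<dots> \<le> 1 / real Q ^ (2 * E + 2) * (real N1 * real N2)"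
              using QK[of "2 * E + 2"] Q0 by (intro mult_right_mono divide_left_mono) (auto simp: K_def)
            finally show ?thesis by (simp add: mult.assoc)
          qed
          ultimately show ?thesis unfolding H(2) inner outer by linarith
        qed simp
      qed
    qed
  qed
qed

end
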